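(* Let $\mathfrak{g}$ be a seven-dimensional real unimodular Lie algebra with center of dimension $\dim\mathfrak{z}(\mathfrak{g})\geq 2$ admitting closed $\mathrm{G}_2$-structures. Then $\mathfrak{g}$ admits semi-algebraic solitons if and only if it is isomorphic to one of the following Lie algebras: \[ \begin{split} \mathfrak{n}_1 &=(0,0,0,0,0,0,0),\\ \mathfrak{n}_2 &= (0,0,0,0,e^{12},e^{13},0),\\ \mathfrak{n}_3 &=(0,0,0,e^{12},e^{13},e^{23},0),\\ \mathfrak{n}_4 &= (0,0,e^{12},0,0,e^{13} + e^{24},e^{15}),\\ \mathfrak{n}_5 &= (0,0,e^{12},0,0,e^{13},e^{14} + e^{25}),\\ \mathfrak{n}_6 &=(0,0,0,e^{12},e^{13},e^{14},e^{15}),\\ \mathfrak{n}_7 &= (0, 0, 0, e^{12}, e^{13}, e^{14} + e^{23}, e^{15}),\\ \mathfrak{s}_5 &= (e^{15},-e^{25},-e^{35},e^{45},0,0,0), \\ \mathfrak{s}_6 &= (\alpha e^{15}+e^{25},-e^{15}+\alpha e^{25},-\alpha e^{35}+e^{45},-e^{35}-\alpha e^{45},0,0,0),\quad \alpha> 0, \\ \mathfrak{s}_7 &= (e^{25},-e^{15},e^{45},-e^{35},0,0,0). \end{split} \]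
   Context: All Lie algebras are real and finite-dimensional; $d$ denotes the Chevalley-Eilenberg differential, with $d\alpha(x,y)=-\alpha([x,y])$ for 1-forms $\alpha$. Notation for Lie algebras: an $n$-tuple lists $(de^1,\ldots,de^n)$ with respect to a basis $(e^1,\ldots,e^n)$ of the dual space, and $e^{ij\cdots}=e^i\wedge e^j\wedge\cdots$. In $\mathfrak{s}_6$ the parameter $\alpha$ ranges over all positive real numbers. A 3-form $\varphi$ on a seven-dimensional vector space $W$ is definite if $\iota_w\varphi$ has rank six for each non-zero $w\in W$. A $\mathrm{G}_2$-structure on a seven-dimensional Lie algebra $\mathfrak{g}$ is a definite $\varphi\in\Lambda^3\mathfrak{g}^*$; it is closed if $d\varphi=0$. It induces an inner product and a volume form as follows: with $b_\varphi(v,w)=\frac16\,\iota_v\varphi\wedge\iota_w\varphi\wedge\varphi\in\Lambda^7\mathfrak{g}^*$, one has $g_\varphi=\det(b_\varphi)^{-1/9}b_\varphi$ and $\mathrm{vol}_{g_\varphi}=\det(b_\varphi)^{1/9}$; $*_\varphi$ is the corresponding Hodge operator. The intrinsic torsion form of a closed $\mathrm{G}_2$-structure $\varphi$ is the unique 2-form $\tau\in\Lambda^2\mathfrak{g}^*$ with $\tau\wedge\varphi=-*_\varphi\tau$ and $d*_\varphi\varphi=\tau\wedge\varphi$. The Hodge Laplacian of $\varphi$ is $\Delta_\varphi\varphi=d\tau$. A closed $\mathrm{G}_2$-structure $\varphi$ on $\mathfrak{g}$ is a semi-algebraic soliton if $\Delta_\varphi\varphi=\lambda\varphi+D^*\varphi$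 for some $\lambda\in\mathbb{R}$ and some derivation $D\in\mathrm{Der}(\mathfrak{g})$, where $A^*\beta(x_1,\ldots,x_k)=\beta(Ax_1,\ldots,x_k)+\cdots+\beta(x_1,\ldots,Ax_k)$ for $A\in\mathrm{End}(\mathfrak{g})$ and $\beta\in\Lambda^k\mathfrak{g}^*$. *)

theory Defs
  imports "HOL-Analysis.Analysis"
begin

section \<open>Real Lie algebras\<close>

locale lie_algebra =
  fixes br :: "'a::real_vector \<Rightarrow> 'a \<Rightarrow> 'a"
  assumes bilinear_br: "bilinear br"
    and br_self: "br x x = 0"
    and jacobi: "br x (br y z) + br y (br z x) + br z (br x y) = 0"

definition lie_center :: "('a::real_vector \<Rightarrow> 'a \<Rightarrow> 'a) \<Rightarrow> 'a set" where
  "lie_center br = {x. \<forall>y. br x y = 0}"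

definition derivation :: "('a::real_vector \<Rightarrow> 'a \<Rightarrow> 'a) \<Rightarrow> ('a \<Rightarrow> 'a) \<Rightarrow> bool" where
  "derivation br D \<longleftrightarrow> linear D \<and> (\<forall>x y. D (br x y) = br (D x) y + br x (D y))"

definition lie_isomorphic ::
    "('a::real_vector \<Rightarrow> 'a \<Rightarrow> 'a) \<Rightarrow> ('b::real_vector \<Rightarrow> 'b \<Rightarrow> 'b) \<Rightarrow> bool" where
  "lie_isomorphic br br' \<longleftrightarrow>
     (\<exists>f. linear f \<and> bij f \<and> (\<forall>x y. f (br x y) = br' (f x) (f y)))"

text \<open>The trace of an endomorphism of a finite-dimensional space; \<open>extend_basis {}\<close> is just some
  basis, on whose choice the value does not depend.\<close>

definition endo_trace :: "('a::real_vector \<Rightarrow> 'a) \<Rightarrow> real" where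
  "endo_trace f = (let B = extend_basis {} in \<Sum>b\<in>B. representation B (f b) b)"

definition unimodular :: "('a::real_vector \<Rightarrow> 'a \<Rightarrow> 'a) \<Rightarrow> bool" where
  "unimodular br \<longleftrightarrow> (\<forall>x. endo_trace (br x) = 0)"

section \<open>Exterior forms\<close>

text \<open>A \<open>k\<close>-form takes its arguments as a sequence \<open>x 0, \<dots>, x (k - 1)\<close>; the remaining entries of
  \<open>x\<close> must not matter, so that equality of \<open>k\<close>-forms is equality of functions.\<close>

type_synonym 'a form = "(nat \<Rightarrow> 'a) \<Rightarrow> real"

definition is_form :: "nat \<Rightarrow> 'a::real_vector form \<Rightarrow> bool" where
  "is_form k \<omega> \<longleftrightarrow>
     (\<forall>x y. (\<forall>i<k. x i = y i) \<longrightarrow> \<omega> x = \<omega> y) \<and>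
     (\<forall>x. \<forall>i<k. linear (\<lambda>v. \<omega> (x(i := v)))) \<and>
     (\<forall>x. \<forall>i<k. \<forall>j<k. i \<noteq> j \<and> x i = x j \<longrightarrow> \<omega> x = 0)"

text \<open>The wedge product of a \<open>k\<close>-form and an \<open>l\<close>-form, normalised such that
  \<open>(\<alpha> \<and> \<beta>)(v, w) = \<alpha> v * \<beta> w - \<alpha> w * \<beta> v\<close> for 1-forms.\<close>

definition wedge :: "nat \<Rightarrow> nat \<Rightarrow> 'a form \<Rightarrow> 'a form \<Rightarrow> 'a form" where
  "wedge k l \<alpha> \<beta> x =
     (\<Sum>p | p permutes {..<k + l}.
        of_int (sign p) * \<alpha> (\<lambda>i. x (p i)) * \<beta> (\<lambda>i. x (p (k + i)))) / (fact k * fact l)"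

definition interior :: "'a \<Rightarrow> 'a form \<Rightarrow> 'a form" where
  "interior v \<omega> x = \<omega> (case_nat v x)"

definition omit :: "nat \<Rightarrow> (nat \<Rightarrow> 'a) \<Rightarrow> nat \<Rightarrow> 'a" where
  "omit i x n = (if n < i then x n else x (Suc n))"

text \<open>The Chevalley-Eilenberg differential of a \<open>k\<close>-form:
  \<open>d\<omega>(x\<^sub>0, \<dots>, x\<^sub>k) = \<Sum>\<^bsub>i < j\<^esub> (-1)\<^bsup>i + j\<^esup> \<omega>([x\<^sub>i, x\<^sub>j], x\<^sub>0, \<dots>, x\<^sub>k)\<close>, with \<open>x\<^sub>i\<close> and
  \<open>x\<^sub>j\<close> omitted from the tail. For \<open>k = 1\<close> this is \<open>d\<alpha>(x, y) = - \<alpha>([x, y])\<close>.\<close>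

definition ce_diff :: "('a \<Rightarrow> 'a \<Rightarrow> 'a) \<Rightarrow> nat \<Rightarrow> 'a form \<Rightarrow> 'a form" where
  "ce_diff br k \<omega> x =
     (\<Sum>j\<le>k. \<Sum>i<j. (-1) ^ (i + j) * \<omega> (case_nat (br (x i) (x j)) (omit i (omit j x))))"

definition endo_act :: "('a \<Rightarrow> 'a) \<Rightarrow> nat \<Rightarrow> 'a form \<Rightarrow> 'a form" where
  "endo_act A k \<omega> x = (\<Sum>i<k. \<omega> (x(i := A (x i))))"

text \<open>The rank of a 2-form, i.e. the codimension of its kernel.\<close>

definition form_rank :: "'a::real_vector form \<Rightarrow> nat" where
  "form_rank \<omega> = dim (UNIV :: 'a set) - dim {v. \<forall>x. interior v \<omega> x = 0}"

section \<open>\<open>G\<^sub>2\<close>-structures on a seven-dimensional space\<close>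

definition definite :: "'a::real_vector form \<Rightarrow> bool" where
  "definite \<phi> \<longleftrightarrow> is_form 3 \<phi> \<and> (\<forall>w. w \<noteq> 0 \<longrightarrow> form_rank (interior w \<phi>) = 6)"

definition b_form :: "'a form \<Rightarrow> 'a \<Rightarrow> 'a \<Rightarrow> 'a form" where
  "b_form \<phi> v w x = wedge 4 3 (wedge 2 2 (interior v \<phi>) (interior w \<phi>)) \<phi> x / 6"

text \<open>The bijection from the index type \<open>7\<close> (where \<open>7 = 0\<close>) to \<open>{..<7}\<close> inverse to \<open>of_nat\<close>.\<close>

definition idx :: "7 \<Rightarrow> nat" where
  "idx i = (LEAST n. of_nat n = i)"

text \<open>The volume form \<open>det(b\<^sub>\<phi>)\<^bsup>1/9\<^esup>\<close>. Since \<open>b\<^sub>\<phi>\<close> takes values in the 7-forms, \<open>det(b\<^sub>\<phi>)\<close> is an element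
  of the ninth tensor power of the line of 7-forms (seven factors from the entries of \<open>b\<^sub>\<phi>\<close>, and two
  from the change of basis). Its value on a basis \<open>x\<^sub>0, \<dots>, x\<^sub>6\<close> is the determinant of the matrix with
  entries \<open>b\<^sub>\<phi>(x\<^sub>i, x\<^sub>j)(x\<^sub>0, \<dots>, x\<^sub>6)\<close>, and its ninth root is the 7-form taking on \<open>x\<^sub>0, \<dots>, x\<^sub>6\<close> the
  real ninth root of this value.\<close>

definition g2_vol :: "'a form \<Rightarrow> 'a form" where
  "g2_vol \<phi> x = root 9 (det (\<chi> i j :: 7. b_form \<phi> (x (idx i)) (x (idx j)) x))"

text \<open>The metric \<open>det(b\<^sub>\<phi>)\<^bsup>-1/9\<^esup> b\<^sub>\<phi>\<close>, i.e. the ratio of the 7-forms \<open>b\<^sub>\<phi>(v, w)\<close> and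
  \<open>g2_vol \<phi>\<close>.\<close>

definition g2_metric :: "'a form \<Rightarrow> 'a \<Rightarrow> 'a \<Rightarrow> real" where
  "g2_metric \<phi> v w = (THE c. \<forall>x. b_form \<phi> v w x = c * g2_vol \<phi> x)"

definition g2_orthonormal :: "'a form \<Rightarrow> (nat \<Rightarrow> 'a) \<Rightarrow> bool" where
  "g2_orthonormal \<phi> e \<longleftrightarrow> (\<forall>i<7. \<forall>j<7. g2_metric \<phi> (e i) (e j) = (if i = j then 1 else 0))"

text \<open>The inner product of \<open>k\<close>-forms for which the \<open>e\<^bsup>i\<^sub>1 \<dots> i\<^sub>k\<^esup>\<close>, with \<open>i\<^sub>1 < \<dots> < i\<^sub>k\<close>, are
  orthonormal; it does not depend on the choice of the orthonormal basis \<open>e\<close>. The sum ranges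
  over all multi-indices, hence the factor \<open>1 / k!\<close>.\<close>

definition form_inner :: "'a form \<Rightarrow> nat \<Rightarrow> 'a form \<Rightarrow> 'a form \<Rightarrow> real" where
  "form_inner \<phi> k \<alpha> \<beta> =
     (let e = (SOME e. g2_orthonormal \<phi> e)
      in (\<Sum>f\<in>{..<k} \<rightarrow>\<^sub>E {..<7}. \<alpha> (\<lambda>i. e (f i)) * \<beta> (\<lambda>i. e (f i))) / fact k)"

definition hodge :: "'a::real_vector form \<Rightarrow> nat \<Rightarrow> 'a form \<Rightarrow> 'a form" where
  "hodge \<phi> k \<beta> =
     (THE \<gamma>. is_form (7 - k) \<gamma> \<and>
        (\<forall>\<alpha>. is_form k \<alpha> \<longrightarrow>
           wedge k (7 - k) \<alpha> \<gamma> = (\<lambda>x. form_inner \<phi> k \<alpha> \<beta> * g2_vol \<phi> x)))"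

definition closed_g2_structure ::
    "('a::real_vector \<Rightarrow> 'a \<Rightarrow> 'a) \<Rightarrow> 'a form \<Rightarrow> bool" where
  "closed_g2_structure br \<phi> \<longleftrightarrow> definite \<phi> \<and> ce_diff br 3 \<phi> = (\<lambda>x. 0)"

definition torsion_form :: "('a::real_vector \<Rightarrow> 'a \<Rightarrow> 'a) \<Rightarrow> 'a form \<Rightarrow> 'a form" where
  "torsion_form br \<phi> =
     (THE \<tau>. is_form 2 \<tau> \<and>
        wedge 2 3 \<tau> \<phi> = (\<lambda>x. - hodge \<phi> 2 \<tau> x) \<and>
        ce_diff br 4 (hodge \<phi> 3 \<phi>) = wedge 2 3 \<tau> \<phi>)"

definition g2_laplacian :: "('a::real_vector \<Rightarrow> 'a \<Rightarrow> 'a) \<Rightarrow> 'a form \<Rightarrow> 'a form" where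
  "g2_laplacian br \<phi> = ce_diff br 2 (torsion_form br \<phi>)"

definition semi_algebraic_soliton ::
    "('a::real_vector \<Rightarrow> 'a \<Rightarrow> 'a) \<Rightarrow> 'a form \<Rightarrow> bool" where
  "semi_algebraic_soliton br \<phi> \<longleftrightarrow>
     closed_g2_structure br \<phi> \<and>
     (\<exists>c D. derivation br D \<and>
        g2_laplacian br \<phi> = (\<lambda>x. c * \<phi> x + endo_act D 3 \<phi> x))"

section \<open>The Lie algebras in the classification\<close>

text \<open>A tuple \<open>(de\<^sup>1, \<dots>, de\<^sup>7)\<close> determines the bracket on \<open>\<real>\<^sup>7\<close> because
  \<open>e\<^sup>k([x, y]) = - de\<^sup>k(x, y)\<close>. In the tuples below, \<open>e i j\<close> stands for the value of
  \<open>e\<^bsup>ij\<^esup> = e\<^sup>i \<and> e\<^sup>j\<close> at the pair \<open>(x, y)\<close>.\<close>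

definition e2 :: "real^7 \<Rightarrow> real^7 \<Rightarrow> 7 \<Rightarrow> 7 \<Rightarrow> real" where
  "e2 x y i j = x $ i * y $ j - x $ j * y $ i"

definition bracket_of :: "((7 \<Rightarrow> 7 \<Rightarrow> real) \<Rightarrow> real list) \<Rightarrow> real^7 \<Rightarrow> real^7 \<Rightarrow> real^7" where
  "bracket_of s x y = - vector (s (e2 x y))"

definition "\<nn>\<^sub>1 = bracket_of (\<lambda>e. [0, 0, 0, 0, 0, 0, 0])"
definition "\<nn>\<^sub>2 = bracket_of (\<lambda>e. [0, 0, 0, 0, e 1 2, e 1 3, 0])"
definition "\<nn>\<^sub>3 = bracket_of (\<lambda>e. [0, 0, 0, e 1 2, e 1 3, e 2 3, 0])"
definition "\<nn>\<^sub>4 = bracket_of (\<lambda>e. [0, 0, e 1 2, 0, 0, e 1 3 + e 2 4, e 1 5])"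
definition "\<nn>\<^sub>5 = bracket_of (\<lambda>e. [0, 0, e 1 2, 0, 0, e 1 3, e 1 4 + e 2 5])"
definition "\<nn>\<^sub>6 = bracket_of (\<lambda>e. [0, 0, 0, e 1 2, e 1 3, e 1 4, e 1 5])"
definition "\<nn>\<^sub>7 = bracket_of (\<lambda>e. [0, 0, 0, e 1 2, e 1 3, e 1 4 + e 2 3, e 1 5])"
definition "\<ss>\<^sub>5 = bracket_of (\<lambda>e. [e 1 5, - e 2 5, - e 3 5, e 4 5, 0, 0, 0])"
definition "\<ss>\<^sub>6 \<alpha> = bracket_of (\<lambda>e.
  [\<alpha> * e 1 5 + e 2 5, - e 1 5 + \<alpha> * e 2 5, - \<alpha> * e 3 5 + e 4 5, - e 3 5 - \<alpha> * e 4 5, 0, 0, 0])"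
definition "\<ss>\<^sub>7 = bracket_of (\<lambda>e. [e 2 5, - e 1 5, e 4 5, - e 3 5, 0, 0, 0])"

end

theory Submission
  imports Defs
begin

text \<open>Two independent elements of the center belong to a basis \<open>b 0, \<dots>, b 6\<close> in which the closed
  \<open>G\<^sub>2\<close>-structure \<open>\<phi>\<close> is standard and \<open>b 0\<close>, \<open>b 1\<close> are central. In the structure constants,
  closedness and unimodularity are linear equations; they show that \<open>b 3, \<dots>, b 6\<close> span, modulo the
  plane of \<open>b 0\<close> and \<open>b 1\<close>, an ideal with an abelian complex structure. A rotation of this basis,
  chosen by means of the Jacobi identity, removes all its brackets but that of \<open>b 4\<close> and \<open>b 5\<close>. If it
  is not abelian, the Lie algebra is two-step nilpotent with three generators. Otherwise, a
  second rotation, which exists because isotropic subspaces in signature (1,3) have dimension at most one,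
  leads to a family with twelve real parameters, where the torsion form and its differential are
  explicit. If \<open>b 4\<close> and \<open>b 5\<close> commute, \<open>br (b 2)\<close> is a traceless complex \<open>2 \<times> 2\<close> matrix, triangular
  after a third rotation; if they do not, the soliton equation makes \<open>br (b 2)\<close> nilpotent. The remaining
  Lie algebras are identified by exhibiting bases. Conversely, each Lie algebra of the
  list occurs in the family for parameters for which a derivation solves the soliton equation.\<close>

section \<open>Exterior forms\<close>

lemma is_formD_local:
  assumes "is_form k \<omega>" "\<And>i. i < k \<Longrightarrow> x i = y i"
  shows "\<omega> x = \<omega> y"
  by (rule assms(1)[unfolded is_form_def, THEN conjunct1, rule_format, OF assms(2)])

lemma is_formD_linear: "is_form k \<omega> \<Longrightarrow> i < k \<Longrightarrow> linear (\<lambda>v. \<omega> (x(i := v)))"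
  by (simp only: is_form_def)

lemma is_formD_alternating:
  assumes "is_form k \<omega>" "i < k" "j < k" "i \<noteq> j" "x i = x j"
  shows "\<omega> x = 0"
  using assms(1)[unfolded is_form_def, THEN conjunct2, THEN conjunct2, rule_format, OF assms(2,3), of x] assms(4,5)
  by simp

lemma form_swap:
  assumes "is_form k \<omega>" "a < k" "b < k" "a \<noteq> b"
  shows "\<omega> (x \<circ> Transposition.transpose a b) = - \<omega> x"
proof -
  let ?f = "\<lambda>u v. \<omega> (x(a := u, b := v))"
  have lin1: "linear (\<lambda>u. ?f u v)" for v
    using is_formD_linear[OF assms(1,2), of "x(b := v)"] by (simp only: fun_upd_twist[OF assms(4)])
  have lin2: "linear (\<lambda>v. ?f u v)" for u
    using is_formD_linear[OF assms(1,3), of "x(a := u)"] by simp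
  have alt: "?f u u = 0" for u
    by (rule is_formD_alternating[OF assms(1-4)]) (use assms(4) in auto)
  have "0 = ?f (x a + x b) (x a + x b)" by (simp only: alt)
  also have "\<dots> = ?f (x a) (x a) + ?f (x a) (x b) + (?f (x b) (x a) + ?f (x b) (x b))"
    by (simp only: linear_add[OF lin1] linear_add[OF lin2])
  finally have "?f (x b) (x a) = - ?f (x a) (x b)" by (simp only: alt)
  moreover have "x \<circ> Transposition.transpose a b = x(a := x b, b := x a)"
    using assms(4) by (auto simp: fun_eq_iff Transposition.transpose_def)
  ultimately show ?thesis by simp
qed

lemma form_permute:
  assumes "is_form k \<omega>" "p permutes {..<k}"
  shows "\<omega> (\<lambda>i. x (p i)) = of_int (sign p) * \<omega> x"
  using assms(2) finite_lessThan[of k]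
proof (induction arbitrary: x rule: permutes_induct)
  case id
  then show ?case by simp
next
  case (swap a b p)
  have "\<omega> (\<lambda>i. x ((Transposition.transpose a b \<circ> p) i))
      = of_int (sign p) * \<omega> (x \<circ> Transposition.transpose a b)"
    using swap.IH[of "x \<circ> Transposition.transpose a b"] by (simp add: comp_def)
  also have "\<dots> = - of_int (sign p) * \<omega> x"
    using swap by (simp add: form_swap[OF assms(1)])
  also have "- sign p = sign (Transposition.transpose a b \<circ> p)"
    using swap by (simp add: sign_compose permutation_swap_id sign_swap_id permutes_imp_permutation[OF finite_lessThan])
  then have "- of_int (sign p) * \<omega> x = of_int (sign (Transposition.transpose a b \<circ> p)) * \<omega> x"
    by (metis of_int_minus)
  finally show ?case .
qed

lemma is_form_sum:
  fixes \<omega> :: "'i \<Rightarrow> 'a::real_vector form"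
  assumes "\<And>i. i \<in> S \<Longrightarrow> is_form k (\<omega> i)"
  shows "is_form k (\<lambda>x. \<Sum>i\<in>S. r i * \<omega> i x)"
  unfolding is_form_def
proof (intro conjI allI impI)
  fix x y :: "nat \<Rightarrow> 'a" assume "\<forall>i<k. x i = y i"
  then show "(\<Sum>i\<in>S. r i * \<omega> i x) = (\<Sum>i\<in>S. r i * \<omega> i y)"
    by (intro sum.cong refl arg_cong[of _ _ "(*) _"] is_formD_local[OF assms]) auto
next
  fix x i assume "i < k"
  have "linear (\<lambda>v. r j *\<^sub>R \<omega> j (x(i := v)))" if "j \<in> S" for j
    by (rule linear_compose_scale_right[OF is_formD_linear[OF assms[OF that] \<open>i < k\<close>]])
  then have "\<forall>j\<in>S. linear (\<lambda>v. r j * \<omega> j (x(i := v)))" by simp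
  then show "linear (\<lambda>v. \<Sum>j\<in>S. r j * \<omega> j (x(i := v)))"
    by (rule linear_compose_sum)
next
  fix x :: "nat \<Rightarrow> 'a" and i j assume "i < k" "j < k" "i \<noteq> j \<and> x i = x j"
  then have "\<omega> l x = 0" if "l \<in> S" for l
    using is_formD_alternating[OF assms[OF that], of i j x] by simp
  then show "(\<Sum>i\<in>S. r i * \<omega> i x) = 0" by simp
qed

lemma is_form_lin2:
  assumes "is_form k \<alpha>" "is_form k \<beta>"
  shows "is_form k (\<lambda>x. r * \<alpha> x + s * \<beta> x)"
proof -
  have "is_form k (\<lambda>x. \<Sum>i\<in>{True, False}. (if i then r else s) * (if i then \<alpha> else \<beta>) x)"
    by (rule is_form_sum) (use assms in auto)
  then show ?thesis by simp
qed

lemma is_form_diff: "is_form k \<alpha> \<Longrightarrow> is_form k \<beta> \<Longrightarrow> is_form k (\<lambda>x. \<alpha> x - \<beta> x)"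
  using is_form_lin2[of k \<alpha> \<beta> 1 "-1"] by simp

lemma is_form_add: "is_form k \<alpha> \<Longrightarrow> is_form k \<beta> \<Longrightarrow> is_form k (\<lambda>x. \<alpha> x + \<beta> x)"
  using is_form_lin2[of k \<alpha> \<beta> 1 1] by simp

lemma is_form_scale: "is_form k \<alpha> \<Longrightarrow> is_form k (\<lambda>x. r * \<alpha> x)"
  using is_form_lin2[of k \<alpha> \<alpha> r 0] by simp

lemma is_form_minus: "is_form k \<alpha> \<Longrightarrow> is_form k (\<lambda>x. - \<alpha> x)"
  using is_form_scale[of k \<alpha> "-1"] by simp

definition ext_basis :: "(nat \<Rightarrow> 'a \<Rightarrow> real) \<Rightarrow> nat list \<Rightarrow> 'a form" where
  "ext_basis c I x =
     (\<Sum>p | p permutes {..<length I}. of_int (sign p) * (\<Prod>j<length I. c (I ! j) (x (p j))))"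

lemma sum_permutes_compose_left:
  assumes "q permutes S"
  shows "(\<Sum>p | p permutes S. f (q \<circ> p)) = (\<Sum>p | p permutes S. f p)"
  using assms
  by (intro sum.reindex_bij_witness[of _ "\<lambda>p. inv q \<circ> p" "\<lambda>p. q \<circ> p"])
     (simp_all add: o_assoc permutes_inv_o permutes_compose permutes_inv)

lemma is_form_ext_basis:
  assumes "\<And>i. i \<in> set I \<Longrightarrow> linear (c i)"
  shows "is_form (length I) (ext_basis c I)"
  unfolding is_form_def
proof (intro conjI allI impI)
  fix x y :: "nat \<Rightarrow> 'a" assume *: "\<forall>i<length I. x i = y i"
  have "(\<Prod>j<length I. c (I ! j) (x (p j))) = (\<Prod>j<length I. c (I ! j) (y (p j)))"
    if "p permutes {..<length I}" for p
    using * permutes_in_image[OF that] by (intro prod.cong) auto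
  then show "ext_basis c I x = ext_basis c I y" unfolding ext_basis_def by (intro sum.cong) auto
next
  fix x :: "nat \<Rightarrow> 'a" and i assume i: "i < length I"
  have lin: "linear (\<lambda>v. \<Prod>j<length I. c (I ! j) ((x(i := v)) (p j)))" if p: "p permutes {..<length I}" for p
  proof -
    define j0 where "j0 = inv p i"
    have j0: "j0 < length I" "p j0 = i"
      using i permutes_in_image[OF permutes_inv[OF p]] permutes_inverses[OF p] by (auto simp: j0_def)
    have ne: "p j \<noteq> i" if "j \<noteq> j0" for j
      using permutes_inverses[OF p] that by (auto simp: j0_def)
    have "(\<Prod>j<length I. c (I ! j) ((x(i := v)) (p j)))
        = (\<Prod>j\<in>{..<length I} - {j0}. c (I ! j) (x (p j))) *\<^sub>R c (I ! j0) v" for v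
      using j0 ne by (subst prod.remove[of _ j0]) (auto intro!: prod.cong)
    then show ?thesis
      using linear_compose_scale_right[OF assms[of "I ! j0"]] j0 by simp
  qed
  have "linear (\<lambda>v. of_int (sign p) * (\<Prod>j<length I. c (I ! j) ((x(i := v)) (p j))))"
    if "p \<in> {p. p permutes {..<length I}}" for p
    using linear_compose_scale_right[OF lin[of p], of "of_int (sign p)"] that by simp
  then show "linear (\<lambda>v. ext_basis c I (x(i := v)))"
    unfolding ext_basis_def by (intro linear_compose_sum ballI)
next
  fix x :: "nat \<Rightarrow> 'a" and i j assume ij: "i < length I" "j < length I" "i \<noteq> j \<and> x i = x j"
  let ?t = "Transposition.transpose i j"
  let ?F = "\<lambda>p. of_int (sign p) * (\<Prod>j<length I. c (I ! j) (x (p j)))"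
  have t: "?t permutes {..<length I}" using ij by (intro permutes_swap_id) auto
  have "?F (?t \<circ> p) = - ?F p" if "p permutes {..<length I}" for p
  proof -
    have "sign (?t \<circ> p) = - sign p"
      using ij that by (simp add: sign_compose permutation_swap_id sign_swap_id permutes_imp_permutation[OF
          finite_lessThan])
    moreover have "x (?t k) = x k" for k using ij by (auto simp: Transposition.transpose_def)
    ultimately show ?thesis by simp
  qed
  then have "(\<Sum>p | p permutes {..<length I}. ?F (?t \<circ> p)) = - (\<Sum>p | p permutes {..<length I}. ?F p)"
    by (simp add: sum_negf[symmetric])
  then have "ext_basis c I x = - ext_basis c I x"
    unfolding ext_basis_def by (subst (asm) sum_permutes_compose_left[OF t])
  then show "ext_basis c I x = 0" by simp
qed

lemma sum_permutes_append:
  fixes k l :: nat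
  assumes q: "q permutes {..<k}" and r: "r permutes {..<l}"
    and G: "\<And>p p'. (\<And>i. i < k + l \<Longrightarrow> p i = p' i) \<Longrightarrow> G p = G p'"
  shows "(\<Sum>p | p permutes {..<k + l}. of_int (sign p) * of_int (sign q) * of_int (sign r) *
            (G (\<lambda>i. if i < k then p (q i) else p (k + r (i - k))) :: real))
       = (\<Sum>p | p permutes {..<k + l}. of_int (sign p) * G p)" (is "?L = ?R")
proof -
  define r' where "r' = map_permutation {..<l} ((+) k) r"
  have bij: "bij_betw ((+) k) {..<l} {k..<k + l}"
    by (rule bij_betw_byWitness[of _ "\<lambda>i. i - k"]) auto
  have r': "r' permutes {k..<k + l}" unfolding r'_def by (rule map_permutation_permutes[OF bij r])
  have sr: "sign r' = sign r" unfolding r'_def by (rule sign_map_permutation) (use r in auto)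
  have r'k: "r' (k + i) = k + r i" if "i < l" for i
    using that unfolding r'_def by (simp add: map_permutation_apply)
  define s where "s = q \<circ> r'"
  have q': "q permutes {..<k + l}" by (rule permutes_subset[OF q]) auto
  have r'': "r' permutes {..<k + l}" by (rule permutes_subset[OF r']) auto
  have s: "s permutes {..<k + l}" unfolding s_def by (rule permutes_compose[OF r'' q'])
  have ss: "sign s = sign q * sign r"
    unfolding s_def using q' r'' sr by (simp add: sign_compose permutes_imp_permutation[OF finite_lessThan])
  have s1: "s i = q i" if "i < k" for i
    using that r' by (simp add: s_def permutes_not_in)
  have s2: "s i = k + r (i - k)" if "\<not> i < k" "i < k + l" for i
    using that q r'k[of "i - k"] by (simp add: s_def permutes_not_in)
  have G': "G (\<lambda>i. if i < k then p (q i) else p (k + r (i - k))) = G (p \<circ> s)" for p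
    by (rule G) (auto simp: s1 s2)
  have "?L = (\<Sum>p | p permutes {..<k + l}. of_int (sign (p \<circ> s)) * G (p \<circ> s))"
    by (intro sum.cong refl)
       (use s in \<open>auto simp: G' ss sign_compose permutes_imp_permutation[OF finite_lessThan]\<close>)
  also have "\<dots> = ?R"
    using sum_permutations_compose_right[OF s, of "\<lambda>p. of_int (sign p) * G p"] by simp
  finally show ?thesis .
qed

lemma wedge_ext_basis:
  "wedge (length I) (length J) (ext_basis c I) (ext_basis c J) = ext_basis c (I @ J)"
proof
  fix x :: "nat \<Rightarrow> 'a"
  let ?k = "length I" and ?l = "length J"
  let ?P = "\<lambda>n::nat. {p. p permutes {..<n}}"
  let ?G = "\<lambda>p. \<Prod>j<?k + ?l. c ((I @ J) ! j) (x (p j))"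
  have split: "?G (\<lambda>i. if i < ?k then p (q i) else p (?k + r (i - ?k)))
      = (\<Prod>j<?k. c (I ! j) (x (p (q j)))) * (\<Prod>j<?l. c (J ! j) (x (p (?k + r j))))" for p q r
  proof -
    let ?h = "\<lambda>j. c ((I @ J) ! j) (x (if j < ?k then p (q j) else p (?k + r (j - ?k))))"
    have "prod ?h {..<?k + ?l} = prod ?h {..<?k} * prod ?h {?k..<?k + ?l}"
      by (subst prod.union_disjoint[symmetric]) (auto intro!: prod.cong)
    also have "prod ?h {?k..<?k + ?l} = (\<Prod>j<?l. ?h (?k + j))"
      by (rule prod.reindex_bij_witness[of _ "\<lambda>j. ?k + j" "\<lambda>j. j - ?k"]) auto
    also have "\<dots> = (\<Prod>j<?l. c (J ! j) (x (p (?k + r j))))" by (simp add: nth_append)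
    also have "prod ?h {..<?k} = (\<Prod>j<?k. c (I ! j) (x (p (q j))))"
      by (intro prod.cong) (auto simp: nth_append)
    finally show ?thesis .
  qed
  have "(\<Sum>p\<in>?P (?k + ?l). of_int (sign p) * ext_basis c I (\<lambda>i. x (p i)) * ext_basis c J (\<lambda>i. x (p (?k + i))))
      = (\<Sum>p\<in>?P (?k + ?l). \<Sum>q\<in>?P ?k. \<Sum>r\<in>?P ?l. of_int (sign p) * of_int (sign q) * of_int (sign r) *
          ?G (\<lambda>i. if i < ?k then p (q i) else p (?k + r (i - ?k))))"
    unfolding ext_basis_def split
    by (simp add: sum_distrib_left sum_distrib_right mult_ac)
  also have "\<dots> = (\<Sum>q\<in>?P ?k. \<Sum>r\<in>?P ?l. \<Sum>p\<in>?P (?k + ?l). of_int (sign p) * of_int (sign q) * of_int (sign r) *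
          ?G (\<lambda>i. if i < ?k then p (q i) else p (?k + r (i - ?k))))"
    by (rule trans[OF sum.swap], rule sum.cong[OF refl], rule sum.swap)
  also have "\<dots> = (\<Sum>q\<in>?P ?k. \<Sum>r\<in>?P ?l. ext_basis c (I @ J) x)"
    unfolding ext_basis_def length_append
    by (intro sum.cong refl sum_permutes_append) auto
  also have "\<dots> = fact ?k * fact ?l * ext_basis c (I @ J) x"
    by (simp add: card_permutations)
  finally show "wedge ?k ?l (ext_basis c I) (ext_basis c J) x = ext_basis c (I @ J) x"
    unfolding wedge_def by simp
qed

lemma wedge_sum_left:
  "wedge k l (\<lambda>x. \<Sum>i\<in>S. r i * \<alpha> i x) \<beta> x = (\<Sum>i\<in>S. r i * wedge k l (\<alpha> i) \<beta> x)"
  unfolding wedge_def sum_divide_distrib sum_distrib_left sum_distrib_right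
  by (subst sum.swap) (simp add: mult_ac)

lemma wedge_sum_right:
  "wedge k l \<alpha> (\<lambda>x. \<Sum>i\<in>S. r i * \<beta> i x) x = (\<Sum>i\<in>S. r i * wedge k l \<alpha> (\<beta> i) x)"
  unfolding wedge_def sum_divide_distrib sum_distrib_left sum_distrib_right
  by (subst sum.swap) (simp add: mult_ac)

lemma wedge_scale_left: "wedge k l (\<lambda>x. r * \<alpha> x) \<beta> x = r * wedge k l \<alpha> \<beta> x"
  using wedge_sum_left[of k l "\<lambda>_. r" "\<lambda>_. \<alpha>" "{0::nat}"] by simp

lemma ext_basis_pair: "ext_basis c [i, j] x = c i (x 0) * c j (x 1) - c i (x 1) * c j (x 0)"
proof -
  let ?t = "Transposition.transpose 0 (1::nat)"
  have "{..<2::nat} = {0, 1}" by auto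
  then have P: "{p. p permutes {..<2::nat}} = {id, ?t}"
    using permutes_doubleton_iff[of _ "0::nat" 1] by auto
  have ne: "id \<noteq> ?t"
    by (metis id_apply transpose_apply_first zero_neq_one)
  have L: "length [i, j] = 2" by simp
  have pr: "(\<Prod>k<2::nat. f k) = f 0 * f 1" for f :: "nat \<Rightarrow> real"
    by (simp add: numeral_2_eq_2)
  have "ext_basis c [i, j] x = (\<Sum>p\<in>{id, ?t}. of_int (sign p) * (c i (x (p 0)) * c j (x (p 1))))"
    unfolding ext_basis_def L P pr by simp
  also have "\<dots> = c i (x 0) * c j (x 1) - c i (x 1) * c j (x 0)"
    using ne by (simp add: sign_swap_id)
  finally show ?thesis .
qed

lemma ext_basis_swap: "ext_basis c [i, j] x = - ext_basis c [j, i] x"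
  by (simp add: ext_basis_pair)

lemma wedge_scale_right: "wedge k l \<alpha> (\<lambda>x. r * \<beta> x) x = r * wedge k l \<alpha> \<beta> x"
  using wedge_sum_right[of k l \<alpha> "\<lambda>_. r" "\<lambda>_. \<beta>" "{0::nat}"] by simp

lemma ext_basis_cons_cong:
  assumes "length J = length K" "\<And>x. ext_basis c J x = r * ext_basis c K x"
  shows "ext_basis c (i # J) x = r * ext_basis c (i # K) x"
proof -
  have *: "ext_basis c (i # J) = wedge 1 (length J) (ext_basis c [i]) (ext_basis c J)" for J
    using wedge_ext_basis[of "[i]" J c] by simp
  have "ext_basis c J = (\<lambda>x. r * ext_basis c K x)"
    by (rule ext) (rule assms(2))
  then show ?thesis
    unfolding *[of J] *[of K] assms(1) by (simp only: wedge_scale_right)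
qed

lemma ext_basis_swap_head: "ext_basis c (i # j # J) x = - ext_basis c (j # i # J) x"
proof -
  have *: "ext_basis c (i # j # J) = wedge 2 (length J) (ext_basis c [i, j]) (ext_basis c J)" for i j
    using wedge_ext_basis[of "[i, j]" J c] by (simp add: numeral_2_eq_2)
  have "ext_basis c [i, j] = (\<lambda>x. (-1) * ext_basis c [j, i] x)"
    by (rule ext) (simp add: ext_basis_swap[of c i j])
  then show ?thesis
    unfolding *[of i j] *[of j i] by (simp only: wedge_scale_left)
qed

fun inversions :: "nat list \<Rightarrow> nat" where
  "inversions [] = 0"
| "inversions (i # I) = length (filter (\<lambda>j. j < i) I) + inversions I"

lemma ext_basis_insort:
  "sorted I \<Longrightarrow> ext_basis c (i # I) x = (-1) ^ length (filter (\<lambda>j. j < i) I) * ext_basis c (insort i I) x"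
proof (induction I arbitrary: x)
  case Nil
  then show ?case by simp
next
  case (Cons j I)
  show ?case
  proof (cases "i \<le> j")
    case True
    then have "filter (\<lambda>j. j < i) (j # I) = []" using Cons.prems by (auto simp: filter_empty_conv)
    then show ?thesis using True by simp
  next
    case False
    have "ext_basis c (j # i # I) x
        = (-1) ^ length (filter (\<lambda>j. j < i) I) * ext_basis c (j # insort i I) x"
      by (rule ext_basis_cons_cong) (use Cons in auto)
    then show ?thesis using False by (simp add: ext_basis_swap_head[of c i j])
  qed
qed

lemma ext_basis_sort: "ext_basis c I x = (-1) ^ inversions I * ext_basis c (sort I) x"
proof (induction I arbitrary: x)
  case Nil
  then show ?case by simp
next
  case (Cons i I)
  have "ext_basis c (i # I) x = (-1) ^ inversions I * ext_basis c (i # sort I) x"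
    by (rule ext_basis_cons_cong) (use Cons in auto)
  also have "ext_basis c (i # sort I) x
      = (-1) ^ length (filter (\<lambda>j. j < i) I) * ext_basis c (sort (i # I)) x"
    by (simp add: ext_basis_insort filter_sort)
  finally show ?case by (simp add: power_add)
qed

section \<open>The Chevalley-Eilenberg differential is an exterior form\<close>

lemma is_formI_adjacent:
  assumes local: "\<And>x y. (\<And>i. i < k \<Longrightarrow> x i = y i) \<Longrightarrow> \<omega> x = \<omega> y"
    and lin: "\<And>x i. i < k \<Longrightarrow> linear (\<lambda>v. \<omega> (x(i := v)))"
    and adj: "\<And>x m. Suc m < k \<Longrightarrow> \<omega> (x \<circ> Transposition.transpose m (Suc m)) = - \<omega> x"
  shows "is_form k \<omega>"
proof -
  have zero: "\<omega> x = 0" if "i < j" "j < k" "x i = x j" for x i j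
    using that
  proof (induction "j - i" arbitrary: x j)
    case 0
    then show ?case by simp
  next
    case (Suc d)
    define m where "m = j - 1"
    have m: "j = Suc m" "Suc m < k" using Suc by (auto simp: m_def)
    let ?x = "x \<circ> Transposition.transpose m (Suc m)"
    show ?case
    proof (cases "i = m")
      case True
      then have "?x = x" using Suc m by (auto simp: fun_eq_iff Transposition.transpose_def)
      then show ?thesis using adj[OF m(2), of x] by simp
    next
      case False
      have "\<omega> ?x = 0"
        by (rule Suc.hyps(1)[of m]) (use Suc.hyps(2) Suc.prems m False in \<open>auto simp: Transposition.transpose_def\<close>)
      then show ?thesis using adj[OF m(2), of x] by simp
    qed
  qed
  show ?thesis
    unfolding is_form_def using local lin zero by (metis linorder_neqE_nat)
qed

lemma ce_diff_pairs:
  "ce_diff br k \<omega> x = (\<Sum>(i, j)\<in>{(i, j). i < j \<and> j \<le> k}.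
     (-1) ^ (i + j) * \<omega> (case_nat (br (x i) (x j)) (omit i (omit j x))))"
proof -
  have "{(i, j). i < j \<and> j \<le> k} = (\<lambda>(j, i). (i, j)) ` (SIGMA j:{..k}. {..<j})" by force
  then show ?thesis
    unfolding ce_diff_def
    by (simp add: sum.Sigma split_def sum.reindex inj_on_def)
qed

context
  fixes br :: "'a::real_vector \<Rightarrow> 'a \<Rightarrow> 'a" and \<omega> :: "'a form" and k :: nat
  assumes br: "bilinear br" and br_self: "\<And>x. br x x = 0" and form: "is_form k \<omega>"
begin

private definition T :: "nat \<Rightarrow> nat \<Rightarrow> 'a form" where
  "T i j x = (-1) ^ (i + j) * \<omega> (case_nat (br (x i) (x j)) (omit i (omit j x)))"

private lemma br_swap: "br y x = - br x y"
proof -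
  have "br x y + br y x = 0"
    using br_self[of "x + y"] unfolding bilinear_ladd[OF br] bilinear_radd[OF br] by (simp add: br_self add.commute)
  then show ?thesis by (simp add: eq_neg_iff_add_eq_0 add.commute)
qed

private lemma linear_head: "linear g \<Longrightarrow> 0 < k \<Longrightarrow> linear (\<lambda>v. \<omega> (case_nat (g v) y))"
proof -
  assume g: "linear g" and "0 < k"
  have "\<omega> (case_nat u y) = \<omega> ((case_nat 0 y)(0 := u))" for u
    by (rule arg_cong[of _ _ \<omega>]) (auto split: nat.split)
  then show ?thesis
    using linear_compose[OF g is_formD_linear[OF form \<open>0 < k\<close>, of "case_nat 0 y"]]
    by (simp add: comp_def)
qed

private lemma T_linear:
  assumes "i < j" "j \<le> k" "l \<le> k"
  shows "linear (\<lambda>v. T i j (x(l := v)))"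
proof -
  have k: "0 < k" using assms by simp
  have "linear (\<lambda>v. \<omega> (case_nat (br ((x(l := v)) i) ((x(l := v)) j)) (omit i (omit j (x(l := v))))))"
  proof (cases "l = i \<or> l = j")
    case True
    have o: "omit i (omit j (x(l := v))) = omit i (omit j x)" for v
      using True assms by (auto simp: omit_def fun_eq_iff)
    have l1: "linear (\<lambda>v. br v (x j))" "linear (\<lambda>v. br (x i) v)"
      using br by (auto simp: bilinear_def)
    from True show ?thesis
    proof
      assume l: "l = i"
      show ?thesis using linear_head[OF l1(1) k, of "omit i (omit j x)"] assms l o by simp
    next
      assume l: "l = j"
      show ?thesis using linear_head[OF l1(2) k, of "omit i (omit j x)"] assms l o by simp
    qed
  next
    case False
    define l' where "l' = (if l < i then l else if l < j then l - 1 else l - 2)"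
    have o: "omit i (omit j (x(l := v))) = (omit i (omit j x))(l' := v)" for v
    proof
      fix n
      consider "l < i" | "i < l" "l < j" | "j < l" using False by linarith
      then show "omit i (omit j (x(l := v))) n = ((omit i (omit j x))(l' := v)) n"
        using assms(1) by cases (auto simp: omit_def l'_def)
    qed
    have e: "case_nat u (y(l' := v)) = (case_nat u y)(Suc l' := v)" for u y and v :: 'a
      by (auto simp: fun_eq_iff split: nat.split)
    have "Suc l' < k" using False assms by (auto simp: l'_def)
    from is_formD_linear[OF form this] show ?thesis using False by (simp add: o e)
  qed
  from linear_compose_scale_right[OF this, of "(-1) ^ (i + j)"] show ?thesis
    unfolding T_def by simp
qed

private lemma T_adjacent:
  assumes "i < j" "j \<le> k" "m < k"
  defines "s \<equiv> Transposition.transpose m (Suc m)"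
  shows "(if (i, j) = (m, Suc m) then T i j (x \<circ> s) else T (s i) (s j) (x \<circ> s)) = - T i j x"
proof -
  consider "i = m" "j = Suc m" | "i = m" "j > Suc m" | "i = Suc m" | "j = m" | "j = Suc m" "i < m"
    | "i \<noteq> m" "i \<noteq> Suc m" "j \<noteq> m" "j \<noteq> Suc m"
    using assms(1) by linarith
  then show ?thesis
  proof cases
    case 1
    have "omit i (omit j (x \<circ> s)) = omit i (omit j x)"
      using 1 by (auto simp: omit_def fun_eq_iff s_def Transposition.transpose_def)
    moreover have "\<omega> (case_nat (- u) y) = - \<omega> (case_nat u y)" for u y
      using linear_neg[OF linear_head[OF linear_id]] assms by simp
    ultimately show ?thesis using 1 by (simp add: T_def s_def br_swap[of "x m"])
  next
    case 2
    have "omit (Suc m) (omit j (x \<circ> s)) = omit m (omit j x)"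
      using 2 by (auto simp: omit_def fun_eq_iff s_def Transposition.transpose_def less_Suc_eq)
    then show ?thesis using 2 by (simp add: T_def s_def Transposition.transpose_def)
  next
    case 3
    have "omit m (omit j (x \<circ> s)) = omit (Suc m) (omit j x)"
      using 3 assms(1) by (auto simp: omit_def fun_eq_iff s_def Transposition.transpose_def less_Suc_eq)
    then show ?thesis using 3 assms by (simp add: T_def s_def Transposition.transpose_def)
  next
    case 4
    have "omit i (omit (Suc m) (x \<circ> s)) = omit i (omit m x)"
      using 4 assms(1) by (auto simp: omit_def fun_eq_iff s_def Transposition.transpose_def) (rule arg_cong[of _ _ x],
          linarith)
    then show ?thesis using 4 assms by (simp add: T_def s_def Transposition.transpose_def)
  next
    case 5
    have o: "omit i (omit m (x \<circ> s)) = omit i (omit (Suc m) x)"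
      using 5 assms(1) by (auto simp: omit_def fun_eq_iff s_def Transposition.transpose_def) (rule arg_cong[of _ _ x],
          linarith)
    have "s i = i" "s j = m" "(x \<circ> s) i = x i" "(x \<circ> s) m = x j"
      using 5 by (auto simp: s_def Transposition.transpose_def)
    then show ?thesis using 5 by (simp add: T_def o)
  next
    case 6
    define m' where "m' = (if m < i then m else if m < j then m - 1 else m - 2)"
    define f where "f n = (if n < i then n else if Suc n < j then Suc n else Suc (Suc n))" for n
    have f: "omit i (omit j y) n = y (f n)" for y :: "nat \<Rightarrow> 'a" and n
      using assms(1) by (simp add: omit_def f_def)
    have "s (f n) = f (Transposition.transpose m' (Suc m') n)" for n
    proof -
      consider "Suc m < i" | "i < m" "Suc m < j" | "j < m"
        using 6 assms(1) by linarith
      then show ?thesis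
      proof cases
        case 1
        then have "m' = m" by (simp add: m'_def)
        then show ?thesis
          using 1 assms(1) by (simp add: s_def f_def Transposition.transpose_def)
      next
        case 2
        then have "m = Suc m'" by (simp add: m'_def)
        then show ?thesis
          using 2 assms(1) by (simp add: s_def f_def Transposition.transpose_def)
      next
        case 3
        then have "m = Suc (Suc m')" using assms(1) by (simp add: m'_def)
        then show ?thesis
          using 3 assms(1) by (simp add: s_def f_def Transposition.transpose_def)
      qed
    qed
    then have o: "omit i (omit j (x \<circ> s)) = omit i (omit j x) \<circ> Transposition.transpose m' (Suc m')"
      by (simp add: fun_eq_iff f)
    have c: "case_nat u (y \<circ> Transposition.transpose m' (Suc m'))
      = case_nat u y \<circ> Transposition.transpose (Suc m') (Suc (Suc m'))" for u :: 'a and y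
      by (auto simp: fun_eq_iff Transposition.transpose_def split: nat.split)
    have "Suc (Suc m') < k" using 6 assms by (auto simp: m'_def)
    then have "\<omega> (case_nat (br (x i) (x j)) (omit i (omit j (x \<circ> s))))
      = - \<omega> (case_nat (br (x i) (x j)) (omit i (omit j x)))"
      unfolding o c by (intro form_swap[OF form]) auto
    moreover have "s i = i" "s j = j" "(x \<circ> s) i = x i" "(x \<circ> s) j = x j"
      using 6 by (auto simp: s_def Transposition.transpose_def)
    ultimately show ?thesis using 6 by (simp add: T_def)
  qed
qed

lemma is_form_ce_diff: "is_form (Suc k) (ce_diff br k \<omega>)"
proof (rule is_formI_adjacent)
  let ?S = "{(i, j). i < j \<and> j \<le> k}"
  have ce: "ce_diff br k \<omega> x = (\<Sum>(i, j)\<in>?S. T i j x)" for x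
    unfolding ce_diff_pairs T_def by simp
  fix x :: "nat \<Rightarrow> 'a"
  { fix y assume xy: "\<And>i. i < Suc k \<Longrightarrow> x i = y i"
    have "T i j x = T i j y" if "i < j" "j \<le> k" for i j
    proof -
      have "\<omega> (case_nat (br (x i) (x j)) (omit i (omit j x))) = \<omega> (case_nat (br (y i) (y j)) (omit i (omit j y)))"
        by (rule is_formD_local[OF form]) (use that xy in \<open>auto simp: omit_def split: nat.split\<close>)
      then show ?thesis by (simp add: T_def)
    qed
    then show "ce_diff br k \<omega> x = ce_diff br k \<omega> y"
      unfolding ce by (intro sum.cong) auto }
  { fix l assume "l < Suc k"
    then have "\<forall>p\<in>?S. linear (\<lambda>v. case p of (i, j) \<Rightarrow> T i j (x(l := v)))"
      using T_linear by (auto split: prod.split)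
    then show "linear (\<lambda>v. ce_diff br k \<omega> (x(l := v)))"
      unfolding ce by (rule linear_compose_sum) }
  { fix m assume m: "Suc m < Suc k"
    define s where "s = Transposition.transpose m (Suc m)"
    define \<pi> where "\<pi> = (\<lambda>(i, j). if (i, j) = (m, Suc m) then (i, j) else (s i, s j))"
    have "(\<Sum>p\<in>?S. case p of (i, j) \<Rightarrow> T i j (x \<circ> s)) = (\<Sum>p\<in>?S. case \<pi> p of (i, j) \<Rightarrow> T i j (x \<circ> s))"
      by (rule sum.reindex_bij_witness[of _ \<pi> \<pi>])
         (use m in \<open>auto simp: \<pi>_def s_def Transposition.transpose_def split: if_splits\<close>)
    also have "\<dots> = (\<Sum>p\<in>?S. - (case p of (i, j) \<Rightarrow> T i j x))"
    proof (intro sum.cong refl)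
      fix p assume "p \<in> ?S"
      then obtain i j where p: "p = (i, j)" "i < j" "j \<le> k" by auto
      show "(case \<pi> p of (i, j) \<Rightarrow> T i j (x \<circ> s)) = - (case p of (i, j) \<Rightarrow> T i j x)"
        using T_adjacent[OF p(2,3), of m x] m p by (auto simp: \<pi>_def s_def split: if_splits)
    qed
    finally show "ce_diff br k \<omega> (x \<circ> Transposition.transpose m (Suc m)) = - ce_diff br k \<omega> x"
      unfolding ce s_def by (simp add: sum_negf) }
qed

end

lemma is_form_endo_act:
  assumes D: "linear D" and form: "is_form k \<omega>"
  shows "is_form k (endo_act D k \<omega>)"
  unfolding is_form_def
proof (intro conjI allI impI)
  fix x y :: "nat \<Rightarrow> 'a" assume "\<forall>i<k. x i = y i"
  then have "\<omega> (x(i := D (x i))) = \<omega> (y(i := D (y i)))" if "i < k" for i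
    using that by (intro is_formD_local[OF form]) auto
  then show "endo_act D k \<omega> x = endo_act D k \<omega> y" by (simp add: endo_act_def)
next
  fix x :: "nat \<Rightarrow> 'a" and l assume l: "l < k"
  have "linear (\<lambda>v. \<omega> ((x(l := v))(i := D ((x(l := v)) i))))" if "i < k" for i
  proof (cases "i = l")
    case True
    then show ?thesis
      using linear_compose[OF D is_formD_linear[OF form l, of x]] by (simp add: comp_def)
  next
    case False
    then show ?thesis
      using is_formD_linear[OF form l, of "x(i := D (x i))"] by (simp add: fun_upd_twist)
  qed
  then show "linear (\<lambda>v. endo_act D k \<omega> (x(l := v)))"
    unfolding endo_act_def by (intro linear_compose_sum) auto
next
  fix x :: "nat \<Rightarrow> 'a" and i j assume ij: "i < k" "j < k" "i \<noteq> j \<and> x i = x j"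
  have "\<omega> (x(l := D (x l))) = 0" if "l < k" "l \<noteq> i" "l \<noteq> j" for l
    by (rule is_formD_alternating[OF form ij(1,2)]) (use that ij in auto)
  then have "endo_act D k \<omega> x = (\<Sum>l\<in>{i, j}. \<omega> (x(l := D (x l))))"
    unfolding endo_act_def using ij by (intro sum.mono_neutral_right) auto
  also have "\<dots> = \<omega> (x(i := D (x i))) + \<omega> (x(j := D (x j)))" using ij by simp
  finally have *: "endo_act D k \<omega> x = \<dots>" .
  have eq: "x(i := D (x i)) = x(j := D (x j)) \<circ> Transposition.transpose i j"
    using ij by (auto simp: fun_eq_iff Transposition.transpose_def)
  have "\<omega> (x(i := D (x i))) = - \<omega> (x(j := D (x j)))"
    unfolding eq by (rule form_swap[OF form ij(1,2)]) (use ij in simp)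
  with * show "endo_act D k \<omega> x = 0" by simp
qed

section \<open>Frames\<close>

lemma strict_sorted_eqI:
  "sorted_wrt (<) I \<Longrightarrow> sorted_wrt (<) J \<Longrightarrow> set I = set J \<Longrightarrow> I = (J :: nat list)"
  by (simp add: sorted_distinct_set_unique strict_sorted_iff)

lemma strict_sorted_subseqs:
  "sorted_wrt (<) K \<Longrightarrow> I \<in> set (subseqs K) \<Longrightarrow> sorted_wrt (<) I \<and> set I \<subseteq> set (K :: nat list)"
  by (induction K arbitrary: I) (fastforce simp: Let_def)+

lemma set_subseqs_strict_sorted:
  assumes "sorted_wrt (<) K"
  shows "set (subseqs K) = {I. sorted_wrt (<) I \<and> set I \<subseteq> set (K :: nat list)}"
proof (intro equalityI subsetI)
  fix I assume "I \<in> {I. sorted_wrt (<) I \<and> set I \<subseteq> set K}"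
  then have I: "sorted_wrt (<) I" "set I \<subseteq> set K" by auto
  then obtain J where J: "J \<in> set (subseqs K)" "set J = set I"
    using subset_subseqs[of "set I" K] by auto
  with strict_sorted_subseqs[OF assms J(1)] I have "J = I" by (simp add: strict_sorted_eqI)
  then show "I \<in> set (subseqs K)" using J by simp
qed (use strict_sorted_subseqs[OF assms] in auto)

lemma distinct_subseqs: "distinct K \<Longrightarrow> distinct (subseqs K)"
  using distinct_set_subseqs distinct_map by blast

definition combs :: "nat \<Rightarrow> nat list set" where
  "combs k = {I. sorted_wrt (<) I \<and> length I = k \<and> set I \<subseteq> {..<7}}"

lemma combs_code: "combs k = set (filter (\<lambda>I. length I = k) (subseqs [0..<7]))"
  using set_subseqs_strict_sorted[of "[0..<7]"] by (auto simp: combs_def lessThan_atLeast0)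

lemma finite_combs: "finite (combs k)"
  by (simp add: combs_code)

lemma combsD:
  assumes "I \<in> combs k"
  shows "sorted_wrt (<) I" "length I = k" "set I \<subseteq> {..<7}" "distinct I" "card (set I) = k"
  using assms by (auto simp: combs_def strict_sorted_iff distinct_card)

lemma combs_eqI: "I \<in> combs k \<Longrightarrow> J \<in> combs l \<Longrightarrow> set I = set J \<Longrightarrow> I = J"
  by (metis combsD(1) strict_sorted_eqI)

lemma combs_7: "combs 7 = {[0..<7]}"
proof -
  have "I = [0..<7]" if "I \<in> combs 7" for I
  proof (rule strict_sorted_eqI)
    show "set I = set [0..<7]"
      using combsD[OF that] card_subset_eq[of "{..<7}" "set I"] by (auto simp: lessThan_atLeast0)
  qed (use combsD[OF that] in auto)
  then show ?thesis by (auto simp: combs_def)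
qed

locale frame =
  fixes b :: "nat \<Rightarrow> 'a::real_vector" and c :: "nat \<Rightarrow> 'a \<Rightarrow> real"
  assumes linear_coord: "i < 7 \<Longrightarrow> linear (c i)"
    and coord_basis: "i < 7 \<Longrightarrow> j < 7 \<Longrightarrow> c i (b j) = (if i = j then 1 else 0)"
    and expansion: "(\<Sum>i<7. c i x *\<^sub>R b i) = x"
begin

definition bt :: "nat list \<Rightarrow> nat \<Rightarrow> 'a" where
  "bt I i = b (I ! i)"

lemma linear_expand: "linear f \<Longrightarrow> f x = (\<Sum>i<7. c i x * f (b i))" for f :: "'a \<Rightarrow> real"
  by (subst expansion[symmetric, of x]) (simp add: linear_sum linear_cmul)

lemma coord_eqI: "(\<And>i. i < 7 \<Longrightarrow> c i x = c i y) \<Longrightarrow> x = y"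
  using expansion[of x] expansion[of y] by (metis (no_types, lifting) lessThan_iff sum.cong)

lemma form_zeroI:
  assumes form: "is_form k \<omega>" and zero: "\<And>I. I \<in> combs k \<Longrightarrow> \<omega> (bt I) = 0"
  shows "\<omega> x = 0"
proof -
  have basis: "\<omega> x = 0" if "\<And>i. i < k \<Longrightarrow> x i \<in> b ` {..<7}" for x
  proof -
    have "\<forall>i. \<exists>m. i < k \<longrightarrow> x i = b m \<and> m < 7" using that by fastforce
    then obtain f where f: "\<And>i. i < k \<Longrightarrow> x i = b (f i) \<and> f i < 7" by metis
    show ?thesis
    proof (cases "inj_on f {..<k}")
      case False
      then obtain i j where "i < k" "j < k" "i \<noteq> j" "f i = f j" by (auto simp: inj_on_def)
      then show ?thesis using is_formD_alternating[OF form, of i j x] f by simp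
    next
      case True
      define J where "J = map f [0..<k]"
      have J: "distinct J" "length J = k" "set J \<subseteq> {..<7}"
        using True f by (auto simp: J_def distinct_map lessThan_atLeast0)
      obtain p where p: "p permutes {..<k}" "permute_list p J = sort J"
        using mset_eq_permutation[of "sort J" J] J by auto
      have sJ: "sort J \<in> combs k" using J by (simp add: combs_def strict_sorted_iff)
      have "\<omega> (bt (sort J)) = \<omega> (\<lambda>i. x (p i))"
      proof (rule is_formD_local[OF form])
        fix i assume i: "i < k"
        then have "p i < k" using permutes_in_image[OF p(1)] by simp
        have "sort J ! i = J ! p i"
          using permute_list_nth[of p J i] p J(2) i by simp
        then show "bt (sort J) i = x (p i)"
          using \<open>p i < k\<close> f by (simp add: bt_def J_def)
      qed
      then have "of_int (sign p) * \<omega> x = 0"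
        using zero[OF sJ] form_permute[OF form p(1), of x] by simp
      then show ?thesis by (simp add: sign_def split: if_splits)
    qed
  qed
  have "\<omega> x = 0" if "m \<le> k" "\<And>i. m \<le> i \<Longrightarrow> i < k \<Longrightarrow> x i \<in> b ` {..<7}" for m x
    using that
  proof (induction m arbitrary: x)
    case 0
    then show ?case by (intro basis) auto
  next
    case (Suc m)
    have "\<omega> (x(m := b i)) = 0" if "i < 7" for i
      by (rule Suc.IH) (use Suc.prems that in auto)
    then show ?case
      using linear_expand[OF is_formD_linear[OF form, of m x], of "x m"] Suc.prems by simp
  qed
  from this[of k x] show ?thesis by simp
qed

lemma form_eqI:
  assumes "is_form k \<alpha>" "is_form k \<beta>" "\<And>I. I \<in> combs k \<Longrightarrow> \<alpha> (bt I) = \<beta> (bt I)"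
  shows "\<alpha> = \<beta>"
proof
  fix x
  show "\<alpha> x = \<beta> x" using form_zeroI[OF is_form_diff[OF assms(1,2)], of x] assms(3) by simp
qed

lemma is_form_ext: "set I \<subseteq> {..<7} \<Longrightarrow> length I = k \<Longrightarrow> is_form k (ext_basis c I)"
  using is_form_ext_basis[of I c] linear_coord by auto

lemma ext_basis_bt_eq_0:
  assumes "length L = length K" "set L \<subseteq> {..<7}" "set K \<subseteq> {..<7}" "set L \<noteq> set K"
  shows "ext_basis c L (bt K) = 0"
  unfolding ext_basis_def
proof (intro sum.neutral ballI)
  fix p assume "p \<in> {p. p permutes {..<length L}}"
  then have p: "p permutes {..<length L}" by simp
  have "\<exists>j<length L. L ! j \<noteq> K ! p j"
  proof (rule ccontr)
    assume "\<not> ?thesis"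
    then have "L = permute_list p K"
      using assms(1) p by (intro nth_equalityI) (auto simp: permute_list_nth)
    then show False using assms p by simp
  qed
  then obtain j where j: "j < length L" "L ! j \<noteq> K ! p j" by blast
  have "p j < length K" using j permutes_in_image[OF p] assms by simp
  then have "c (L ! j) (bt K (p j)) = 0"
    using j assms nth_mem[of j L] nth_mem[of "p j" K] by (auto simp: bt_def coord_basis subset_iff)
  then show "of_int (sign p) * (\<Prod>j<length L. c (L ! j) (bt K (p j))) = 0" using j by auto
qed

lemma ext_basis_bt_self:
  assumes "distinct K" "set K \<subseteq> {..<7}"
  shows "ext_basis c K (bt K) = 1"
proof -
  let ?F = "\<lambda>p. of_int (sign p) * (\<Prod>j<length K. c (K ! j) (bt K (p j)))"
  have "?F p = 0" if p: "p permutes {..<length K}" "p \<noteq> id" for p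
  proof -
    obtain j where j: "j < length K" "p j \<noteq> j"
      using p by (metis eq_id_iff lessThan_iff permutes_not_in)
    have "p j < length K" using j permutes_in_image[OF p(1)] by simp
    then have "c (K ! j) (bt K (p j)) = 0"
      using j assms nth_mem[of j K] nth_mem[of "p j" K] nth_eq_iff_index_eq[OF assms(1), of j "p j"]
      by (auto simp: bt_def coord_basis subset_iff)
    then show ?thesis using j by auto
  qed
  then have "ext_basis c K (bt K) = (\<Sum>p\<in>{id}. ?F p)"
    unfolding ext_basis_def
    by (intro sum.mono_neutral_right) (auto simp: permutes_id finite_permutations)
  also have "\<dots> = 1"
    using assms by (simp add: bt_def coord_basis subset_iff)
  finally show ?thesis .
qed

lemma ext_basis_bt:
  "I \<in> combs k \<Longrightarrow> J \<in> combs k \<Longrightarrow> ext_basis c I (bt J) = (if I = J then 1 else 0)"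
  using ext_basis_bt_self[of J] ext_basis_bt_eq_0[of I J] combs_eqI[of I k J k] combsD[of I] combsD[of J]
  by auto

lemma form_expansion:
  assumes "is_form k \<alpha>"
  shows "\<alpha> = (\<lambda>x. \<Sum>I\<in>combs k. \<alpha> (bt I) * ext_basis c I x)"
proof (rule form_eqI[OF assms])
  show "is_form k (\<lambda>x. \<Sum>I\<in>combs k. \<alpha> (bt I) * ext_basis c I x)"
    by (intro is_form_sum is_form_ext) (auto dest: combsD)
  fix J assume J: "J \<in> combs k"
  have "(\<Sum>I\<in>combs k. \<alpha> (bt I) * ext_basis c I (bt J)) = (\<Sum>I\<in>combs k. if I = J then \<alpha> (bt I) else 0)"
    using J by (intro sum.cong) (auto simp: ext_basis_bt)
  then show "\<alpha> (bt J) = (\<Sum>I\<in>combs k. \<alpha> (bt I) * ext_basis c I (bt J))"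
    using J finite_combs by simp
qed

lemma wedge_expansion:
  assumes "is_form k \<alpha>" "is_form l \<beta>"
  shows "wedge k l \<alpha> \<beta> x
    = (\<Sum>I\<in>combs k. \<Sum>J\<in>combs l. \<alpha> (bt I) * \<beta> (bt J) * ext_basis c (I @ J) x)"
proof -
  have "wedge k l \<alpha> \<beta> x
      = wedge k l (\<lambda>x. \<Sum>I\<in>combs k. \<alpha> (bt I) * ext_basis c I x)
          (\<lambda>x. \<Sum>J\<in>combs l. \<beta> (bt J) * ext_basis c J x) x"
    using form_expansion[OF assms(1)] form_expansion[OF assms(2)] by simp
  also have "\<dots> = (\<Sum>I\<in>combs k. \<Sum>J\<in>combs l. \<alpha> (bt I) * \<beta> (bt J) *
      wedge k l (ext_basis c I) (ext_basis c J) x)"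
    by (simp add: wedge_sum_left wedge_sum_right sum_distrib_left mult.assoc)
  also have "\<dots> = (\<Sum>I\<in>combs k. \<Sum>J\<in>combs l. \<alpha> (bt I) * \<beta> (bt J) * ext_basis c (I @ J) x)"
  proof (intro sum.cong refl)
    fix I J assume "I \<in> combs k" "J \<in> combs l"
    then have "length I = k" "length J = l" by (auto dest: combsD)
    then show "\<alpha> (bt I) * \<beta> (bt J) * wedge k l (ext_basis c I) (ext_basis c J) x
        = \<alpha> (bt I) * \<beta> (bt J) * ext_basis c (I @ J) x"
      using wedge_ext_basis[of I J c] by simp
  qed
  finally show ?thesis .
qed

lemma is_form_wedge:
  fixes \<alpha> \<beta> :: "'a form"
  assumes "is_form k \<alpha>" "is_form l \<beta>"
  shows "is_form (k + l) (wedge k l \<alpha> \<beta>)"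
proof -
  have "wedge k l \<alpha> \<beta> = (\<lambda>x. \<Sum>p\<in>combs k \<times> combs l.
      (\<alpha> (bt (fst p)) * \<beta> (bt (snd p))) * ext_basis c (fst p @ snd p) x)"
    by (simp add: fun_eq_iff wedge_expansion[OF assms] sum.cartesian_product split_def)
  then show ?thesis
    by (auto intro!: is_form_sum is_form_ext simp: combs_def)
qed

lemma wedge_bt:
  assumes "is_form k \<alpha>" "is_form l \<beta>" and K: "K \<in> combs (k + l)"
  shows "wedge k l \<alpha> \<beta> (bt K) = (\<Sum>I\<leftarrow>filter (\<lambda>I. length I = k) (subseqs K).
    (-1) ^ inversions (I @ filter (\<lambda>i. i \<notin> set I) K) * \<alpha> (bt I) * \<beta> (bt (filter (\<lambda>i. i \<notin> set I) K)))"
proof -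
  define rest where "rest I = filter (\<lambda>i. i \<notin> set I) K" for I
  let ?S = "{I \<in> combs k. set I \<subseteq> set K}"
  note Kp = combsD[OF K]
  have rest: "rest I \<in> combs l" "set I \<union> set (rest I) = set K" if "I \<in> ?S" for I
  proof -
    have I: "sorted_wrt (<) I" "length I = k" "distinct I" "set I \<subseteq> set K" using that combsD by auto
    have "length (rest I) = card (set K - set I)"
      using Kp distinct_card[of "rest I"] by (simp add: rest_def set_diff_eq)
    also have "\<dots> = l" using I Kp by (simp add: card_Diff_subset distinct_card)
    finally show "rest I \<in> combs l"
      using Kp by (auto simp: combs_def rest_def sorted_wrt_filter)
    show "set I \<union> set (rest I) = set K" using I by (auto simp: rest_def)
  qed
  have ext: "ext_basis c (I @ J) (bt K) = (if set I \<subseteq> set K \<and> J = rest I then (-1) ^ inversions (I @ J) else 0)"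
    if I: "I \<in> combs k" and J: "J \<in> combs l" for I J
  proof (cases "set I \<union> set J = set K")
    case True
    have d: "distinct (I @ J)"
      using True combsD[OF I] combsD[OF J] Kp by (intro card_distinct) simp
    have "sort (I @ J) = K"
      using d True Kp by (intro strict_sorted_eqI) (auto simp: strict_sorted_iff simp del: sort_append)
    then have "ext_basis c (I @ J) (bt K) = (-1) ^ inversions (I @ J)"
      using ext_basis_sort[of c "I @ J"] ext_basis_bt_self[of K] Kp by simp
    moreover have "J = rest I"
      using combsD(1)[OF J] Kp d True by (intro strict_sorted_eqI) (auto simp: rest_def sorted_wrt_filter)
    ultimately show ?thesis using True by auto
  next
    case False
    then have "ext_basis c (I @ J) (bt K) = 0"
      using combsD[OF I] combsD[OF J] Kp by (intro ext_basis_bt_eq_0) auto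
    then show ?thesis using False rest I by auto
  qed
  have "wedge k l \<alpha> \<beta> (bt K) = (\<Sum>I\<in>combs k. \<Sum>J\<in>combs l. \<alpha> (bt I) * \<beta> (bt J) *
      (if set I \<subseteq> set K \<and> J = rest I then (-1) ^ inversions (I @ J) else 0))"
    by (simp add: wedge_expansion[OF assms(1,2)] ext)
  also have "\<dots> = (\<Sum>I\<in>combs k. if set I \<subseteq> set K
      then (-1) ^ inversions (I @ rest I) * \<alpha> (bt I) * \<beta> (bt (rest I)) else 0)"
  proof (intro sum.cong refl)
    fix I assume I: "I \<in> combs k"
    show "(\<Sum>J\<in>combs l. \<alpha> (bt I) * \<beta> (bt J) *
        (if set I \<subseteq> set K \<and> J = rest I then (-1) ^ inversions (I @ J) else 0))
      = (if set I \<subseteq> set K then (-1) ^ inversions (I @ rest I) * \<alpha> (bt I) * \<beta> (bt (rest I)) else 0)"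
    proof (cases "set I \<subseteq> set K")
      case True
      have "(\<Sum>J\<in>combs l. \<alpha> (bt I) * \<beta> (bt J) *
          (if set I \<subseteq> set K \<and> J = rest I then (-1) ^ inversions (I @ J) else 0))
        = (\<Sum>J\<in>combs l. if J = rest I then \<alpha> (bt I) * \<beta> (bt J) * (-1) ^ inversions (I @ J) else 0)"
        using True by (intro sum.cong) auto
      then show ?thesis using True rest(1)[of I] I finite_combs by simp
    qed auto
  qed
  also have "\<dots> = (\<Sum>I\<in>?S. (-1) ^ inversions (I @ rest I) * \<alpha> (bt I) * \<beta> (bt (rest I)))"
    by (intro sum.mono_neutral_cong_right) (auto simp: finite_combs)
  also have "?S = set (filter (\<lambda>I. length I = k) (subseqs K))"
    using Kp set_subseqs_strict_sorted[OF Kp(1)] by (auto simp: combs_def)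
  finally show ?thesis
    using Kp distinct_subseqs[of K] by (simp add: sum_list_distinct_conv_sum_set rest_def)
qed

end

section \<open>The standard \<open>G\<^sub>2\<close>-form\<close>

lemma inj_of_nat_7: "inj_on (of_nat :: nat \<Rightarrow> 7) {..<7}"
proof -
  have *: "m = n" if "(of_nat m :: 7) = of_nat n" "m \<le> n" "n < 7" for m n
  proof -
    have "(of_nat (n - m) :: 7) = 0" using that by (simp add: of_nat_diff)
    then have "7 dvd n - m" by (simp add: of_nat_eq_0_iff_char_dvd)
    then show "m = n" using that by (auto dest!: dvd_imp_le)
  qed
  show ?thesis
    by (rule inj_onI) (metis * lessThan_iff nat_le_linear)
qed

lemma idx_of_nat: "n < 7 \<Longrightarrow> idx (of_nat n) = n"
  unfolding idx_def
  by (rule Least_equality) (use inj_onD[OF inj_of_nat_7] in \<open>force simp: not_le[symmetric]\<close>)+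

lemma bij_betw_of_nat_7: "bij_betw (of_nat :: nat \<Rightarrow> 7) {..<7} UNIV"
  unfolding bij_betw_def
  by (intro conjI inj_of_nat_7 card_subset_eq) (simp_all add: card_image inj_of_nat_7)

lemma idx_less: "idx i < 7" and of_nat_idx: "of_nat (idx i) = i"
proof -
  have "i \<in> of_nat ` {..<7}"
    using bij_betw_imp_surj_on[OF bij_betw_of_nat_7] by simp
  then obtain n where "n < 7" "i = of_nat n" by auto
  then show "idx i < 7" "of_nat (idx i) = i" by (simp_all add: idx_of_nat)
qed

lemma bij_betw_idx: "bij_betw idx UNIV {..<7}"
  by (rule bij_betw_byWitness[where f' = of_nat]) (auto simp: of_nat_idx idx_of_nat idx_less)

lemma idx_eq_iff: "idx i = idx j \<longleftrightarrow> i = j"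
  using bij_betw_idx by (auto simp: bij_betw_def inj_on_def)

lemma sum_idx: "(\<Sum>i\<in>UNIV. f (idx i)) = (\<Sum>n<7. f n)"
  by (rule sum.reindex_bij_betw[OF bij_betw_idx])

lemma sum_7: "(\<Sum>i<(7::nat). f i) = f 0 + f 1 + f 2 + f 3 + f 4 + f 5 + (f 6 :: 'b::comm_monoid_add)"
  by (simp add: eval_nat_numeral add.assoc)

lemma sum_PiE_upd:
  assumes "finite B" "m < k"
  shows "(\<Sum>f\<in>{..<k} \<rightarrow>\<^sub>E B. \<Sum>v\<in>B. F (f(m := v))) = real (card B) * (\<Sum>f\<in>{..<k} \<rightarrow>\<^sub>E B. F f)"
proof -
  let ?P = "{..<k} \<rightarrow>\<^sub>E B"
  have "(\<Sum>f\<in>?P. \<Sum>v\<in>B. F (f(m := v))) = (\<Sum>(f, v)\<in>?P \<times> B. F (f(m := v)))"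
    by (simp add: sum.cartesian_product)
  also have "\<dots> = (\<Sum>(f, v)\<in>?P \<times> B. F f)"
    by (rule sum.reindex_bij_witness[of _ "\<lambda>(f, v). (f(m := v), f m)" "\<lambda>(f, v). (f(m := v), f m)"])
       (use assms in \<open>auto simp: PiE_def extensional_def Pi_def\<close>)
  also have "\<dots> = real (card B) * (\<Sum>f\<in>?P. F f)"
    by (simp add: sum.cartesian_product[symmetric] sum_distrib_left)
  finally show ?thesis .
qed

context frame
begin

definition inner :: "'a \<Rightarrow> 'a \<Rightarrow> real" where
  "inner v w = (\<Sum>r<7. c r v * c r w)"

definition orthonormal :: "(nat \<Rightarrow> 'a) \<Rightarrow> bool" where
  "orthonormal e \<longleftrightarrow> (\<forall>i<7. \<forall>j<7. inner (e i) (e j) = (if i = j then 1 else 0))"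

lemma orthonormal_b: "orthonormal b"
proof -
  have "(\<Sum>r<7. c r (b i) * c r (b j)) = (\<Sum>r<7. if r = i then c r (b j) else 0)" if "i < 7" "j < 7" for i j
    using that by (intro sum.cong) (auto simp: coord_basis)
  then show ?thesis unfolding orthonormal_def inner_def by (simp add: coord_basis)
qed

lemma orthonormal_columns:
  assumes "orthonormal e" "r < 7" "s < 7"
  shows "(\<Sum>i<7. c r (e i) * c s (e i)) = (if r = s then 1 else 0)"
proof -
  define M :: "real^7^7" where "M = (\<chi> i j. c (idx j) (e (idx i)))"
  have "(M ** transpose M) $ i $ j = (mat 1 :: real^7^7) $ i $ j" for i j
    using assms(1) idx_less[of i] idx_less[of j]
    by (simp add: M_def matrix_matrix_mult_def transpose_def mat_def orthonormal_def inner_def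
        sum_idx[of "\<lambda>k. c k (e (idx i)) * c k (e (idx j))"] idx_eq_iff)
  then have "M ** transpose M = mat 1" by (simp add: vec_eq_iff)
  then have "transpose M ** M = mat 1" by (simp add: matrix_left_right_inverse)
  then have "(transpose M ** M) $ of_nat r $ of_nat s = (mat 1 :: real^7^7) $ of_nat r $ of_nat s" by simp
  moreover have "(of_nat r :: 7) = of_nat s \<longleftrightarrow> r = s"
    using assms inj_of_nat_7 by (auto simp: inj_on_def)
  ultimately show ?thesis
    using assms by (simp add: M_def matrix_matrix_mult_def transpose_def mat_def idx_of_nat
        sum_idx[of "\<lambda>k. c r (e k) * c s (e k)"])
qed

lemma contraction_invariant:
  assumes "orthonormal e" "\<And>w. linear (\<lambda>v. G v w)" "\<And>v. linear (\<lambda>w. G v w :: real)"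
  shows "(\<Sum>i<7. G (e i) (e i)) = (\<Sum>i<7. G (b i) (b i))"
proof -
  have "G v v = (\<Sum>r<7. \<Sum>s<7. (c r v * c s v) * G (b r) (b s))" for v
    by (subst linear_expand[OF assms(2)], subst linear_expand[OF assms(3)])
       (simp add: sum_distrib_left mult.assoc)
  then have "(\<Sum>i<7. G (e i) (e i)) = (\<Sum>i<7. \<Sum>r<7. \<Sum>s<7. (c r (e i) * c s (e i)) * G (b r) (b s))"
    by simp
  also have "\<dots> = (\<Sum>r<7. \<Sum>i<7. \<Sum>s<7. (c r (e i) * c s (e i)) * G (b r) (b s))"
    by (rule sum.swap)
  also have "\<dots> = (\<Sum>r<7. \<Sum>s<7. \<Sum>i<7. (c r (e i) * c s (e i)) * G (b r) (b s))"
    by (rule sum.cong[OF refl], rule sum.swap)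
  also have "\<dots> = (\<Sum>r<7. \<Sum>s<7. (if r = s then 1 else 0) * G (b r) (b s))"
    by (intro sum.cong refl) (simp add: sum_distrib_right[symmetric] orthonormal_columns[OF assms(1)])
  also have "\<dots> = (\<Sum>r<7. \<Sum>s<7. if r = s then G (b r) (b s) else 0)"
    by (intro sum.cong refl) simp
  finally show ?thesis by simp
qed

lemma form_contraction:
  assumes \<alpha>: "is_form k \<alpha>" and \<beta>: "is_form k \<beta>" and e: "orthonormal e"
  shows "(\<Sum>f\<in>{..<k} \<rightarrow>\<^sub>E {..<7}. \<alpha> (\<lambda>i. e (f i)) * \<beta> (\<lambda>i. e (f i)))
    = (\<Sum>f\<in>{..<k} \<rightarrow>\<^sub>E {..<7}. \<alpha> (\<lambda>i. b (f i)) * \<beta> (\<lambda>i. b (f i)))"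
proof -
  define mix where "mix m f i = (if i < m then b (f i) else e (f i))" for m f and i :: nat
  define S where "S m = (\<Sum>f\<in>{..<k} \<rightarrow>\<^sub>E {..<7}. \<alpha> (mix m f) * \<beta> (mix m f))" for m
  have step: "S m = S (Suc m)" if "m < k" for m
  proof -
    have u1: "mix m (f(m := v)) = (mix m f)(m := e v)" and u2: "mix (Suc m) (f(m := v)) = (mix m f)(m := b v)" for f v
      by (auto simp: mix_def fun_eq_iff)
    have "(\<Sum>v<7. \<alpha> ((mix m f)(m := e v)) * \<beta> ((mix m f)(m := e v)))
      = (\<Sum>v<7. \<alpha> ((mix m f)(m := b v)) * \<beta> ((mix m f)(m := b v)))" for f
    proof (rule contraction_invariant[OF e, of "\<lambda>v w. \<alpha> ((mix m f)(m := v)) * \<beta> ((mix m f)(m := w))"])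
      show "linear (\<lambda>v. \<alpha> ((mix m f)(m := v)) * \<beta> ((mix m f)(m := w)))" for w
        using linear_compose_scale_right[OF is_formD_linear[OF \<alpha> that, of "mix m f"], of "\<beta> ((mix m f)(m := w))"]
        by (simp add: mult.commute)
      show "linear (\<lambda>w. \<alpha> ((mix m f)(m := v)) * \<beta> ((mix m f)(m := w)))" for v
        using linear_compose_scale_right[OF is_formD_linear[OF \<beta> that, of "mix m f"], of "\<alpha> ((mix m f)(m := v))"]
        by simp
    qed
    then have "real (card {..<7::nat}) * S m = real (card {..<7::nat}) * S (Suc m)"
      unfolding S_def
      by (subst (1 2) sum_PiE_upd[OF _ that, symmetric]) (auto simp: u1 u2)
    then show ?thesis by simp
  qed
  have "m \<le> k \<Longrightarrow> S 0 = S m" for m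
    by (induction m) (auto simp: step)
  from this[of k] have "S 0 = S k" by simp
  moreover have "S k = (\<Sum>f\<in>{..<k} \<rightarrow>\<^sub>E {..<7}. \<alpha> (\<lambda>i. b (f i)) * \<beta> (\<lambda>i. b (f i)))"
    unfolding S_def mix_def
    by (intro sum.cong refl arg_cong2[of _ _ _ _ "(*)"] is_formD_local[OF \<alpha>] is_formD_local[OF \<beta>]) auto
  moreover have "mix 0 f = (\<lambda>i. e (f i))" for f by (rule ext) (simp add: mix_def)
  ultimately show ?thesis by (simp add: S_def)
qed

lemma form_contraction_ext:
  assumes \<beta>: "is_form k \<beta>" and I: "I \<in> combs k"
  shows "(\<Sum>f\<in>{..<k} \<rightarrow>\<^sub>E {..<7}. ext_basis c I (\<lambda>i. b (f i)) * \<beta> (\<lambda>i. b (f i))) = fact k * \<beta> (bt I)"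
proof -
  let ?P = "{p. p permutes {..<k}}" and ?F = "{..<k} \<rightarrow>\<^sub>E {..<(7::nat)}"
  have len: "length I = k" and sub: "\<And>j. j < k \<Longrightarrow> I ! j < 7"
    using combsD[OF I] nth_mem[of _ I] by (auto simp: subset_iff)
  have one: "(\<Sum>f\<in>?F. (\<Prod>j<k. c (I ! j) (b (f (p j)))) * \<beta> (\<lambda>i. b (f i))) = of_int (sign p) * \<beta> (bt I)"
    if p: "p \<in> ?P" for p
  proof -
    have p': "p permutes {..<k}" using p by simp
    define f0 where "f0 = restrict (\<lambda>i. I ! inv p i) {..<k}"
    have ip: "inv p i < k" if "i < k" for i
      using permutes_in_image[OF permutes_inv[OF p']] that by simp
    have f0: "f0 \<in> ?F" using sub ip by (auto simp: f0_def)
    have "(\<Prod>j<k. c (I ! j) (b (f (p j)))) = 0" if f: "f \<in> ?F" "f \<noteq> f0" for f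
    proof -
      obtain i where i: "i < k" "f i \<noteq> f0 i"
        using f f0 by (metis PiE_ext lessThan_iff)
      have fi: "f i < 7" using f i by auto
      have "c (I ! inv p i) (b (f (p (inv p i)))) = 0"
        using i fi sub[OF ip[OF i(1)]] permutes_inverses(1)[OF p'] by (simp add: f0_def coord_basis)
      then show ?thesis using ip[OF i(1)] by (metis finite_lessThan lessThan_iff prod_zero)
    qed
    then have "(\<Sum>f\<in>?F. (\<Prod>j<k. c (I ! j) (b (f (p j)))) * \<beta> (\<lambda>i. b (f i)))
      = (\<Sum>f\<in>{f0}. (\<Prod>j<k. c (I ! j) (b (f (p j)))) * \<beta> (\<lambda>i. b (f i)))"
      by (intro sum.mono_neutral_right) (auto simp: f0 finite_PiE)
    also have "\<dots> = \<beta> (\<lambda>i. bt I (inv p i))"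
    proof -
      have "(\<Prod>j<k. c (I ! j) (b (f0 (p j)))) = 1"
        using permutes_in_image[OF p'] permutes_inverses(2)[OF p'] sub
        by (intro prod.neutral) (auto simp: f0_def coord_basis)
      moreover have "\<beta> (\<lambda>i. b (f0 i)) = \<beta> (\<lambda>i. bt I (inv p i))"
        by (rule is_formD_local[OF \<beta>]) (simp add: f0_def bt_def)
      ultimately show ?thesis by simp
    qed
    also have "\<dots> = of_int (sign p) * \<beta> (bt I)"
      using form_permute[OF \<beta> permutes_inv[OF p'], of "bt I"] p'
      by (simp add: sign_inverse permutes_imp_permutation[OF finite_lessThan])
    finally show ?thesis .
  qed
  have "(\<Sum>f\<in>?F. ext_basis c I (\<lambda>i. b (f i)) * \<beta> (\<lambda>i. b (f i)))
    = (\<Sum>f\<in>?F. \<Sum>p\<in>?P. of_int (sign p) * ((\<Prod>j<k. c (I ! j) (b (f (p j)))) * \<beta> (\<lambda>i. b (f i))))"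
    unfolding ext_basis_def len by (simp add: sum_distrib_right mult.assoc)
  also have "\<dots> = (\<Sum>p\<in>?P. of_int (sign p) * (\<Sum>f\<in>?F. (\<Prod>j<k. c (I ! j) (b (f (p j)))) * \<beta> (\<lambda>i. b (f i))))"
    unfolding sum_distrib_left by (rule sum.swap)
  also have "\<dots> = (\<Sum>p\<in>?P. \<beta> (bt I))"
    by (intro sum.cong refl) (simp add: one del: mem_Collect_eq, simp flip: mult.assoc of_int_mult)
  also have "\<dots> = fact k * \<beta> (bt I)"
    by (simp add: card_permutations)
  finally show ?thesis .
qed

end

lemma case_nat_nth: "case_nat v ((!) xs) = (!) (v # xs)"
  by (rule ext) (simp add: nth_Cons)

lemma interior_nth: "interior v \<omega> ((!) xs) = \<omega> ((!) (v # xs))"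
  by (simp add: interior_def case_nat_nth)

lemma is_form_interior:
  assumes "is_form (Suc k) \<omega>"
  shows "is_form k (interior v \<omega>)"
  unfolding is_form_def interior_def
proof (intro conjI allI impI)
  fix x y :: "nat \<Rightarrow> 'a" assume "\<forall>i<k. x i = y i"
  then show "\<omega> (case_nat v x) = \<omega> (case_nat v y)"
    by (intro is_formD_local[OF assms]) (auto split: nat.split)
next
  fix x :: "nat \<Rightarrow> 'a" and i assume "i < k"
  moreover have "case_nat v (x(i := u)) = (case_nat v x)(Suc i := u)" for u
    by (auto simp: fun_eq_iff split: nat.split)
  ultimately show "linear (\<lambda>u. \<omega> (case_nat v (x(i := u))))"
    using is_formD_linear[OF assms, of "Suc i" "case_nat v x"] by simp
next
  fix x :: "nat \<Rightarrow> 'a" and i j assume "i < k" "j < k" "i \<noteq> j \<and> x i = x j"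
  then show "\<omega> (case_nat v x) = 0"
    by (intro is_formD_alternating[OF assms, of "Suc i" "Suc j"]) auto
qed

lemma fun_upd_nth: "i < length xs \<Longrightarrow> ((!) xs)(i := v) = (!) (xs[i := v])"
  by (auto simp: fun_eq_iff nth_list_update)

lemma form_nth_swap:
  assumes "is_form k \<omega>" "length xs = k" "i < k" "j < k" "i \<noteq> j"
  shows "\<omega> ((!) (xs[i := xs ! j, j := xs ! i])) = - \<omega> ((!) xs)"
proof -
  have "\<omega> ((!) (xs[i := xs ! j, j := xs ! i])) = \<omega> ((!) xs \<circ> Transposition.transpose i j)"
    by (rule is_formD_local[OF assms(1)])
       (use assms in \<open>auto simp: nth_list_update Transposition.transpose_def\<close>)
  then show ?thesis using form_swap[OF assms(1,3,4,5), of "(!) xs"] by simp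
qed

lemma form_nth_linear:
  assumes "is_form k \<omega>" "length xs = k" "i < k"
  shows "linear (\<lambda>v. \<omega> ((!) (xs[i := v])))"
proof -
  show ?thesis
    using is_formD_linear[OF assms(1,3), of "(!) xs"] assms by (simp only: fun_upd_nth)
qed

context
  fixes \<omega> :: "'a::real_vector form"
  assumes \<omega>: "is_form 2 \<omega>"
begin

lemma form2_swap: "\<omega> ((!) [v, u]) = - \<omega> ((!) [u, v])"
  using form_nth_swap[OF \<omega>, of "[u, v]" 0 1] by simp

lemma form2_self: "\<omega> ((!) [u, u]) = 0"
  using form2_swap[of u u] by simp

lemma form2_linear: "linear (\<lambda>u. \<omega> ((!) [u, v]))" "linear (\<lambda>v. \<omega> ((!) [u, v]))"
  using form_nth_linear[OF \<omega>, of "[0, v]" 0] form_nth_linear[OF \<omega>, of "[u, 0]" 1] by simp_all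

end

context
  fixes \<omega> :: "'a::real_vector form"
  assumes \<omega>: "is_form 3 \<omega>"
begin

lemma form3_swap12: "\<omega> ((!) [v, u, w]) = - \<omega> ((!) [u, v, w])"
  using form_nth_swap[OF \<omega>, of "[u, v, w]" 0 1] by simp

lemma form3_swap23: "\<omega> ((!) [u, w, v]) = - \<omega> ((!) [u, v, w])"
  using form_nth_swap[OF \<omega>, of "[u, v, w]" 1 2] by simp

lemma form3_self: "\<omega> ((!) [u, u, w]) = 0" "\<omega> ((!) [w, u, u]) = 0" "\<omega> ((!) [u, w, u]) = 0"
  using form3_swap12[of u u w] form3_swap23[of w u u] form3_swap12[of u w u] form3_swap23[of w u u]
  by simp_all

lemma form3_linear: "linear (\<lambda>u. \<omega> ((!) [u, v, w]))" "linear (\<lambda>v. \<omega> ((!) [u, v, w]))"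
  "linear (\<lambda>w. \<omega> ((!) [u, v, w]))"
  using form_nth_linear[OF \<omega>, of "[0, v, w]" 0] form_nth_linear[OF \<omega>, of "[u, 0, w]" 1]
    form_nth_linear[OF \<omega>, of "[u, v, 0]" 2] by simp_all

end

definition alt3 :: "(nat \<Rightarrow> nat \<Rightarrow> nat \<Rightarrow> real) \<Rightarrow> nat \<Rightarrow> nat \<Rightarrow> nat \<Rightarrow> real" where
  "alt3 T i j k = (if i = j \<or> j = k \<or> i = k then 0
     else if i < j then (if j < k then T i j k else if i < k then - T i k j else T k i j)
     else (if i < k then - T j i k else if j < k then T j k i else - T k j i))"

lemma form3_alt3:
  assumes "is_form 3 \<omega>" "\<And>i j k. i < j \<Longrightarrow> j < k \<Longrightarrow> k < n \<Longrightarrow> \<omega> ((!) [v i, v j, v k]) = T i j k"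
    and "i < n" "j < n" "k < n"
  shows "\<omega> ((!) [v i, v j, v k]) = alt3 T i j k"
proof -
  note s = form3_swap12[OF assms(1)] form3_swap23[OF assms(1)]
  consider "i = j \<or> j = k \<or> i = k" | "i < j" "j < k" | "i < k" "k < j" | "k < i" "i < j"
    | "j < i" "i < k" | "j < k" "k < i" | "k < j" "j < i"
    by linarith
  then show ?thesis
  proof cases
    case 1 then show ?thesis by (auto simp: alt3_def form3_self[OF assms(1)])
  next
    case 2 then show ?thesis using assms by (simp add: alt3_def)
  next
    case 3
    then show ?thesis using assms s(2)[of "v i" "v j" "v k"] by (simp add: alt3_def)
  next
    case 4
    then show ?thesis using assms s(1)[of "v i" "v k" "v j"] s(2)[of "v i" "v k" "v j"]
      by (simp add: alt3_def)
  next
    case 5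
    then show ?thesis using assms s(1)[of "v i" "v j" "v k"] by (simp add: alt3_def)
  next
    case 6
    then show ?thesis using assms s(1)[of "v j" "v i" "v k"] s(2)[of "v j" "v i" "v k"]
      by (simp add: alt3_def)
  next
    case 7
    then show ?thesis using assms s(1)[of "v k" "v i" "v j"] s(2)[of "v k" "v i" "v j"] s(1)[of "v j" "v i" "v k"]
       s(2)[of "v j" "v i" "v k"]  s(1)[of "v k" "v j" "v i"] s(2)[of "v i" "v k" "v j"]
      by (simp add: alt3_def)
  qed
qed

definition g2_table :: "nat \<Rightarrow> nat \<Rightarrow> nat \<Rightarrow> real" where
  "g2_table i j k = (if (i, j, k) \<in> {(0, 1, 2), (0, 3, 4), (0, 5, 6), (1, 3, 5)} then 1
     else if (i, j, k) \<in> {(1, 4, 6), (2, 3, 6), (2, 4, 5)} then -1 else 0)"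

definition g2_eps :: "nat \<Rightarrow> nat \<Rightarrow> nat \<Rightarrow> real" where
  "g2_eps = alt3 g2_table"

context frame
begin

lemma bt_nth: "is_form k \<omega> \<Longrightarrow> length I = k \<Longrightarrow> \<omega> (bt I) = \<omega> ((!) (map b I))"
  by (rule is_formD_local) (auto simp: bt_def)

lemma combs2_iff: "[i, j] \<in> combs 2 \<longleftrightarrow> i < j \<and> j < 7"
  by (auto simp: combs_def)

lemma combs3_iff: "[i, j, k] \<in> combs 3 \<longleftrightarrow> i < j \<and> j < k \<and> k < 7"
  by (auto simp: combs_def)

lemma combs4_iff: "[i, j, k, l] \<in> combs 4 \<longleftrightarrow> i < j \<and> j < k \<and> k < l \<and> l < 7"
  by (auto simp: combs_def)

lemma wedge22:
  assumes "is_form 2 \<alpha>" "is_form 2 \<beta>" "i < j" "j < k" "k < l" "l < 7"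
  shows "wedge 2 2 \<alpha> \<beta> (bt [i, j, k, l]) = \<alpha> (bt [i, j]) * \<beta> (bt [k, l]) - \<alpha> (bt [i, k]) * \<beta> (bt [j, l])
    + \<alpha> (bt [i, l]) * \<beta> (bt [j, k]) + \<alpha> (bt [j, k]) * \<beta> (bt [i, l]) - \<alpha> (bt [j, l]) * \<beta> (bt [i, k])
    + \<alpha> (bt [k, l]) * \<beta> (bt [i, j])"
proof -
  have "[i, j, k, l] \<in> combs (2 + 2)" using assms by (auto simp: combs_def)
  from wedge_bt[OF assms(1,2) this] assms(3-) show ?thesis
    by (simp add: Let_def)
qed

end

locale g2_frame = frame b c for b :: "nat \<Rightarrow> 'a::real_vector" and c +
  fixes \<phi> :: "'a form"
  assumes form: "is_form 3 \<phi>"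
    and tab: "i < j \<Longrightarrow> j < k \<Longrightarrow> k < 7 \<Longrightarrow> \<phi> ((!) [b i, b j, b k]) = g2_table i j k"
begin

lemma eps: "i < 7 \<Longrightarrow> j < 7 \<Longrightarrow> k < 7 \<Longrightarrow> \<phi> ((!) [b i, b j, b k]) = g2_eps i j k"
  unfolding g2_eps_def by (rule form3_alt3[OF form tab])

lemma tab_bt: "[i, j, k] \<in> combs 3 \<Longrightarrow> \<phi> (bt [i, j, k]) = g2_table i j k"
  using bt_nth[OF form, of "[i, j, k]"] tab[of i j k] by (simp add: combs3_iff)

lemma eps_first: "j < 7 \<Longrightarrow> k < 7 \<Longrightarrow> \<phi> ((!) [v, b j, b k]) = (\<Sum>r<7. c r v * g2_eps r j k)"
  by (subst linear_expand[OF form3_linear(1)[OF form]]) (simp add: eps)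

lemma interior_bt: "i < 7 \<Longrightarrow> j < 7 \<Longrightarrow> interior v \<phi> (bt [i, j]) = (\<Sum>r<7. c r v * g2_eps r i j)"
  using bt_nth[of 2 "interior v \<phi>" "[i, j]"] is_form_interior[of 2 \<phi> v] form eps_first[of i j v]
  by (simp add: interior_nth eval_nat_numeral)

lemma interior_values:
  "interior v \<phi> (bt [0, 1]) = c 2 v"
  "interior v \<phi> (bt [0, 2]) = - c 1 v"
  "interior v \<phi> (bt [0, 3]) = c 4 v"
  "interior v \<phi> (bt [0, 4]) = - c 3 v"
  "interior v \<phi> (bt [0, 5]) = c 6 v"
  "interior v \<phi> (bt [0, 6]) = - c 5 v"
  "interior v \<phi> (bt [1, 2]) = c 0 v"
  "interior v \<phi> (bt [1, 3]) = c 5 v"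
  "interior v \<phi> (bt [1, 4]) = - c 6 v"
  "interior v \<phi> (bt [1, 5]) = - c 3 v"
  "interior v \<phi> (bt [1, 6]) = c 4 v"
  "interior v \<phi> (bt [2, 3]) = - c 6 v"
  "interior v \<phi> (bt [2, 4]) = - c 5 v"
  "interior v \<phi> (bt [2, 5]) = c 4 v"
  "interior v \<phi> (bt [2, 6]) = c 3 v"
  "interior v \<phi> (bt [3, 4]) = c 0 v"
  "interior v \<phi> (bt [3, 5]) = c 1 v"
  "interior v \<phi> (bt [3, 6]) = - c 2 v"
  "interior v \<phi> (bt [4, 5]) = - c 2 v"
  "interior v \<phi> (bt [4, 6]) = - c 1 v"
  "interior v \<phi> (bt [5, 6]) = c 0 v"
  by (simp_all add: interior_bt sum_7 g2_eps_def alt3_def g2_table_def)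

lemma is_form_interior_phi: "is_form 2 (interior v \<phi>)"
  using is_form_interior[of 2 \<phi> v] form by (simp add: eval_nat_numeral)

definition vol :: "'a form" where
  "vol = ext_basis c [0..<7]"

lemma vol_top: "vol (bt [0..<7]) = 1"
  unfolding vol_def by (rule ext_basis_bt_self) auto

lemma top_form_eq: "is_form 7 \<omega> \<Longrightarrow> \<omega> x = \<omega> (bt [0..<7]) * vol x"
  using fun_cong[OF form_expansion[of 7 \<omega>], of x] by (simp add: combs_7 vol_def)

lemma b_form_top: "b_form \<phi> v w (bt [0..<7]) = inner v w"
proof -
  have seven: "[0..<7] = [0, 1, 2, 3, 4, 5, 6]" by (simp add: upt_rec)
  have f4: "is_form 4 (wedge 2 2 (interior v \<phi>) (interior w \<phi>))"
    using is_form_wedge[OF is_form_interior_phi is_form_interior_phi] by simp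
  have K: "[0..<7] \<in> combs (4 + 3)" using combs_7 by simp
  show ?thesis
    unfolding b_form_def wedge_bt[OF f4 form K]
    unfolding seven
    by (simp add: Let_def tab_bt combs3_iff g2_table_def wedge22 is_form_interior_phi interior_values
        interior_values[unfolded One_nat_def] sum_7 inner_def)
qed

lemma b_form_eq: "b_form \<phi> v w x = inner v w * vol x"
proof -
  have "is_form (2 + 2) (wedge 2 2 (interior v \<phi>) (interior w \<phi>))"
    by (rule is_form_wedge[OF is_form_interior_phi is_form_interior_phi])
  from is_form_wedge[OF this form]
  have "is_form 7 (wedge 4 3 (wedge 2 2 (interior v \<phi>) (interior w \<phi>)) \<phi>)" by simp
  from is_form_scale[OF this, of "1/6"] have "is_form 7 (b_form \<phi> v w)"
    by (simp add: b_form_def[abs_def])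
  from top_form_eq[OF this, of x] show ?thesis by (simp add: b_form_top)
qed

lemma vol_det: "vol x = det (\<chi> i j :: 7. c (idx j) (x (idx i)))"
proof -
  define D where "D = (\<lambda>x. det (\<chi> i j :: 7. c (idx j) (x (idx i))))"
  have "is_form 7 D"
    unfolding is_form_def
  proof (intro conjI allI impI)
    fix x y :: "nat \<Rightarrow> 'a" assume "\<forall>i<7. x i = y i"
    then show "D x = D y" by (simp add: D_def idx_less)
  next
    fix x :: "nat \<Rightarrow> 'a" and i :: nat assume i: "i < 7"
    have upd: "(\<chi> k j :: 7. c (idx j) ((x(i := v)) (idx k)))
      = (\<chi> k. if k = of_nat i then (\<chi> j. c (idx j) v) else (\<chi> j. c (idx j) (x (idx k))))" for v
      using i idx_of_nat[OF i] by (auto simp: vec_eq_iff of_nat_idx)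
    show "linear (\<lambda>v. D (x(i := v)))"
    proof (rule linearI)
      fix u v :: 'a and r :: real
      have a: "(\<chi> j. c (idx j) (u + v)) = (\<chi> j. c (idx j) u) + (\<chi> j :: 7. c (idx j) v)"
        using linear_coord[OF idx_less] by (simp add: vec_eq_iff linear_add)
      show "D (x(i := u + v)) = D (x(i := u)) + D (x(i := v))"
        unfolding D_def upd a by (rule det_row_add)
      have m: "(\<chi> j. c (idx j) (r *\<^sub>R u)) = r *s (\<chi> j :: 7. c (idx j) u)"
        using linear_coord[OF idx_less] by (simp add: vec_eq_iff linear_cmul)
      show "D (x(i := r *\<^sub>R u)) = r *\<^sub>R D (x(i := u))"
        unfolding D_def upd m by (simp add: det_row_mul)
    qed
  next
    fix x :: "nat \<Rightarrow> 'a" and i j :: nat assume ij: "i < 7" "j < 7" "i \<noteq> j \<and> x i = x j"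
    have "(of_nat i :: 7) \<noteq> of_nat j" using ij idx_of_nat by metis
    then show "D x = 0"
      unfolding D_def
      by (rule det_identical_rows) (use ij in \<open>simp add: row_def vec_eq_iff idx_of_nat\<close>)
  qed
  from top_form_eq[OF this, of x]
  have "D x = D (bt [0..<7]) * vol x" .
  also have "(\<chi> i j :: 7. c (idx j) (bt [0..<7] (idx i))) = mat 1"
    using idx_less by (auto simp: bt_def mat_def vec_eq_iff coord_basis idx_eq_iff)
  then have "D (bt [0..<7]) = 1" by (simp add: D_def)
  finally show ?thesis by (simp add: D_def)
qed

lemma g2_vol_eq: "g2_vol \<phi> = vol"
proof
  fix x
  let ?X = "(\<chi> i j :: 7. c (idx j) (x (idx i))) :: real^7^7"
  have "(\<chi> i j. b_form \<phi> (x (idx i)) (x (idx j)) x) = (\<chi> i. vol x *s ((?X ** transpose ?X) $ i))"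
    by (simp add: vec_eq_iff b_form_eq matrix_matrix_mult_def transpose_def inner_def
        sum_idx[of "\<lambda>k. c k (x _) * c k (x _)"])
  moreover have "(\<chi> i. (?X ** transpose ?X) $ i) = ?X ** transpose ?X" by (simp add: vec_eq_iff)
  ultimately have "det (\<chi> i j :: 7. b_form \<phi> (x (idx i)) (x (idx j)) x) = vol x ^ 7 * (vol x * vol x)"
    by (simp add: det_rows_mul det_mul vol_det[symmetric])
  also have "\<dots> = vol x ^ 9" by (simp add: eval_nat_numeral)
  finally show "g2_vol \<phi> x = vol x"
    by (simp add: g2_vol_def odd_real_root_power_cancel)
qed

lemma g2_metric_eq: "g2_metric \<phi> v w = inner v w"
  unfolding g2_metric_def g2_vol_eq
proof (rule the_equality)
  fix r assume "\<forall>x. b_form \<phi> v w x = r * vol x"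
  then have "b_form \<phi> v w (bt [0..<7]) = r * vol (bt [0..<7])" by blast
  then show "r = inner v w" by (simp only: vol_top b_form_top mult_1_right)
qed (simp add: b_form_eq)

lemma form_inner_ext:
  assumes "is_form k \<beta>" "I \<in> combs k"
  shows "form_inner \<phi> k (ext_basis c I) \<beta> = \<beta> (bt I)"
proof -
  have *: "g2_orthonormal \<phi> e \<longleftrightarrow> orthonormal e" for e
    by (simp add: g2_orthonormal_def orthonormal_def g2_metric_eq)
  have "g2_orthonormal \<phi> b" using orthonormal_b by (simp add: *)
  then have "g2_orthonormal \<phi> (SOME e. g2_orthonormal \<phi> e)"
    by (rule someI[of "g2_orthonormal \<phi>"])
  then have "orthonormal (SOME e. g2_orthonormal \<phi> e)" by (simp only: *)
  from form_contraction[OF is_form_ext assms(1) this] combsD[OF assms(2)] form_contraction_ext[OF assms]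
  show ?thesis by (simp add: form_inner_def Let_def)
qed

definition compl :: "nat list \<Rightarrow> nat list" where
  "compl I = filter (\<lambda>i. i \<notin> set I) [0..<7]"

lemma compl_combs: "I \<in> combs k \<Longrightarrow> compl I \<in> combs (7 - k)"
proof -
  assume I: "I \<in> combs k"
  have "length (compl I) = card ({..<7} - set I)"
    using distinct_card[of "compl I"] by (simp add: compl_def set_diff_eq lessThan_atLeast0 del: upt_rec_numeral)
  also have "\<dots> = 7 - k" using combsD[OF I] by (simp add: card_Diff_subset)
  finally show ?thesis by (auto simp: combs_def compl_def sorted_wrt_filter simp del: upt_rec_numeral)
qed

lemma compl_compl: "I \<in> combs k \<Longrightarrow> compl (compl I) = I"
  by (rule strict_sorted_eqI) (auto simp: compl_def sorted_wrt_filter dest: combsD simp del: upt_rec_numeral)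

lemma wedge_ext_top:
  assumes \<gamma>: "is_form (7 - k) \<gamma>" and I: "I \<in> combs k"
  shows "wedge k (7 - k) (ext_basis c I) \<gamma> x = (-1) ^ inversions (I @ compl I) * \<gamma> (bt (compl I)) * vol x"
proof -
  have k: "k \<le> 7" using combsD[OF I] card_mono[of "{..<7}" "set I"] by simp
  have e: "is_form k (ext_basis c I)" using combsD[OF I] by (intro is_form_ext) auto
  have K: "[0..<7] \<in> combs (k + (7 - k))" using combs_7 k by simp
  have "wedge k (7 - k) (ext_basis c I) \<gamma> (bt [0..<7])
    = (\<Sum>J\<leftarrow>filter (\<lambda>I. length I = k) (subseqs [0..<7]).
        if J = I then (-1) ^ inversions (J @ compl J) * \<gamma> (bt (compl J)) else 0)"
    unfolding wedge_bt[OF e \<gamma> K] compl_def[symmetric]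
  proof (rule arg_cong[of _ _ sum_list], rule map_cong[OF refl])
    fix J assume "J \<in> set (filter (\<lambda>I. length I = k) (subseqs [0..<7]))"
    then have "J \<in> combs k" by (simp only: combs_code)
    then show "(-1) ^ inversions (J @ compl J) * ext_basis c I (bt J) * \<gamma> (bt (compl J))
      = (if J = I then (-1) ^ inversions (J @ compl J) * \<gamma> (bt (compl J)) else 0)"
      using I by (simp add: ext_basis_bt)
  qed
  also have "\<dots> = (\<Sum>J\<in>combs k. if J = I then (-1) ^ inversions (J @ compl J) * \<gamma> (bt (compl J)) else 0)"
    unfolding combs_code by (rule sum_list_distinct_conv_sum_set) (intro distinct_filter distinct_subseqs, rule
        distinct_upt)
  also have "\<dots> = (-1) ^ inversions (I @ compl I) * \<gamma> (bt (compl I))"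
    using I finite_combs by simp
  finally show ?thesis
    using top_form_eq[of "wedge k (7 - k) (ext_basis c I) \<gamma>" x] is_form_wedge[OF e \<gamma>] k by simp
qed

lemma hodge_eqI:
  assumes k: "k \<le> 7" and \<beta>: "is_form k \<beta>" and \<gamma>: "is_form (7 - k) \<gamma>"
    and eq: "\<And>I. I \<in> combs k \<Longrightarrow> \<gamma> (bt (compl I)) = (-1) ^ inversions (I @ compl I) * \<beta> (bt I)"
  shows "hodge \<phi> k \<beta> = \<gamma>"
  unfolding hodge_def g2_vol_eq
proof (rule the_equality)
  have "wedge k (7 - k) \<alpha> \<gamma> = (\<lambda>x. form_inner \<phi> k \<alpha> \<beta> * vol x)" if \<alpha>: "is_form k \<alpha>" for \<alpha>
  proof
    fix x
    have inner_sum: "form_inner \<phi> k (\<lambda>x. \<Sum>I\<in>combs k. r I * ext_basis c I x) \<beta>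
      = (\<Sum>I\<in>combs k. r I * form_inner \<phi> k (ext_basis c I) \<beta>)" for r
      unfolding form_inner_def Let_def sum_divide_distrib sum_distrib_left sum_distrib_right
      by (subst sum.swap) (simp add: mult_ac)
    have "wedge k (7 - k) \<alpha> \<gamma> x = (\<Sum>I\<in>combs k. \<alpha> (bt I) * wedge k (7 - k) (ext_basis c I) \<gamma> x)"
      by (subst form_expansion[OF \<alpha>]) (rule wedge_sum_left)
    also have "\<dots> = (\<Sum>I\<in>combs k. \<alpha> (bt I) * (\<beta> (bt I) * vol x))"
      by (intro sum.cong refl) (simp add: wedge_ext_top[OF \<gamma>] eq flip: power_mult_distrib mult.assoc)
    also have "\<dots> = form_inner \<phi> k \<alpha> \<beta> * vol x"
      by (subst form_expansion[OF \<alpha>])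
         (simp add: inner_sum form_inner_ext[OF \<beta>] sum_distrib_right mult.assoc)
    finally show "wedge k (7 - k) \<alpha> \<gamma> x = form_inner \<phi> k \<alpha> \<beta> * vol x" .
  qed
  with \<gamma> show "is_form (7 - k) \<gamma> \<and> (\<forall>\<alpha>. is_form k \<alpha> \<longrightarrow>
      wedge k (7 - k) \<alpha> \<gamma> = (\<lambda>x. form_inner \<phi> k \<alpha> \<beta> * vol x))" by blast
  fix \<delta> assume \<delta>: "is_form (7 - k) \<delta> \<and> (\<forall>\<alpha>. is_form k \<alpha> \<longrightarrow>
      wedge k (7 - k) \<alpha> \<delta> = (\<lambda>x. form_inner \<phi> k \<alpha> \<beta> * vol x))"
  show "\<delta> = \<gamma>"
  proof (rule form_eqI[OF _ \<gamma>])
    show d: "is_form (7 - k) \<delta>" using \<delta> by blast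
    fix J assume J: "J \<in> combs (7 - k)"
    have I: "compl J \<in> combs k" using compl_combs[OF J] k by simp
    let ?s = "(-1) ^ inversions (compl J @ J) :: real"
    have ss: "?s * ?s = 1" by (simp flip: power_mult_distrib)
    have "is_form k (ext_basis c (compl J))" using I by (intro is_form_ext) (auto dest: combsD)
    then have "wedge k (7 - k) (ext_basis c (compl J)) \<delta> (bt [0..<7]) = \<beta> (bt (compl J))"
      using \<delta> form_inner_ext[OF \<beta> I] by (simp add: vol_top del: upt_rec_numeral)
    then have "?s * \<delta> (bt J) = \<beta> (bt (compl J))"
      by (simp add: wedge_ext_top[OF d I] compl_compl[OF J] vol_top del: upt_rec_numeral)
    then have "?s * (?s * \<delta> (bt J)) = ?s * \<beta> (bt (compl J))" by simp
    then show "\<delta> (bt J) = \<gamma> (bt J)"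
      using eq[OF I] ss by (simp add: compl_compl[OF J] flip: mult.assoc)
  qed
qed

end

definition delete_at :: "nat \<Rightarrow> 'b list \<Rightarrow> 'b list" where
  "delete_at i xs = take i xs @ drop (Suc i) xs"

lemma delete_at_simps [simp]:
  "delete_at 0 (x # xs) = xs" "delete_at (Suc i) (x # xs) = x # delete_at i xs"
  by (simp_all add: delete_at_def)

lemma length_delete_at: "i < length xs \<Longrightarrow> length (delete_at i xs) = length xs - 1"
  by (auto simp: delete_at_def)

lemma omit_nth: "Suc n < length xs \<Longrightarrow> i < length xs \<Longrightarrow> omit i ((!) xs) n = delete_at i xs ! n"
  by (auto simp: omit_def delete_at_def nth_append)

lemma ce_diff_nth:
  assumes "is_form k \<omega>" "length xs = Suc k"
  shows "ce_diff br k \<omega> ((!) xs) = (\<Sum>j\<le>k. \<Sum>i<j. (-1) ^ (i + j) *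
    \<omega> ((!) (br (xs ! i) (xs ! j) # delete_at i (delete_at j xs))))"
  unfolding ce_diff_def
proof (intro sum.cong refl arg_cong2[of _ _ _ _ "(*)"])
  fix i j assume ij: "j \<in> {..k}" "i \<in> {..<j}"
  show "\<omega> (case_nat (br (xs ! i) (xs ! j)) (omit i (omit j ((!) xs))))
    = \<omega> ((!) (br (xs ! i) (xs ! j) # delete_at i (delete_at j xs)))"
  proof (rule is_formD_local[OF assms(1)])
    fix n assume n: "n < k"
    show "case_nat (br (xs ! i) (xs ! j)) (omit i (omit j ((!) xs))) n
      = (br (xs ! i) (xs ! j) # delete_at i (delete_at j xs)) ! n"
    proof (cases n)
      case (Suc m)
      have l: "length (delete_at j xs) = k" using ij assms by (simp add: length_delete_at)
      have "omit i (omit j ((!) xs)) m = omit i ((!) (delete_at j xs)) m"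
        using Suc n ij assms by (simp add: omit_def[of i] omit_nth)
      also have "\<dots> = delete_at i (delete_at j xs) ! m"
        by (rule omit_nth) (use Suc n ij l in auto)
      finally show ?thesis using Suc by simp
    qed simp
  qed
qed

lemma ce_diff_2:
  "is_form 2 \<omega> \<Longrightarrow> ce_diff br 2 \<omega> ((!) [x, y, z])
    = - \<omega> ((!) [br x y, z]) + \<omega> ((!) [br x z, y]) - \<omega> ((!) [br y z, x])"
  by (subst ce_diff_nth) (simp_all add: eval_nat_numeral)

lemma ce_diff_3:
  "is_form 3 \<omega> \<Longrightarrow> ce_diff br 3 \<omega> ((!) [x, y, z, w])
    = - \<omega> ((!) [br x y, z, w]) + \<omega> ((!) [br x z, y, w]) - \<omega> ((!) [br y z, x, w])
      - \<omega> ((!) [br x w, y, z]) + \<omega> ((!) [br y w, x, z]) - \<omega> ((!) [br z w, x, y])"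
  by (subst ce_diff_nth) (simp_all add: eval_nat_numeral)

lemma ce_diff_4:
  "is_form 4 \<omega> \<Longrightarrow> ce_diff br 4 \<omega> ((!) [x, y, z, w, v])
    = - \<omega> ((!) [br x y, z, w, v]) + \<omega> ((!) [br x z, y, w, v]) - \<omega> ((!) [br y z, x, w, v])
      - \<omega> ((!) [br x w, y, z, v]) + \<omega> ((!) [br y w, x, z, v]) - \<omega> ((!) [br z w, x, y, v])
      + \<omega> ((!) [br x v, y, z, w]) - \<omega> ((!) [br y v, x, z, w]) + \<omega> ((!) [br z v, x, y, w])
      - \<omega> ((!) [br w v, x, y, z])"
  by (subst ce_diff_nth) (simp_all add: eval_nat_numeral)

lemma endo_act_3: "is_form 3 \<omega> \<Longrightarrow> endo_act D 3 \<omega> ((!) [x, y, z])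
    = \<omega> ((!) [D x, y, z]) + \<omega> ((!) [x, D y, z]) + \<omega> ((!) [x, y, D z])"
proof -
  assume \<omega>: "is_form 3 \<omega>"
  have "endo_act D 3 \<omega> ((!) xs) = (\<Sum>i<3. \<omega> ((!) (xs[i := D (xs ! i)])))" if "length xs = 3" for xs
    unfolding endo_act_def using that by (intro sum.cong) (auto simp: fun_upd_nth)
  from this[of "[x, y, z]"]
  show ?thesis by (simp add: eval_nat_numeral)
qed

context frame
begin

lemma dim_UNIV: "dim (UNIV :: 'a set) = 7"
proof -
  have inj: "inj_on b {..<7}"
    by (rule inj_onI) (metis coord_basis lessThan_iff one_neq_zero)
  have "independent (b ` {..<7})"
    unfolding independent_explicit_finite_subsets
  proof (intro allI impI ballI)
    fix A u v assume A: "A \<subseteq> b ` {..<7}" "finite A" "(\<Sum>v\<in>A. u v *\<^sub>R v) = 0" "v \<in> A"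
    then obtain i where i: "i < 7" "v = b i" by auto
    have "0 = c i (\<Sum>v\<in>A. u v *\<^sub>R v)" using A linear_0[OF linear_coord[OF i(1)]] by simp
    also have "\<dots> = (\<Sum>v\<in>A. u v * c i v)"
      by (simp add: linear_sum[OF linear_coord[OF i(1)]] linear_cmul[OF linear_coord[OF i(1)]])
    also have "\<dots> = (\<Sum>w\<in>A. if w = v then u v else 0)"
    proof (intro sum.cong refl)
      fix w assume "w \<in> A"
      then obtain k where k: "k < 7" "w = b k" using A(1) by auto
      show "u w * c i w = (if w = v then u v else 0)"
        using k i inj_onD[OF inj, of k i] by (auto simp: coord_basis)
    qed
    finally show "u v = 0" using A by simp
  qed
  moreover have "span (b ` {..<7}) = UNIV"
  proof -
    have "x \<in> span (b ` {..<7})" for x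
      by (subst expansion[symmetric, of x]) (intro span_sum span_scale span_base, auto)
    then show ?thesis by blast
  qed
  ultimately show ?thesis
    using dim_eq_card[of "b ` {..<7}" UNIV] card_image[OF inj] by simp
qed

lemma form4_first:
  assumes \<omega>: "is_form 4 \<omega>" and "j < k" "k < l" "l < 7"
  shows "\<omega> ((!) [v, b j, b k, b l]) = (\<Sum>r<7. c r v *
    (if r < j then \<omega> (bt [r, j, k, l]) else if r = j then 0
     else if r < k then - \<omega> (bt [j, r, k, l]) else if r = k then 0
     else if r < l then \<omega> (bt [j, k, r, l]) else if r = l then 0 else - \<omega> (bt [j, k, l, r])))"
proof -
  have lin: "linear (\<lambda>v. \<omega> ((!) [v, b j, b k, b l]))"
    using form_nth_linear[OF \<omega>, of "[0, b j, b k, b l]" 0] by simp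
  have s1: "\<omega> ((!) [y, x, z, w]) = - \<omega> ((!) [x, y, z, w])" for x y z w
    using form_nth_swap[OF \<omega>, of "[x, y, z, w]" 0 1] by simp
  have s2: "\<omega> ((!) [x, z, y, w]) = - \<omega> ((!) [x, y, z, w])" for x y z w
    using form_nth_swap[OF \<omega>, of "[x, y, z, w]" 1 2] by (simp add: eval_nat_numeral)
  have s3: "\<omega> ((!) [x, y, w, z]) = - \<omega> ((!) [x, y, z, w])" for x y z w
    using form_nth_swap[OF \<omega>, of "[x, y, z, w]" 2 3] by (simp add: eval_nat_numeral)
  have "\<omega> ((!) [b r, b j, b k, b l]) =
    (if r < j then \<omega> (bt [r, j, k, l]) else if r = j then 0
     else if r < k then - \<omega> (bt [j, r, k, l]) else if r = k then 0
     else if r < l then \<omega> (bt [j, k, r, l]) else if r = l then 0 else - \<omega> (bt [j, k, l, r]))"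
    if "r < 7" for r
  proof -
    note bt4 = bt_nth[OF \<omega>]
    consider "r < j" | "r = j" | "j < r" "r < k" | "r = k" | "k < r" "r < l" | "r = l" | "l < r"
      by linarith
    then show ?thesis
    proof cases
      case 1 then show ?thesis by (simp add: bt4)
    next
      case 2 then show ?thesis using s1[of "b j" "b j" "b k" "b l"] by simp
    next
      case 3 then show ?thesis using s1[of "b r" "b j" "b k" "b l"] by (simp add: bt4)
    next
      case 4
      then show ?thesis using s1[of "b k" "b j" "b k" "b l"] s2[of "b j" "b k" "b k" "b l"] assms by simp
    next
      case 5
      then show ?thesis using s1[of "b r" "b j" "b k" "b l"] s2[of "b j" "b r" "b k" "b l"] assms
        by (simp add: bt4)
    next
      case 6
      then show ?thesis using s1[of "b l" "b j" "b k" "b l"] s2[of "b j" "b l" "b k" "b l"]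
        s3[of "b j" "b k" "b l" "b l"] assms by simp
    next
      case 7
      then show ?thesis using s1[of "b r" "b j" "b k" "b l"] s2[of "b j" "b r" "b k" "b l"]
        s3[of "b j" "b k" "b r" "b l"] assms by (simp add: bt4)
    qed
  qed
  then show ?thesis by (subst linear_expand[OF lin]) (simp cong: if_cong)
qed

end

lemma cross_cross_coordinates:
  fixes w0 v0 w1 v1 w2 v2 w3 v3 w4 v4 w5 v5 w6 v6 :: real
  assumes X0: "-v1 * w2 + v2 * w1 - v3 * w4 + v4 * w3 - v5 * w6 + v6 * w5 = 0"
    and X1: "v0 * w2 - v2 * w0 - v3 * w5 + v4 * w6 + v5 * w3 - v6 * w4 = 0"
    and X2: "-v0 * w1 + v1 * w0 + v3 * w6 + v4 * w5 - v5 * w4 - v6 * w3 = 0"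
    and X3: "v0 * w4 + v1 * w5 - v2 * w6 - v4 * w0 - v5 * w1 + v6 * w2 = 0"
    and X4: "-v0 * w3 - v1 * w6 - v2 * w5 + v3 * w0 + v5 * w2 + v6 * w1 = 0"
    and X5: "v0 * w6 - v1 * w3 + v2 * w4 + v3 * w1 - v4 * w2 - v6 * w0 = 0"
    and X6: "-v0 * w5 + v1 * w4 + v2 * w3 - v3 * w2 - v4 * w1 + v5 * w0 = 0"
  defines "n \<equiv> w0 * w0 + w1 * w1 + w2 * w2 + w3 * w3 + w4 * w4 + w5 * w5 + w6 * w6"
    and "r \<equiv> w0 * v0 + w1 * v1 + w2 * v2 + w3 * v3 + w4 * v4 + w5 * v5 + w6 * v6"
  shows "n * v0 = r * w0" "n * v1 = r * w1" "n * v2 = r * w2" "n * v3 = r * w3" "n * v4 = r * w4" "n * v5 = r * w5"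
      "n * v6 = r * w6"
  unfolding n_def r_def
  subgoal using X1 X2 X3 X4 X5 X6 by algebra
  subgoal using X0 X2 X3 X4 X5 X6 by algebra
  subgoal using X0 X1 X3 X4 X5 X6 by algebra
  subgoal using X0 X1 X2 X4 X5 X6 by algebra
  subgoal using X0 X1 X2 X3 X5 X6 by algebra
  subgoal using X0 X1 X2 X3 X4 X6 by algebra
  subgoal using X0 X1 X2 X3 X4 X5 by algebra
  done

context g2_frame
begin

lemma cross_cross:
  assumes "\<And>k. k < 7 \<Longrightarrow> \<phi> ((!) [w, v, b k]) = 0"
  shows "inner w w *\<^sub>R v = inner w v *\<^sub>R w"
proof (rule coord_eqI)
  fix i :: nat assume i: "i < 7"
  have X: "(\<Sum>r<7. c r w * (\<Sum>s<7. c s v * g2_eps r s k)) = 0" if "k < 7" for k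
  proof -
    have "\<phi> ((!) [w, v, b k]) = (\<Sum>r<7. c r w * (\<Sum>s<7. c s v * g2_eps r s k))"
      by (subst linear_expand[OF form3_linear(1)[OF form]], subst linear_expand[OF form3_linear(2)[OF form]])
         (simp add: eps that)
    then show ?thesis using assms[OF that] by simp
  qed
  have X0: "-c 1 v * c 2 w + c 2 v * c 1 w - c 3 v * c 4 w + c 4 v * c 3 w - c 5 v * c 6 w + c 6 v * c 5 w = 0"
    using X[of 0] by (simp add: sum_7 g2_eps_def alt3_def g2_table_def algebra_simps del: One_nat_def)
  have X1: "c 0 v * c 2 w - c 2 v * c 0 w - c 3 v * c 5 w + c 4 v * c 6 w + c 5 v * c 3 w - c 6 v * c 4 w = 0"
    using X[of 1] by (simp add: sum_7 g2_eps_def alt3_def g2_table_def algebra_simps del: One_nat_def)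
  have X2: "-c 0 v * c 1 w + c 1 v * c 0 w + c 3 v * c 6 w + c 4 v * c 5 w - c 5 v * c 4 w - c 6 v * c 3 w = 0"
    using X[of 2] by (simp add: sum_7 g2_eps_def alt3_def g2_table_def algebra_simps del: One_nat_def)
  have X3: "c 0 v * c 4 w + c 1 v * c 5 w - c 2 v * c 6 w - c 4 v * c 0 w - c 5 v * c 1 w + c 6 v * c 2 w = 0"
    using X[of 3] by (simp add: sum_7 g2_eps_def alt3_def g2_table_def algebra_simps del: One_nat_def)
  have X4: "-c 0 v * c 3 w - c 1 v * c 6 w - c 2 v * c 5 w + c 3 v * c 0 w + c 5 v * c 2 w + c 6 v * c 1 w = 0"
    using X[of 4] by (simp add: sum_7 g2_eps_def alt3_def g2_table_def algebra_simps del: One_nat_def)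
  have X5: "c 0 v * c 6 w - c 1 v * c 3 w + c 2 v * c 4 w + c 3 v * c 1 w - c 4 v * c 2 w - c 6 v * c 0 w = 0"
    using X[of 5] by (simp add: sum_7 g2_eps_def alt3_def g2_table_def algebra_simps del: One_nat_def)
  have X6: "-c 0 v * c 5 w + c 1 v * c 4 w + c 2 v * c 3 w - c 3 v * c 2 w - c 4 v * c 1 w + c 5 v * c 0 w = 0"
    using X[of 6] by (simp add: sum_7 g2_eps_def alt3_def g2_table_def algebra_simps del: One_nat_def)
  consider "i = 0" | "i = 1" | "i = 2" | "i = 3" | "i = 4" | "i = 5" | "i = 6"
    using i by linarith
  then have "inner w w * c i v = inner w v * c i w"
    unfolding inner_def sum_7 using cross_cross_coordinates[OF X0 X1 X2 X3 X4 X5 X6]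
    by cases (simp_all only:)
  then show "c i (inner w w *\<^sub>R v) = c i (inner w v *\<^sub>R w)"
    using linear_cmul[OF linear_coord[OF i]] by simp
qed

lemma inner_pos: "w \<noteq> 0 \<Longrightarrow> inner w w > 0"
proof -
  assume "w \<noteq> 0"
  then obtain i where i: "i < 7" "c i w \<noteq> 0"
    using coord_eqI[of w 0] linear_0[OF linear_coord] by fastforce
  then show ?thesis unfolding inner_def
    by (intro sum_pos2[of _ i]) (auto simp: zero_less_mult_iff)
qed

lemma definite: "definite \<phi>"
  unfolding definite_def
proof (intro conjI allI impI form)
  fix w :: 'a assume w: "w \<noteq> 0"
  have "{v. \<forall>x. interior v (interior w \<phi>) x = 0} = span {w}"
  proof (intro equalityI subsetI)
    fix v assume "v \<in> {v. \<forall>x. interior v (interior w \<phi>) x = 0}"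
    then have "\<phi> ((!) [w, v, b k]) = 0" for k
      by (auto simp: interior_nth dest: spec[of _ "(!) [b k]"])
    from cross_cross[OF this] have "v = (inner w v / inner w w) *\<^sub>R w"
      using inner_pos[OF w] by (metis divide_inverse_commute less_numeral_extra(3) scaleR_scaleR scaleR_one
          left_inverse)
    then show "v \<in> span {w}" by (metis span_base span_scale singletonI)
  next
    fix v assume "v \<in> span {w}"
    then obtain r where v: "v = r *\<^sub>R w" by (auto simp: span_singleton)
    have "\<phi> (case_nat w (case_nat v x)) = 0" for x
    proof -
      have "\<phi> (case_nat w (case_nat v x)) = \<phi> ((!) [w, v, x 0])"
        by (rule is_formD_local[OF form]) (auto simp: nth_Cons less_Suc_eq eval_nat_numeral split: nat.splits)
      then show ?thesis by (simp add: v linear_cmul[OF form3_linear(2)[OF form]] form3_self[OF form])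
    qed
    then show "v \<in> {v. \<forall>x. interior v (interior w \<phi>) x = 0}" by (simp add: interior_def)
  qed
  moreover have "dim (span {w}) = 1" using w by (simp add: dim_eq_card_independent)
  ultimately show "form_rank (interior w \<phi>) = 6"
    by (simp add: form_rank_def dim_UNIV)
qed

end

section \<open>The intrinsic torsion of a closed \<open>G\<^sub>2\<close>-structure\<close>

context g2_frame
begin

lemma hodge_exists:
  assumes k: "k \<le> 7" and \<beta>: "is_form k \<beta>"
  shows "is_form (7 - k) (hodge \<phi> k \<beta>) \<and>
    (\<forall>J\<in>combs (7 - k). hodge \<phi> k \<beta> (bt J) = (-1) ^ inversions (compl J @ J) * \<beta> (bt (compl J)))"
proof -
  define \<gamma> where "\<gamma> = (\<lambda>x. \<Sum>I\<in>combs k. ((-1) ^ inversions (I @ compl I) * \<beta> (bt I)) * ext_basis c (compl I) x)"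
  have \<gamma>: "is_form (7 - k) \<gamma>"
    unfolding \<gamma>_def by (intro is_form_sum is_form_ext) (use compl_combs combsD in blast)+
  have val: "\<gamma> (bt (compl I)) = (-1) ^ inversions (I @ compl I) * \<beta> (bt I)" if I: "I \<in> combs k" for I
  proof -
    have "\<gamma> (bt (compl I)) = (\<Sum>J\<in>combs k. if J = I then (-1) ^ inversions (J @ compl J) * \<beta> (bt J) else 0)"
      unfolding \<gamma>_def
    proof (intro sum.cong refl)
      fix J assume J: "J \<in> combs k"
      have "compl J = compl I \<longleftrightarrow> J = I" using compl_compl[OF I] compl_compl[OF J] by metis
      then show "(-1) ^ inversions (J @ compl J) * \<beta> (bt J) * ext_basis c (compl J) (bt (compl I))
        = (if J = I then (-1) ^ inversions (J @ compl J) * \<beta> (bt J) else 0)"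
        using ext_basis_bt[OF compl_combs[OF J] compl_combs[OF I]] by simp
    qed
    then show ?thesis using I finite_combs by simp
  qed
  have "hodge \<phi> k \<beta> = \<gamma>" by (rule hodge_eqI[OF k \<beta> \<gamma> val])
  moreover have "\<gamma> (bt J) = (-1) ^ inversions (compl J @ J) * \<beta> (bt (compl J))" if J: "J \<in> combs (7 - k)" for J
    using val[of "compl J"] compl_combs[OF J] k by (simp add: compl_compl[OF J])
  ultimately show ?thesis using \<gamma> by simp
qed

lemma upt_7: "[0..<7] = [0, 1, 2, 3, 4, 5, 6]"
  by (simp add: upt_rec)

lemma combs_5_all: "(\<forall>K\<in>combs 5. P K) \<longleftrightarrow>
    P [0, 1, 2, 3, 4] \<and> P [0, 1, 2, 3, 5] \<and> P [0, 1, 2, 3, 6] \<and> P [0, 1, 2, 4, 5] \<and> P [0, 1, 2, 4, 6] \<and>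
    P [0, 1, 2, 5, 6] \<and> P [0, 1, 3, 4, 5] \<and> P [0, 1, 3, 4, 6] \<and> P [0, 1, 3, 5, 6] \<and> P [0, 1, 4, 5, 6] \<and>
    P [0, 2, 3, 4, 5] \<and> P [0, 2, 3, 4, 6] \<and> P [0, 2, 3, 5, 6] \<and> P [0, 2, 4, 5, 6] \<and> P [0, 3, 4, 5, 6] \<and>
    P [1, 2, 3, 4, 5] \<and> P [1, 2, 3, 4, 6] \<and> P [1, 2, 3, 5, 6] \<and> P [1, 2, 4, 5, 6] \<and> P [1, 3, 4, 5, 6] \<and>
    P [2, 3, 4, 5, 6]"
  unfolding combs_code upt_7 by (simp add: Let_def del: One_nat_def)

lemmas is_form_hodge = hodge_exists[THEN conjunct1]
lemmas hodge_bt = hodge_exists[THEN conjunct2, rule_format]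

abbreviation \<psi> :: "'a form" where "\<psi> \<equiv> hodge \<phi> 3 \<phi>"

lemma is_form_psi: "is_form 4 \<psi>"
  using is_form_hodge[of 3, OF _ form] by simp

lemma psi_bt:
  "\<psi> (bt [0, 1, 2, 3]) = 0"
  "\<psi> (bt [0, 1, 2, 4]) = 0"
  "\<psi> (bt [0, 1, 2, 5]) = 0"
  "\<psi> (bt [0, 1, 2, 6]) = 0"
  "\<psi> (bt [0, 1, 3, 4]) = 0"
  "\<psi> (bt [0, 1, 3, 5]) = 0"
  "\<psi> (bt [0, 1, 3, 6]) = -1"
  "\<psi> (bt [0, 1, 4, 5]) = -1"
  "\<psi> (bt [0, 1, 4, 6]) = 0"
  "\<psi> (bt [0, 1, 5, 6]) = 0"
  "\<psi> (bt [0, 2, 3, 4]) = 0"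
  "\<psi> (bt [0, 2, 3, 5]) = -1"
  "\<psi> (bt [0, 2, 3, 6]) = 0"
  "\<psi> (bt [0, 2, 4, 5]) = 0"
  "\<psi> (bt [0, 2, 4, 6]) = 1"
  "\<psi> (bt [0, 2, 5, 6]) = 0"
  "\<psi> (bt [0, 3, 4, 5]) = 0"
  "\<psi> (bt [0, 3, 4, 6]) = 0"
  "\<psi> (bt [0, 3, 5, 6]) = 0"
  "\<psi> (bt [0, 4, 5, 6]) = 0"
  "\<psi> (bt [1, 2, 3, 4]) = 1"
  "\<psi> (bt [1, 2, 3, 5]) = 0"
  "\<psi> (bt [1, 2, 3, 6]) = 0"
  "\<psi> (bt [1, 2, 4, 5]) = 0"
  "\<psi> (bt [1, 2, 4, 6]) = 0"
  "\<psi> (bt [1, 2, 5, 6]) = 1"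
  "\<psi> (bt [1, 3, 4, 5]) = 0"
  "\<psi> (bt [1, 3, 4, 6]) = 0"
  "\<psi> (bt [1, 3, 5, 6]) = 0"
  "\<psi> (bt [1, 4, 5, 6]) = 0"
  "\<psi> (bt [2, 3, 4, 5]) = 0"
  "\<psi> (bt [2, 3, 4, 6]) = 0"
  "\<psi> (bt [2, 3, 5, 6]) = 0"
  "\<psi> (bt [2, 4, 5, 6]) = 0"
  "\<psi> (bt [3, 4, 5, 6]) = 1"
  by (simp_all add: hodge_bt[of 3, OF _ form] combs4_iff compl_def upt_7 tab_bt combs3_iff g2_table_def del:
      One_nat_def)

end

locale g2_lie_frame = g2_frame b c \<phi>
  for b :: "nat \<Rightarrow> 'a::real_vector" and c \<phi> +
  fixes br :: "'a \<Rightarrow> 'a \<Rightarrow> 'a"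
  assumes lie: "lie_algebra br"
begin

definition B :: "nat \<Rightarrow> nat \<Rightarrow> nat \<Rightarrow> real" where
  "B i j r = c r (br (b i) (b j))"

lemmas bilinear_br = lie_algebra.bilinear_br[OF lie] and br_self = lie_algebra.br_self[OF lie]

lemma is_form_d: "is_form k \<omega> \<Longrightarrow> is_form (Suc k) (ce_diff br k \<omega>)"
  by (rule is_form_ce_diff[OF bilinear_br br_self])

lemma is_form_d_nums:
  "is_form 2 \<omega> \<Longrightarrow> is_form 3 (ce_diff br 2 \<omega>)"
  "is_form 3 \<omega> \<Longrightarrow> is_form 4 (ce_diff br 3 \<omega>)"
  "is_form 4 \<omega> \<Longrightarrow> is_form 5 (ce_diff br 4 \<omega>)"
  using is_form_d[of 2 \<omega>] is_form_d[of 3 \<omega>] is_form_d[of 4 \<omega>] by simp_all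

lemma br_swap: "br y x = - br x y"
proof -
  have "br x y + br y x = 0"
    using br_self[of "x + y"] unfolding bilinear_ladd[OF bilinear_br] bilinear_radd[OF bilinear_br]
    by (simp add: br_self add.commute)
  then show ?thesis by (simp add: eq_neg_iff_add_eq_0 add.commute)
qed

lemma br_expand: "i < 7 \<Longrightarrow> j < 7 \<Longrightarrow> br (b i) (b j) = (\<Sum>r<7. B i j r *\<^sub>R b r)"
  unfolding B_def by (rule expansion[symmetric])

lemma B_swap: "r < 7 \<Longrightarrow> B j i r = - B i j r"
  unfolding B_def by (subst br_swap) (simp add: linear_neg linear_coord)

lemma B_self: "r < 7 \<Longrightarrow> B i i r = 0"
  unfolding B_def by (simp add: br_self linear_0 linear_coord)

lemma d_phi:
  "ce_diff br 3 \<phi> (bt [0, 1, 2, 3]) = B 0 1 6 + B 0 2 5 - B 0 3 0 - B 1 2 4 - B 1 3 1 - B 2 3 2"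
  "ce_diff br 3 \<phi> (bt [0, 1, 2, 4]) = B 0 1 5 - B 0 2 6 - B 0 4 0 + B 1 2 3 - B 1 4 1 - B 2 4 2"
  "ce_diff br 3 \<phi> (bt [0, 1, 2, 5]) = - B 0 1 4 - B 0 2 3 - B 0 5 0 - B 1 2 6 - B 1 5 1 - B 2 5 2"
  "ce_diff br 3 \<phi> (bt [0, 1, 2, 6]) = - B 0 1 3 + B 0 2 4 - B 0 6 0 + B 1 2 5 - B 1 6 1 - B 2 6 2"
  "ce_diff br 3 \<phi> (bt [0, 1, 3, 4]) = - B 0 1 0 - B 0 3 6 - B 0 4 5 + B 1 3 3 + B 1 4 4 - B 3 4 2"
  "ce_diff br 3 \<phi> (bt [0, 1, 3, 5]) = - B 0 1 1 - B 0 3 3 - B 0 5 5 - B 1 3 6 + B 1 5 4 - B 3 5 2"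
  "ce_diff br 3 \<phi> (bt [0, 1, 3, 6]) = B 0 1 2 + B 0 3 4 - B 0 6 5 + B 1 3 5 + B 1 6 4 - B 3 6 2"
  "ce_diff br 3 \<phi> (bt [0, 1, 4, 5]) = B 0 1 2 - B 0 4 3 + B 0 5 6 - B 1 4 6 - B 1 5 3 - B 4 5 2"
  "ce_diff br 3 \<phi> (bt [0, 1, 4, 6]) = B 0 1 1 + B 0 4 4 + B 0 6 6 + B 1 4 5 - B 1 6 3 - B 4 6 2"
  "ce_diff br 3 \<phi> (bt [0, 1, 5, 6]) = - B 0 1 0 + B 0 5 4 + B 0 6 3 + B 1 5 5 + B 1 6 6 - B 5 6 2"
  "ce_diff br 3 \<phi> (bt [0, 2, 3, 4]) = - B 0 2 0 - B 0 3 5 + B 0 4 6 + B 2 3 3 + B 2 4 4 + B 3 4 1"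
  "ce_diff br 3 \<phi> (bt [0, 2, 3, 5]) = - B 0 2 1 + B 0 3 4 + B 0 5 6 - B 2 3 6 + B 2 5 4 + B 3 5 1"
  "ce_diff br 3 \<phi> (bt [0, 2, 3, 6]) = B 0 2 2 + B 0 3 3 + B 0 6 6 + B 2 3 5 + B 2 6 4 + B 3 6 1"
  "ce_diff br 3 \<phi> (bt [0, 2, 4, 5]) = B 0 2 2 + B 0 4 4 + B 0 5 5 - B 2 4 6 - B 2 5 3 + B 4 5 1"
  "ce_diff br 3 \<phi> (bt [0, 2, 4, 6]) = B 0 2 1 + B 0 4 3 + B 0 6 5 + B 2 4 5 - B 2 6 3 + B 4 6 1"
  "ce_diff br 3 \<phi> (bt [0, 2, 5, 6]) = - B 0 2 0 + B 0 5 3 - B 0 6 4 + B 2 5 5 + B 2 6 6 + B 5 6 1"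
  "ce_diff br 3 \<phi> (bt [0, 3, 4, 5]) = B 0 3 2 + B 0 4 1 - B 0 5 0 - B 3 4 6 - B 3 5 3 - B 4 5 4"
  "ce_diff br 3 \<phi> (bt [0, 3, 4, 6]) = B 0 3 1 - B 0 4 2 - B 0 6 0 + B 3 4 5 - B 3 6 3 - B 4 6 4"
  "ce_diff br 3 \<phi> (bt [0, 3, 5, 6]) = - B 0 3 0 - B 0 5 2 - B 0 6 1 + B 3 5 5 + B 3 6 6 - B 5 6 4"
  "ce_diff br 3 \<phi> (bt [0, 4, 5, 6]) = - B 0 4 0 - B 0 5 1 + B 0 6 2 + B 4 5 5 + B 4 6 6 + B 5 6 3"
  "ce_diff br 3 \<phi> (bt [1, 2, 3, 4]) = - B 1 2 0 - B 1 3 5 + B 1 4 6 + B 2 3 6 + B 2 4 5 - B 3 4 0"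
  "ce_diff br 3 \<phi> (bt [1, 2, 3, 5]) = - B 1 2 1 + B 1 3 4 + B 1 5 6 + B 2 3 3 + B 2 5 5 - B 3 5 0"
  "ce_diff br 3 \<phi> (bt [1, 2, 3, 6]) = B 1 2 2 + B 1 3 3 + B 1 6 6 - B 2 3 4 + B 2 6 5 - B 3 6 0"
  "ce_diff br 3 \<phi> (bt [1, 2, 4, 5]) = B 1 2 2 + B 1 4 4 + B 1 5 5 + B 2 4 3 - B 2 5 6 - B 4 5 0"
  "ce_diff br 3 \<phi> (bt [1, 2, 4, 6]) = B 1 2 1 + B 1 4 3 + B 1 6 5 - B 2 4 4 - B 2 6 6 - B 4 6 0"
  "ce_diff br 3 \<phi> (bt [1, 2, 5, 6]) = - B 1 2 0 + B 1 5 3 - B 1 6 4 - B 2 5 4 - B 2 6 3 - B 5 6 0"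
  "ce_diff br 3 \<phi> (bt [1, 3, 4, 5]) = B 1 3 2 + B 1 4 1 - B 1 5 0 + B 3 4 3 - B 3 5 6 - B 4 5 5"
  "ce_diff br 3 \<phi> (bt [1, 3, 4, 6]) = B 1 3 1 - B 1 4 2 - B 1 6 0 - B 3 4 4 - B 3 6 6 - B 4 6 5"
  "ce_diff br 3 \<phi> (bt [1, 3, 5, 6]) = - B 1 3 0 - B 1 5 2 - B 1 6 1 - B 3 5 4 - B 3 6 3 - B 5 6 5"
  "ce_diff br 3 \<phi> (bt [1, 4, 5, 6]) = - B 1 4 0 - B 1 5 1 + B 1 6 2 - B 4 5 4 - B 4 6 3 + B 5 6 6"
  "ce_diff br 3 \<phi> (bt [2, 3, 4, 5]) = B 2 3 2 + B 2 4 1 - B 2 5 0 - B 3 4 4 - B 3 5 5 + B 4 5 6"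
  "ce_diff br 3 \<phi> (bt [2, 3, 4, 6]) = B 2 3 1 - B 2 4 2 - B 2 6 0 - B 3 4 3 - B 3 6 5 + B 4 6 6"
  "ce_diff br 3 \<phi> (bt [2, 3, 5, 6]) = - B 2 3 0 - B 2 5 2 - B 2 6 1 - B 3 5 3 + B 3 6 4 + B 5 6 6"
  "ce_diff br 3 \<phi> (bt [2, 4, 5, 6]) = - B 2 4 0 - B 2 5 1 + B 2 6 2 - B 4 5 3 + B 4 6 4 + B 5 6 5"
  "ce_diff br 3 \<phi> (bt [3, 4, 5, 6]) = - B 3 4 0 - B 3 5 1 + B 3 6 2 + B 4 5 2 + B 4 6 1 - B 5 6 0"
  by (simp_all add: bt_nth[OF is_form_d_nums(2)[OF form]] ce_diff_3[OF form] eps_first sum_7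
      g2_eps_def alt3_def g2_table_def B_def del: One_nat_def)

text \<open>Since \<open>**\<close> is the identity, \<open>\<tau> \<and> \<phi> = - *\<tau>\<close> and \<open>d*\<phi> = \<tau> \<and> \<phi>\<close> leave no other candidate.\<close>

definition \<tau> :: "'a form" where
  "\<tau> = (\<lambda>x. - hodge \<phi> 5 (ce_diff br 4 \<psi>) x)"

lemma is_form_tau: "is_form 2 \<tau>"
  using is_form_minus[OF is_form_hodge[of 5, OF _ is_form_d_nums(3)[OF is_form_psi]]] by (simp add: \<tau>_def)

lemma d_psi:
  "ce_diff br 4 \<psi> (bt [0, 1, 2, 3, 4]) = - B 0 1 1 - B 0 2 2 - B 0 3 3 - B 0 4 4 - B 1 3 6 - B 1 4 5 - B 2 3 5
      + B 2 4 6"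
  "ce_diff br 4 \<psi> (bt [0, 1, 2, 3, 5]) = B 0 1 0 + B 0 3 6 - B 0 5 4 - B 1 2 2 - B 1 3 3 - B 1 5 5 + B 2 3 4 + B 2 5 6"
  "ce_diff br 4 \<psi> (bt [0, 1, 2, 3, 6]) = - B 0 2 0 - B 0 3 5 - B 0 6 4 - B 1 2 1 + B 1 3 4 - B 1 6 5 + B 2 3 3
      + B 2 6 6"
  "ce_diff br 4 \<psi> (bt [0, 1, 2, 4, 5]) = - B 0 2 0 + B 0 4 6 + B 0 5 3 - B 1 2 1 - B 1 4 3 + B 1 5 6 + B 2 4 4
      + B 2 5 5"
  "ce_diff br 4 \<psi> (bt [0, 1, 2, 4, 6]) = - B 0 1 0 - B 0 4 5 + B 0 6 3 + B 1 2 2 + B 1 4 4 + B 1 6 6 + B 2 4 3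
      + B 2 6 5"
  "ce_diff br 4 \<psi> (bt [0, 1, 2, 5, 6]) = - B 0 1 1 - B 0 2 2 - B 0 5 5 - B 0 6 6 + B 1 5 4 + B 1 6 3 + B 2 5 3
      - B 2 6 4"
  "ce_diff br 4 \<psi> (bt [0, 1, 3, 4, 5]) = B 0 1 6 - B 0 3 0 - B 0 5 2 - B 1 3 1 + B 1 4 2 + B 3 4 4 + B 3 5 5 - B 4 5 6"
  "ce_diff br 4 \<psi> (bt [0, 1, 3, 4, 6]) = - B 0 1 5 + B 0 4 0 - B 0 6 2 + B 1 3 2 + B 1 4 1 + B 3 4 3 + B 3 6 5
      - B 4 6 6"
  "ce_diff br 4 \<psi> (bt [0, 1, 3, 5, 6]) = B 0 1 4 - B 0 3 2 + B 0 5 0 + B 1 5 1 - B 1 6 2 + B 3 5 3 - B 3 6 4 - B 5 6 6"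
  "ce_diff br 4 \<psi> (bt [0, 1, 4, 5, 6]) = - B 0 1 3 - B 0 4 2 - B 0 6 0 - B 1 5 2 - B 1 6 1 + B 4 5 3 - B 4 6 4
      - B 5 6 5"
  "ce_diff br 4 \<psi> (bt [0, 2, 3, 4, 5]) = B 0 2 6 + B 0 4 0 + B 0 5 1 - B 2 3 1 + B 2 4 2 + B 3 4 3 - B 3 5 6 - B 4 5 5"
  "ce_diff br 4 \<psi> (bt [0, 2, 3, 4, 6]) = - B 0 2 5 + B 0 3 0 + B 0 6 1 + B 2 3 2 + B 2 4 1 - B 3 4 4 - B 3 6 6
      - B 4 6 5"
  "ce_diff br 4 \<psi> (bt [0, 2, 3, 5, 6]) = B 0 2 4 + B 0 3 1 - B 0 6 0 + B 2 5 1 - B 2 6 2 - B 3 5 4 - B 3 6 3 - B 5 6 5"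
  "ce_diff br 4 \<psi> (bt [0, 2, 4, 5, 6]) = - B 0 2 3 + B 0 4 1 - B 0 5 0 - B 2 5 2 - B 2 6 1 - B 4 5 4 - B 4 6 3
      + B 5 6 6"
  "ce_diff br 4 \<psi> (bt [0, 3, 4, 5, 6]) = - B 0 3 3 - B 0 4 4 - B 0 5 5 - B 0 6 6 - B 3 5 2 - B 3 6 1 - B 4 5 1
      + B 4 6 2"
  "ce_diff br 4 \<psi> (bt [1, 2, 3, 4, 5]) = B 1 2 6 + B 1 4 0 + B 1 5 1 + B 2 3 0 + B 2 5 2 + B 3 4 6 + B 3 5 3 + B 4 5 4"
  "ce_diff br 4 \<psi> (bt [1, 2, 3, 4, 6]) = - B 1 2 5 + B 1 3 0 + B 1 6 1 - B 2 4 0 + B 2 6 2 - B 3 4 5 + B 3 6 3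
      + B 4 6 4"
  "ce_diff br 4 \<psi> (bt [1, 2, 3, 5, 6]) = B 1 2 4 + B 1 3 1 - B 1 6 0 + B 2 3 2 - B 2 5 0 - B 3 5 5 - B 3 6 6 + B 5 6 4"
  "ce_diff br 4 \<psi> (bt [1, 2, 4, 5, 6]) = - B 1 2 3 + B 1 4 1 - B 1 5 0 + B 2 4 2 + B 2 6 0 - B 4 5 5 - B 4 6 6
      - B 5 6 3"
  "ce_diff br 4 \<psi> (bt [1, 3, 4, 5, 6]) = - B 1 3 3 - B 1 4 4 - B 1 5 5 - B 1 6 6 + B 3 4 2 + B 3 6 0 + B 4 5 0
      + B 5 6 2"
  "ce_diff br 4 \<psi> (bt [2, 3, 4, 5, 6]) = - B 2 3 3 - B 2 4 4 - B 2 5 5 - B 2 6 6 - B 3 4 1 + B 3 5 0 - B 4 6 0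
      - B 5 6 1"
  by (simp_all add: bt_nth[OF is_form_d_nums(3)[OF is_form_psi]] ce_diff_4[OF is_form_psi] form4_first[OF is_form_psi]
      psi_bt sum_7 B_def del: One_nat_def)

lemma tau_bt:
  "\<tau> (bt [0, 1]) = B 2 3 3 + B 2 4 4 + B 2 5 5 + B 2 6 6 + B 3 4 1 - B 3 5 0 + B 4 6 0 + B 5 6 1"
  "\<tau> (bt [0, 2]) = - B 1 3 3 - B 1 4 4 - B 1 5 5 - B 1 6 6 + B 3 4 2 + B 3 6 0 + B 4 5 0 + B 5 6 2"
  "\<tau> (bt [0, 3]) = B 1 2 3 - B 1 4 1 + B 1 5 0 - B 2 4 2 - B 2 6 0 + B 4 5 5 + B 4 6 6 + B 5 6 3"
  "\<tau> (bt [0, 4]) = B 1 2 4 + B 1 3 1 - B 1 6 0 + B 2 3 2 - B 2 5 0 - B 3 5 5 - B 3 6 6 + B 5 6 4"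
  "\<tau> (bt [0, 5]) = B 1 2 5 - B 1 3 0 - B 1 6 1 + B 2 4 0 - B 2 6 2 + B 3 4 5 - B 3 6 3 - B 4 6 4"
  "\<tau> (bt [0, 6]) = B 1 2 6 + B 1 4 0 + B 1 5 1 + B 2 3 0 + B 2 5 2 + B 3 4 6 + B 3 5 3 + B 4 5 4"
  "\<tau> (bt [1, 2]) = B 0 3 3 + B 0 4 4 + B 0 5 5 + B 0 6 6 + B 3 5 2 + B 3 6 1 + B 4 5 1 - B 4 6 2"
  "\<tau> (bt [1, 3]) = - B 0 2 3 + B 0 4 1 - B 0 5 0 - B 2 5 2 - B 2 6 1 - B 4 5 4 - B 4 6 3 + B 5 6 6"
  "\<tau> (bt [1, 4]) = - B 0 2 4 - B 0 3 1 + B 0 6 0 - B 2 5 1 + B 2 6 2 + B 3 5 4 + B 3 6 3 + B 5 6 5"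
  "\<tau> (bt [1, 5]) = - B 0 2 5 + B 0 3 0 + B 0 6 1 + B 2 3 2 + B 2 4 1 - B 3 4 4 - B 3 6 6 - B 4 6 5"
  "\<tau> (bt [1, 6]) = - B 0 2 6 - B 0 4 0 - B 0 5 1 + B 2 3 1 - B 2 4 2 - B 3 4 3 + B 3 5 6 + B 4 5 5"
  "\<tau> (bt [2, 3]) = B 0 1 3 + B 0 4 2 + B 0 6 0 + B 1 5 2 + B 1 6 1 - B 4 5 3 + B 4 6 4 + B 5 6 5"
  "\<tau> (bt [2, 4]) = B 0 1 4 - B 0 3 2 + B 0 5 0 + B 1 5 1 - B 1 6 2 + B 3 5 3 - B 3 6 4 - B 5 6 6"
  "\<tau> (bt [2, 5]) = B 0 1 5 - B 0 4 0 + B 0 6 2 - B 1 3 2 - B 1 4 1 - B 3 4 3 - B 3 6 5 + B 4 6 6"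
  "\<tau> (bt [2, 6]) = B 0 1 6 - B 0 3 0 - B 0 5 2 - B 1 3 1 + B 1 4 2 + B 3 4 4 + B 3 5 5 - B 4 5 6"
  "\<tau> (bt [3, 4]) = B 0 1 1 + B 0 2 2 + B 0 5 5 + B 0 6 6 - B 1 5 4 - B 1 6 3 - B 2 5 3 + B 2 6 4"
  "\<tau> (bt [3, 5]) = - B 0 1 0 - B 0 4 5 + B 0 6 3 + B 1 2 2 + B 1 4 4 + B 1 6 6 + B 2 4 3 + B 2 6 5"
  "\<tau> (bt [3, 6]) = B 0 2 0 - B 0 4 6 - B 0 5 3 + B 1 2 1 + B 1 4 3 - B 1 5 6 - B 2 4 4 - B 2 5 5"
  "\<tau> (bt [4, 5]) = B 0 2 0 + B 0 3 5 + B 0 6 4 + B 1 2 1 - B 1 3 4 + B 1 6 5 - B 2 3 3 - B 2 6 6"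
  "\<tau> (bt [4, 6]) = B 0 1 0 + B 0 3 6 - B 0 5 4 - B 1 2 2 - B 1 3 3 - B 1 5 5 + B 2 3 4 + B 2 5 6"
  "\<tau> (bt [5, 6]) = B 0 1 1 + B 0 2 2 + B 0 3 3 + B 0 4 4 + B 1 3 6 + B 1 4 5 + B 2 3 5 - B 2 4 6"
  unfolding \<tau>_def
  by (simp_all add: hodge_bt[of 5, OF _ is_form_d_nums(3)[OF is_form_psi]] combs2_iff compl_def upt_7 d_psi del:
      One_nat_def)

lemma wedge_tau_phi:
  "wedge 2 3 \<tau> \<phi> (bt [0, 1, 2, 3, 4]) = \<tau> (bt [1, 2]) + \<tau> (bt [3, 4])"
  "wedge 2 3 \<tau> \<phi> (bt [0, 1, 2, 3, 5]) = - \<tau> (bt [0, 2]) + \<tau> (bt [3, 5])"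
  "wedge 2 3 \<tau> \<phi> (bt [0, 1, 2, 3, 6]) = - \<tau> (bt [0, 1]) + \<tau> (bt [3, 6])"
  "wedge 2 3 \<tau> \<phi> (bt [0, 1, 2, 4, 5]) = - \<tau> (bt [0, 1]) + \<tau> (bt [4, 5])"
  "wedge 2 3 \<tau> \<phi> (bt [0, 1, 2, 4, 6]) = \<tau> (bt [0, 2]) + \<tau> (bt [4, 6])"
  "wedge 2 3 \<tau> \<phi> (bt [0, 1, 2, 5, 6]) = \<tau> (bt [1, 2]) + \<tau> (bt [5, 6])"
  "wedge 2 3 \<tau> \<phi> (bt [0, 1, 3, 4, 5]) = \<tau> (bt [0, 4]) + \<tau> (bt [1, 5])"
  "wedge 2 3 \<tau> \<phi> (bt [0, 1, 3, 4, 6]) = \<tau> (bt [0, 3]) + \<tau> (bt [1, 6])"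
  "wedge 2 3 \<tau> \<phi> (bt [0, 1, 3, 5, 6]) = - \<tau> (bt [0, 6]) + \<tau> (bt [1, 3])"
  "wedge 2 3 \<tau> \<phi> (bt [0, 1, 4, 5, 6]) = - \<tau> (bt [0, 5]) + \<tau> (bt [1, 4])"
  "wedge 2 3 \<tau> \<phi> (bt [0, 2, 3, 4, 5]) = \<tau> (bt [0, 3]) + \<tau> (bt [2, 5])"
  "wedge 2 3 \<tau> \<phi> (bt [0, 2, 3, 4, 6]) = - \<tau> (bt [0, 4]) + \<tau> (bt [2, 6])"
  "wedge 2 3 \<tau> \<phi> (bt [0, 2, 3, 5, 6]) = - \<tau> (bt [0, 5]) + \<tau> (bt [2, 3])"
  "wedge 2 3 \<tau> \<phi> (bt [0, 2, 4, 5, 6]) = \<tau> (bt [0, 6]) + \<tau> (bt [2, 4])"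
  "wedge 2 3 \<tau> \<phi> (bt [0, 3, 4, 5, 6]) = \<tau> (bt [3, 4]) + \<tau> (bt [5, 6])"
  "wedge 2 3 \<tau> \<phi> (bt [1, 2, 3, 4, 5]) = \<tau> (bt [1, 3]) - \<tau> (bt [2, 4])"
  "wedge 2 3 \<tau> \<phi> (bt [1, 2, 3, 4, 6]) = - \<tau> (bt [1, 4]) - \<tau> (bt [2, 3])"
  "wedge 2 3 \<tau> \<phi> (bt [1, 2, 3, 5, 6]) = - \<tau> (bt [1, 5]) + \<tau> (bt [2, 6])"
  "wedge 2 3 \<tau> \<phi> (bt [1, 2, 4, 5, 6]) = \<tau> (bt [1, 6]) + \<tau> (bt [2, 5])"
  "wedge 2 3 \<tau> \<phi> (bt [1, 3, 4, 5, 6]) = \<tau> (bt [3, 5]) - \<tau> (bt [4, 6])"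
  "wedge 2 3 \<tau> \<phi> (bt [2, 3, 4, 5, 6]) = - \<tau> (bt [3, 6]) - \<tau> (bt [4, 5])"
  by (simp_all add: wedge_bt[OF is_form_tau form] combs_def Let_def tab_bt[unfolded combs3_iff] g2_table_def del:
      One_nat_def)

lemma closed_iff: "ce_diff br 3 \<phi> = (\<lambda>x. 0) \<longleftrightarrow> (\<forall>K\<in>combs 4. ce_diff br 3 \<phi> (bt K) = 0)"
  using form_zeroI[OF is_form_d_nums(2)[OF form]] by auto

context
  assumes closed: "ce_diff br 3 \<phi> = (\<lambda>x. 0)"
begin

lemma wedge_tau_eq_d_psi: "wedge 2 3 \<tau> \<phi> = ce_diff br 4 \<psi>"
proof (rule form_eqI)
  show "is_form 5 (wedge 2 3 \<tau> \<phi>)" using is_form_wedge[OF is_form_tau form] by simp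
  show "is_form 5 (ce_diff br 4 \<psi>)" by (rule is_form_d_nums(3)[OF is_form_psi])
  have "\<forall>K\<in>combs 5. wedge 2 3 \<tau> \<phi> (bt K) = ce_diff br 4 \<psi> (bt K)"
    unfolding combs_5_all wedge_tau_phi tau_bt d_psi
    using d_phi[unfolded closed] by (intro conjI; linarith)
  then show "wedge 2 3 \<tau> \<phi> (bt K) = ce_diff br 4 \<psi> (bt K)" if "K \<in> combs 5" for K
    using that by blast
qed

lemma hodge_tau: "hodge \<phi> 2 \<tau> = (\<lambda>x. - ce_diff br 4 \<psi> x)"
proof (rule form_eqI)
  show "is_form 5 (hodge \<phi> 2 \<tau>)" using is_form_hodge[of 2, OF _ is_form_tau] by simp
  show "is_form 5 (\<lambda>x. - ce_diff br 4 \<psi> x)"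
    by (rule is_form_minus[OF is_form_d_nums(3)[OF is_form_psi]])
  fix K assume K: "K \<in> combs 5"
  have "\<forall>K\<in>combs 5. (-1) ^ inversions (compl K @ K) * (-1) ^ inversions (K @ compl K) = (1 :: real)"
    unfolding combs_5_all by (simp add: compl_def upt_7)
  then have sgn: "(-1) ^ inversions (compl K @ K) * (-1) ^ inversions (K @ compl K) = (1 :: real)"
    using K by blast
  have "compl K \<in> combs 2" using compl_combs[OF K] by simp
  then have "hodge \<phi> 2 \<tau> (bt K) = - ((-1) ^ inversions (compl K @ K) * (-1) ^ inversions (K @ compl K)) * ce_diff br 4
      \<psi> (bt K)"
    using hodge_bt[of 2 \<tau> K] hodge_bt[of 5 "ce_diff br 4 \<psi>" "compl K"] is_form_tau is_form_d_nums(3)[OF is_form_psi] K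
    by (simp add: \<tau>_def compl_compl[OF K])
  then show "hodge \<phi> 2 \<tau> (bt K) = - ce_diff br 4 \<psi> (bt K)" unfolding sgn by simp
qed

lemma torsion_form_eq: "torsion_form br \<phi> = \<tau>"
  unfolding torsion_form_def
proof (rule the_equality)
  show "is_form 2 \<tau> \<and> wedge 2 3 \<tau> \<phi> = (\<lambda>x. - hodge \<phi> 2 \<tau> x) \<and> ce_diff br 4 \<psi> = wedge 2 3 \<tau> \<phi>"
    using is_form_tau wedge_tau_eq_d_psi hodge_tau by simp
  fix \<sigma>
  assume \<sigma>: "is_form 2 \<sigma> \<and> wedge 2 3 \<sigma> \<phi> = (\<lambda>x. - hodge \<phi> 2 \<sigma> x) \<and> ce_diff br 4 \<psi> = wedge 2 3 \<sigma> \<phi>"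
  then have "hodge \<phi> 2 \<sigma> x = hodge \<phi> 2 \<tau> x" for x
    by (simp add: hodge_tau)
  show "\<sigma> = \<tau>"
  proof (rule form_eqI)
    show "is_form 2 \<sigma>" using \<sigma> by blast
    show "is_form 2 \<tau>" by (rule is_form_tau)
    fix I assume I: "I \<in> combs 2"
    then have "compl I \<in> combs (7 - 2)" using compl_combs by blast
    from hodge_bt[of 2 \<sigma>, OF _ _ this] hodge_bt[of 2 \<tau>, OF _ is_form_tau this]
      \<open>hodge \<phi> 2 \<sigma> (bt (compl I)) = hodge \<phi> 2 \<tau> (bt (compl I))\<close> \<sigma>
    show "\<sigma> (bt I) = \<tau> (bt I)" by (simp add: compl_compl[OF I])
  qed
qed

lemma soliton_iff: "semi_algebraic_soliton br \<phi> \<longleftrightarrow> (\<exists>r D. derivation br D \<and>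
    (\<forall>K\<in>combs 3. ce_diff br 2 \<tau> (bt K) = r * \<phi> (bt K) + endo_act D 3 \<phi> (bt K)))"
proof -
  have "ce_diff br 2 \<tau> = (\<lambda>x. r * \<phi> x + endo_act D 3 \<phi> x) \<longleftrightarrow>
    (\<forall>K\<in>combs 3. ce_diff br 2 \<tau> (bt K) = r * \<phi> (bt K) + endo_act D 3 \<phi> (bt K))"
    if "derivation br D" for r D
  proof -
    have "linear D" using that by (simp add: derivation_def)
    then have "is_form 3 (\<lambda>x. r * \<phi> x + endo_act D 3 \<phi> x)"
      by (intro is_form_add is_form_scale is_form_endo_act form)
    from form_eqI[OF is_form_d_nums(1)[OF is_form_tau] this] show ?thesis by auto
  qed
  then show ?thesis
    unfolding semi_algebraic_soliton_def closed_g2_structure_def g2_laplacian_def torsion_form_eq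
    using definite closed by blast
qed

end

definition alt2 :: "nat \<Rightarrow> nat \<Rightarrow> real" where
  "alt2 i j = (if i < j then \<tau> (bt [i, j]) else if j < i then - \<tau> (bt [j, i]) else 0)"

lemma tau_alt2: "\<tau> ((!) [b i, b j]) = alt2 i j"
  unfolding alt2_def
  using bt_nth[OF is_form_tau, of "[i, j]"] bt_nth[OF is_form_tau, of "[j, i]"]
    form2_swap[OF is_form_tau, of "b i" "b j"] form2_self[OF is_form_tau, of "b i"]
  by (auto simp: not_less_iff_gr_or_eq)

lemma tau_first: "\<tau> ((!) [v, b k]) = (\<Sum>r<7. c r v * alt2 r k)"
  by (subst linear_expand[OF form2_linear(1)[OF is_form_tau]]) (simp add: tau_alt2)

lemma d_tau_bt:
  "ce_diff br 2 \<tau> (bt [i, j, k]) = (\<Sum>r<7. - B i j r * alt2 r k + B i k r * alt2 r j - B j k r * alt2 r i)"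
proof -
  have "ce_diff br 2 \<tau> (bt [i, j, k]) = ce_diff br 2 \<tau> ((!) [b i, b j, b k])"
    using bt_nth[OF is_form_d_nums(1)[OF is_form_tau], of "[i, j, k]"] by simp
  then show ?thesis
    by (simp only: ce_diff_2[OF is_form_tau] tau_first B_def[symmetric] sum_subtractf sum.distrib
        sum_negf[symmetric] mult_minus_left)
qed

lemma endo_act_bt:
  assumes "linear D" "i < 7" "j < 7" "k < 7"
  shows "endo_act D 3 \<phi> (bt [i, j, k]) = (\<Sum>r<7. c r (D (b i)) * g2_eps r j k
    + c r (D (b j)) * g2_eps i r k + c r (D (b k)) * g2_eps i j r)"
proof -
  have "endo_act D 3 \<phi> (bt [i, j, k]) = endo_act D 3 \<phi> ((!) [b i, b j, b k])"
    using bt_nth[OF is_form_endo_act[OF assms(1) form], of "[i, j, k]"] by simp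
  moreover have "\<phi> ((!) [b i, v, b k]) = (\<Sum>r<7. c r v * g2_eps i r k)" for v
    by (subst linear_expand[OF form3_linear(2)[OF form]]) (simp add: eps assms)
  moreover have "\<phi> ((!) [b i, b j, v]) = (\<Sum>r<7. c r v * g2_eps i j r)" for v
    by (subst linear_expand[OF form3_linear(3)[OF form]]) (simp add: eps assms)
  ultimately show ?thesis
    by (simp only: endo_act_3[OF form] eps_first[OF assms(3,4)] sum.distrib)
qed

end

section \<open>A family of closed \<open>G\<^sub>2\<close>-structures\<close>

definition g2_form :: "(nat \<Rightarrow> 'a \<Rightarrow> real) \<Rightarrow> 'a form" where
  "g2_form c x = (\<Sum>I\<in>combs 3. g2_table (I ! 0) (I ! 1) (I ! 2) * ext_basis c I x)"

lemma (in frame) g2_frame_g2_form: "g2_frame b c (g2_form c)"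
proof
  have form: "is_form 3 (g2_form c)"
    unfolding g2_form_def[abs_def] by (intro is_form_sum is_form_ext) (auto dest: combsD)
  then show "is_form 3 (g2_form c)" .
  fix i j k :: nat assume "i < j" "j < k" "k < 7"
  then have K: "[i, j, k] \<in> combs 3" by (simp add: combs3_iff)
  have "g2_form c (bt [i, j, k]) = (\<Sum>I\<in>combs 3. if I = [i, j, k] then g2_table (I ! 0) (I ! 1) (I ! 2) else 0)"
    unfolding g2_form_def using K by (intro sum.cong) (auto simp: ext_basis_bt)
  also have "\<dots> = g2_table i j k" using K finite_combs by (simp add: eval_nat_numeral)
  finally show "g2_form c ((!) [b i, b j, b k]) = g2_table i j k"
    using bt_nth[OF form, of "[i, j, k]"] by simp
qed

text \<open>With the complex structure \<open>b 3 \<mapsto> b 6\<close>, \<open>b 4 \<mapsto> b 5\<close>, \<open>b 0 \<mapsto> - b 1\<close>, the map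
  \<open>br (b 2)\<close> is complex linear apart from the component mapping \<open>b 4\<close>, \<open>b 5\<close> to \<open>b 3\<close>, \<open>b 6\<close>,
  whose deviation from complex linearity is \<open>br (b 4) (b 5)\<close>.\<close>

locale core_frame = g2_lie_frame b c \<phi> br
  for b :: "nat \<Rightarrow> 'a::real_vector" and c \<phi> br +
  fixes m s g h A1 A2 A3 A4 p q u v :: real
  assumes central: "br (b 0) x = 0" "br (b 1) x = 0"
    and br23: "br (b 2) (b 3) = p *\<^sub>R b 0 + q *\<^sub>R b 1 + m *\<^sub>R b 3 + g *\<^sub>R b 4 + h *\<^sub>R b 5 + s *\<^sub>R b 6"
    and br24: "br (b 2) (b 4) = u *\<^sub>R b 0 + v *\<^sub>R b 1 + A1 *\<^sub>R b 3 + (-m) *\<^sub>R b 4 + (-s) *\<^sub>R b 5 + A2 *\<^sub>R b 6"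
    and br25: "br (b 2) (b 5) = v *\<^sub>R b 0 + (-u) *\<^sub>R b 1 + A3 *\<^sub>R b 3 + s *\<^sub>R b 4 + (-m) *\<^sub>R b 5 + A4 *\<^sub>R b 6"
    and br26: "br (b 2) (b 6) = q *\<^sub>R b 0 + (-p) *\<^sub>R b 1 + (-s) *\<^sub>R b 3 + (-h) *\<^sub>R b 4 + g *\<^sub>R b 5 + m *\<^sub>R b 6"
    and br45: "br (b 4) (b 5) = (A1 - A4) *\<^sub>R b 0 + (A2 + A3) *\<^sub>R b 1"
    and br34: "br (b 3) (b 4) = 0"
    and br35: "br (b 3) (b 5) = 0"
    and br36: "br (b 3) (b 6) = 0"
    and br46: "br (b 4) (b 6) = 0"
    and br56: "br (b 5) (b 6) = 0"
begin

lemmas br_core = central br23 br24 br25 br26 br34 br35 br36 br45 br46 br56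

lemma B_core:
  "B 0 1 0 = 0"
  "B 0 1 1 = 0"
  "B 0 1 2 = 0"
  "B 0 1 3 = 0"
  "B 0 1 4 = 0"
  "B 0 1 5 = 0"
  "B 0 1 6 = 0"
  "B 0 2 0 = 0"
  "B 0 2 1 = 0"
  "B 0 2 2 = 0"
  "B 0 2 3 = 0"
  "B 0 2 4 = 0"
  "B 0 2 5 = 0"
  "B 0 2 6 = 0"
  "B 0 3 0 = 0"
  "B 0 3 1 = 0"
  "B 0 3 2 = 0"
  "B 0 3 3 = 0"
  "B 0 3 4 = 0"
  "B 0 3 5 = 0"
  "B 0 3 6 = 0"
  "B 0 4 0 = 0"
  "B 0 4 1 = 0"
  "B 0 4 2 = 0"
  "B 0 4 3 = 0"
  "B 0 4 4 = 0"
  "B 0 4 5 = 0"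
  "B 0 4 6 = 0"
  "B 0 5 0 = 0"
  "B 0 5 1 = 0"
  "B 0 5 2 = 0"
  "B 0 5 3 = 0"
  "B 0 5 4 = 0"
  "B 0 5 5 = 0"
  "B 0 5 6 = 0"
  "B 0 6 0 = 0"
  "B 0 6 1 = 0"
  "B 0 6 2 = 0"
  "B 0 6 3 = 0"
  "B 0 6 4 = 0"
  "B 0 6 5 = 0"
  "B 0 6 6 = 0"
  "B 1 2 0 = 0"
  "B 1 2 1 = 0"
  "B 1 2 2 = 0"
  "B 1 2 3 = 0"
  "B 1 2 4 = 0"
  "B 1 2 5 = 0"
  "B 1 2 6 = 0"
  "B 1 3 0 = 0"
  "B 1 3 1 = 0"
  "B 1 3 2 = 0"
  "B 1 3 3 = 0"
  "B 1 3 4 = 0"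
  "B 1 3 5 = 0"
  "B 1 3 6 = 0"
  "B 1 4 0 = 0"
  "B 1 4 1 = 0"
  "B 1 4 2 = 0"
  "B 1 4 3 = 0"
  "B 1 4 4 = 0"
  "B 1 4 5 = 0"
  "B 1 4 6 = 0"
  "B 1 5 0 = 0"
  "B 1 5 1 = 0"
  "B 1 5 2 = 0"
  "B 1 5 3 = 0"
  "B 1 5 4 = 0"
  "B 1 5 5 = 0"
  "B 1 5 6 = 0"
  "B 1 6 0 = 0"
  "B 1 6 1 = 0"
  "B 1 6 2 = 0"
  "B 1 6 3 = 0"
  "B 1 6 4 = 0"
  "B 1 6 5 = 0"
  "B 1 6 6 = 0"
  "B 2 3 0 = p"
  "B 2 3 1 = q"
  "B 2 3 2 = 0"
  "B 2 3 3 = m"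
  "B 2 3 4 = g"
  "B 2 3 5 = h"
  "B 2 3 6 = s"
  "B 2 4 0 = u"
  "B 2 4 1 = v"
  "B 2 4 2 = 0"
  "B 2 4 3 = A1"
  "B 2 4 4 = -m"
  "B 2 4 5 = -s"
  "B 2 4 6 = A2"
  "B 2 5 0 = v"
  "B 2 5 1 = -u"
  "B 2 5 2 = 0"
  "B 2 5 3 = A3"
  "B 2 5 4 = s"
  "B 2 5 5 = -m"
  "B 2 5 6 = A4"
  "B 2 6 0 = q"
  "B 2 6 1 = -p"
  "B 2 6 2 = 0"
  "B 2 6 3 = -s"
  "B 2 6 4 = -h"
  "B 2 6 5 = g"
  "B 2 6 6 = m"
  "B 3 4 0 = 0"
  "B 3 4 1 = 0"
  "B 3 4 2 = 0"
  "B 3 4 3 = 0"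
  "B 3 4 4 = 0"
  "B 3 4 5 = 0"
  "B 3 4 6 = 0"
  "B 3 5 0 = 0"
  "B 3 5 1 = 0"
  "B 3 5 2 = 0"
  "B 3 5 3 = 0"
  "B 3 5 4 = 0"
  "B 3 5 5 = 0"
  "B 3 5 6 = 0"
  "B 3 6 0 = 0"
  "B 3 6 1 = 0"
  "B 3 6 2 = 0"
  "B 3 6 3 = 0"
  "B 3 6 4 = 0"
  "B 3 6 5 = 0"
  "B 3 6 6 = 0"
  "B 4 5 0 = A1 - A4"
  "B 4 5 1 = A2 + A3"
  "B 4 5 2 = 0"
  "B 4 5 3 = 0"
  "B 4 5 4 = 0"
  "B 4 5 5 = 0"
  "B 4 5 6 = 0"
  "B 4 6 0 = 0"
  "B 4 6 1 = 0"
  "B 4 6 2 = 0"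
  "B 4 6 3 = 0"
  "B 4 6 4 = 0"
  "B 4 6 5 = 0"
  "B 4 6 6 = 0"
  "B 5 6 0 = 0"
  "B 5 6 1 = 0"
  "B 5 6 2 = 0"
  "B 5 6 3 = 0"
  "B 5 6 4 = 0"
  "B 5 6 5 = 0"
  "B 5 6 6 = 0"
  by (simp_all add: B_def br_core linear_add linear_diff linear_cmul linear_0 linear_neg linear_coord coord_basis del:
      One_nat_def)

lemma core_closed: "ce_diff br 3 \<phi> = (\<lambda>x. 0)"
  unfolding closed_iff combs_code upt_7
  by (simp add: Let_def d_phi B_core del: One_nat_def)

lemma core_tau:
  "\<tau> (bt [0, 1]) = 0"
  "\<tau> (bt [0, 2]) = A1 - A4"
  "\<tau> (bt [0, 3]) = -q"
  "\<tau> (bt [0, 4]) = -v"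
  "\<tau> (bt [0, 5]) = u"
  "\<tau> (bt [0, 6]) = p"
  "\<tau> (bt [1, 2]) = A2 + A3"
  "\<tau> (bt [1, 3]) = p"
  "\<tau> (bt [1, 4]) = u"
  "\<tau> (bt [1, 5]) = v"
  "\<tau> (bt [1, 6]) = q"
  "\<tau> (bt [2, 3]) = 0"
  "\<tau> (bt [2, 4]) = 0"
  "\<tau> (bt [2, 5]) = 0"
  "\<tau> (bt [2, 6]) = 0"
  "\<tau> (bt [3, 4]) = -A3 - h"
  "\<tau> (bt [3, 5]) = A1 + g"
  "\<tau> (bt [3, 6]) = 2 * m"
  "\<tau> (bt [4, 5]) = -2 * m"
  "\<tau> (bt [4, 6]) = A4 + g"
  "\<tau> (bt [5, 6]) = -A2 + h"
  by (simp_all add: tau_bt B_core del: One_nat_def)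

lemma core_alt2:
  "alt2 0 0 = 0"
  "alt2 0 1 = 0"
  "alt2 0 2 = A1 - A4"
  "alt2 0 3 = -q"
  "alt2 0 4 = -v"
  "alt2 0 5 = u"
  "alt2 0 6 = p"
  "alt2 1 0 = 0"
  "alt2 1 1 = 0"
  "alt2 1 2 = A2 + A3"
  "alt2 1 3 = p"
  "alt2 1 4 = u"
  "alt2 1 5 = v"
  "alt2 1 6 = q"
  "alt2 2 0 = -A1 + A4"
  "alt2 2 1 = -A2 - A3"
  "alt2 2 2 = 0"
  "alt2 2 3 = 0"
  "alt2 2 4 = 0"
  "alt2 2 5 = 0"
  "alt2 2 6 = 0"
  "alt2 3 0 = q"
  "alt2 3 1 = -p"
  "alt2 3 2 = 0"
  "alt2 3 3 = 0"
  "alt2 3 4 = -A3 - h"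
  "alt2 3 5 = A1 + g"
  "alt2 3 6 = 2 * m"
  "alt2 4 0 = v"
  "alt2 4 1 = -u"
  "alt2 4 2 = 0"
  "alt2 4 3 = A3 + h"
  "alt2 4 4 = 0"
  "alt2 4 5 = -2 * m"
  "alt2 4 6 = A4 + g"
  "alt2 5 0 = -u"
  "alt2 5 1 = -v"
  "alt2 5 2 = 0"
  "alt2 5 3 = -A1 - g"
  "alt2 5 4 = 2 * m"
  "alt2 5 5 = 0"
  "alt2 5 6 = -A2 + h"
  "alt2 6 0 = -p"
  "alt2 6 1 = -q"
  "alt2 6 2 = 0"
  "alt2 6 3 = -2 * m"
  "alt2 6 4 = -A4 - g"
  "alt2 6 5 = A2 - h"
  "alt2 6 6 = 0"
  by (simp_all add: alt2_def core_tau del: One_nat_def)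

lemma core_d_tau:
  "ce_diff br 2 \<tau> (bt [0, 1, 2]) = 0"
  "ce_diff br 2 \<tau> (bt [0, 1, 3]) = 0"
  "ce_diff br 2 \<tau> (bt [0, 1, 4]) = 0"
  "ce_diff br 2 \<tau> (bt [0, 1, 5]) = 0"
  "ce_diff br 2 \<tau> (bt [0, 1, 6]) = 0"
  "ce_diff br 2 \<tau> (bt [0, 2, 3]) = -g * v + h * u - m * q + p * s"
  "ce_diff br 2 \<tau> (bt [0, 2, 4]) = -A1 * q + A2 * p + m * v - s * u"
  "ce_diff br 2 \<tau> (bt [0, 2, 5]) = -A3 * q + A4 * p - m * u - s * v"
  "ce_diff br 2 \<tau> (bt [0, 2, 6]) = g * u + h * v + m * p + q * s"
  "ce_diff br 2 \<tau> (bt [0, 3, 4]) = 0"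
  "ce_diff br 2 \<tau> (bt [0, 3, 5]) = 0"
  "ce_diff br 2 \<tau> (bt [0, 3, 6]) = 0"
  "ce_diff br 2 \<tau> (bt [0, 4, 5]) = 0"
  "ce_diff br 2 \<tau> (bt [0, 4, 6]) = 0"
  "ce_diff br 2 \<tau> (bt [0, 5, 6]) = 0"
  "ce_diff br 2 \<tau> (bt [1, 2, 3]) = g * u + h * v + m * p + q * s"
  "ce_diff br 2 \<tau> (bt [1, 2, 4]) = A1 * p + A2 * q - m * u - s * v"
  "ce_diff br 2 \<tau> (bt [1, 2, 5]) = A3 * p + A4 * q - m * v + s * u"
  "ce_diff br 2 \<tau> (bt [1, 2, 6]) = g * v - h * u + m * q - p * s"
  "ce_diff br 2 \<tau> (bt [1, 3, 4]) = 0"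
  "ce_diff br 2 \<tau> (bt [1, 3, 5]) = 0"
  "ce_diff br 2 \<tau> (bt [1, 3, 6]) = 0"
  "ce_diff br 2 \<tau> (bt [1, 4, 5]) = 0"
  "ce_diff br 2 \<tau> (bt [1, 4, 6]) = 0"
  "ce_diff br 2 \<tau> (bt [1, 5, 6]) = 0"
  "ce_diff br 2 \<tau> (bt [2, 3, 4]) = A1 * s - 2 * A2 * m + A4 * s + 2 * g * s - 2 * h * m + 2 * p * v - 2 * q * u"
  "ce_diff br 2 \<tau> (bt [2, 3, 5]) = -A2 * s + A3 * s - 2 * A4 * m + 2 * g * m + 2 * h * s - 2 * p * u - 2 * q * v"
  "ce_diff br 2 \<tau> (bt [2, 3, 6]) = -A1 * g + A2 * h - A3 * h - A4 * g - 2 * g * g - 2 * h * h - 4 * m * m - 2 * p * p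
      - 2 * q * q"
  "ce_diff br 2 \<tau> (bt [2, 4, 5]) = -2 * A1 * A1 + 2 * A1 * A4 - A1 * g - 2 * A2 * A2 - 2 * A2 * A3 + A2 * h
      - 2 * A3 * A3 - A3 * h - 2 * A4 * A4 - A4 * g - 4 * m * m - 2 * u * u - 2 * v * v"
  "ce_diff br 2 \<tau> (bt [2, 4, 6]) = -2 * A1 * m - A2 * s + A3 * s + 2 * g * m + 2 * h * s - 2 * p * u - 2 * q * v"
  "ce_diff br 2 \<tau> (bt [2, 5, 6]) = -A1 * s - 2 * A3 * m - A4 * s - 2 * g * s + 2 * h * m - 2 * p * v + 2 * q * u"
  "ce_diff br 2 \<tau> (bt [3, 4, 5]) = A1 * q - A2 * p - A3 * p - A4 * q"
  "ce_diff br 2 \<tau> (bt [3, 4, 6]) = 0"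
  "ce_diff br 2 \<tau> (bt [3, 5, 6]) = 0"
  "ce_diff br 2 \<tau> (bt [4, 5, 6]) = -A1 * p - A2 * q - A3 * q + A4 * p"
  by (simp_all add: d_tau_bt sum_7 B_core core_alt2 algebra_simps del: One_nat_def)

end

lemma (in g2_lie_frame) derivation_frameI:
  assumes D: "linear D"
    and der: "\<forall>K\<in>combs 2. D (br (b (K ! 0)) (b (K ! 1))) = br (D (b (K ! 0))) (b (K ! 1))
        + br (b (K ! 0)) (D (b (K ! 1)))"
  shows "derivation br D"
  unfolding derivation_def
proof (intro conjI allI D)
  have lt: "D (br (b i) (b j)) = br (D (b i)) (b j) + br (b i) (D (b j))" if "i < j" "j < 7" for i j
    using der that combs2_iff[of i j] by force
  have basis: "D (br (b i) (b j)) = br (D (b i)) (b j) + br (b i) (D (b j))" if "i < 7" "j < 7" for i j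
  proof -
    consider "i < j" | "i = j" | "j < i" by linarith
    then show ?thesis
    proof cases
      case 1 then show ?thesis using lt that by simp
    next
      case 2
      then show ?thesis using br_swap[of "D (b j)" "b j"] linear_0[OF D] by (simp add: br_self)
    next
      case 3
      then show ?thesis
        using lt[of j i] that br_swap[of "b i" "b j"] br_swap[of "D (b i)" "b j"] br_swap[of "b i" "D (b j)"]
        by (simp add: linear_neg[OF D])
    qed
  qed
  have lin: "linear (\<lambda>x. br x y)" "linear (\<lambda>y. br x y)" for x y
    using bilinear_br by (auto simp: bilinear_def)
  fix x y
  let ?L = "\<lambda>x y. D (br x y) - br (D x) y - br x (D y)"
  have l1: "linear (\<lambda>x. ?L x y)" and l2: "linear (\<lambda>y. ?L x y)" for x y
    using D by (auto simp: linear_iff bilinear_ladd[OF bilinear_br] bilinear_radd[OF bilinear_br]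
        bilinear_lmul[OF bilinear_br] bilinear_rmul[OF bilinear_br] algebra_simps)
  have ex: "f x = (\<Sum>i<7. c i x *\<^sub>R f (b i))" if "linear f" for f :: "'a \<Rightarrow> 'a" and x
    by (subst expansion[symmetric, of x]) (simp add: linear_sum[OF that] linear_cmul[OF that])
  have "?L x y = 0"
    by (subst ex[OF l1], subst ex[OF l2]) (simp add: basis)
  then show "D (br x y) = br (D x) y + br x (D y)" by (simp add: algebra_simps)
qed

definition (in frame) endo :: "(nat \<Rightarrow> 'a) \<Rightarrow> 'a \<Rightarrow> 'a" where
  "endo d x = (\<Sum>i<7. c i x *\<^sub>R d i)"

context frame
begin

lemma coord_eq_iff: "x = y \<longleftrightarrow> c 0 x = c 0 y \<and> c 1 x = c 1 y \<and> c 2 x = c 2 y \<and> c 3 x = c 3 y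
    \<and> c 4 x = c 4 y \<and> c 5 x = c 5 y \<and> c 6 x = c 6 y"
proof
  assume *: "c 0 x = c 0 y \<and> c 1 x = c 1 y \<and> c 2 x = c 2 y \<and> c 3 x = c 3 y
    \<and> c 4 x = c 4 y \<and> c 5 x = c 5 y \<and> c 6 x = c 6 y"
  show "x = y"
  proof (rule coord_eqI)
    fix i :: nat assume "i < 7"
    then consider "i = 0" | "i = 1" | "i = 2" | "i = 3" | "i = 4" | "i = 5" | "i = 6" by linarith
    then show "c i x = c i y" using * by cases simp_all
  qed
qed simp

lemmas coord_simps = coord_basis linear_0[OF linear_coord] linear_add[OF linear_coord]
  linear_diff[OF linear_coord] linear_neg[OF linear_coord] linear_cmul[OF linear_coord]

lemma linear_endo: "linear (endo d)"
  unfolding endo_def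
  by (intro linear_compose_sum ballI) (auto simp: linear_iff linear_add[OF linear_coord] linear_cmul[OF linear_coord]
      algebra_simps)

lemma endo_basis: "i < 7 \<Longrightarrow> endo d (b i) = d i"
proof -
  assume "i < 7"
  then have "(\<Sum>j<7. c j (b i) *\<^sub>R d j) = (\<Sum>j<7. if j = i then d j else 0)"
    by (intro sum.cong) (auto simp: coord_basis)
  then show ?thesis using \<open>i < 7\<close> by (simp add: endo_def)
qed

end

lemma (in g2_lie_frame) endo_act_values:
  assumes "linear D"
  shows
  "endo_act D 3 \<phi> (bt [0, 1, 2]) = c 0 (D (b 0)) + c 1 (D (b 1)) + c 2 (D (b 2))"
  "endo_act D 3 \<phi> (bt [0, 1, 3]) = c 5 (D (b 0)) - c 4 (D (b 1)) + c 2 (D (b 3))"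
  "endo_act D 3 \<phi> (bt [0, 1, 4]) = - c 6 (D (b 0)) + c 3 (D (b 1)) + c 2 (D (b 4))"
  "endo_act D 3 \<phi> (bt [0, 1, 5]) = - c 3 (D (b 0)) - c 6 (D (b 1)) + c 2 (D (b 5))"
  "endo_act D 3 \<phi> (bt [0, 1, 6]) = c 4 (D (b 0)) + c 5 (D (b 1)) + c 2 (D (b 6))"
  "endo_act D 3 \<phi> (bt [0, 2, 3]) = - c 6 (D (b 0)) - c 4 (D (b 2)) - c 1 (D (b 3))"
  "endo_act D 3 \<phi> (bt [0, 2, 4]) = - c 5 (D (b 0)) + c 3 (D (b 2)) - c 1 (D (b 4))"
  "endo_act D 3 \<phi> (bt [0, 2, 5]) = c 4 (D (b 0)) - c 6 (D (b 2)) - c 1 (D (b 5))"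
  "endo_act D 3 \<phi> (bt [0, 2, 6]) = c 3 (D (b 0)) + c 5 (D (b 2)) - c 1 (D (b 6))"
  "endo_act D 3 \<phi> (bt [0, 3, 4]) = c 0 (D (b 0)) + c 3 (D (b 3)) + c 4 (D (b 4))"
  "endo_act D 3 \<phi> (bt [0, 3, 5]) = c 1 (D (b 0)) - c 6 (D (b 3)) + c 4 (D (b 5))"
  "endo_act D 3 \<phi> (bt [0, 3, 6]) = - c 2 (D (b 0)) + c 5 (D (b 3)) + c 4 (D (b 6))"
  "endo_act D 3 \<phi> (bt [0, 4, 5]) = - c 2 (D (b 0)) - c 6 (D (b 4)) - c 3 (D (b 5))"
  "endo_act D 3 \<phi> (bt [0, 4, 6]) = - c 1 (D (b 0)) + c 5 (D (b 4)) - c 3 (D (b 6))"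
  "endo_act D 3 \<phi> (bt [0, 5, 6]) = c 0 (D (b 0)) + c 5 (D (b 5)) + c 6 (D (b 6))"
  "endo_act D 3 \<phi> (bt [1, 2, 3]) = - c 6 (D (b 1)) - c 5 (D (b 2)) + c 0 (D (b 3))"
  "endo_act D 3 \<phi> (bt [1, 2, 4]) = - c 5 (D (b 1)) + c 6 (D (b 2)) + c 0 (D (b 4))"
  "endo_act D 3 \<phi> (bt [1, 2, 5]) = c 4 (D (b 1)) + c 3 (D (b 2)) + c 0 (D (b 5))"
  "endo_act D 3 \<phi> (bt [1, 2, 6]) = c 3 (D (b 1)) - c 4 (D (b 2)) + c 0 (D (b 6))"
  "endo_act D 3 \<phi> (bt [1, 3, 4]) = c 0 (D (b 1)) + c 6 (D (b 3)) + c 5 (D (b 4))"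
  "endo_act D 3 \<phi> (bt [1, 3, 5]) = c 1 (D (b 1)) + c 3 (D (b 3)) + c 5 (D (b 5))"
  "endo_act D 3 \<phi> (bt [1, 3, 6]) = - c 2 (D (b 1)) - c 4 (D (b 3)) + c 5 (D (b 6))"
  "endo_act D 3 \<phi> (bt [1, 4, 5]) = - c 2 (D (b 1)) + c 3 (D (b 4)) - c 6 (D (b 5))"
  "endo_act D 3 \<phi> (bt [1, 4, 6]) = - c 1 (D (b 1)) - c 4 (D (b 4)) - c 6 (D (b 6))"
  "endo_act D 3 \<phi> (bt [1, 5, 6]) = c 0 (D (b 1)) - c 4 (D (b 5)) - c 3 (D (b 6))"
  "endo_act D 3 \<phi> (bt [2, 3, 4]) = c 0 (D (b 2)) + c 5 (D (b 3)) - c 6 (D (b 4))"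
  "endo_act D 3 \<phi> (bt [2, 3, 5]) = c 1 (D (b 2)) - c 4 (D (b 3)) - c 6 (D (b 5))"
  "endo_act D 3 \<phi> (bt [2, 3, 6]) = - c 2 (D (b 2)) - c 3 (D (b 3)) - c 6 (D (b 6))"
  "endo_act D 3 \<phi> (bt [2, 4, 5]) = - c 2 (D (b 2)) - c 4 (D (b 4)) - c 5 (D (b 5))"
  "endo_act D 3 \<phi> (bt [2, 4, 6]) = - c 1 (D (b 2)) - c 3 (D (b 4)) - c 5 (D (b 6))"
  "endo_act D 3 \<phi> (bt [2, 5, 6]) = c 0 (D (b 2)) - c 3 (D (b 5)) + c 4 (D (b 6))"
  "endo_act D 3 \<phi> (bt [3, 4, 5]) = - c 2 (D (b 3)) - c 1 (D (b 4)) + c 0 (D (b 5))"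
  "endo_act D 3 \<phi> (bt [3, 4, 6]) = - c 1 (D (b 3)) + c 2 (D (b 4)) + c 0 (D (b 6))"
  "endo_act D 3 \<phi> (bt [3, 5, 6]) = c 0 (D (b 3)) + c 2 (D (b 5)) + c 1 (D (b 6))"
  "endo_act D 3 \<phi> (bt [4, 5, 6]) = c 0 (D (b 4)) + c 1 (D (b 5)) - c 2 (D (b 6))"
  by (simp_all add: endo_act_bt[OF assms] sum_7 g2_eps_def alt3_def g2_table_def del: One_nat_def)

lemma combs_2_all: "(\<forall>K\<in>combs 2. P K) \<longleftrightarrow>
    P [0, 1] \<and> P [0, 2] \<and> P [0, 3] \<and> P [0, 4] \<and> P [0, 5] \<and> P [0, 6] \<and> P [1, 2] \<and> P [1, 3] \<and>
    P [1, 4] \<and> P [1, 5] \<and> P [1, 6] \<and> P [2, 3] \<and> P [2, 4] \<and> P [2, 5] \<and> P [2, 6] \<and> P [3, 4] \<and>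
    P [3, 5] \<and> P [3, 6] \<and> P [4, 5] \<and> P [4, 6] \<and> P [5, 6]"
proof -
  have "[0..<7] = [0, 1, 2, 3, 4, 5, 6::nat]" by (simp add: upt_rec)
  then show ?thesis by (simp add: combs_code Let_def del: One_nat_def)
qed

lemma combs_3_all: "(\<forall>K\<in>combs 3. P K) \<longleftrightarrow>
    P [0, 1, 2] \<and> P [0, 1, 3] \<and> P [0, 1, 4] \<and> P [0, 1, 5] \<and> P [0, 1, 6] \<and> P [0, 2, 3] \<and> P [0, 2, 4] \<and>
    P [0, 2, 5] \<and> P [0, 2, 6] \<and> P [0, 3, 4] \<and> P [0, 3, 5] \<and> P [0, 3, 6] \<and> P [0, 4, 5] \<and> P [0, 4, 6] \<and>
    P [0, 5, 6] \<and> P [1, 2, 3] \<and> P [1, 2, 4] \<and> P [1, 2, 5] \<and> P [1, 2, 6] \<and> P [1, 3, 4] \<and> P [1, 3, 5] \<and>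
    P [1, 3, 6] \<and> P [1, 4, 5] \<and> P [1, 4, 6] \<and> P [1, 5, 6] \<and> P [2, 3, 4] \<and> P [2, 3, 5] \<and> P [2, 3, 6] \<and>
    P [2, 4, 5] \<and> P [2, 4, 6] \<and> P [2, 5, 6] \<and> P [3, 4, 5] \<and> P [3, 4, 6] \<and> P [3, 5, 6] \<and> P [4, 5, 6]"
proof -
  have "[0..<7] = [0, 1, 2, 3, 4, 5, 6::nat]" by (simp add: upt_rec)
  then show ?thesis by (simp add: combs_code Let_def del: One_nat_def)
qed

context core_frame
begin

lemma br_core_swap:
  "br x (b 0) = 0" "br x (b 1) = 0"
  "br (b 3) (b 2) = - (p *\<^sub>R b 0 + q *\<^sub>R b 1 + m *\<^sub>R b 3 + g *\<^sub>R b 4 + h *\<^sub>R b 5 + s *\<^sub>R b 6)"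
  "br (b 4) (b 2) = - (u *\<^sub>R b 0 + v *\<^sub>R b 1 + A1 *\<^sub>R b 3 + (-m) *\<^sub>R b 4 + (-s) *\<^sub>R b 5 + A2 *\<^sub>R b 6)"
  "br (b 5) (b 2) = - (v *\<^sub>R b 0 + (-u) *\<^sub>R b 1 + A3 *\<^sub>R b 3 + s *\<^sub>R b 4 + (-m) *\<^sub>R b 5 + A4 *\<^sub>R b 6)"
  "br (b 6) (b 2) = - (q *\<^sub>R b 0 + (-p) *\<^sub>R b 1 + (-s) *\<^sub>R b 3 + (-h) *\<^sub>R b 4 + g *\<^sub>R b 5 + m *\<^sub>R b 6)"
  "br (b 5) (b 4) = - ((A1 - A4) *\<^sub>R b 0 + (A2 + A3) *\<^sub>R b 1)"
  "br (b 4) (b 3) = 0" "br (b 5) (b 3) = 0" "br (b 6) (b 3) = 0" "br (b 6) (b 4) = 0" "br (b 6) (b 5) = 0"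
  by (simp_all add: central br_core br_swap[of x "b 0"] br_swap[of x "b 1"] br_swap[of "b 3" "b 2"]
    br_swap[of "b 4" "b 2"] br_swap[of "b 5" "b 2"] br_swap[of "b 6" "b 2"]
    br_swap[of "b 4" "b 3"] br_swap[of "b 5" "b 3"] br_swap[of "b 6" "b 3"]
    br_swap[of "b 5" "b 4"] br_swap[of "b 6" "b 4"] br_swap[of "b 6" "b 5"] algebra_simps del: One_nat_def)

lemmas br_bilinear = bilinear_ladd[OF bilinear_br] bilinear_radd[OF bilinear_br]
  bilinear_lmul[OF bilinear_br] bilinear_rmul[OF bilinear_br] bilinear_lneg[OF bilinear_br] bilinear_rneg[OF
      bilinear_br]
  bilinear_lsub[OF bilinear_br] bilinear_rsub[OF bilinear_br] bilinear_lzero[OF bilinear_br] bilinear_rzero[OF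
      bilinear_br]

lemmas soliton_simps = combs_2_all combs_3_all br_core br_core_swap br_bilinear br_self endo_basis
  linear_0[OF linear_endo] linear_add[OF linear_endo] linear_diff[OF linear_endo] linear_neg[OF linear_endo]
  linear_cmul[OF linear_endo] coord_eq_iff coord_simps core_d_tau tab_bt combs3_iff endo_act_values[OF linear_endo]
  g2_table_def nth_Cons'

lemma core_solitonI:
  assumes "\<forall>K\<in>combs 2. endo d (br (b (K ! 0)) (b (K ! 1)))
      = br (endo d (b (K ! 0))) (b (K ! 1)) + br (b (K ! 0)) (endo d (b (K ! 1)))"
    and "\<forall>K\<in>combs 3. ce_diff br 2 \<tau> (bt K) = r * \<phi> (bt K) + endo_act (endo d) 3 \<phi> (bt K)"
  shows "semi_algebraic_soliton br \<phi>"
  using soliton_iff[OF core_closed] derivation_frameI[OF linear_endo assms(1)] assms(2) by blast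

end

section \<open>Semi-algebraic solitons\<close>

lemma core_frame_g2_form:
  assumes "frame b c" "lie_algebra br"
    and "\<And>x. br (b 0) x = 0" "\<And>x. br (b 1) x = 0"
    and "br (b 2) (b 3) = p *\<^sub>R b 0 + q *\<^sub>R b 1 + m *\<^sub>R b 3 + g *\<^sub>R b 4 + h *\<^sub>R b 5 + s *\<^sub>R b 6"
    and "br (b 2) (b 4) = u *\<^sub>R b 0 + v *\<^sub>R b 1 + A1 *\<^sub>R b 3 + (-m) *\<^sub>R b 4 + (-s) *\<^sub>R b 5 + A2 *\<^sub>R b 6"
    and "br (b 2) (b 5) = v *\<^sub>R b 0 + (-u) *\<^sub>R b 1 + A3 *\<^sub>R b 3 + s *\<^sub>R b 4 + (-m) *\<^sub>R b 5 + A4 *\<^sub>R b 6"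
    and "br (b 2) (b 6) = q *\<^sub>R b 0 + (-p) *\<^sub>R b 1 + (-s) *\<^sub>R b 3 + (-h) *\<^sub>R b 4 + g *\<^sub>R b 5 + m *\<^sub>R b 6"
    and "br (b 4) (b 5) = (A1 - A4) *\<^sub>R b 0 + (A2 + A3) *\<^sub>R b 1"
    and "br (b 3) (b 4) = 0"
    and "br (b 3) (b 5) = 0"
    and "br (b 3) (b 6) = 0"
    and "br (b 4) (b 6) = 0"
    and "br (b 5) (b 6) = 0"
  shows "core_frame b c (g2_form c) br m s g h A1 A2 A3 A4 p q u v"
  unfolding core_frame_def core_frame_axioms_def g2_lie_frame_def g2_lie_frame_axioms_def
  using frame.g2_frame_g2_form[OF assms(1)] assms by blast

lemma soliton_n1:
  assumes "core_frame b c \<phi> br 0 0 0 0 0 0 0 0 0 0 0 0"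
  shows "semi_algebraic_soliton br \<phi>"
proof -
  interpret core_frame b c \<phi> br 0 0 0 0 0 0 0 0 0 0 0 0 by (fact assms)
  show ?thesis
    by (rule core_solitonI[of "(!) [0, 0, 0, 0, 0, 0, 0]" "0"])
      (simp_all add: soliton_simps algebra_simps del: One_nat_def)
qed

lemma soliton_n2:
  assumes "core_frame b c \<phi> br 0 0 1 0 0 0 0 0 0 0 0 0"
  shows "semi_algebraic_soliton br \<phi>"
proof -
  interpret core_frame b c \<phi> br 0 0 1 0 0 0 0 0 0 0 0 0 by (fact assms)
  show ?thesis
    by (rule core_solitonI[of "(!) [-2 *\<^sub>R b 0, -2 *\<^sub>R b 1, -1 *\<^sub>R b 2, -1 *\<^sub>R b 3, -2 *\<^sub>R b 4, -2 *\<^sub>R b 5,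
        -1 *\<^sub>R b 6]" "5"])
      (simp_all add: soliton_simps algebra_simps del: One_nat_def)
qed

lemma soliton_n3:
  assumes "core_frame b c \<phi> br 0 0 0 0 (-2) 0 0 1 0 0 0 0"
  shows "semi_algebraic_soliton br \<phi>"
proof -
  interpret core_frame b c \<phi> br 0 0 0 0 "-2" 0 0 1 0 0 0 0 by (fact assms)
  show ?thesis
    by (rule core_solitonI[of "(!) [-14 *\<^sub>R b 0, -14 *\<^sub>R b 1, -7 *\<^sub>R b 2, -14 *\<^sub>R b 3, -7 *\<^sub>R b 4, -7 *\<^sub>R b 5,
        -14 *\<^sub>R b 6]" "35"])
      (simp_all add: soliton_simps algebra_simps del: One_nat_def)
qed

lemma soliton_n4:
  assumes "core_frame b c \<phi> br 0 0 0 0 (sqrt 2) 0 0 0 1 0 0 0"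
  shows "semi_algebraic_soliton br \<phi>"
proof -
  interpret core_frame b c \<phi> br 0 0 0 0 "sqrt 2" 0 0 0 1 0 0 0 by (fact assms)
  show ?thesis
    by (rule core_solitonI[of "(!) [-4 *\<^sub>R b 0, -4 *\<^sub>R b 1, -1 *\<^sub>R b 2 + sqrt 2 *\<^sub>R b 6, -3 *\<^sub>R b 3, -2 *\<^sub>R b 4,
        -2 *\<^sub>R b 5 + (- sqrt 2) *\<^sub>R b 1, -3 *\<^sub>R b 6]" "9"])
      (simp_all add: soliton_simps algebra_simps del: One_nat_def)
qed

lemma soliton_n5:
  assumes "core_frame b c \<phi> br 0 0 0 0 (sqrt 2) 0 0 0 0 1 0 0"
  shows "semi_algebraic_soliton br \<phi>"
proof -
  interpret core_frame b c \<phi> br 0 0 0 0 "sqrt 2" 0 0 0 0 1 0 0 by (fact assms)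
  show ?thesis
    by (rule core_solitonI[of "(!) [-4 *\<^sub>R b 0, -4 *\<^sub>R b 1, -1 *\<^sub>R b 2 + (- sqrt 2) *\<^sub>R b 3, -3 *\<^sub>R b 3, -2 *\<^sub>R b 4,
        -2 *\<^sub>R b 5 + sqrt 2 *\<^sub>R b 0, -3 *\<^sub>R b 6]" "9"])
      (simp_all add: soliton_simps algebra_simps del: One_nat_def)
qed

lemma soliton_n6:
  assumes "core_frame b c \<phi> br 0 0 (sqrt 2) 0 0 0 0 0 0 0 1 0"
  shows "semi_algebraic_soliton br \<phi>"
proof -
  interpret core_frame b c \<phi> br 0 0 "sqrt 2" 0 0 0 0 0 0 0 1 0 by (fact assms)
  show ?thesis
    by (rule core_solitonI[of "(!) [-4 *\<^sub>R b 0, -4 *\<^sub>R b 1, -1 *\<^sub>R b 2, -2 *\<^sub>R b 3 + sqrt 2 *\<^sub>R b 0, -3 *\<^sub>R b 4,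
        -3 *\<^sub>R b 5, -2 *\<^sub>R b 6 + (- sqrt 2) *\<^sub>R b 1]" "9"])
      (simp_all add: soliton_simps algebra_simps del: One_nat_def)
qed

lemma soliton_n7:
  assumes "core_frame b c \<phi> br 0 0 0 0 1 0 0 (-1) (sqrt (3 / 2)) 0 0 0"
  shows "semi_algebraic_soliton br \<phi>"
proof -
  interpret core_frame b c \<phi> br 0 0 0 0 1 0 0 "-1" "sqrt (3 / 2)" 0 0 0 by (fact assms)
  show ?thesis
    by (rule core_solitonI[of "(!) [-6 *\<^sub>R b 0, -6 *\<^sub>R b 1, (-3 / 2) *\<^sub>R b 2 + (2 * sqrt (3 / 2)) *\<^sub>R b 6,
        (-9 / 2) *\<^sub>R b 3, -3 *\<^sub>R b 4 + (- sqrt (3 / 2)) *\<^sub>R b 0, -3 *\<^sub>R b 5 + (- sqrt (3 / 2)) *\<^sub>R b 1, (-9 / 2) *\<^sub>R b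
        6]" "27 / 2"])
      (simp_all add: soliton_simps algebra_simps del: One_nat_def)
qed

lemma soliton_s5:
  assumes "core_frame b c \<phi> br 1 0 0 0 0 0 0 0 0 0 0 0"
  shows "semi_algebraic_soliton br \<phi>"
proof -
  interpret core_frame b c \<phi> br 1 0 0 0 0 0 0 0 0 0 0 0 by (fact assms)
  show ?thesis
    by (rule core_solitonI[of "(!) [-4 *\<^sub>R b 0, -4 *\<^sub>R b 1, 0, -2 *\<^sub>R b 3, -2 *\<^sub>R b 4, -2 *\<^sub>R b 5, -2 *\<^sub>R b 6]" "8"])
      (simp_all add: soliton_simps algebra_simps del: One_nat_def)
qed

lemma soliton_s6:
  assumes "core_frame b c \<phi> br k 1 0 0 0 0 0 0 0 0 0 0"
  shows "semi_algebraic_soliton br \<phi>"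
proof -
  interpret core_frame b c \<phi> br k 1 0 0 0 0 0 0 0 0 0 0 by (fact assms)
  show ?thesis
    by (rule core_solitonI[of "(!) [(-4 * k * k) *\<^sub>R b 0, (-4 * k * k) *\<^sub>R b 1, 0, (-2 * k * k) *\<^sub>R b 3,
        (-2 * k * k) *\<^sub>R b 4, (-2 * k * k) *\<^sub>R b 5, (-2 * k * k) *\<^sub>R b 6]" "8 * k * k"])
      (simp_all add: soliton_simps algebra_simps del: One_nat_def)
qed

section \<open>Isomorphisms with the Lie algebras of the classification\<close>

abbreviation ax :: "nat \<Rightarrow> real^7" where
  "ax i \<equiv> axis (of_nat (Suc i)) 1"

lemma of_nat_Suc_7: "inj_on (\<lambda>i. of_nat (Suc i) :: 7) {..<7}" "range (\<lambda>i. of_nat (Suc i) :: 7) = UNIV"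
  "bij_betw (\<lambda>i. of_nat (Suc i) :: 7) {..<7} UNIV"
proof -
  show inj: "inj_on (\<lambda>i. of_nat (Suc i) :: 7) {..<7}"
    using inj_of_nat_7 by (auto simp: inj_on_def)
  show bij: "bij_betw (\<lambda>i. of_nat (Suc i) :: 7) {..<7} UNIV"
    unfolding bij_betw_def
    by (intro conjI inj card_subset_eq) (simp_all add: card_image[OF inj] del: of_nat_Suc)
  then show "range (\<lambda>i. of_nat (Suc i) :: 7) = UNIV" by (auto simp: bij_betw_def)
qed

lemma vec7_expansion: "(\<Sum>i<7. (v $ of_nat (Suc i)) *\<^sub>R ax i) = v"
proof -
  have "(\<Sum>i<7. (v $ of_nat (Suc i)) *\<^sub>R ax i) = (\<Sum>k\<in>UNIV. (v $ k) *\<^sub>R axis k (1 :: real))"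
    by (rule sum.reindex_bij_betw[OF of_nat_Suc_7(3)])
  also have "\<dots> = v" by (simp add: vec_eq_iff axis_def if_distrib cong: if_cong)
  finally show ?thesis .
qed

lemma (in frame) bilinear_expand:
  assumes "bilinear f"
  shows "f x y = (\<Sum>i<7. \<Sum>j<7. (c i x * c j y) *\<^sub>R f (b i) (b j))"
proof -
  have "f x y = f (\<Sum>i<7. c i x *\<^sub>R b i) (\<Sum>j<7. c j y *\<^sub>R b j)" by (simp add: expansion)
  then show ?thesis
    using assms by (simp add: bilinear_sum bilinear_lmul bilinear_rmul sum.cartesian_product)
qed

lemma lie_isomorphic_iff_frame:
  fixes br :: "'a::real_vector \<Rightarrow> 'a \<Rightarrow> 'a" and n :: "real^7 \<Rightarrow> real^7 \<Rightarrow> real^7"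
  assumes lie: "lie_algebra br" and n: "bilinear n" and alt: "\<And>x y. n y x = - n x y"
  shows "lie_isomorphic br n \<longleftrightarrow> (\<exists>b c. frame b c \<and> (\<forall>K\<in>combs 2.
    br (b (K ! 0)) (b (K ! 1)) = (\<Sum>r<7. (n (ax (K ! 0)) (ax (K ! 1)) $ of_nat (Suc r)) *\<^sub>R b r)))"
    (is "_ \<longleftrightarrow> (\<exists>b c. _ \<and> ?T b)")
proof
  assume "lie_isomorphic br n"
  then obtain f where f: "linear f" "bij f" "\<And>x y. f (br x y) = n (f x) (f y)"
    by (auto simp: lie_isomorphic_def)
  define b where "b i = inv f (ax i)" for i
  define c where "c i x = f x $ of_nat (Suc i)" for i x
  have fb: "f (b i) = ax i" for i using f(2) by (simp add: b_def bij_is_surj surj_f_inv_f)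
  have inj: "x = y" if "f x = f y" for x y using f(2) that by (metis bij_is_inj injD)
  have "frame b c"
  proof (rule frame.intro)
    show "linear (c i)" if "i < 7" for i
      using f(1) by (auto simp: c_def linear_iff)
    show "c i (b j) = (if i = j then 1 else 0)" if "i < 7" "j < 7" for i j
      using that inj_onD[OF of_nat_Suc_7(1), of i j] by (auto simp: c_def fb axis_def simp del: of_nat_Suc)
    show "(\<Sum>i<7. c i x *\<^sub>R b i) = x" for x
      by (rule inj) (simp add: linear_sum[OF f(1)] linear_cmul[OF f(1)] fb c_def vec7_expansion del: of_nat_Suc)
  qed
  moreover have "?T b"
  proof
    fix K
    show "br (b (K ! 0)) (b (K ! 1)) = (\<Sum>r<7. (n (ax (K ! 0)) (ax (K ! 1)) $ of_nat (Suc r)) *\<^sub>R b r)"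
      by (rule inj) (simp add: f(3) linear_sum[OF f(1)] linear_cmul[OF f(1)] fb vec7_expansion del: of_nat_Suc)
  qed
  ultimately show "\<exists>b c. frame b c \<and> ?T b" by blast
next
  assume "\<exists>b c. frame b c \<and> ?T b"
  then obtain b c where "frame b c" and T: "?T b" by blast
  then interpret frame b c by simp
  note br = lie_algebra.bilinear_br[OF lie]
  define f where "f x = (\<Sum>i<7. c i x *\<^sub>R ax i)" for x
  have lin: "linear f"
    unfolding f_def using coord_simps(3,6)
    by (intro linear_compose_sum ballI) (auto simp: linear_iff linear_add[OF linear_coord] linear_cmul[OF
        linear_coord] algebra_simps)
  have fb: "f (b i) = ax i" if "i < 7" for i
  proof -
    have "f (b i) = (\<Sum>j<7. if j = i then ax j else 0)"
      unfolding f_def using that by (intro sum.cong) (auto simp: coord_basis)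
    then show ?thesis using that by simp
  qed
  have bij: "bij f"
  proof (rule o_bij)
    show "(\<lambda>v. \<Sum>i<7. (v $ of_nat (Suc i)) *\<^sub>R b i) \<circ> f = id"
    proof
      fix x
      have "f x $ of_nat (Suc i) = c i x" if i: "i < 7" for i
      proof -
        have "f x $ of_nat (Suc i) = (\<Sum>j<7. c j x * (if (of_nat (Suc i) :: 7) = of_nat (Suc j) then 1 else 0))"
          unfolding f_def by (simp add: axis_def del: of_nat_Suc)
        also have "\<dots> = (\<Sum>j<7. if j = i then c j x else 0)"
          using i inj_onD[OF of_nat_Suc_7(1), of i] by (intro sum.cong) (auto simp del: of_nat_Suc)
        finally have "f x $ of_nat (Suc i) = (\<Sum>j<7. if j = i then c j x else 0)" .
        then show ?thesis using i by simp
      qed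
      then show "((\<lambda>v. \<Sum>i<7. (v $ of_nat (Suc i)) *\<^sub>R b i) \<circ> f) x = id x"
        by (simp add: expansion del: of_nat_Suc)
    qed
    show "f \<circ> (\<lambda>v. \<Sum>i<7. (v $ of_nat (Suc i)) *\<^sub>R b i) = id"
      by (rule ext) (simp add: linear_sum[OF lin] linear_cmul[OF lin] fb vec7_expansion del: of_nat_Suc)
  qed
  have lt: "f (br (b i) (b j)) = n (ax i) (ax j)" if "i < j" "j < 7" for i j
  proof -
    have "br (b i) (b j) = (\<Sum>r<7. (n (ax i) (ax j) $ of_nat (Suc r)) *\<^sub>R b r)"
      using bspec[OF T, of "[i, j]"] that combs2_iff[of i j] by (simp del: of_nat_Suc)
    then show ?thesis
      by (simp add: linear_sum[OF lin] linear_cmul[OF lin] fb vec7_expansion del: of_nat_Suc)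
  qed
  have swap: "br y x = - br x y" for x y
  proof -
    have "br x y + br y x = 0"
      using lie_algebra.br_self[OF lie, of "x + y"] unfolding bilinear_ladd[OF br] bilinear_radd[OF br]
      by (simp add: lie_algebra.br_self[OF lie] add.commute)
    then show ?thesis by (simp add: eq_neg_iff_add_eq_0 add.commute)
  qed
  have self: "n x x = 0" for x
  proof -
    have "n x x $ i = (- n x x) $ i" for i by (rule arg_cong[OF alt])
    then show ?thesis by (simp add: vec_eq_iff)
  qed
  have basis: "f (br (b i) (b j)) = n (ax i) (ax j)" if "i < 7" "j < 7" for i j
  proof -
    consider "i < j" | "i = j" | "j < i" by linarith
    then show ?thesis
    proof cases
      case 1 then show ?thesis using lt that by simp
    next
      case 2 then show ?thesis by (simp add: lie_algebra.br_self[OF lie] linear_0[OF lin] self)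
    next
      case 3
      then show ?thesis
        using lt[of j i] that alt[of "ax j" "ax i"] swap[of "b i" "b j"] by (simp add: linear_neg[OF lin])
    qed
  qed
  have b1: "bilinear (\<lambda>x y. f (br x y))"
    using br linear_compose[OF _ lin] unfolding bilinear_def comp_def by blast
  have b2: "bilinear (\<lambda>x y. n (f x) (f y))"
    using n linear_compose[OF lin] unfolding bilinear_def comp_def by blast
  have "f (br x y) = n (f x) (f y)" for x y
    by (subst bilinear_expand[OF b1], subst bilinear_expand[OF b2]) (simp add: basis fb)
  with lin bij show "lie_isomorphic br n" unfolding lie_isomorphic_def by blast
qed

lemma forall_7: "(\<forall>i::7. P i) \<longleftrightarrow> P 1 \<and> P 2 \<and> P 3 \<and> P 4 \<and> P 5 \<and> P 6 \<and> P 0"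
proof -
  have "(\<forall>i::7. P i) \<longleftrightarrow> (\<forall>k\<in>of_nat ` {..<7}. P k)"
    using bij_betw_imp_surj_on[OF bij_betw_of_nat_7] by simp
  moreover have "{..<7::nat} = {0, 1, 2, 3, 4, 5, 6}" by auto
  ultimately show ?thesis by auto
qed

lemmas bracket_defs = \<nn>\<^sub>1_def \<nn>\<^sub>2_def \<nn>\<^sub>3_def \<nn>\<^sub>4_def \<nn>\<^sub>5_def \<nn>\<^sub>6_def \<nn>\<^sub>7_def \<ss>\<^sub>5_def \<ss>\<^sub>6_def \<ss>\<^sub>7_def
  bracket_of_def e2_def

definition brackets :: "('a \<Rightarrow> 'a \<Rightarrow> 'a) \<Rightarrow> (nat \<Rightarrow> 'a) \<Rightarrow> 'a list" where
  "brackets br b = [br (b 0) (b 1), br (b 0) (b 2), br (b 0) (b 3), br (b 0) (b 4), br (b 0) (b 5), br (b 0) (b 6),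
     br (b 1) (b 2), br (b 1) (b 3), br (b 1) (b 4), br (b 1) (b 5), br (b 1) (b 6),
     br (b 2) (b 3), br (b 2) (b 4), br (b 2) (b 5), br (b 2) (b 6),
     br (b 3) (b 4), br (b 3) (b 5), br (b 3) (b 6),
     br (b 4) (b 5), br (b 4) (b 6),
     br (b 5) (b 6)]"

lemma bilinear_nn1: "bilinear \<nn>\<^sub>1" and alternating_nn1: "\<nn>\<^sub>1 y x = - \<nn>\<^sub>1 x y"
  by (simp_all add: bilinear_def linear_iff vec_eq_iff forall_7 bracket_defs vector_def algebra_simps)

lemma lie_isomorphic_nn1_iff:
  assumes "lie_algebra br"
  shows "lie_isomorphic br \<nn>\<^sub>1 \<longleftrightarrow> (\<exists>b c. frame b c \<and> brackets br b =
    [0, 0, 0, 0, 0, 0, 0, 0, 0, 0, 0, 0, 0, 0, 0, 0, 0, 0, 0, 0, 0])"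
  unfolding lie_isomorphic_iff_frame[OF assms bilinear_nn1 alternating_nn1] combs_2_all
  by (simp add: bracket_defs sum_7 vector_def axis_def brackets_def del: One_nat_def)

lemma bilinear_nn2: "bilinear \<nn>\<^sub>2" and alternating_nn2: "\<nn>\<^sub>2 y x = - \<nn>\<^sub>2 x y"
  by (simp_all add: bilinear_def linear_iff vec_eq_iff forall_7 bracket_defs vector_def algebra_simps)

lemma lie_isomorphic_nn2_iff:
  assumes "lie_algebra br"
  shows "lie_isomorphic br \<nn>\<^sub>2 \<longleftrightarrow> (\<exists>b c. frame b c \<and> brackets br b =
    [- b 4, - b 5, 0, 0, 0, 0, 0, 0, 0, 0, 0, 0, 0, 0, 0, 0, 0, 0, 0, 0, 0])"
  unfolding lie_isomorphic_iff_frame[OF assms bilinear_nn2 alternating_nn2] combs_2_all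
  by (simp add: bracket_defs sum_7 vector_def axis_def brackets_def del: One_nat_def)

lemma bilinear_nn3: "bilinear \<nn>\<^sub>3" and alternating_nn3: "\<nn>\<^sub>3 y x = - \<nn>\<^sub>3 x y"
  by (simp_all add: bilinear_def linear_iff vec_eq_iff forall_7 bracket_defs vector_def algebra_simps)

lemma lie_isomorphic_nn3_iff:
  assumes "lie_algebra br"
  shows "lie_isomorphic br \<nn>\<^sub>3 \<longleftrightarrow> (\<exists>b c. frame b c \<and> brackets br b =
    [- b 3, - b 4, 0, 0, 0, 0, - b 5, 0, 0, 0, 0, 0, 0, 0, 0, 0, 0, 0, 0, 0, 0])"
  unfolding lie_isomorphic_iff_frame[OF assms bilinear_nn3 alternating_nn3] combs_2_all
  by (simp add: bracket_defs sum_7 vector_def axis_def brackets_def del: One_nat_def)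

lemma bilinear_nn4: "bilinear \<nn>\<^sub>4" and alternating_nn4: "\<nn>\<^sub>4 y x = - \<nn>\<^sub>4 x y"
  by (simp_all add: bilinear_def linear_iff vec_eq_iff forall_7 bracket_defs vector_def algebra_simps)

lemma lie_isomorphic_nn4_iff:
  assumes "lie_algebra br"
  shows "lie_isomorphic br \<nn>\<^sub>4 \<longleftrightarrow> (\<exists>b c. frame b c \<and> brackets br b =
    [- b 2, - b 5, 0, - b 6, 0, 0, 0, - b 5, 0, 0, 0, 0, 0, 0, 0, 0, 0, 0, 0, 0, 0])"
  unfolding lie_isomorphic_iff_frame[OF assms bilinear_nn4 alternating_nn4] combs_2_all
  by (simp add: bracket_defs sum_7 vector_def axis_def brackets_def del: One_nat_def)

lemma bilinear_nn5: "bilinear \<nn>\<^sub>5" and alternating_nn5: "\<nn>\<^sub>5 y x = - \<nn>\<^sub>5 x y"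
  by (simp_all add: bilinear_def linear_iff vec_eq_iff forall_7 bracket_defs vector_def algebra_simps)

lemma lie_isomorphic_nn5_iff:
  assumes "lie_algebra br"
  shows "lie_isomorphic br \<nn>\<^sub>5 \<longleftrightarrow> (\<exists>b c. frame b c \<and> brackets br b =
    [- b 2, - b 5, - b 6, 0, 0, 0, 0, 0, - b 6, 0, 0, 0, 0, 0, 0, 0, 0, 0, 0, 0, 0])"
  unfolding lie_isomorphic_iff_frame[OF assms bilinear_nn5 alternating_nn5] combs_2_all
  by (simp add: bracket_defs sum_7 vector_def axis_def brackets_def del: One_nat_def)

lemma bilinear_nn6: "bilinear \<nn>\<^sub>6" and alternating_nn6: "\<nn>\<^sub>6 y x = - \<nn>\<^sub>6 x y"
  by (simp_all add: bilinear_def linear_iff vec_eq_iff forall_7 bracket_defs vector_def algebra_simps)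

lemma lie_isomorphic_nn6_iff:
  assumes "lie_algebra br"
  shows "lie_isomorphic br \<nn>\<^sub>6 \<longleftrightarrow> (\<exists>b c. frame b c \<and> brackets br b =
    [- b 3, - b 4, - b 5, - b 6, 0, 0, 0, 0, 0, 0, 0, 0, 0, 0, 0, 0, 0, 0, 0, 0, 0])"
  unfolding lie_isomorphic_iff_frame[OF assms bilinear_nn6 alternating_nn6] combs_2_all
  by (simp add: bracket_defs sum_7 vector_def axis_def brackets_def del: One_nat_def)

lemma bilinear_nn7: "bilinear \<nn>\<^sub>7" and alternating_nn7: "\<nn>\<^sub>7 y x = - \<nn>\<^sub>7 x y"
  by (simp_all add: bilinear_def linear_iff vec_eq_iff forall_7 bracket_defs vector_def algebra_simps)

lemma lie_isomorphic_nn7_iff: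
  assumes "lie_algebra br"
  shows "lie_isomorphic br \<nn>\<^sub>7 \<longleftrightarrow> (\<exists>b c. frame b c \<and> brackets br b =
    [- b 3, - b 4, - b 5, - b 6, 0, 0, - b 5, 0, 0, 0, 0, 0, 0, 0, 0, 0, 0, 0, 0, 0, 0])"
  unfolding lie_isomorphic_iff_frame[OF assms bilinear_nn7 alternating_nn7] combs_2_all
  by (simp add: bracket_defs sum_7 vector_def axis_def brackets_def del: One_nat_def)

lemma bilinear_ss5: "bilinear \<ss>\<^sub>5" and alternating_ss5: "\<ss>\<^sub>5 y x = - \<ss>\<^sub>5 x y"
  by (simp_all add: bilinear_def linear_iff vec_eq_iff forall_7 bracket_defs vector_def algebra_simps)

lemma lie_isomorphic_ss5_iff:
  assumes "lie_algebra br"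
  shows "lie_isomorphic br \<ss>\<^sub>5 \<longleftrightarrow> (\<exists>b c. frame b c \<and> brackets br b =
    [0, 0, 0, - b 0, 0, 0, 0, 0, b 1, 0, 0, 0, b 2, 0, 0, - b 3, 0, 0, 0, 0, 0])"
  unfolding lie_isomorphic_iff_frame[OF assms bilinear_ss5 alternating_ss5] combs_2_all
  by (simp add: bracket_defs sum_7 vector_def axis_def brackets_def del: One_nat_def)

lemma bilinear_ss6: "bilinear (\<ss>\<^sub>6 \<alpha>)" and alternating_ss6: "(\<ss>\<^sub>6 \<alpha>) y x = - (\<ss>\<^sub>6 \<alpha>) x y"
  by (simp_all add: bilinear_def linear_iff vec_eq_iff forall_7 bracket_defs vector_def algebra_simps)

lemma lie_isomorphic_ss6_iff:
  assumes "lie_algebra br"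
  shows "lie_isomorphic br (\<ss>\<^sub>6 \<alpha>) \<longleftrightarrow> (\<exists>b c. frame b c \<and> brackets br b =
    [0, 0, 0, - \<alpha> *\<^sub>R b 0 + b 1, 0, 0, 0, 0, - b 0 - \<alpha> *\<^sub>R b 1, 0, 0, 0, \<alpha> *\<^sub>R b 2 + b 3, 0, 0, - b 2 + \<alpha> *\<^sub>R b 3, 0,
        0, 0, 0, 0])"
  unfolding lie_isomorphic_iff_frame[OF assms bilinear_ss6 alternating_ss6] combs_2_all
  by (simp add: bracket_defs sum_7 vector_def axis_def brackets_def del: One_nat_def)

lemma bilinear_ss7: "bilinear \<ss>\<^sub>7" and alternating_ss7: "\<ss>\<^sub>7 y x = - \<ss>\<^sub>7 x y"
  by (simp_all add: bilinear_def linear_iff vec_eq_iff forall_7 bracket_defs vector_def algebra_simps)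

lemma lie_isomorphic_ss7_iff:
  assumes "lie_algebra br"
  shows "lie_isomorphic br \<ss>\<^sub>7 \<longleftrightarrow> (\<exists>b c. frame b c \<and> brackets br b =
    [0, 0, 0, b 1, 0, 0, 0, 0, - b 0, 0, 0, 0, b 3, 0, 0, - b 2, 0, 0, 0, 0, 0])"
  unfolding lie_isomorphic_iff_frame[OF assms bilinear_ss7 alternating_ss7] combs_2_all
  by (simp add: bracket_defs sum_7 vector_def axis_def brackets_def del: One_nat_def)

lemma all_less_7: "(\<forall>i<7. P i) \<longleftrightarrow> P 0 \<and> P 1 \<and> P 2 \<and> P 3 \<and> P 4 \<and> P 5 \<and> P (6 :: nat)"
proof safe
  fix i :: nat assume "P 0" "P 1" "P 2" "P 3" "P 4" "P 5" "P 6" "i < 7"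
  moreover from this have "i = 0 \<or> i = 1 \<or> i = 2 \<or> i = 3 \<or> i = 4 \<or> i = 5 \<or> i = 6" by linarith
  ultimately show "P i" by blast
qed simp_all

lemma less_7: "0 < (7 :: nat)" "1 < (7 :: nat)" "2 < (7 :: nat)" "3 < (7 :: nat)" "4 < (7 :: nat)" "5 < (7 :: nat)"
    "6 < (7 :: nat)"
  by simp_all

lemma frame_monomial:
  assumes "frame a c" and \<pi>: "bij_betw \<pi> {..<7} {..<7}" and t: "\<And>i. i < 7 \<Longrightarrow> t i \<noteq> 0"
  shows "frame (\<lambda>i. t i *\<^sub>R a (\<pi> i)) (\<lambda>i x. c (\<pi> i) x / t i)"
proof (rule frame.intro)
  interpret frame a c by (fact assms)
  have \<pi>7: "\<pi> i < 7" if "i < 7" for i using bij_betwE[OF \<pi>] that by simp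
  show "linear (\<lambda>x. c (\<pi> i) x / t i)" if "i < 7" for i
    using linear_compose_scale_right[OF linear_coord[OF \<pi>7[OF that]], of "1 / t i"] by simp
  show "c (\<pi> i) (t j *\<^sub>R a (\<pi> j)) / t i = (if i = j then 1 else 0)" if "i < 7" "j < 7" for i j
    using that \<pi>7 t inj_onD[OF bij_betw_imp_inj_on[OF \<pi>], of i j] by (auto simp: coord_simps)
  show "(\<Sum>i<7. (c (\<pi> i) x / t i) *\<^sub>R t i *\<^sub>R a (\<pi> i)) = x" for x
  proof -
    have "(\<Sum>i<7. (c (\<pi> i) x / t i) *\<^sub>R t i *\<^sub>R a (\<pi> i)) = (\<Sum>i<7. c (\<pi> i) x *\<^sub>R a (\<pi> i))"
      by (intro sum.cong) (auto simp: t)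
    also have "\<dots> = (\<Sum>i<7. c i x *\<^sub>R a i)" by (rule sum.reindex_bij_betw[OF \<pi>])
    finally show ?thesis by (simp add: expansion)
  qed
qed

context
  fixes br :: "'a::real_vector \<Rightarrow> 'a \<Rightarrow> 'a"
  assumes lie: "lie_algebra br"
begin

lemmas lie_bilinear = lie_algebra.bilinear_br[OF lie]

lemma lie_swap: "br y x = - br x y"
proof -
  have "br x y + br y x = 0"
    using lie_algebra.br_self[OF lie, of "x + y"] unfolding bilinear_ladd[OF lie_bilinear] bilinear_radd[OF
        lie_bilinear]
    by (simp add: lie_algebra.br_self[OF lie] add.commute)
  then show ?thesis by (simp add: eq_neg_iff_add_eq_0 add.commute)
qed

lemmas lie_simps = lie_algebra.br_self[OF lie] bilinear_ladd[OF lie_bilinear] bilinear_radd[OF lie_bilinear]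
  bilinear_lmul[OF lie_bilinear] bilinear_rmul[OF lie_bilinear] bilinear_lneg[OF lie_bilinear] bilinear_rneg[OF
      lie_bilinear]
  bilinear_lsub[OF lie_bilinear] bilinear_rsub[OF lie_bilinear] bilinear_lzero[OF lie_bilinear] bilinear_rzero[OF
      lie_bilinear]

lemma central_frameI:
  assumes "frame b c" "br v (b 0) = 0" "br v (b 1) = 0" "br v (b 2) = 0" "br v (b 3) = 0"
    "br v (b 4) = 0" "br v (b 5) = 0" "br v (b 6) = 0"
  shows "br v x = 0"
proof -
  have "linear (br v)" using lie_bilinear by (simp add: bilinear_def)
  then have "br v (\<Sum>i<7. c i x *\<^sub>R b i) = (\<Sum>i<7. c i x *\<^sub>R br v (b i))"
    by (simp add: linear_sum linear_cmul)
  then show ?thesis using assms by (simp add: frame.expansion[OF assms(1)] sum_7 del: One_nat_def)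
qed

lemma lie_swap_eq: "br x y = z \<Longrightarrow> br y x = - z"
  using lie_swap[of y x] by simp

lemma nth_7:
  "[x0, x1, x2, x3, x4, x5, x6] ! 0 = x0" "[x0, x1, x2, x3, x4, x5, x6] ! 1 = x1"
      "[x0, x1, x2, x3, x4, x5, x6] ! 2 = x2"
  "[x0, x1, x2, x3, x4, x5, x6] ! 3 = x3" "[x0, x1, x2, x3, x4, x5, x6] ! 4 = x4"
      "[x0, x1, x2, x3, x4, x5, x6] ! 5 = x5"
  "[x0, x1, x2, x3, x4, x5, x6] ! 6 = x6"
  by simp_all

lemma core_frame_monomial:
  fixes ts :: "real list" and ps :: "nat list"
  assumes a: "frame a c" and ps: "distinct ps" "length ps = 7" "\<forall>i\<in>set ps. i < 7" and ts: "length ts = 7" "0 \<notin> set ts"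
    and b: "b = (\<lambda>i. ts ! i *\<^sub>R a (ps ! i))"
    and cen: "\<forall>i<7. br (b 0) (a i) = 0 \<and> br (b 1) (a i) = 0"
    and "br (b 2) (b 3) = p *\<^sub>R b 0 + q *\<^sub>R b 1 + m *\<^sub>R b 3 + g *\<^sub>R b 4 + h *\<^sub>R b 5 + s *\<^sub>R b 6"
    and "br (b 2) (b 4) = u *\<^sub>R b 0 + v *\<^sub>R b 1 + A1 *\<^sub>R b 3 + (-m) *\<^sub>R b 4 + (-s) *\<^sub>R b 5 + A2 *\<^sub>R b 6"
    and "br (b 2) (b 5) = v *\<^sub>R b 0 + (-u) *\<^sub>R b 1 + A3 *\<^sub>R b 3 + s *\<^sub>R b 4 + (-m) *\<^sub>R b 5 + A4 *\<^sub>R b 6"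
    and "br (b 2) (b 6) = q *\<^sub>R b 0 + (-p) *\<^sub>R b 1 + (-s) *\<^sub>R b 3 + (-h) *\<^sub>R b 4 + g *\<^sub>R b 5 + m *\<^sub>R b 6"
    and "br (b 4) (b 5) = (A1 - A4) *\<^sub>R b 0 + (A2 + A3) *\<^sub>R b 1"
    and "br (b 3) (b 4) = 0" "br (b 3) (b 5) = 0" "br (b 3) (b 6) = 0" "br (b 4) (b 6) = 0" "br (b 5) (b 6) = 0"
  shows "\<exists>b d. core_frame b d (g2_form d) br m s g h A1 A2 A3 A4 p q u v"
proof -
  have "set ps = {..<7}"
    using ps distinct_card[of ps] by (intro card_subset_eq) auto
  then have "bij_betw ((!) ps) {..<7} {..<7}" by (intro bij_betw_nth ps) (simp_all add: ps)
  moreover have "ts ! i \<noteq> 0" if "i < 7" for i using ts that nth_mem[of i ts] by metis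
  ultimately have fr: "frame b (\<lambda>i x. c (ps ! i) x / ts ! i)"
    unfolding b by (rule frame_monomial[OF a])
  have z: "br (b 0) (a i) = 0" "br (b 1) (a i) = 0" if "i < 7" for i using cen[rule_format, OF that] by simp_all
  have "br (b 0) x = 0" "br (b 1) x = 0" for x
    by (rule central_frameI[OF a]; rule z; simp)+
  from core_frame_g2_form[OF fr lie this assms(9-)] show ?thesis by blast
qed

lemma soliton_if_nn1:
  assumes "lie_isomorphic br \<nn>\<^sub>1"
  shows "\<exists>\<phi>. semi_algebraic_soliton br \<phi>"
  using assms unfolding lie_isomorphic_nn1_iff[OF lie] brackets_def list.inject
proof (elim exE conjE, goal_cases)
  case (1 a c)
  note s = 1(2-22) 1(2-22)[THEN lie_swap_eq] lie_simps all_less_7 nth_7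
  have "\<exists>b d. core_frame b d (g2_form d) br 0 0 0 0 0 0 0 0 0 0 0 0"
    by (rule core_frame_monomial[where ps = "[0, 1, 2, 3, 4, 5, 6]"
        and ts = "[1, 1, 1, 1, 1, 1, 1]", OF 1(1) _ _ _ _ _ refl])
      (simp_all add: s del: One_nat_def)
  then show ?case using soliton_n1 by blast
qed

lemma soliton_if_nn2:
  assumes "lie_isomorphic br \<nn>\<^sub>2"
  shows "\<exists>\<phi>. semi_algebraic_soliton br \<phi>"
  using assms unfolding lie_isomorphic_nn2_iff[OF lie] brackets_def list.inject
proof (elim exE conjE, goal_cases)
  case (1 a c)
  note s = 1(2-22) 1(2-22)[THEN lie_swap_eq] lie_simps all_less_7 nth_7
  have "\<exists>b d. core_frame b d (g2_form d) br 0 0 1 0 0 0 0 0 0 0 0 0"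
    by (rule core_frame_monomial[where ps = "[3, 6, 0, 1, 4, 5, 2]"
        and ts = "[1, 1, 1, 1, -1, -1, 1]", OF 1(1) _ _ _ _ _ refl])
      (simp_all add: s del: One_nat_def)
  then show ?case using soliton_n2 by blast
qed

lemma soliton_if_nn3:
  assumes "lie_isomorphic br \<nn>\<^sub>3"
  shows "\<exists>\<phi>. semi_algebraic_soliton br \<phi>"
  using assms unfolding lie_isomorphic_nn3_iff[OF lie] brackets_def list.inject
proof (elim exE conjE, goal_cases)
  case (1 a c)
  note s = 1(2-22) 1(2-22)[THEN lie_swap_eq] lie_simps all_less_7 nth_7
  have "\<exists>b d. core_frame b d (g2_form d) br 0 0 0 0 (-2) 0 0 1 0 0 0 0"
    by (rule core_frame_monomial[where ps = "[5, 6, 0, 3, 1, 2, 4]"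
        and ts = "[1 / 3, 1, 1, 1 / 2, 1, 1, -1]", OF 1(1) _ _ _ _ _ refl])
      (simp_all add: s del: One_nat_def)
  then show ?case using soliton_n3 by blast
qed

lemma soliton_if_nn4:
  assumes "lie_isomorphic br \<nn>\<^sub>4"
  shows "\<exists>\<phi>. semi_algebraic_soliton br \<phi>"
  using assms unfolding lie_isomorphic_nn4_iff[OF lie] brackets_def list.inject
proof (elim exE conjE, goal_cases)
  case (1 a c)
  note s = 1(2-22) 1(2-22)[THEN lie_swap_eq] lie_simps all_less_7 nth_7
  have "\<exists>b d. core_frame b d (g2_form d) br 0 0 0 0 (sqrt 2) 0 0 0 1 0 0 0"
    by (rule core_frame_monomial[where ps = "[5, 6, 0, 2, 1, 3, 4]"
        and ts = "[1 / sqrt 2, 1, 1, - 1 / sqrt 2, 1, -1, 1]", OF 1(1) _ _ _ _ _ refl])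
      (simp_all add: s del: One_nat_def)
  then show ?case using soliton_n4 by blast
qed

lemma soliton_if_nn5:
  assumes "lie_isomorphic br \<nn>\<^sub>5"
  shows "\<exists>\<phi>. semi_algebraic_soliton br \<phi>"
  using assms unfolding lie_isomorphic_nn5_iff[OF lie] brackets_def list.inject
proof (elim exE conjE, goal_cases)
  case (1 a c)
  note s = 1(2-22) 1(2-22)[THEN lie_swap_eq] lie_simps all_less_7 nth_7
  have "\<exists>b d. core_frame b d (g2_form d) br 0 0 0 0 (sqrt 2) 0 0 0 0 1 0 0"
    by (rule core_frame_monomial[where ps = "[6, 5, 0, 2, 1, 4, 3]"
        and ts = "[-1, 1 / sqrt 2, 1, - 1 / sqrt 2, 1, sqrt 2, 1]", OF 1(1) _ _ _ _ _ refl])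
      (simp_all add: s del: One_nat_def)
  then show ?case using soliton_n5 by blast
qed

lemma soliton_if_nn6:
  assumes "lie_isomorphic br \<nn>\<^sub>6"
  shows "\<exists>\<phi>. semi_algebraic_soliton br \<phi>"
  using assms unfolding lie_isomorphic_nn6_iff[OF lie] brackets_def list.inject
proof (elim exE conjE, goal_cases)
  case (1 a c)
  note s = 1(2-22) 1(2-22)[THEN lie_swap_eq] lie_simps all_less_7 nth_7
  have "\<exists>b d. core_frame b d (g2_form d) br 0 0 (sqrt 2) 0 0 0 0 0 0 0 1 0"
    by (rule core_frame_monomial[where ps = "[5, 6, 0, 1, 3, 4, 2]"
        and ts = "[1 / sqrt 2, - 1 / sqrt 2, 1, 1, - 1 / sqrt 2, - 1 / sqrt 2, 1]", OF 1(1) _ _ _ _ _ refl])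
      (simp_all add: s del: One_nat_def)
  then show ?case using soliton_n6 by blast
qed

lemma soliton_if_nn7:
  assumes "lie_isomorphic br \<nn>\<^sub>7"
  shows "\<exists>\<phi>. semi_algebraic_soliton br \<phi>"
  using assms unfolding lie_isomorphic_nn7_iff[OF lie] brackets_def list.inject
proof (elim exE conjE, goal_cases)
  case (1 a c)
  note s = 1(2-22) 1(2-22)[THEN lie_swap_eq] lie_simps all_less_7 nth_7
  have "\<exists>b d. core_frame b d (g2_form d) br 0 0 0 0 1 0 0 (-1) (sqrt (3 / 2)) 0 0 0"
    by (rule core_frame_monomial[where ps = "[5, 6, 0, 3, 1, 2, 4]"
        and ts = "[1 / sqrt (3 / 2), - 4 / 3, 1, -1, 1, - 2 / sqrt (3 / 2), - 2 / sqrt (3 / 2)]", OF 1(1) _ _ _ _ _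
        refl])
      (simp_all add: s del: One_nat_def, simp add: field_simps)
  then show ?case using soliton_n7 by blast
qed

lemma soliton_if_ss5:
  assumes "lie_isomorphic br \<ss>\<^sub>5"
  shows "\<exists>\<phi>. semi_algebraic_soliton br \<phi>"
  using assms unfolding lie_isomorphic_ss5_iff[OF lie] brackets_def list.inject
proof (elim exE conjE, goal_cases)
  case (1 a c)
  note s = 1(2-22) 1(2-22)[THEN lie_swap_eq] lie_simps all_less_7 nth_7
  have "\<exists>b d. core_frame b d (g2_form d) br 1 0 0 0 0 0 0 0 0 0 0 0"
    by (rule core_frame_monomial[where ps = "[5, 6, 4, 0, 1, 2, 3]"
        and ts = "[1, 1, 1, 1, 1, 1, 1]", OF 1(1) _ _ _ _ _ refl])
      (simp_all add: s del: One_nat_def)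
  then show ?case using soliton_s5 by blast
qed

lemma soliton_if_ss6:
  assumes "lie_isomorphic br (\<ss>\<^sub>6 \<alpha>)"
  shows "\<exists>\<phi>. semi_algebraic_soliton br \<phi>"
  using assms unfolding lie_isomorphic_ss6_iff[OF lie] brackets_def list.inject
proof (elim exE conjE, goal_cases)
  case (1 a c)
  note s = 1(2-22) 1(2-22)[THEN lie_swap_eq] lie_simps all_less_7 nth_7
  have "\<exists>b d. core_frame b d (g2_form d) br \<alpha> 1 0 0 0 0 0 0 0 0 0 0"
    by (rule core_frame_monomial[where ps = "[5, 6, 4, 0, 2, 3, 1]"
        and ts = "[1, 1, 1, 1, 1, 1, -1]", OF 1(1) _ _ _ _ _ refl])
      (simp_all add: s del: One_nat_def)
  then show ?case using soliton_s6 by blast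
qed

lemma soliton_if_ss7:
  assumes "lie_isomorphic br \<ss>\<^sub>7"
  shows "\<exists>\<phi>. semi_algebraic_soliton br \<phi>"
  using assms unfolding lie_isomorphic_ss7_iff[OF lie] brackets_def list.inject
proof (elim exE conjE, goal_cases)
  case (1 a c)
  note s = 1(2-22) 1(2-22)[THEN lie_swap_eq] lie_simps all_less_7 nth_7
  have "\<exists>b d. core_frame b d (g2_form d) br 0 1 0 0 0 0 0 0 0 0 0 0"
    by (rule core_frame_monomial[where ps = "[5, 6, 4, 0, 2, 3, 1]"
        and ts = "[1, 1, 1, 1, 1, 1, -1]", OF 1(1) _ _ _ _ _ refl])
      (simp_all add: s del: One_nat_def)
  then show ?case using soliton_s6 by blast
qed

end

section \<open>A basis adapted to a definite 3-form\<close>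

lemma frame_of_basis:
  fixes v :: "nat \<Rightarrow> 'a::real_vector"
  assumes B: "independent B" "span B = UNIV" and v: "bij_betw v {..<7::nat} B"
  shows "frame v (\<lambda>i x. representation B x (v i))"
proof (rule frame.intro)
  have fin: "finite B" using bij_betw_finite[OF v] by simp
  show "linear (\<lambda>x. representation B x (v i))" for i
    using B by (intro linearI) (simp_all add: representation_add representation_scale)
  show "representation B (v j) (v i) = (if i = j then 1 else 0)" if "i < 7" "j < 7" for i j
    using that B(1) v by (auto simp: representation_basis bij_betw_def inj_on_def)
  show "(\<Sum>i<7. representation B x (v i) *\<^sub>R v i) = x" for x
    using sum.reindex_bij_betw[OF v, of "\<lambda>y. representation B x y *\<^sub>R y"] B fin
    by (simp add: sum_representation_eq)
qed

lemma frame_completion: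
  fixes v :: "nat \<Rightarrow> 'a::real_vector"
  assumes dim: "dim (UNIV :: 'a set) = 7" and I: "I \<subseteq> {..<7}"
    and indep: "\<And>a i. (\<Sum>i\<in>I. a i *\<^sub>R v i) = 0 \<Longrightarrow> i \<in> I \<Longrightarrow> a i = 0"
    and sp: "span (v ` I \<union> S) = UNIV"
  obtains w c where "frame w c" "\<And>i. i \<in> I \<Longrightarrow> w i = v i" "\<And>i. i < 7 \<Longrightarrow> i \<notin> I \<Longrightarrow> w i \<in> S"
proof -
  have fI: "finite I" using I finite_subset by blast
  have inj: "inj_on v I"
  proof (rule inj_onI, rule ccontr)
    fix i j assume ij: "i \<in> I" "j \<in> I" "v i = v j" "i \<noteq> j"
    have "(\<Sum>k\<in>I. (if k = i then 1 else if k = j then -1 else 0) *\<^sub>R v k)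
      = (\<Sum>k\<in>{i, j}. (if k = i then 1 else if k = j then -1 else 0) *\<^sub>R v k)"
      using ij fI by (intro sum.mono_neutral_right) auto
    also have "\<dots> = 0" using ij by simp
    finally show False using indep[of "\<lambda>k. if k = i then 1 else if k = j then -1 else 0" i] ij by simp
  qed
  have ind: "independent (v ` I)"
    unfolding independent_explicit_finite_subsets
  proof (intro allI impI ballI)
    fix A u x assume A: "A \<subseteq> v ` I" "finite A" "(\<Sum>x\<in>A. u x *\<^sub>R x) = 0" "x \<in> A"
    then obtain i where i: "i \<in> I" "x = v i" by auto
    have "(\<Sum>i\<in>I. (if v i \<in> A then u (v i) else 0) *\<^sub>R v i) = (\<Sum>x\<in>v ` I. (if x \<in> A then u x else 0) *\<^sub>R x)"
      by (simp add: sum.reindex[OF inj])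
    also have "\<dots> = (\<Sum>x\<in>A. u x *\<^sub>R x)"
      using A fI by (intro sum.mono_neutral_cong_right) auto
    finally show "u x = 0"
      using indep[of "\<lambda>i. if v i \<in> A then u (v i) else 0" i] A i by simp
  qed
  obtain B where B: "v ` I \<subseteq> B" "B \<subseteq> v ` I \<union> S" "independent B" "v ` I \<union> S \<subseteq> span B"
    using maximal_independent_subset_extend[OF _ ind, of "v ` I \<union> S"] by blast
  then have spB: "span B = UNIV" using sp span_mono[OF B(4)] by (auto simp: span_span)
  then have cB: "card B = 7" using dim_eq_card[of B UNIV] B(3) dim by simp
  then have fB: "finite B" using card.infinite by force
  have "card (B - v ` I) = card ({..<7} - I)"
    using B(1) I fI fB cB card_image[OF inj] by (simp add: card_Diff_subset finite_subset)
  then obtain u where u: "bij_betw u ({..<7} - I) (B - v ` I)"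
    using finite_same_card_bij[of "{..<7} - I" "B - v ` I"] fB by auto
  define w where "w i = (if i \<in> I then v i else u i)" for i
  have "bij_betw w (I \<union> ({..<7} - I)) (v ` I \<union> (B - v ` I))"
    by (rule bij_betw_combine) (use inj u in \<open>auto simp: w_def bij_betw_def inj_on_def\<close>)
  moreover have "I \<union> ({..<7} - I) = {..<7}" "v ` I \<union> (B - v ` I) = B" using I B(1) by auto
  ultimately have "bij_betw w {..<7} B" by simp
  from frame_of_basis[OF B(3) spB this] have "frame w (\<lambda>i x. representation B x (w i))" .
  moreover have "w i \<in> S" if "i < 7" "i \<notin> I" for i
    using bij_betwE[OF u] that B(2) by (auto simp: w_def)
  ultimately show ?thesis using that[of w] by (simp add: w_def)
qed

lemma frame_of_independent:
  fixes v :: "nat \<Rightarrow> 'a::real_vector"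
  assumes dim: "dim (UNIV :: 'a set) = 7"
    and indep: "\<And>a i. (\<Sum>i<7. a i *\<^sub>R v i) = 0 \<Longrightarrow> i < 7 \<Longrightarrow> a i = 0"
  obtains c where "frame v c"
proof -
  obtain w c where w: "frame w c" "\<And>i. i \<in> {..<7} \<Longrightarrow> w i = v i"
  proof (rule frame_completion[OF dim order_refl, of v UNIV])
    show "span (v ` {..<7} \<union> UNIV) = UNIV" by simp
  qed (use indep in auto)
  from w(1) have "frame v c" unfolding frame_def using w(2) by auto
  then show ?thesis by (rule that)
qed

lemma frame_exists:
  assumes dim: "dim (UNIV :: 'a::real_vector set) = 7"
  obtains v :: "nat \<Rightarrow> 'a::real_vector" and c where "frame v c"
  by (rule frame_completion[OF dim, of "{}" "\<lambda>_. 0" UNIV]) auto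

lemma common_kernel:
  fixes f :: "nat \<Rightarrow> 'a::real_vector \<Rightarrow> real"
  assumes dim: "dim (UNIV :: 'a set) = 7" and lin: "\<And>i. i < 6 \<Longrightarrow> linear (f i)"
  obtains x where "x \<noteq> 0" "\<And>i. i < 6 \<Longrightarrow> f i x = 0"
proof -
  obtain v :: "nat \<Rightarrow> 'a" and c where "frame v c" by (rule frame_exists[OF dim])
  then interpret frame v c .
  define X where "X a = (\<Sum>j<7. (a $ of_nat (Suc j)) *\<^sub>R v j)" for a :: "real^7"
  define G where "G a = (\<Sum>i<6. f i (X a) *\<^sub>R ax i)" for a
  have linX: "linear X" unfolding X_def
    by (intro linear_compose_sum ballI) (auto simp: linear_iff algebra_simps)
  have "linear (\<lambda>a. f i (X a))" if "i < 6" for i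
    using linear_compose[OF linX lin[OF that]] by (simp add: comp_def)
  then have linG: "linear G" unfolding G_def
    by (intro linear_compose_sum ballI) (auto simp: linear_iff algebra_simps)
  have ne: "(of_nat (Suc i) :: 7) \<noteq> of_nat (Suc 6)" if "i < 6" for i
    using inj_onD[OF of_nat_Suc_7(1), of i 6] that by auto
  have comp: "G a $ of_nat (Suc j) = (if j < 6 then f j (X a) else 0)" if "j < 7" for a j
  proof -
    have "G a $ of_nat (Suc j) = (\<Sum>i<6. f i (X a) * (if (of_nat (Suc j) :: 7) = of_nat (Suc i) then 1 else 0))"
      unfolding G_def by (simp add: axis_def del: of_nat_Suc)
    also have "\<dots> = (\<Sum>i<6. if i = j then f i (X a) else 0)"
      using that inj_onD[OF of_nat_Suc_7(1), of j] by (intro sum.cong) (auto simp del: of_nat_Suc)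
    finally show ?thesis by simp
  qed
  have "ax 6 \<notin> range G"
  proof
    assume "ax 6 \<in> range G"
    then obtain a where a: "G a = ax 6" by auto
    have "G a $ of_nat (Suc 6) = 0" using comp[of 6 a] by (simp del: of_nat_Suc)
    then show False unfolding a by (simp add: axis_def del: of_nat_Suc)
  qed
  then have "\<not> inj G" using linear_injective_imp_surjective[OF linG] by auto
  then obtain a where a: "a \<noteq> 0" "G a = 0"
    using linear_injective_0[OF linG] by blast
  have cX: "c j (X a) = a $ of_nat (Suc j)" if "j < 7" for j
  proof -
    have "c j (X a) = (\<Sum>i<7. a $ of_nat (Suc i) * c j (v i))"
      unfolding X_def using that by (simp add: linear_sum[OF linear_coord] linear_cmul[OF linear_coord] del: of_nat_Suc)
    also have "\<dots> = (\<Sum>i<7. if i = j then a $ of_nat (Suc i) else 0)"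
      using that by (intro sum.cong) (auto simp: coord_basis)
    finally have "c j (X a) = (\<Sum>i<7. if i = j then a $ of_nat (Suc i) else 0)" .
    then show ?thesis using that by simp
  qed
  have "X a \<noteq> 0"
  proof
    assume "X a = 0"
    then have "a $ of_nat (Suc j) = 0" if "j < 7" for j
      using cX[OF that] linear_0[OF linear_coord[OF that]] by simp
    then have "a = 0" using vec7_expansion[of a] by (simp del: of_nat_Suc)
    then show False using a by simp
  qed
  moreover have "f i (X a) = 0" if "i < 6" for i
    using comp[of i a] a(2) that by (simp del: of_nat_Suc)
  ultimately show ?thesis by (rule that)
qed

lemma definite_kernel:
  assumes dim: "dim (UNIV :: 'a::real_vector set) = 7" and def: "definite (\<phi> :: 'a form)"
    and w: "w \<noteq> 0" and v: "\<And>y. \<phi> ((!) [w, v, y]) = 0"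
  shows "\<exists>k. v = k *\<^sub>R w"
proof -
  have form: "is_form 3 \<phi>" using def by (simp add: definite_def)
  let ?K = "{v. \<forall>x. interior v (interior w \<phi>) x = 0}"
  have K: "u \<in> ?K" if "\<And>y. \<phi> ((!) [w, u, y]) = 0" for u
  proof -
    have "\<phi> (case_nat w (case_nat u x)) = \<phi> ((!) [w, u, x 0])" for x
      by (rule is_formD_local[OF form]) (auto simp: nth_Cons less_Suc_eq eval_nat_numeral split: nat.splits)
    then show ?thesis using that by (simp add: interior_def)
  qed
  have "form_rank (interior w \<phi>) = 6" using def w by (simp add: definite_def)
  then have "dim ?K = 1" using dim by (simp add: form_rank_def)
  then obtain B where B: "?K \<subseteq> span B" "card B = 1" using basis_exists[of ?K] by metis
  then obtain u where "B = {u}" by (metis card_1_singletonE)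
  then have "w \<in> span {u}" "v \<in> span {u}"
    using B K[of w] K[of v] v by (auto simp: form3_self[OF form])
  then obtain r s where "w = r *\<^sub>R u" "v = s *\<^sub>R u" by (auto simp: span_singleton)
  then have "v = (s / r) *\<^sub>R w" using w by auto
  then show ?thesis by blast
qed

text \<open>The basis is changed in steps, each of which normalises further components of \<open>\<phi>\<close>. The values
  that cannot be normalised away are those for which some \<open>w \<noteq> 0\<close> would have a two-dimensional kernel
  of \<open>interior w \<phi>\<close>; this is where definiteness enters.\<close>

context
  fixes \<phi> :: "'a::real_vector form"
  assumes dim: "dim (UNIV :: 'a set) = 7" and def: "definite \<phi>"
begin

private abbreviation (input) F :: "'a \<Rightarrow> 'a \<Rightarrow> 'a \<Rightarrow> real" where
  "F x y z \<equiv> \<phi> ((!) [x, y, z])"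

private lemma form: "is_form 3 \<phi>"
  using def by (simp add: definite_def)

private lemmas F_linear = linear_add[OF form3_linear(1)[OF form]] linear_add[OF form3_linear(2)[OF form]]
  linear_add[OF form3_linear(3)[OF form]] linear_diff[OF form3_linear(1)[OF form]]
  linear_diff[OF form3_linear(2)[OF form]] linear_diff[OF form3_linear(3)[OF form]]
  linear_neg[OF form3_linear(1)[OF form]] linear_neg[OF form3_linear(2)[OF form]]
  linear_neg[OF form3_linear(3)[OF form]] linear_cmul[OF form3_linear(1)[OF form]]
  linear_cmul[OF form3_linear(2)[OF form]] linear_cmul[OF form3_linear(3)[OF form]]

private lemmas F_alt = form3_self[OF form]

private lemma F_rot: "F y z x = F x y z" "F z x y = F x y z" "F y x z = - F x y z" "F x z y = - F x y z"
  "F z y x = - F x y z"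
proof -
  have a: "F y x z = - F x y z" and b: "F x z y = - F x y z" for x y z
    by (rule form3_swap12[OF form], rule form3_swap23[OF form])
  show "F y z x = F x y z" using a[of x y z] b[of y x z] by simp
  show "F z x y = F x y z" using a[of x z y] b[of x y z] by simp
  show "F y x z = - F x y z" "F x z y = - F x y z" by (rule a, rule b)
  show "F z y x = - F x y z" using b[of z x y] a[of x z y] b[of x y z] by simp
qed

private lemma F_kernel:
  assumes fr: "frame v c" and w: "w \<noteq> 0" and z: "F w u (v 0) = 0" "F w u (v 1) = 0" "F w u (v 2) = 0"
    "F w u (v 3) = 0" "F w u (v 4) = 0" "F w u (v 5) = 0" "F w u (v 6) = 0"
  shows "\<exists>k. u = k *\<^sub>R w"
proof (rule definite_kernel[OF dim def w])
  fix y
  show "F w u y = 0"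
    by (subst frame.linear_expand[OF fr form3_linear(3)[OF form]]) (simp add: sum_7 z del: One_nat_def)
qed

private definition phase_A :: "(nat \<Rightarrow> 'a) \<Rightarrow> bool" where
  "phase_A v \<longleftrightarrow> F (v 0) (v 1) (v 2) = 1
    \<and> F (v 0) (v 1) (v 3) = 0 \<and> F (v 0) (v 1) (v 4) = 0 \<and> F (v 0) (v 1) (v 5) = 0 \<and> F (v 0) (v 1) (v 6) = 0
    \<and> F (v 0) (v 2) (v 3) = 0 \<and> F (v 0) (v 2) (v 4) = 0 \<and> F (v 0) (v 2) (v 5) = 0 \<and> F (v 0) (v 2) (v 6) = 0
    \<and> F (v 1) (v 2) (v 3) = 0 \<and> F (v 1) (v 2) (v 4) = 0 \<and> F (v 1) (v 2) (v 5) = 0 \<and> F (v 1) (v 2) (v 6) = 0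
    \<and> F (v 0) (v 3) (v 4) = 1 \<and> F (v 0) (v 3) (v 5) = 0 \<and> F (v 0) (v 3) (v 6) = 0
    \<and> F (v 1) (v 3) (v 4) = 0 \<and> F (v 1) (v 3) (v 5) = 1 \<and> F (v 1) (v 3) (v 6) = 0"

private lemma phase_A_exists:
  assumes ind: "\<And>r s. r *\<^sub>R z1 + s *\<^sub>R z2 = 0 \<Longrightarrow> r = 0 \<and> s = 0"
  obtains v c where "frame v c" "phase_A v" "v 0 = z1" "v 1 = z2"
proof -
  have z1: "z1 \<noteq> 0" using ind[of 1 0] by auto
  obtain e0 where e0: "F z1 z2 e0 \<noteq> 0"
  proof (rule ccontr)
    assume "\<not> thesis"
    then have "\<And>y. F z1 z2 y = 0" using that by blast
    from definite_kernel[OF dim def z1 this] obtain k where "z2 = k *\<^sub>R z1" ..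
    then show False using ind[of k "-1"] by simp
  qed
  define e where "e = (1 / F z1 z2 e0) *\<^sub>R e0"
  have e: "F z1 z2 e = 1" using e0 by (simp add: e_def F_linear)
  have e': "F z1 e z2 = -1" "F z2 e z1 = 1" using e F_rot[where x = z1 and y = z2 and z = e] by simp_all
  have lin: "linear (F x y)" for x y by (rule form3_linear(3)[OF form])
  obtain x3 where x3: "x3 \<noteq> 0" "F z1 z2 x3 = 0" "F z1 e x3 = 0" "F z2 e x3 = 0"
  proof -
    obtain x where "x \<noteq> 0" and x: "\<And>i::nat. i < 6 \<Longrightarrow> (if i = 0 then F z1 z2 else if i = 1 then F z1 e else F z2 e) x = 0"
      by (rule common_kernel[OF dim, of "\<lambda>i::nat. if i = 0 then F z1 z2 else if i = 1 then F z1 e else F z2 e"])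
         (use lin in auto)
    then show ?thesis using that[of x] x[of 0] x[of 1] x[of 2] by simp
  qed
  define pr where "pr y = y - F z1 z2 y *\<^sub>R e - F z2 e y *\<^sub>R z1 + F z1 e y *\<^sub>R z2" for y
  have pr: "F z1 z2 (pr y) = 0" "F z1 e (pr y) = 0" "F z2 e (pr y) = 0"
    "F z1 x3 (pr y) = F z1 x3 y" "F z2 x3 (pr y) = F z2 x3 y" for y
    using x3 F_rot[of z1 z2 x3] F_rot[of z1 e x3] F_rot[of z2 e x3]
    by (simp_all add: pr_def F_linear F_alt e e')
  have nondeg: "\<exists>x. r * F z1 x3 x + s * F z2 x3 x \<noteq> 0" if "r \<noteq> 0 \<or> s \<noteq> 0" for r s
  proof (rule ccontr)
    assume "\<not> ?thesis"
    then have "F (r *\<^sub>R z1 + s *\<^sub>R z2) x3 y = 0" for y by (simp add: F_linear)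
    moreover have "r *\<^sub>R z1 + s *\<^sub>R z2 \<noteq> 0" using ind that by blast
    ultimately obtain k where k: "x3 = k *\<^sub>R (r *\<^sub>R z1 + s *\<^sub>R z2)"
      using definite_kernel[OF dim def] by blast
    from x3(3,4) have "k * s = 0" "k * r = 0" unfolding k by (simp_all add: F_linear F_alt e')
    with k x3(1) that show False by auto
  qed
  obtain x1 where x1: "F z1 x3 x1 \<noteq> 0" using nondeg[of 1 0] by auto
  define q where "q = F z2 x3 x1 / F z1 x3 x1"
  obtain x2 where x2: "- q * F z1 x3 x2 + F z2 x3 x2 \<noteq> 0" using nondeg[of "- q" 1] by auto
  define h where "h = - q * F z1 x3 x2 + F z2 x3 x2"
  have h: "h \<noteq> 0" using x2 by (simp add: h_def)
  define y5 where "y5 = (1 / h) *\<^sub>R (x2 - (F z1 x3 x2 / F z1 x3 x1) *\<^sub>R x1)"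
  have "F z2 x3 x2 - F z1 x3 x2 / F z1 x3 x1 * F z2 x3 x1 = h"
    by (simp add: h_def q_def)
  then have y5: "F z1 x3 y5 = 0" "F z2 x3 y5 = 1"
    using x1 h by (simp_all add: y5_def F_linear)
  define y4 where "y4 = (1 / F z1 x3 x1) *\<^sub>R x1 - q *\<^sub>R y5"
  have y4: "F z1 x3 y4 = 1" "F z2 x3 y4 = 0"
    using x1 y5 by (simp_all add: y4_def F_linear q_def)
  obtain g where g: "linear g" "g x3 = (1 :: real)"
  proof -
    obtain w :: "nat \<Rightarrow> 'a" and c where "frame w c" by (rule frame_exists[OF dim])
    then interpret frame w c .
    obtain i where i: "i < 7" "c i x3 \<noteq> 0"
      using coord_eqI[of x3 0] x3(1) linear_0[OF linear_coord] by fastforce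
    have "linear (\<lambda>x. c i x / c i x3)"
      using linear_compose_scale_right[OF linear_coord[OF i(1)], of "1 / c i x3"] by simp
    then show ?thesis using that i by simp
  qed
  obtain x6 where x6: "x6 \<noteq> 0" "F z1 z2 x6 = 0" "F z1 e x6 = 0" "F z2 e x6 = 0" "F z1 x3 x6 = 0" "F z2 x3 x6 = 0"
      "g x6 = 0"
  proof -
    let ?f = "(!) [F z1 z2, F z1 e, F z2 e, F z1 x3, F z2 x3, g]"
    obtain x where "x \<noteq> 0" and x: "\<And>i. i < 6 \<Longrightarrow> ?f i x = 0"
      by (rule common_kernel[OF dim, of ?f]) (use lin g in \<open>auto simp: less_Suc_eq eval_nat_numeral\<close>)
    then show ?thesis using that[of x] x[of 0] x[of 1] x[of 2] x[of 3] x[of 4] x[of 5] by simp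
  qed
  define v where "v = (!) [z1, z2, e, x3, pr y4, pr y5, x6]"
  have v: "v 0 = z1" "v 1 = z2" "v 2 = e" "v 3 = x3" "v 4 = pr y4" "v 5 = pr y5" "v 6 = x6"
    by (simp_all add: v_def)
  obtain c where c: "frame v c"
  proof (rule frame_of_independent[OF dim])
    fix a i assume s: "(\<Sum>i<7. a i *\<^sub>R v i) = 0" and i: "i < (7::nat)"
    have s': "L 0 = a 0 * L (v 0) + a 1 * L (v 1) + a 2 * L (v 2) + a 3 * L (v 3) + a 4 * L (v 4) + a 5 * L (v 5)
        + a 6 * L (v 6)"
      if L: "linear L" for L :: "'a \<Rightarrow> real"
      unfolding s[symmetric] sum_7 by (simp add: linear_add[OF L] linear_cmul[OF L] del: One_nat_def)
    have a2: "a 2 = 0"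
      using s'[OF lin[of z1 z2]] by (simp add: v pr x3 x6 F_alt e linear_0[OF lin] del: One_nat_def)
    have a1: "a 1 = 0"
      using s'[OF lin[of z1 e]] by (simp add: v pr x3 x6 F_alt e' linear_0[OF lin] del: One_nat_def)
    have a0: "a 0 = 0"
      using s'[OF lin[of z2 e]] by (simp add: v pr x3 x6 F_alt e' linear_0[OF lin] del: One_nat_def)
    have a4: "a 4 = 0"
      using s'[OF lin[of z1 x3]] a0 a1 a2 by (simp add: v pr x3 x6 y4 y5 F_alt linear_0[OF lin] del: One_nat_def)
    have a5: "a 5 = 0"
      using s'[OF lin[of z2 x3]] a0 a1 a2 by (simp add: v pr x3 x6 y4 y5 F_alt linear_0[OF lin] del: One_nat_def)
    have a3: "a 3 = 0"
      using s'[OF g(1)] a0 a1 a2 a4 a5 by (simp add: v x6 g(2) linear_0[OF g(1)] del: One_nat_def)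
    have "a 6 *\<^sub>R x6 = 0"
      using s a0 a1 a2 a3 a4 a5 by (simp add: sum_7 v del: One_nat_def)
    then have a6: "a 6 = 0" using x6 by simp
    consider "i = 0" | "i = 1" | "i = 2" | "i = 3" | "i = 4" | "i = 5" | "i = 6" using i by linarith
    then show "a i = 0" using a0 a1 a2 a3 a4 a5 a6 by cases simp_all
  qed
  have "phase_A v"
    unfolding phase_A_def v using x3 x6 y4 y5 e by (simp add: pr)
  with c show ?thesis using that v by blast
qed

private lemma F_table:
  assumes "\<And>i j k. T i j k = F (v i) (v j) (v k)" "i < 7" "j < 7" "k < 7"
  shows "F (v i) (v j) (v k) = alt3 T i j k"
  by (rule form3_alt3[OF form, of 7]) (simp_all add: assms)

private lemma phase_B:
  assumes fr: "frame v c" and A: "phase_A v"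
  obtains w k t where "phase_A w" "w 0 = v 0" "w 1 = t *\<^sub>R (v 1 + k *\<^sub>R v 0)"
    "F (w 0) (w 4) (w 6) = F (w 1) (w 5) (w 6)" "F (w 1) (w 4) (w 6) = - F (w 0) (w 5) (w 6)"
    "F (w 0) (w 5) (w 6) \<noteq> 0"
proof -
  interpret frame v c by (fact fr)
  define T where "T i j k = F (v i) (v j) (v k)" for i j k
  note tb = F_table[of T v, OF T_def]
  have TA: "T 0 1 2 = 1" "T 0 1 3 = 0" "T 0 1 4 = 0" "T 0 1 5 = 0" "T 0 1 6 = 0"
    "T 0 2 3 = 0" "T 0 2 4 = 0" "T 0 2 5 = 0" "T 0 2 6 = 0" "T 1 2 3 = 0" "T 1 2 4 = 0" "T 1 2 5 = 0" "T 1 2 6 = 0"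
    "T 0 3 4 = 1" "T 0 3 5 = 0" "T 0 3 6 = 0" "T 1 3 4 = 0" "T 1 3 5 = 1" "T 1 3 6 = 0"
    using A by (simp_all add: phase_A_def T_def)
  note ev = F_linear F_alt tb alt3_def TA
  let ?b1 = "T 0 4 6" and ?c1 = "T 0 5 6" and ?b2 = "T 1 4 6" and ?c2 = "T 1 5 6"
  have neq: "u \<noteq> x" if "c i u \<noteq> c i x" for u x i using that by auto
  have c1: "?c1 \<noteq> 0"
  proof
    assume z: "?c1 = 0"
    have "v 0 \<noteq> 0" using coord_basis[of 0 0] linear_0[OF linear_coord[of 0]] by auto
    then have "\<exists>k. v 6 + ?b1 *\<^sub>R v 3 = k *\<^sub>R v 0"
      by (rule F_kernel[OF fr]) (simp_all add: ev z del: One_nat_def)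
    then obtain k where k: "v 6 + ?b1 *\<^sub>R v 3 = k *\<^sub>R v 0" ..
    have "c 6 (v 6 + ?b1 *\<^sub>R v 3) = c 6 (k *\<^sub>R v 0)" unfolding k ..
    then show False by (simp add: coord_simps)
  qed
  have Pf: "?c1 * x * x + (?c2 - ?b1) * x - ?b2 \<noteq> 0" for x
  proof
    assume z: "?c1 * x * x + (?c2 - ?b1) * x - ?b2 = 0"
    let ?w = "x *\<^sub>R v 0 + v 1" and ?u = "v 6 + (x * ?c1 + ?c2) *\<^sub>R v 3"
    have "c 1 ?w = 1" by (simp add: coord_simps)
    then have "?w \<noteq> 0" using linear_0[OF linear_coord[of 1]] by auto
    then have "\<exists>k. ?u = k *\<^sub>R ?w"
      by (rule F_kernel[OF fr]) (use z in \<open>simp_all add: ev algebra_simps del: One_nat_def\<close>)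
    then obtain k where k: "?u = k *\<^sub>R ?w" ..
    have "c 6 ?u = c 6 (k *\<^sub>R ?w)" unfolding k ..
    then show False by (simp add: coord_simps)
  qed
  have disc: "(?c2 - ?b1)\<^sup>2 + 4 * ?c1 * ?b2 < 0"
  proof (rule ccontr)
    let ?d = "(?c2 - ?b1)\<^sup>2 + 4 * ?c1 * ?b2"
    assume "\<not> ?thesis"
    then have "sqrt ?d * sqrt ?d = ?d" by simp
    define x where "x = (- (?c2 - ?b1) + sqrt ?d) / (2 * ?c1)"
    have "2 * ?c1 * x + (?c2 - ?b1) = sqrt ?d" using c1 by (simp add: x_def)
    then have "(2 * ?c1 * x + (?c2 - ?b1)) * (2 * ?c1 * x + (?c2 - ?b1)) = ?d"
      using \<open>sqrt ?d * sqrt ?d = ?d\<close> by simp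
    then have "4 * ?c1 * (?c1 * x * x + (?c2 - ?b1) * x - ?b2) = 0"
      by (simp add: algebra_simps power2_eq_square)
    then show False using Pf[of x] c1 by simp
  qed
  define k where "k = (?b1 - ?c2) / (2 * ?c1)"
  have k: "2 * ?c1 * k = ?b1 - ?c2" using c1 by (simp add: k_def)
  define m where "m = ?b2 + k * k * ?c1"
  have "4 * ?c1 * m = (2 * ?c1 * k) * (2 * ?c1 * k) + 4 * ?c1 * ?b2" by (simp add: m_def algebra_simps)
  also have "\<dots> = (?c2 - ?b1)\<^sup>2 + 4 * ?c1 * ?b2" unfolding k by (simp add: power2_eq_square algebra_simps)
  finally have cm: "?c1 * m < 0" using disc by simp
  then have m: "m \<noteq> 0" "- ?c1 / m > 0" by (auto simp: mult_less_0_iff divide_less_0_iff)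
  define t where "t = sqrt (- ?c1 / m)"
  have t: "t > 0" "t * t = - ?c1 / m"
    using m real_sqrt_pow2[of "- ?c1 / m"] unfolding t_def power2_eq_square by (simp_all only: real_sqrt_gt_zero
        less_imp_le)
  have t': "t * (t * m) = - ?c1" using t(2) m(1) by (simp add: field_simps)
  have ub: "?b1 = ?c2 + 2 * ?c1 * k" using k by simp
  define w where "w = (!) [v 0, t *\<^sub>R (v 1 + k *\<^sub>R v 0), (1 / t) *\<^sub>R v 2, v 3, v 4 - k *\<^sub>R v 5, (1 / t) *\<^sub>R v 5, v 6]"
  have w: "w 0 = v 0" "w 1 = t *\<^sub>R (v 1 + k *\<^sub>R v 0)" "w 2 = (1 / t) *\<^sub>R v 2" "w 3 = v 3"
    "w 4 = v 4 - k *\<^sub>R v 5" "w 5 = (1 / t) *\<^sub>R v 5" "w 6 = v 6"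
    by (simp_all add: w_def)
  have "phase_A w"
    unfolding phase_A_def w using t(1) by (simp add: ev del: One_nat_def)
  moreover have "F (w 0) (w 4) (w 6) = F (w 1) (w 5) (w 6)"
    unfolding w using t(1) ub by (simp add: ev del: One_nat_def)
  moreover have "F (w 1) (w 4) (w 6) = - F (w 0) (w 5) (w 6)"
  proof -
    have "F (w 1) (w 4) (w 6) = t * m"
      unfolding w m_def using ub by (simp add: ev algebra_simps del: One_nat_def)
    moreover have "F (w 0) (w 5) (w 6) = ?c1 / t" unfolding w by (simp add: ev del: One_nat_def)
    moreover have "t * m = - (?c1 / t)" using t' t(1) by (simp add: field_simps)
    ultimately show ?thesis by (simp only:)
  qed
  moreover have "F (w 0) (w 5) (w 6) \<noteq> 0" unfolding w using c1 t(1) by (simp add: ev del: One_nat_def)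
  ultimately show ?thesis using that w(1,2) by blast
qed

private definition phase_C :: "(nat \<Rightarrow> 'a) \<Rightarrow> bool" where
  "phase_C v \<longleftrightarrow> phase_A v \<and> F (v 0) (v 4) (v 5) = 0 \<and> F (v 0) (v 4) (v 6) = 0 \<and> F (v 0) (v 5) (v 6) = 1
    \<and> F (v 1) (v 4) (v 5) = 0 \<and> F (v 1) (v 4) (v 6) = -1 \<and> F (v 1) (v 5) (v 6) = 0"

private lemma phase_C_exists:
  assumes A: "phase_A v" and h: "F (v 0) (v 4) (v 6) = F (v 1) (v 5) (v 6)"
    "F (v 1) (v 4) (v 6) = - F (v 0) (v 5) (v 6)" "F (v 0) (v 5) (v 6) \<noteq> 0"
  obtains w where "phase_C w" "w 0 = v 0" "w 1 = v 1"
proof -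
  define T where "T i j k = F (v i) (v j) (v k)" for i j k
  note tb = F_table[of T v, OF T_def]
  have TA: "T 0 1 2 = 1" "T 0 1 3 = 0" "T 0 1 4 = 0" "T 0 1 5 = 0" "T 0 1 6 = 0"
    "T 0 2 3 = 0" "T 0 2 4 = 0" "T 0 2 5 = 0" "T 0 2 6 = 0" "T 1 2 3 = 0" "T 1 2 4 = 0" "T 1 2 5 = 0" "T 1 2 6 = 0"
    "T 0 3 4 = 1" "T 0 3 5 = 0" "T 0 3 6 = 0" "T 1 3 4 = 0" "T 1 3 5 = 1" "T 1 3 6 = 0"
    using A by (simp_all add: phase_A_def T_def)
  have TB: "T 1 5 6 = T 0 4 6" "T 1 4 6 = - T 0 5 6" "T 0 5 6 \<noteq> 0" using h by (simp_all add: T_def)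
  note ev = F_linear F_alt tb alt3_def TA TB
  define w where "w = (!) [v 0, v 1, v 2, v 3, v 4 - T 1 4 5 *\<^sub>R v 3, v 5 + T 0 4 5 *\<^sub>R v 3,
      (1 / T 0 5 6) *\<^sub>R (v 6 + T 0 4 6 *\<^sub>R v 3)]"
  have w: "w 0 = v 0" "w 1 = v 1" "w 2 = v 2" "w 3 = v 3" "w 4 = v 4 - T 1 4 5 *\<^sub>R v 3"
    "w 5 = v 5 + T 0 4 5 *\<^sub>R v 3" "w 6 = (1 / T 0 5 6) *\<^sub>R (v 6 + T 0 4 6 *\<^sub>R v 3)"
    by (simp_all add: w_def)
  have "phase_C w"
    unfolding phase_C_def phase_A_def w by (simp add: ev del: One_nat_def)
  then show ?thesis using that w by blast
qed

private lemma phase_C_table: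
  assumes "phase_C v" "\<And>i j k. T i j k = F (v i) (v j) (v k)"
  shows "T 0 1 2 = 1" "T 0 1 3 = 0" "T 0 1 4 = 0" "T 0 1 5 = 0" "T 0 1 6 = 0"
    "T 0 2 3 = 0" "T 0 2 4 = 0" "T 0 2 5 = 0" "T 0 2 6 = 0" "T 1 2 3 = 0" "T 1 2 4 = 0" "T 1 2 5 = 0" "T 1 2 6 = 0"
    "T 0 3 4 = 1" "T 0 3 5 = 0" "T 0 3 6 = 0" "T 1 3 4 = 0" "T 1 3 5 = 1" "T 1 3 6 = 0"
    "T 0 4 5 = 0" "T 0 4 6 = 0" "T 0 5 6 = 1" "T 1 4 5 = 0" "T 1 4 6 = -1" "T 1 5 6 = 0"
  using assms by (simp_all add: phase_C_def phase_A_def)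

private lemma phase_C_frame:
  assumes C: "phase_C v"
  obtains c where "frame v c"
proof (rule frame_of_independent[OF dim])
  define T where "T i j k = F (v i) (v j) (v k)" for i j k
  note ev = F_table[of T v, OF T_def] alt3_def phase_C_table[OF C T_def]
  fix a i assume s: "(\<Sum>i<7. a i *\<^sub>R v i) = 0" and i: "i < (7::nat)"
  have s': "0 = a 0 * L (v 0) + a 1 * L (v 1) + a 2 * L (v 2) + a 3 * L (v 3) + a 4 * L (v 4) + a 5 * L (v 5)
      + a 6 * L (v 6)"
    if L: "linear L" for L :: "'a \<Rightarrow> real"
  proof -
    have "0 = L (\<Sum>i<7. a i *\<^sub>R v i)" unfolding s by (simp add: linear_0[OF L])
    then show ?thesis unfolding sum_7 by (simp add: linear_add[OF L] linear_cmul[OF L] del: One_nat_def)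
  qed
  note s'' = s'[OF form3_linear(3)[OF form]]
  have a2: "a 2 = 0" using s''[of "v 0" "v 1"] by (simp add: ev del: One_nat_def)
  have a1: "a 1 = 0" using s''[of "v 0" "v 2"] by (simp add: ev del: One_nat_def)
  have a0: "a 0 = 0" using s''[of "v 1" "v 2"] by (simp add: ev del: One_nat_def)
  have a4: "a 4 = 0" using s''[of "v 0" "v 3"] by (simp add: ev a1 a2 del: One_nat_def)
  have a3: "a 3 = 0" using s''[of "v 0" "v 4"] by (simp add: ev a1 a2 del: One_nat_def)
  have a6: "a 6 = 0" using s''[of "v 0" "v 5"] by (simp add: ev a1 a2 del: One_nat_def)
  have a5: "a 5 = 0" using s''[of "v 0" "v 6"] by (simp add: ev a1 a2 del: One_nat_def)
  consider "i = 0" | "i = 1" | "i = 2" | "i = 3" | "i = 4" | "i = 5" | "i = 6" using i by linarith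
  then show "a i = 0" using a0 a1 a2 a3 a4 a5 a6 by cases simp_all
qed (rule that)

private definition phase_D :: "(nat \<Rightarrow> 'a) \<Rightarrow> bool" where
  "phase_D v \<longleftrightarrow> phase_C v \<and> F (v 3) (v 4) (v 5) = 0 \<and> F (v 3) (v 4) (v 6) = 0
    \<and> F (v 3) (v 5) (v 6) = 0 \<and> F (v 4) (v 5) (v 6) = 0"

private lemma phase_D_exists:
  assumes C: "phase_C v"
  obtains w where "phase_D w" "w 0 = v 0" "w 1 = v 1"
proof -
  define T where "T i j k = F (v i) (v j) (v k)" for i j k
  note ev = F_linear F_alt F_table[of T v, OF T_def] alt3_def phase_C_table[OF C T_def]
  define q3 q4 q5 q6 where "q3 = T 3 4 5 / 2" and "q4 = - T 3 4 6 / 2" and "q5 = - T 3 5 6 / 2" and "q6 = T 4 5 6 / 2"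
  note q = q3_def q4_def q5_def q6_def
  define w where "w = (!) [v 0, v 1, v 2 + q3 *\<^sub>R v 3 + q4 *\<^sub>R v 4 + q5 *\<^sub>R v 5 + q6 *\<^sub>R v 6,
    v 3 + q5 *\<^sub>R v 0 - q4 *\<^sub>R v 1, v 4 - q6 *\<^sub>R v 0 + q3 *\<^sub>R v 1,
    v 5 - q3 *\<^sub>R v 0 - q6 *\<^sub>R v 1, v 6 + q4 *\<^sub>R v 0 + q5 *\<^sub>R v 1]"
  have w: "w 0 = v 0" "w 1 = v 1" "w 2 = v 2 + q3 *\<^sub>R v 3 + q4 *\<^sub>R v 4 + q5 *\<^sub>R v 5 + q6 *\<^sub>R v 6"
    "w 3 = v 3 + q5 *\<^sub>R v 0 - q4 *\<^sub>R v 1" "w 4 = v 4 - q6 *\<^sub>R v 0 + q3 *\<^sub>R v 1"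
    "w 5 = v 5 - q3 *\<^sub>R v 0 - q6 *\<^sub>R v 1" "w 6 = v 6 + q4 *\<^sub>R v 0 + q5 *\<^sub>R v 1"
    by (simp_all add: w_def)
  have "phase_C w"
    unfolding phase_C_def phase_A_def w by (simp add: ev del: One_nat_def)
  moreover have "F (w 3) (w 4) (w 5) = 0" "F (w 3) (w 4) (w 6) = 0" "F (w 3) (w 5) (w 6) = 0" "F (w 4) (w 5) (w 6) = 0"
    unfolding w by (simp_all add: ev q del: One_nat_def)
  ultimately show ?thesis using that[of w] w by (simp add: phase_D_def)
qed

private lemma phase_D_table:
  assumes "phase_D v" "\<And>i j k. T i j k = F (v i) (v j) (v k)"
  shows "T 3 4 5 = 0" "T 3 4 6 = 0" "T 3 5 6 = 0" "T 4 5 6 = 0"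
  using assms by (simp_all add: phase_D_def)

private lemma phase_E_exists:
  assumes D: "phase_D v"
  obtains w where "phase_D w" "w 0 = v 0" "w 1 = v 1"
    "F (w 2) (w 5) (w 6) = - F (w 2) (w 3) (w 4)" "F (w 2) (w 4) (w 6) = F (w 2) (w 3) (w 5)"
proof -
  define T where "T i j k = F (v i) (v j) (v k)" for i j k
  have C: "phase_C v" using D by (simp add: phase_D_def)
  note ev = F_linear F_alt F_table[of T v, OF T_def] alt3_def phase_C_table[OF C T_def] phase_D_table[OF D T_def]
  define r1 r2 where "r1 = - (T 2 3 4 + T 2 5 6) / 2" and "r2 = (T 2 4 6 - T 2 3 5) / 2"
  define w where "w = (!) [v 0, v 1, v 2 + r1 *\<^sub>R v 0 + r2 *\<^sub>R v 1, v 3, v 4, v 5, v 6]"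
  have w: "w 0 = v 0" "w 1 = v 1" "w 2 = v 2 + r1 *\<^sub>R v 0 + r2 *\<^sub>R v 1" "w 3 = v 3" "w 4 = v 4" "w 5 = v 5" "w 6 = v 6"
    by (simp_all add: w_def)
  have "phase_D w"
    unfolding phase_D_def phase_C_def phase_A_def w by (simp add: ev del: One_nat_def)
  moreover have "F (w 2) (w 5) (w 6) = - F (w 2) (w 3) (w 4)" "F (w 2) (w 4) (w 6) = F (w 2) (w 3) (w 5)"
    unfolding w by (simp_all add: ev r1_def r2_def field_simps del: One_nat_def)
  ultimately show ?thesis using that[of w] w by simp
qed

private lemma phase_F_exists:
  assumes D: "phase_D v"
    and h: "F (v 2) (v 5) (v 6) = - F (v 2) (v 3) (v 4)" "F (v 2) (v 4) (v 6) = F (v 2) (v 3) (v 5)"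
  obtains w where "phase_D w" "w 0 = v 0" "w 1 = v 1" "F (w 2) (w 3) (w 4) = 0" "F (w 2) (w 3) (w 5) = 0"
    "F (w 2) (w 4) (w 6) = 0" "F (w 2) (w 5) (w 6) = 0"
proof -
  define T where "T i j k = F (v i) (v j) (v k)" for i j k
  have C: "phase_C v" using D by (simp add: phase_D_def)
  obtain c where fr: "frame v c" by (rule phase_C_frame[OF C])
  interpret frame v c by (fact fr)
  have TE: "T 2 5 6 = - T 2 3 4" "T 2 4 6 = T 2 3 5" using h by (simp_all add: T_def)
  note ev = F_linear F_alt F_table[of T v, OF T_def] alt3_def phase_C_table[OF C T_def] phase_D_table[OF D T_def] TE
  have S: "T 2 3 6 \<noteq> 0"
  proof
    assume z: "T 2 3 6 = 0"
    have "v 3 \<noteq> 0" using coord_basis[of 3 3] linear_0[OF linear_coord[of 3]] by auto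
    then have "\<exists>k. v 6 = k *\<^sub>R v 3"
      by (rule F_kernel[OF fr]) (simp_all add: ev z del: One_nat_def)
    then obtain k where k: "v 6 = k *\<^sub>R v 3" ..
    have "c 6 (v 6) = c 6 (k *\<^sub>R v 3)" unfolding k[symmetric] ..
    then show False by (simp add: coord_simps)
  qed
  define k k' where "k = - T 2 3 5 / T 2 3 6" and "k' = - T 2 3 4 / T 2 3 6"
  have kk: "k * T 2 3 6 = - T 2 3 5" "k' * T 2 3 6 = - T 2 3 4" using S by (simp_all add: k_def k'_def)
  define w where "w = (!) [v 0, v 1, v 2, v 3, v 4 + k *\<^sub>R v 3 + k' *\<^sub>R v 6, v 5 + k *\<^sub>R v 6 - k' *\<^sub>R v 3, v 6]"
  have w: "w 0 = v 0" "w 1 = v 1" "w 2 = v 2" "w 3 = v 3" "w 4 = v 4 + k *\<^sub>R v 3 + k' *\<^sub>R v 6"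
    "w 5 = v 5 + k *\<^sub>R v 6 - k' *\<^sub>R v 3" "w 6 = v 6"
    by (simp_all add: w_def)
  have "phase_D w"
    unfolding phase_D_def phase_C_def phase_A_def w by (simp add: ev del: One_nat_def)
  moreover have "F (w 2) (w 3) (w 4) = 0" "F (w 2) (w 3) (w 5) = 0" "F (w 2) (w 4) (w 6) = 0" "F (w 2) (w 5) (w 6) = 0"
    unfolding w by (simp_all add: ev kk del: One_nat_def)
  ultimately show ?thesis using that[of w] w by simp
qed

private lemma phase_G:
  assumes D: "phase_D v"
    and h: "F (v 2) (v 3) (v 4) = 0" "F (v 2) (v 3) (v 5) = 0" "F (v 2) (v 4) (v 6) = 0" "F (v 2) (v 5) (v 6) = 0"
  shows "F (v 2) (v 3) (v 6) < 0" "F (v 2) (v 4) (v 5) < 0"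
proof -
  define T where "T i j k = F (v i) (v j) (v k)" for i j k
  have C: "phase_C v" using D by (simp add: phase_D_def)
  obtain c where fr: "frame v c" by (rule phase_C_frame[OF C])
  interpret frame v c by (fact fr)
  have TE: "T 2 3 4 = 0" "T 2 3 5 = 0" "T 2 5 6 = 0" "T 2 4 6 = 0" using h by (simp_all add: T_def)
  note ev = F_linear F_alt F_table[of T v, OF T_def] alt3_def phase_C_table[OF C T_def] phase_D_table[OF D T_def] TE
  have T1: "T 2 4 5 < 0"
  proof (rule ccontr)
    assume "\<not> ?thesis"
    then have s: "sqrt (T 2 4 5) * sqrt (T 2 4 5) = T 2 4 5" by simp
    let ?w = "v 2 + sqrt (T 2 4 5) *\<^sub>R v 6" and ?u = "v 4 - sqrt (T 2 4 5) *\<^sub>R v 0"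
    have "c 2 ?w = 1" by (simp add: coord_simps)
    then have "?w \<noteq> 0" using linear_0[OF linear_coord[of 2]] by auto
    then have "\<exists>k. ?u = k *\<^sub>R ?w"
      by (rule F_kernel[OF fr]) (use s in \<open>simp_all add: ev algebra_simps del: One_nat_def real_sqrt_mult_self\<close>)
    then obtain k where k: "?u = k *\<^sub>R ?w" ..
    have "c 4 ?u = c 4 (k *\<^sub>R ?w)" unfolding k ..
    then show False by (simp add: coord_simps)
  qed
  have "T 2 3 6 < 0"
  proof (rule ccontr)
    assume S: "\<not> ?thesis"
    define r where "r = sqrt (- (T 2 3 6 / T 2 4 5))"
    have "r * r = - (T 2 3 6 / T 2 4 5)"
      using S T1 unfolding r_def by (simp add: divide_le_0_iff)
    then have r: "r * (r * T 2 4 5) = - T 2 3 6" using T1 by (simp add: field_simps)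
    let ?w = "v 3 + r *\<^sub>R v 4" and ?u = "v 6 + r *\<^sub>R v 5"
    have "c 3 ?w = 1" by (simp add: coord_simps)
    then have "?w \<noteq> 0" using linear_0[OF linear_coord[of 3]] by auto
    then have "\<exists>k. ?u = k *\<^sub>R ?w"
      by (rule F_kernel[OF fr]) (use r in \<open>simp_all add: ev algebra_simps del: One_nat_def\<close>)
    then obtain k where k: "?u = k *\<^sub>R ?w" ..
    have "c 6 ?u = c 6 (k *\<^sub>R ?w)" unfolding k ..
    then show False by (simp add: coord_simps)
  qed
  with T1 show "F (v 2) (v 3) (v 6) < 0" "F (v 2) (v 4) (v 5) < 0" by (simp_all add: T_def)
qed

private lemma scalars:
  assumes "S < 0" "T < 0"
  obtains l a b m :: real where "l * a * b = 1" "m * l * l = 1" "m * a * a * S = -1" "m * b * b * T = -1" "l \<noteq> 0"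
proof -
  define l where "l = root 6 (S * T)"
  have ST: "S * T > 0" using assms by (simp add: mult_neg_neg)
  have l: "l > 0" "l ^ 6 = S * T" using ST by (simp_all add: l_def)
  define p q where "p = sqrt (- S)" and "q = sqrt (- T)"
  have pq: "p > 0" "q > 0" "p * p = - S" "q * q = - T"
    using assms real_sqrt_pow2[of "- S"] real_sqrt_pow2[of "- T"] unfolding p_def q_def power2_eq_square
    by (simp_all del: real_sqrt_minus add: real_sqrt_gt_zero)
  define a b where "a = l / p" and "b = l / q"
  have a: "a > 0" "a * p = l" and b: "b > 0" "b * q = l" using pq l by (simp_all add: a_def b_def)
  have "a * a * (p * p) = (a * p) * (a * p)" "b * b * (q * q) = (b * q) * (b * q)"
    by (simp_all only: ac_simps)
  then have aa: "a * a * S = - (l * l)" and bb: "b * b * T = - (l * l)" unfolding pq a(2) b(2) by simp_all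
  have "(l * a * b)\<^sup>2 * (S * T) = (l * l) * (a * a * S) * (b * b * T)"
    by (simp add: power2_eq_square algebra_simps)
  also have "\<dots> = S * T" unfolding aa bb using l(2) by (simp add: eval_nat_numeral ac_simps)
  finally have "(l * a * b)\<^sup>2 = 1" using ST mult_cancel_right1[of "S * T" "(l * a * b)\<^sup>2"]
    mult_cancel_right2[of "(l * a * b)\<^sup>2" "S * T"] by (simp only: less_irrefl) auto
  then have "l * a * b = 1" using l a b by (metis abs_of_pos abs_square_eq_1 mult_pos_pos power2_eq_1_iff)
  moreover have "1 / (l * l) * l * l = 1" "1 / (l * l) * a * a * S = -1" "1 / (l * l) * b * b * T = -1"
    using aa bb l(1) by (simp_all add: field_simps)
  ultimately show ?thesis using that[of l a b "1 / (l * l)"] l by simp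
qed

lemma normal_form:
  assumes ind: "\<And>r s. r *\<^sub>R z1 + s *\<^sub>R z2 = 0 \<Longrightarrow> r = 0 \<and> s = 0"
  obtains b c q r s where "g2_frame b c \<phi>" "b 0 = q *\<^sub>R z1" "b 1 = r *\<^sub>R z1 + s *\<^sub>R z2"
proof -
  obtain v0 c0 where v0: "frame v0 c0" "phase_A v0" "v0 0 = z1" "v0 1 = z2"
    by (rule phase_A_exists[OF ind])
  obtain v1 k t where v1: "phase_A v1" "v1 0 = v0 0" "v1 1 = t *\<^sub>R (v0 1 + k *\<^sub>R v0 0)"
    "F (v1 0) (v1 4) (v1 6) = F (v1 1) (v1 5) (v1 6)" "F (v1 1) (v1 4) (v1 6) = - F (v1 0) (v1 5) (v1 6)"
    "F (v1 0) (v1 5) (v1 6) \<noteq> 0"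
    by (rule phase_B[OF v0(1,2)])
  obtain v2 where v2: "phase_C v2" "v2 0 = v1 0" "v2 1 = v1 1"
    by (rule phase_C_exists[OF v1(1,4-6)])
  obtain v3 where v3: "phase_D v3" "v3 0 = v2 0" "v3 1 = v2 1"
    by (rule phase_D_exists[OF v2(1)])
  obtain v4 where v4: "phase_D v4" "v4 0 = v3 0" "v4 1 = v3 1"
    "F (v4 2) (v4 5) (v4 6) = - F (v4 2) (v4 3) (v4 4)" "F (v4 2) (v4 4) (v4 6) = F (v4 2) (v4 3) (v4 5)"
    by (rule phase_E_exists[OF v3(1)])
  obtain v where v: "phase_D v" "v 0 = v4 0" "v 1 = v4 1" and
    h: "F (v 2) (v 3) (v 4) = 0" "F (v 2) (v 3) (v 5) = 0"
    "F (v 2) (v 4) (v 6) = 0" "F (v 2) (v 5) (v 6) = 0"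
    by (rule phase_F_exists[OF v4(1,4,5)])
  obtain l a b m :: real where sc: "l * a * b = 1" "m * l * l = 1" "m * a * a * F (v 2) (v 3) (v 6) = -1"
    "m * b * b * F (v 2) (v 4) (v 5) = -1" "l \<noteq> 0"
    by (rule scalars[OF phase_G[OF v(1) h]])
  define T where "T i j k = F (v i) (v j) (v k)" for i j k
  have C: "phase_C v" using v by (simp add: phase_D_def)
  have TE: "T 2 3 4 = 0" "T 2 3 5 = 0" "T 2 5 6 = 0" "T 2 4 6 = 0" using h by (simp_all add: T_def)
  note ev = F_linear F_alt F_table[of T v, OF T_def] alt3_def phase_C_table[OF C T_def] phase_D_table[OF v(1) T_def] TE
  define w where "w = (!) [l *\<^sub>R v 0, l *\<^sub>R v 1, m *\<^sub>R v 2, a *\<^sub>R v 3, b *\<^sub>R v 4, b *\<^sub>R v 5, a *\<^sub>R v 6]"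
  have w: "w 0 = l *\<^sub>R v 0" "w 1 = l *\<^sub>R v 1" "w 2 = m *\<^sub>R v 2" "w 3 = a *\<^sub>R v 3" "w 4 = b *\<^sub>R v 4" "w 5 = b *\<^sub>R v 5"
      "w 6 = a *\<^sub>R v 6"
    by (simp_all add: w_def)
  have sc': "l * (a * b) = 1" "b * (a * l) = 1" "a * (b * l) = 1" "a * (a * (m * T 2 3 6)) = -1"
      "b * (b * (m * T 2 4 5)) = -1" "m * (l * l) = 1" "l * (l * m) = 1" "l * (b * a) = 1"
    "m * (a * (a * T 2 3 6)) = -1" "m * (b * (b * T 2 4 5)) = -1"
    using sc by (simp_all add: ac_simps T_def)
  have D: "phase_C w"
    unfolding phase_C_def phase_A_def w by (simp add: ev sc' del: One_nat_def)
  obtain c where fr: "frame w c" by (rule phase_C_frame[OF D])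
  have tab: "F (w i) (w j) (w k) = g2_table i j k" if "i < j" "j < k" "k < 7" for i j k
  proof -
    have val: "F (w 2) (w 3) (w 4) = 0" "F (w 2) (w 3) (w 5) = 0" "F (w 2) (w 4) (w 6) = 0" "F (w 2) (w 5) (w 6) = 0"
      "F (w 3) (w 4) (w 5) = 0" "F (w 3) (w 4) (w 6) = 0" "F (w 3) (w 5) (w 6) = 0" "F (w 4) (w 5) (w 6) = 0"
      "F (w 2) (w 3) (w 6) = -1" "F (w 2) (w 4) (w 5) = -1"
      unfolding w by (simp_all add: ev sc' del: One_nat_def)
    have "\<forall>K\<in>combs 3. F (w (K ! 0)) (w (K ! 1)) (w (K ! 2)) = g2_table (K ! 0) (K ! 1) (K ! 2)"
      unfolding combs_3_all by (simp add: g2_table_def val phase_C_table[OF D refl] del: One_nat_def)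
    then have "F (w ([i, j, k] ! 0)) (w ([i, j, k] ! 1)) (w ([i, j, k] ! 2))
      = g2_table ([i, j, k] ! 0) ([i, j, k] ! 1) ([i, j, k] ! 2)"
      by (rule bspec) (simp add: frame.combs3_iff[OF fr] that)
    then show ?thesis by simp
  qed
  have "g2_frame w c \<phi>"
    by (rule g2_frame.intro[OF fr g2_frame_axioms.intro[OF form tab]])
  then show ?thesis
    using that[of w c l "l * t * k" "l * t"] w v v4(2,3) v3(2,3) v2(2,3) v1(2,3) v0(3,4)
    by (simp add: scaleR_add_right)
qed

end

section \<open>Adapted bases of a Lie algebra with large center\<close>

lemma (in frame) endo_trace_eq:
  assumes f: "linear f"
  shows "endo_trace f = (\<Sum>i<7. c i (f (b i)))"
proof -
  define A where "A = extend_basis ({} :: 'a set)"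
  have A: "independent A" "span A = UNIV"
    unfolding A_def using independent_extend_basis[of "{}"] span_extend_basis[of "{}"] by (simp_all add:
        independent_empty)
  have "A \<subseteq> span (b ` {..<7})"
  proof
    fix x
    have "(\<Sum>i<7. c i x *\<^sub>R b i) \<in> span (b ` {..<7})" by (intro span_sum span_scale span_base) auto
    then show "x \<in> span (b ` {..<7})" by (simp add: expansion)
  qed
  then have fin: "finite A" using independent_span_bound[OF _ A(1), of "b ` {..<7}"] by simp
  have "endo_trace f = (\<Sum>a\<in>A. representation A (f a) a)"
    by (simp add: endo_trace_def A_def Let_def)
  also have "\<dots> = (\<Sum>a\<in>A. \<Sum>i<7. c i a * representation A (f (b i)) a)"
  proof (rule sum.cong[OF refl])
    fix a
    have "f a = (\<Sum>i<7. c i a *\<^sub>R f (b i))"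
      by (subst expansion[symmetric, of a]) (simp add: linear_sum[OF f] linear_cmul[OF f])
    then show "representation A (f a) a = (\<Sum>i<7. c i a * representation A (f (b i)) a)"
      using A by (simp add: representation_sum representation_scale)
  qed
  also have "\<dots> = (\<Sum>i<7. \<Sum>a\<in>A. c i a * representation A (f (b i)) a)" by (rule sum.swap)
  also have "\<dots> = (\<Sum>i<7. c i (f (b i)))"
  proof (rule sum.cong[OF refl])
    fix i assume "i \<in> {..<7::nat}"
    then have lin: "linear (c i)" by (simp add: linear_coord)
    have "f (b i) = (\<Sum>a\<in>A. representation A (f (b i)) a *\<^sub>R a)"
      using A fin by (simp add: sum_representation_eq)
    then have "c i (f (b i)) = c i (\<Sum>a\<in>A. representation A (f (b i)) a *\<^sub>R a)" by simp
    also have "\<dots> = (\<Sum>a\<in>A. c i a * representation A (f (b i)) a)"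
      by (simp add: linear_sum[OF lin] linear_cmul[OF lin] mult.commute)
    finally show "(\<Sum>a\<in>A. c i a * representation A (f (b i)) a) = c i (f (b i))" ..
  qed
  finally show ?thesis .
qed

text \<open>The action of \<open>SU(2)\<close>, the unit quaternions, on the span of \<open>b 3, \<dots>, b 6\<close>. It commutes with
  the complex structure \<open>b 3 \<mapsto> b 6\<close>, \<open>b 4 \<mapsto> b 5\<close> and preserves \<open>\<phi>\<close>.\<close>

definition rot :: "real \<Rightarrow> real \<Rightarrow> real \<Rightarrow> real \<Rightarrow> (nat \<Rightarrow> 'a::real_vector) \<Rightarrow> nat \<Rightarrow> 'a" where
  "rot y3 y4 y5 y6 b = (!) [b 0, b 1, b 2,
     y3 *\<^sub>R b 3 + y4 *\<^sub>R b 4 + y5 *\<^sub>R b 5 + y6 *\<^sub>R b 6, - y4 *\<^sub>R b 3 + y3 *\<^sub>R b 4 - y6 *\<^sub>R b 5 + y5 *\<^sub>R b 6,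
     - y5 *\<^sub>R b 3 + y6 *\<^sub>R b 4 + y3 *\<^sub>R b 5 - y4 *\<^sub>R b 6, - y6 *\<^sub>R b 3 - y5 *\<^sub>R b 4 + y4 *\<^sub>R b 5 + y3 *\<^sub>R b 6]"

lemma rot_simps:
  "rot y3 y4 y5 y6 b 0 = b 0" "rot y3 y4 y5 y6 b 1 = b 1" "rot y3 y4 y5 y6 b 2 = b 2"
  "rot y3 y4 y5 y6 b 3 = y3 *\<^sub>R b 3 + y4 *\<^sub>R b 4 + y5 *\<^sub>R b 5 + y6 *\<^sub>R b 6"
  "rot y3 y4 y5 y6 b 4 = - y4 *\<^sub>R b 3 + y3 *\<^sub>R b 4 - y6 *\<^sub>R b 5 + y5 *\<^sub>R b 6"
  "rot y3 y4 y5 y6 b 5 = - y5 *\<^sub>R b 3 + y6 *\<^sub>R b 4 + y3 *\<^sub>R b 5 - y4 *\<^sub>R b 6"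
  "rot y3 y4 y5 y6 b 6 = - y6 *\<^sub>R b 3 - y5 *\<^sub>R b 4 + y4 *\<^sub>R b 5 + y3 *\<^sub>R b 6"
  by (simp_all add: rot_def)

definition rot_coord :: "real \<Rightarrow> real \<Rightarrow> real \<Rightarrow> real \<Rightarrow> (nat \<Rightarrow> 'a \<Rightarrow> real) \<Rightarrow> nat \<Rightarrow> 'a \<Rightarrow> real" where
  "rot_coord y3 y4 y5 y6 c i x = rot y3 y4 y5 y6 (\<lambda>j. c j x) i"

lemma (in g2_frame) g2_frame_rot:
  assumes n: "y3 * y3 + y4 * y4 + y5 * y5 + y6 * y6 = 1"
  shows "g2_frame (rot y3 y4 y5 y6 b) (rot_coord y3 y4 y5 y6 c) \<phi>" (is "g2_frame ?b ?c \<phi>")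
proof -
  have n': "y3 * y3 = 1 - (y4 * y4 + (y5 * y5 + y6 * y6))" using n by simp
  have n'': "y3 * (y3 * z) = z - (y4 * (y4 * z) + (y5 * (y5 * z) + y6 * (y6 * z)))" for z
    unfolding mult.assoc[symmetric] n' by (simp add: algebra_simps)
  note N = n' n''
  note cs = rot_simps rot_coord_def
  have fr: "frame ?b ?c"
  proof (rule frame.intro)
    have "\<forall>i<7. linear (?c i)"
      unfolding all_less_7 cs by (simp add: linear_iff coord_simps algebra_simps del: One_nat_def)
    then show "linear (?c i)" if "i < 7" for i using that by blast
    have "\<forall>i<7. \<forall>j<7. ?c i (?b j) = (if i = j then 1 else 0)"
      unfolding all_less_7 cs by (simp add: coord_simps N algebra_simps del: One_nat_def)
    then show "?c i (?b j) = (if i = j then 1 else 0)" if "i < 7" "j < 7" for i j using that by blast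
    show "(\<Sum>i<7. ?c i x *\<^sub>R ?b i) = x" for x
    proof (rule coord_eqI)
      have "\<forall>i<7. c i (\<Sum>i<7. ?c i x *\<^sub>R ?b i) = c i x"
        unfolding all_less_7 cs sum_7 by (simp add: coord_simps N algebra_simps del: One_nat_def)
      then show "c i (\<Sum>i<7. ?c i x *\<^sub>R ?b i) = c i x" if "i < 7" for i using that by blast
    qed
  qed
  note lin = form3_linear[OF form]
  note F = linear_add[OF lin(1)] linear_add[OF lin(2)] linear_add[OF lin(3)]
    linear_diff[OF lin(1)] linear_diff[OF lin(2)] linear_diff[OF lin(3)]
    linear_neg[OF lin(1)] linear_neg[OF lin(2)] linear_neg[OF lin(3)]
    linear_cmul[OF lin(1)] linear_cmul[OF lin(2)] linear_cmul[OF lin(3)]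
  have "\<forall>K\<in>combs 3. \<phi> ((!) [?b (K ! 0), ?b (K ! 1), ?b (K ! 2)]) = g2_table (K ! 0) (K ! 1) (K ! 2)"
    unfolding combs_3_all
    by (simp add: cs F eps g2_eps_def alt3_def g2_table_def N algebra_simps del: One_nat_def)
  then have "\<phi> ((!) [?b i, ?b j, ?b k]) = g2_table i j k" if "i < j" "j < k" "k < 7" for i j k
    using that by (auto simp: combs3_iff dest: bspec[of _ _ "[i, j, k]"])
  then show ?thesis
    by (intro g2_frame.intro[OF fr] g2_frame_axioms.intro[OF form])
qed

locale central_g2 = g2_lie_frame b c \<phi> br
  for b :: "nat \<Rightarrow> 'a::real_vector" and c \<phi> br +
  assumes closed: "ce_diff br 3 \<phi> x = 0"
    and unimodular: "unimodular br"
    and central: "br (b 0) y = 0" "br (b 1) y = 0"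
begin

lemma B_central: "r < 7 \<Longrightarrow> B 0 j r = 0" "r < 7 \<Longrightarrow> B 1 j r = 0" "r < 7 \<Longrightarrow> B i 0 r = 0" "r < 7 \<Longrightarrow> B i 1 r = 0"
proof -
  assume r: "r < 7"
  show "B 0 j r = 0" "B 1 j r = 0" "B i 0 r = 0" "B i 1 r = 0"
    using B_swap[OF r, of 0 i] B_swap[OF r, of 1 i]
    by (simp_all add: B_def central linear_0 linear_coord r del: One_nat_def)
qed

lemmas B_central_nums = less_7[THEN B_central(1)] less_7[THEN B_central(2)] less_7[THEN B_central(3)] less_7[THEN
    B_central(4)]

lemmas d_closed = d_phi[unfolded closed B_central_nums]

lemma trace_br: "B i 0 0 + B i 1 1 + B i 2 2 + B i 3 3 + B i 4 4 + B i 5 5 + B i 6 6 = 0"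
proof -
  have "linear (br (b i))" using bilinear_br by (simp add: bilinear_def)
  then show ?thesis
    using endo_trace_eq[of "br (b i)"] unimodular by (simp add: unimodular_def sum_7 B_def)
qed

lemma B_e: "B 2 3 2 = 0" "B 2 4 2 = 0" "B 2 5 2 = 0" "B 2 6 2 = 0"
  "B 3 4 2 = 0" "B 3 5 2 = 0" "B 3 6 2 = 0" "B 4 5 2 = 0" "B 4 6 2 = 0" "B 5 6 2 = 0"
  using d_closed(1-10) by simp_all

lemmas B_swap_nums = less_7[THEN B_self[of _ 2]] less_7[THEN B_self[of _ 3]] less_7[THEN B_self[of _ 4]] less_7[THEN
    B_self[of _ 5]] less_7[THEN B_self[of _ 6]]
  less_7[THEN B_swap[of _ 3 2]] less_7[THEN B_swap[of _ 4 2]] less_7[THEN B_swap[of _ 5 2]]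
  less_7[THEN B_swap[of _ 6 2]] less_7[THEN B_swap[of _ 4 3]] less_7[THEN B_swap[of _ 5 3]]
  less_7[THEN B_swap[of _ 6 3]] less_7[THEN B_swap[of _ 5 4]] less_7[THEN B_swap[of _ 6 4]]
  less_7[THEN B_swap[of _ 6 5]]

lemma trace_br_q:
  "B 2 3 3 + B 2 4 4 + B 2 5 5 + B 2 6 6 = 0"
  "B 3 4 4 + B 3 5 5 + B 3 6 6 = 0"
  "- B 3 4 3 + B 4 5 5 + B 4 6 6 = 0"
  "- B 3 5 3 - B 4 5 4 + B 5 6 6 = 0"
  "- B 3 6 3 - B 4 6 4 - B 5 6 5 = 0"
  using trace_br[of 2] trace_br[of 3] trace_br[of 4] trace_br[of 5] trace_br[of 6] B_e
  unfolding B_central_nums B_swap_nums by linarith+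

lemma B_z:
  "B 3 4 1 = - (B 2 3 3 + B 2 4 4)" "B 3 5 1 = B 2 3 6 - B 2 5 4" "B 3 6 1 = - (B 2 3 5 + B 2 6 4)"
  "B 4 5 1 = B 2 4 6 + B 2 5 3" "B 4 6 1 = B 2 6 3 - B 2 4 5" "B 5 6 1 = - (B 2 5 5 + B 2 6 6)"
  "B 3 4 0 = B 2 3 6 + B 2 4 5" "B 3 5 0 = B 2 3 3 + B 2 5 5" "B 3 6 0 = B 2 6 5 - B 2 3 4"
  "B 4 5 0 = B 2 4 3 - B 2 5 6" "B 4 6 0 = - (B 2 4 4 + B 2 6 6)" "B 5 6 0 = - (B 2 5 4 + B 2 6 3)"
  using d_closed(11-16) d_closed(21-26) by (linarith, linarith, linarith, linarith, linarith, linarith, linarith,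
      linarith, linarith, linarith, linarith, linarith)

lemma B_abelian:
  "B 5 6 3 = - B 3 4 3" "B 5 6 4 = - B 3 4 4" "B 5 6 5 = - B 3 4 5" "B 5 6 6 = - B 3 4 6"
  "B 4 6 3 = B 3 5 3" "B 4 6 4 = B 3 5 4" "B 4 6 5 = B 3 5 5" "B 4 6 6 = B 3 5 6"
  "B 3 6 6 = - B 3 4 4 - B 3 5 5" "B 3 5 4 = B 3 4 5 - B 3 6 3"
  "B 4 5 5 = B 3 4 3 - B 3 5 6" "B 4 5 4 = - B 3 4 6 - B 3 5 3"
  using d_closed(17-20) d_closed(27-35) trace_br_q B_e B_z by linarith+

end

section \<open>Rotating the adapted basis\<close>

context central_g2
begin

lemma central_g2_rot:
  assumes "y3 * y3 + y4 * y4 + y5 * y5 + y6 * y6 = 1"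
  shows "central_g2 (rot y3 y4 y5 y6 b) (rot_coord y3 y4 y5 y6 c) \<phi> br"
  by (intro central_g2.intro g2_lie_frame.intro g2_frame_rot assms g2_lie_frame_axioms.intro lie
      central_g2_axioms.intro)
    (simp_all add: rot_simps closed unimodular central del: One_nat_def)

lemma jacobi_coord:
  assumes "i < 7" "j < 7" "k < 7" "r < 7"
  shows "B j k 2 * B i 2 r + B j k 3 * B i 3 r + B j k 4 * B i 4 r + B j k 5 * B i 5 r + B j k 6 * B i 6 r
    + B k i 2 * B j 2 r + B k i 3 * B j 3 r + B k i 4 * B j 4 r + B k i 5 * B j 5 r + B k i 6 * B j 6 r
    + B i j 2 * B k 2 r + B i j 3 * B k 3 r + B i j 4 * B k 4 r + B i j 5 * B k 5 r + B i j 6 * B k 6 r = 0"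
proof -
  have e: "c r (br (b i) (br (b j) (b k))) = (\<Sum>s<7. B j k s * B i s r)" if "i < 7" "j < 7" "k < 7" for i j k
  proof -
    have "linear (\<lambda>x. c r (br (b i) x))"
      using bilinear_br linear_compose[OF _ linear_coord[OF assms(4)], of "br (b i)"] by (simp add: bilinear_def o_def)
    from linear_expand[OF this, of "br (b j) (b k)"] show ?thesis by (simp add: B_def)
  qed
  have "c r (br (b i) (br (b j) (b k))) + c r (br (b j) (br (b k) (b i))) + c r (br (b k) (br (b i) (b j))) = 0"
    using arg_cong[OF lie_algebra.jacobi[OF lie, of "b i" "b j" "b k"], of "c r"]
    by (simp add: linear_add linear_0 linear_coord assms)
  then show ?thesis
    using assms by (simp add: e sum_7 B_central del: One_nat_def)
qed

lemmas jacobi_q =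
  jacobi_coord[OF less_7(4) less_7(5) less_7(6) less_7(4)] jacobi_coord[OF less_7(4) less_7(5) less_7(6) less_7(5)]
  jacobi_coord[OF less_7(4) less_7(5) less_7(6) less_7(6)] jacobi_coord[OF less_7(4) less_7(5) less_7(6) less_7(7)]
  jacobi_coord[OF less_7(4) less_7(5) less_7(7) less_7(4)] jacobi_coord[OF less_7(4) less_7(5) less_7(7) less_7(5)]
  jacobi_coord[OF less_7(4) less_7(5) less_7(7) less_7(6)] jacobi_coord[OF less_7(4) less_7(5) less_7(7) less_7(7)]
  jacobi_coord[OF less_7(4) less_7(6) less_7(7) less_7(4)] jacobi_coord[OF less_7(4) less_7(6) less_7(7) less_7(5)]
  jacobi_coord[OF less_7(4) less_7(6) less_7(7) less_7(6)] jacobi_coord[OF less_7(4) less_7(6) less_7(7) less_7(7)]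
  jacobi_coord[OF less_7(5) less_7(6) less_7(7) less_7(4)] jacobi_coord[OF less_7(5) less_7(6) less_7(7) less_7(5)]
  jacobi_coord[OF less_7(5) less_7(6) less_7(7) less_7(6)] jacobi_coord[OF less_7(5) less_7(6) less_7(7) less_7(7)]
lemmas jacobi_q_elim = jacobi_q[unfolded B_e B_swap_nums B_abelian]

text \<open>Let \<open>J\<close> be the complex structure \<open>b 3 \<mapsto> b 6\<close>, \<open>b 4 \<mapsto> b 5\<close>. Modulo the center, closedness gives
  \<open>[J x, J y] = [x, y]\<close>, the complex linear parts \<open>P x\<close> of the maps \<open>ad x\<close> are traceless and \<open>P\<close> is
  antilinear. By the Jacobi identity they commute, hence they are multiples of a single
  matrix, and \<open>P\<close> has a non-zero kernel.\<close>

lemma ad_commute: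
  "B 3 6 6 * (B 3 5 5 - B 3 4 4) - (- B 3 6 3) * (- B 3 4 5 - B 3 5 4) = B 3 6 5 * (B 3 5 6 - B 3 4 3)
      - (- B 3 6 4) * (- B 3 4 6 - B 3 5 3)"
  "B 3 6 6 * (- B 3 4 5 - B 3 5 4) + (- B 3 6 3) * (B 3 5 5 - B 3 4 4) = B 3 6 5 * (- B 3 4 6 - B 3 5 3)
      + (- B 3 6 4) * (B 3 5 6 - B 3 4 3)"
  "B 3 6 6 * B 4 5 6 - (- B 3 6 3) * (- B 4 5 3) = (B 3 4 3 + B 3 5 6) * (B 3 5 6 - B 3 4 3) - (B 3 4 6
      - B 3 5 3) * (- B 3 4 6 - B 3 5 3)"
  "B 3 6 6 * (- B 4 5 3) + (- B 3 6 3) * B 4 5 6 = (B 3 4 3 + B 3 5 6) * (- B 3 4 6 - B 3 5 3) + (B 3 4 6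
      - B 3 5 3) * (B 3 5 6 - B 3 4 3)"
  "B 3 6 5 * B 4 5 6 - (- B 3 6 4) * (- B 4 5 3) = (B 3 4 3 + B 3 5 6) * (B 3 5 5 - B 3 4 4) - (B 3 4 6
      - B 3 5 3) * (- B 3 4 5 - B 3 5 4)"
  "B 3 6 5 * (- B 4 5 3) + (- B 3 6 4) * B 4 5 6 = (B 3 4 3 + B 3 5 6) * (- B 3 4 5 - B 3 5 4) + (B 3 4 6
      - B 3 5 3) * (B 3 5 5 - B 3 4 4)"
  subgoal using jacobi_q_elim(7) jacobi_q_elim(10) unfolding B_abelian by algebra
  subgoal using jacobi_q_elim(6) unfolding B_abelian by algebra
  subgoal using jacobi_q_elim(4) jacobi_q_elim(13) unfolding B_abelian by algebra
  subgoal using jacobi_q_elim(1) unfolding B_abelian by algebra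
  subgoal using jacobi_q_elim(3) jacobi_q_elim(9) unfolding B_abelian by algebra
  subgoal using jacobi_q_elim(2) jacobi_q_elim(5) unfolding B_abelian by algebra
  done

definition q_kernel :: "real \<Rightarrow> real \<Rightarrow> real \<Rightarrow> real \<Rightarrow> bool" where
  "q_kernel y3 y4 y5 y6 \<longleftrightarrow> y3 * y3 + y4 * y4 + y5 * y5 + y6 * y6 = 1 \<and>
    y3 * B 3 6 6 - y6 * B 3 6 3 + y4 * (B 3 5 6 - B 3 4 3) - y5 * (B 3 4 6 + B 3 5 3) = 0 \<and>
    y3 * B 3 6 3 + y6 * B 3 6 6 + y4 * (B 3 4 6 + B 3 5 3) + y5 * (B 3 5 6 - B 3 4 3) = 0 \<and>
    y3 * B 3 6 5 - y6 * B 3 6 4 + y4 * (B 3 5 5 - B 3 4 4) - y5 * (B 3 4 5 + B 3 5 4) = 0 \<and>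
    y3 * B 3 6 4 + y6 * B 3 6 5 + y4 * (B 3 4 5 + B 3 5 4) + y5 * (B 3 5 5 - B 3 4 4) = 0 \<and>
    y3 * (B 3 4 3 + B 3 5 6) + y6 * (B 3 4 6 - B 3 5 3) + y4 * B 4 5 6 - y5 * B 4 5 3 = 0 \<and>
    y3 * (B 3 4 6 - B 3 5 3) - y6 * (B 3 4 3 + B 3 5 6) - y4 * B 4 5 3 - y5 * B 4 5 6 = 0"

lemma common_kernel_q:
  obtains y3 y4 y5 y6 where "q_kernel y3 y4 y5 y6"
proof -
  define P Q S P' Q' S' where
    "P = Complex (B 3 6 6) (- B 3 6 3)" and "Q = Complex (B 3 6 5) (- B 3 6 4)" and
    "S = Complex (B 3 4 3 + B 3 5 6) (B 3 4 6 - B 3 5 3)" and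
    "P' = Complex (B 3 5 6 - B 3 4 3) (- B 3 4 6 - B 3 5 3)" and
    "Q' = Complex (B 3 5 5 - B 3 4 4) (- B 3 4 5 - B 3 5 4)" and "S' = Complex (B 4 5 6) (- B 4 5 3)"
  note defs = this
  have eq: "P * Q' = Q * P'" "P * S' = S * P'" "Q * S' = S * Q'"
    unfolding complex_eq_iff defs using ad_commute by simp_all
  obtain l m where lm: "l \<noteq> 0 \<or> m \<noteq> 0" "l * P + m * P' = 0" "l * Q + m * Q' = 0" "l * S + m * S' = 0"
  proof (cases "P = 0 \<and> Q = 0 \<and> S = 0")
    case True
    then show ?thesis using that[of 1 0] by simp
  next
    case False
    then consider "P \<noteq> 0" | "Q \<noteq> 0" | "S \<noteq> 0" by blast
    then show ?thesis
    proof cases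
      case 1 then show ?thesis using that[of "- P'" P] eq by (simp add: mult.commute)
    next
      case 2 then show ?thesis using that[of "- Q'" Q] eq by (simp add: mult.commute)
    next
      case 3 then show ?thesis using that[of "- S'" S] eq by (simp add: mult.commute)
    qed
  qed
  define n where "n = sqrt ((cmod l)\<^sup>2 + (cmod m)\<^sup>2)"
  have n: "n * n = (cmod l)\<^sup>2 + (cmod m)\<^sup>2" "n \<noteq> 0"
    using lm(1) by (auto simp: n_def sum_power2_eq_zero_iff)
  define l' m' where "l' = l / of_real n" and "m' = m / of_real n"
  have z: "l' * P + m' * P' = 0" "l' * Q + m' * Q' = 0" "l' * S + m' * S' = 0"
    using lm n by (simp_all add: l'_def m'_def add_divide_distrib[symmetric])
  have "Re l' * Re l' + Re m' * Re m' + (- Im m') * (- Im m') + (- Im l') * (- Im l') = 1"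
  proof -
    have "Re l * Re l + Im l * Im l + Re m * Re m + Im m * Im m = n * n"
      unfolding n(1) cmod_power2 by (simp add: power2_eq_square)
    then show ?thesis using n(2) unfolding l'_def m'_def by (simp add: field_simps)
  qed
  moreover note z[unfolded complex_eq_iff]
  ultimately show ?thesis
    using that[of "Re l'" "Re m'" "- Im m'" "- Im l'"] by (simp add: q_kernel_def defs algebra_simps)
qed

lemma rot_reduced:
  assumes E: "q_kernel y3 y4 y5 y6"
  defines "b' \<equiv> rot y3 y4 y5 y6 b" and "c' \<equiv> rot_coord y3 y4 y5 y6 c"
  shows "g2_lie_frame.B b' c' br 3 6 3 = 0" "g2_lie_frame.B b' c' br 3 6 4 = 0"
    "g2_lie_frame.B b' c' br 3 6 5 = 0" "g2_lie_frame.B b' c' br 3 6 6 = 0"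
    "g2_lie_frame.B b' c' br 3 5 3 = g2_lie_frame.B b' c' br 3 4 6"
    "g2_lie_frame.B b' c' br 3 5 4 = g2_lie_frame.B b' c' br 3 4 5"
    "g2_lie_frame.B b' c' br 3 5 5 = - g2_lie_frame.B b' c' br 3 4 4"
    "g2_lie_frame.B b' c' br 3 5 6 = - g2_lie_frame.B b' c' br 3 4 3"
proof -
  interpret R: central_g2 b' c' \<phi> br
    unfolding b'_def c'_def by (rule central_g2_rot) (use E in \<open>simp add: q_kernel_def\<close>)
  note lin = bilinear_ladd[OF bilinear_br] bilinear_radd[OF bilinear_br]
    bilinear_lsub[OF bilinear_br] bilinear_rsub[OF bilinear_br]
    bilinear_lmul[OF bilinear_br] bilinear_rmul[OF bilinear_br]
    bilinear_lneg[OF bilinear_br] bilinear_rneg[OF bilinear_br]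
  define x where "x = b' 3"
  define X where "X j r = c r (br x (b j))" for j r
  have X: "X j r = y3 * B 3 j r + y4 * B 4 j r + y5 * B 5 j r + y6 * B 6 j r" if "r < 7" for j r
    using that by (simp add: X_def x_def b'_def rot_simps B_def lin coord_simps)
  have rel: "X 6 6 = - X 3 3" "X 6 3 = X 3 6" "X 6 5 = - X 3 4" "X 6 4 = X 3 5"
    "X 5 6 = - X 4 3" "X 5 3 = X 4 6" "X 5 5 = - X 4 4" "X 5 4 = X 4 5"
    unfolding X[OF less_7(4)] X[OF less_7(5)] X[OF less_7(6)] X[OF less_7(7)] B_swap_nums B_abelian
    using E unfolding q_kernel_def B_abelian by (simp_all add: algebra_simps)
  have self: "y3 * X 3 r + y4 * X 4 r + y5 * X 5 r + y6 * X 6 r = 0" if "r < 7" for r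
  proof -
    have "c r (br x x) = y3 * X 3 r + y4 * X 4 r + y5 * X 5 r + y6 * X 6 r"
      unfolding X_def using that by (subst (2) x_def) (simp add: b'_def rot_simps lin coord_simps)
    then show ?thesis using that by (simp add: br_self coord_simps)
  qed
  note self' = self[OF less_7(4)] self[OF less_7(5)] self[OF less_7(6)] self[OF less_7(7)]
  have RB: "R.B 3 j r = c' r (br x (b' j))" for j r by (simp add: R.B_def x_def)
  note ev = b'_def c'_def rot_coord_def rot_simps lin coord_simps X_def[symmetric] rel
  have "c 3 (br x (b' 6)) = 0" "c 4 (br x (b' 6)) = 0" "c 5 (br x (b' 6)) = 0" "c 6 (br x (b' 6)) = 0"
    using self'[unfolded rel] by (simp_all add: ev)
  then show "R.B 3 6 3 = 0" "R.B 3 6 4 = 0" "R.B 3 6 5 = 0" "R.B 3 6 6 = 0"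
    unfolding RB by (simp_all add: c'_def rot_coord_def rot_simps)
  show "R.B 3 5 3 = R.B 3 4 6" "R.B 3 5 4 = R.B 3 4 5" "R.B 3 5 5 = - R.B 3 4 4" "R.B 3 5 6 = - R.B 3 4 3"
    unfolding RB by (simp_all add: ev algebra_simps)
qed

definition q_reduced :: bool where
  "q_reduced \<longleftrightarrow> (\<forall>r\<in>{3, 4, 5, 6}. B 3 4 r = 0 \<and> B 3 5 r = 0 \<and> B 3 6 r = 0 \<and> B 4 6 r = 0 \<and> B 5 6 r = 0)
     \<and> B 4 5 4 = 0 \<and> B 4 5 5 = 0"

lemma q_reducedI:
  assumes a: "B 3 6 3 = 0" "B 3 6 4 = 0" "B 3 6 5 = 0" "B 3 6 6 = 0"
    and h: "B 3 5 3 = B 3 4 6" "B 3 5 4 = B 3 4 5" "B 3 5 5 = - B 3 4 4" "B 3 5 6 = - B 3 4 3"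
  shows q_reduced
proof -
  have e: "B 4 5 5 = 2 * B 3 4 3" "B 4 5 4 = - 2 * B 3 4 6"
    using B_abelian h by simp_all
  note J = jacobi_q_elim[unfolded a h]
  have "B 3 4 3 * B 3 4 3 + B 3 4 6 * B 3 4 6 = 0" using J(4) e h by algebra
  then have g: "B 3 4 3 = 0" "B 3 4 6 = 0" by (simp_all add: sum_squares_eq_zero_iff)
  have "B 3 4 4 * B 3 4 4 + B 3 4 5 * B 3 4 5 = 0" using J(6) J(7) e g by algebra
  then have "B 3 4 4 = 0" "B 3 4 5 = 0" by (simp_all add: sum_squares_eq_zero_iff)
  then show ?thesis using a h g e B_abelian by (simp add: q_reduced_def)
qed

lemmas br_linear = bilinear_ladd[OF bilinear_br] bilinear_radd[OF bilinear_br]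
  bilinear_lsub[OF bilinear_br] bilinear_rsub[OF bilinear_br]
  bilinear_lmul[OF bilinear_br] bilinear_rmul[OF bilinear_br]
  bilinear_lneg[OF bilinear_br] bilinear_rneg[OF bilinear_br]

lemma q_reducedD:
  assumes q_reduced
  shows "B 3 4 3 = 0" "B 3 4 4 = 0" "B 3 4 5 = 0" "B 3 4 6 = 0" "B 3 5 3 = 0" "B 3 5 4 = 0" "B 3 5 5 = 0" "B 3 5 6 = 0"
    "B 3 6 3 = 0" "B 3 6 4 = 0" "B 3 6 5 = 0" "B 3 6 6 = 0" "B 4 6 3 = 0" "B 4 6 4 = 0" "B 4 6 5 = 0" "B 4 6 6 = 0"
    "B 5 6 3 = 0" "B 5 6 4 = 0" "B 5 6 5 = 0" "B 5 6 6 = 0" "B 4 5 4 = 0" "B 4 5 5 = 0"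
  using assms by (simp_all add: q_reduced_def)

lemma q_reduced_exists:
  obtains b' c' where "central_g2 b' c' \<phi> br" "central_g2.q_reduced b' c' br"
proof -
  obtain y3 y4 y5 y6 where E: "q_kernel y3 y4 y5 y6" by (rule common_kernel_q)
  then have n: "y3 * y3 + y4 * y4 + y5 * y5 + y6 * y6 = 1" by (simp add: q_kernel_def)
  note R = central_g2_rot[OF n]
  from central_g2.q_reducedI[OF R rot_reduced[OF E]] R show ?thesis by (rule that[rotated])
qed

lemma q_reduced_exists':
  assumes red: q_reduced
  obtains b' c' where "central_g2 b' c' \<phi> br" "central_g2.q_reduced b' c' br" "g2_lie_frame.B b' c' br 4 5 6 = 0"
proof (cases "B 4 5 6 = 0")
  case True
  then show ?thesis using red central_g2_axioms that by blast
next
  case False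
  define n where "n = sqrt (B 4 5 3 * B 4 5 3 + B 4 5 6 * B 4 5 6)"
  have pos: "B 4 5 3 * B 4 5 3 + B 4 5 6 * B 4 5 6 > 0"
    using False sum_squares_gt_zero_iff[of "B 4 5 3" "B 4 5 6"] by simp
  then have nn: "n * n = B 4 5 3 * B 4 5 3 + B 4 5 6 * B 4 5 6" "n > 0" by (simp_all add: n_def)
  define y3 y6 where "y3 = B 4 5 3 / n" and "y6 = B 4 5 6 / n"
  have y: "n * y3 = B 4 5 3" "n * y6 = B 4 5 6" using nn by (simp_all add: y3_def y6_def)
  have "n * n * (y3 * y3 + y6 * y6) = n * n" using nn(1) y by algebra
  then have n1: "y3 * y3 + 0 * 0 + 0 * 0 + y6 * y6 = 1" using nn(2) by simp
  interpret R: central_g2 "rot y3 0 0 y6 b" "rot_coord y3 0 0 y6 c" \<phi> br by (rule central_g2_rot[OF n1])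
  note ev = R.B_def rot_coord_def rot_simps br_linear coord_simps B_def[symmetric] B_swap_nums q_reducedD[OF red]
  have "R.q_reduced" unfolding R.q_reduced_def by (simp add: ev br_self)
  moreover have "R.B 4 5 6 = 0"
    using n1 by (simp add: ev br_self y[symmetric] algebra_simps)
  ultimately show ?thesis using that R.central_g2_axioms by blast
qed

end

context central_g2
begin

lemma B_closed_e:
  assumes red: q_reduced and z: "B 4 5 6 = 0"
  shows "B 2 4 1 = B 2 5 0" "B 2 3 1 = B 2 6 0" "B 2 6 1 = - B 2 3 0" "B 2 5 1 = - B 2 4 0 - B 4 5 3"
    "B 2 6 6 = - B 2 3 3 - B 2 4 4 - B 2 5 5" "B 2 3 6 + B 2 4 5 = B 2 5 4 + B 2 6 3"
  using d_closed(31-35) trace_br_q(1) B_e B_z q_reducedD[OF red] z by linarith+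

lemma center_if_q_nonabelian:
  assumes red: q_reduced and z: "B 4 5 6 = 0" and n: "B 4 5 3 \<noteq> 0"
  shows "B 2 3 0 = 0" "B 2 3 1 = 0" "B 2 3 3 = 0" "B 2 3 4 = 0" "B 2 3 5 = 0" "B 2 3 6 = 0"
    "B 2 6 0 = 0" "B 2 6 1 = 0" "B 2 6 3 = 0" "B 2 6 4 = 0" "B 2 6 5 = 0" "B 2 6 6 = 0"
    "B 2 4 4 = 0" "B 2 4 5 = 0" "B 2 5 4 = 0" "B 2 5 5 = 0"
proof -
  note q = q_reducedD[OF red] z
  note simps = B_e q B_swap_nums mult_zero_left mult_zero_right mult_minus_left mult_minus_right minus_zero
    add_0_left add_0_right diff_0_right diff_zero
  have J456: "B 4 5 3 * B 3 6 0 = 0" "B 4 5 3 * B 3 6 1 = 0"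
    using jacobi_coord[OF less_7(5) less_7(6) less_7(7) less_7(1)] jacobi_coord[OF less_7(5) less_7(6) less_7(7)
        less_7(2)]
    unfolding simps by linarith+
  have J1: "B 2 3 5 * B 4 5 3 = 0" "B 2 3 4 * B 4 5 3 = 0"
    using jacobi_coord[OF less_7(3) less_7(4) less_7(5) less_7(4)] jacobi_coord[OF less_7(3) less_7(4) less_7(6)
        less_7(4)] unfolding simps by linarith+
  have a: "B 2 3 4 = 0" "B 2 3 5 = 0" "B 3 6 0 = 0" "B 3 6 1 = 0" using J1 J456 n by simp_all
  then have a': "B 2 6 4 = 0" "B 2 6 5 = 0" using B_z by simp_all
  have J2: "B 4 5 3 * B 2 3 6 = 0" "B 4 5 3 * (B 2 3 3 - B 2 4 4 - B 2 5 5) = 0"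
    using jacobi_coord[OF less_7(3) less_7(5) less_7(6) less_7(7)] jacobi_coord[OF less_7(3) less_7(5) less_7(6)
        less_7(4)] unfolding simps a by algebra+
  have b: "B 2 3 6 = 0" "B 2 5 5 = B 2 3 3 - B 2 4 4" "B 2 6 6 = - 2 * B 2 3 3" "B 2 6 3 = B 2 4 5 - B 2 5 4"
    using J2 n B_closed_e[OF red z] by simp_all
  let ?k = "B 2 3 3" and ?m = "B 2 4 4" and ?x = "B 2 4 5" and ?y = "B 2 5 4"
  have Z: "B 3 4 0 = ?x" "B 3 4 1 = - (?k + ?m)" "B 3 5 0 = 2 * ?k - ?m" "B 3 5 1 = - ?y"
    "B 4 6 0 = 2 * ?k - ?m" "B 4 6 1 = - ?y" "B 5 6 0 = - ?x" "B 5 6 1 = ?k + ?m"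
    using B_z a a' b by simp_all
  note J34 = jacobi_coord[OF less_7(3) less_7(4) less_7(5) less_7(1)] jacobi_coord[OF less_7(3) less_7(4) less_7(5)
      less_7(2)]
  note J35 = jacobi_coord[OF less_7(3) less_7(4) less_7(6) less_7(1)] jacobi_coord[OF less_7(3) less_7(4) less_7(6)
      less_7(2)]
  note J46 = jacobi_coord[OF less_7(3) less_7(5) less_7(7) less_7(1)] jacobi_coord[OF less_7(3) less_7(5) less_7(7)
      less_7(2)]
  note J56 = jacobi_coord[OF less_7(3) less_7(6) less_7(7) less_7(1)] jacobi_coord[OF less_7(3) less_7(6) less_7(7)
      less_7(2)]
  note J45 = jacobi_coord[OF less_7(3) less_7(5) less_7(6) less_7(1)] jacobi_coord[OF less_7(3) less_7(5) less_7(6)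
      less_7(2)]
  have k: "?k = 0"
  proof (rule ccontr)
    assume k: "?k \<noteq> 0"
    have "?k * ?x = 0" "?k * ?y = 0" using J34 J35 unfolding simps a a' b Z by algebra+
    with k have xy: "?x = 0" "?y = 0" by simp_all
    have "(?k + ?m) * (?k + ?m) = 0" "(2 * ?k - ?m) * (2 * ?k - ?m) = 0"
      using J34 J35 xy unfolding simps a a' b Z by algebra+
    with k show False by simp
  qed
  have "?m * ?m + ?x * ?y = 0" using J34 k unfolding simps a a' b Z by algebra
  moreover have "?x * (?x - ?y) = 0"
    using J34 J46 k unfolding simps a a' b Z by algebra
  moreover have "?y * (?x - ?y) = 0"
    using J34 J56 k unfolding simps a a' b Z by algebra
  ultimately have xy: "?x = ?y" "?m * ?m + ?x * ?x = 0" by algebra+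
  then have m: "?m = 0" "?x = 0" "?y = 0" by (simp_all add: sum_squares_eq_zero_iff)
  have "B 4 5 3 * B 2 3 0 = 0" "B 4 5 3 * B 2 3 1 = 0"
    using J45 unfolding simps a a' b Z k m by simp_all
  with n have e: "B 2 3 0 = 0" "B 2 3 1 = 0" by simp_all
  show "B 2 3 0 = 0" "B 2 3 1 = 0" "B 2 3 3 = 0" "B 2 3 4 = 0" "B 2 3 5 = 0" "B 2 3 6 = 0"
    "B 2 6 0 = 0" "B 2 6 1 = 0" "B 2 6 3 = 0" "B 2 6 4 = 0" "B 2 6 5 = 0" "B 2 6 6 = 0"
    "B 2 4 4 = 0" "B 2 4 5 = 0" "B 2 5 4 = 0" "B 2 5 5 = 0"
    using e k m a a' b B_closed_e[OF red z] by simp_all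
qed

end

section \<open>Recognising the nilpotent Lie algebras\<close>

context
  fixes br :: "'a::real_vector \<Rightarrow> 'a \<Rightarrow> 'a"
  assumes lie: "lie_algebra br" and dim: "dim (UNIV :: 'a set) = 7"
begin

private lemmas br_simps = lie_simps[OF lie]

lemma lie_isomorphic_nn2I:
  assumes S: "\<And>z y. z \<in> S \<Longrightarrow> br z y = 0" and sp: "span ({y1, y2, y3} \<union> S) = UNIV"
    and y: "br y2 y3 = 0" "\<And>x. br (br y1 y2) x = 0" "\<And>x. br (br y1 y3) x = 0"
    and ind: "\<And>p q r s t. p *\<^sub>R y1 + q *\<^sub>R y2 + r *\<^sub>R y3 + s *\<^sub>R br y1 y2 + t *\<^sub>R br y1 y3 = 0
      \<Longrightarrow> p = 0 \<and> q = 0 \<and> r = 0 \<and> s = 0 \<and> t = 0"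
  shows "lie_isomorphic br \<nn>\<^sub>2"
proof -
  define v where "v = (!) [y1, y2, y3, 0, - br y1 y2, - br y1 y3]"
  have v: "v 0 = y1" "v 1 = y2" "v 2 = y3" "v 4 = - br y1 y2" "v 5 = - br y1 y3" by (simp_all add: v_def)
  obtain w c where w: "frame w c" "\<And>i. i \<in> {0, 1, 2, 4, 5} \<Longrightarrow> w i = v i"
    "\<And>i. i < 7 \<Longrightarrow> i \<notin> {0, 1, 2, 4, 5} \<Longrightarrow> w i \<in> S"
  proof (rule frame_completion[OF dim, of "{0, 1, 2, 4, 5}" v S])
    fix a i assume "(\<Sum>i\<in>{0, 1, 2, 4, 5}. a i *\<^sub>R v i) = 0" and i: "i \<in> {0, 1, 2, 4, 5::nat}"
    then have "a 0 *\<^sub>R y1 + a 1 *\<^sub>R y2 + a 2 *\<^sub>R y3 + (- a 4) *\<^sub>R br y1 y2 + (- a 5) *\<^sub>R br y1 y3 = 0"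
      by (simp add: v algebra_simps del: One_nat_def)
    from ind[OF this] show "a i = 0" using i by auto
  next
    have "{y1, y2, y3} \<union> S \<subseteq> v ` {0, 1, 2, 4, 5} \<union> S" by (auto simp: v simp del: One_nat_def)
    then show "span (v ` {0, 1, 2, 4, 5} \<union> S) = UNIV" using sp span_mono by blast
  qed (use that in auto)
  have c: "br x (w 3) = 0" "br x (w 6) = 0" "br (w 3) x = 0" "br (w 6) x = 0" for x
    using S[OF w(3)[of 3]] S[OF w(3)[of 6]] lie_swap[OF lie, of "w 3" x] lie_swap[OF lie, of "w 6" x] by simp_all
  have c': "br x (br y1 y2) = 0" "br x (br y1 y3) = 0" for x
    using y lie_swap[OF lie, of "br y1 y2" x] lie_swap[OF lie, of "br y1 y3" x] by simp_all
  have w': "w 0 = y1" "w 1 = y2" "w 2 = y3" "w 4 = - br y1 y2" "w 5 = - br y1 y3" using w(2) v by simp_all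
  show ?thesis
    unfolding lie_isomorphic_nn2_iff[OF lie]
    by (intro exI[of _ w] exI[of _ c]) (simp add: brackets_def w(1) w' c c' y br_simps del: One_nat_def)
qed

lemma lie_isomorphic_nn3I:
  assumes S: "\<And>z y. z \<in> S \<Longrightarrow> br z y = 0" and sp: "span ({y1, y2, y3} \<union> S) = UNIV"
    and y: "\<And>x. br (br y1 y2) x = 0" "\<And>x. br (br y1 y3) x = 0" "\<And>x. br (br y2 y3) x = 0"
    and ind: "\<And>p q r s t u. p *\<^sub>R y1 + q *\<^sub>R y2 + r *\<^sub>R y3 + s *\<^sub>R br y1 y2 + t *\<^sub>R br y1 y3 + u *\<^sub>R br y2 y3 = 0
      \<Longrightarrow> p = 0 \<and> q = 0 \<and> r = 0 \<and> s = 0 \<and> t = 0 \<and> u = 0"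
  shows "lie_isomorphic br \<nn>\<^sub>3"
proof -
  define v where "v = (!) [y1, y2, y3, - br y1 y2, - br y1 y3, - br y2 y3]"
  have v: "v 0 = y1" "v 1 = y2" "v 2 = y3" "v 3 = - br y1 y2" "v 4 = - br y1 y3" "v 5 = - br y2 y3"
      by (simp_all add: v_def)
  obtain w c where w: "frame w c" "\<And>i. i \<in> {0, 1, 2, 3, 4, 5} \<Longrightarrow> w i = v i"
    "\<And>i. i < 7 \<Longrightarrow> i \<notin> {0, 1, 2, 3, 4, 5} \<Longrightarrow> w i \<in> S"
  proof (rule frame_completion[OF dim, of "{0, 1, 2, 3, 4, 5}" v S])
    fix a i assume "(\<Sum>i\<in>{0, 1, 2, 3, 4, 5}. a i *\<^sub>R v i) = 0" and i: "i \<in> {0, 1, 2, 3, 4, 5::nat}"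
    then have "a 0 *\<^sub>R y1 + a 1 *\<^sub>R y2 + a 2 *\<^sub>R y3 + (- a 3) *\<^sub>R br y1 y2 + (- a 4) *\<^sub>R br y1 y3
        + (- a 5) *\<^sub>R br y2 y3 = 0"
      by (simp add: v algebra_simps del: One_nat_def)
    from ind[OF this] show "a i = 0" using i by auto
  next
    have "{y1, y2, y3} \<union> S \<subseteq> v ` {0, 1, 2, 3, 4, 5} \<union> S" by (auto simp: v simp del: One_nat_def)
    then show "span (v ` {0, 1, 2, 3, 4, 5} \<union> S) = UNIV" using sp span_mono by blast
  qed (use that in auto)
  have c: "br x (w 6) = 0" "br (w 6) x = 0" for x
    using S[OF w(3)[of 6]] lie_swap[OF lie, of "w 6" x] by simp_all
  have c': "br x (br y1 y2) = 0" "br x (br y1 y3) = 0" "br x (br y2 y3) = 0" for x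
    using y lie_swap[OF lie, of "br y1 y2" x] lie_swap[OF lie, of "br y1 y3" x] lie_swap[OF lie, of "br y2 y3" x] by
        simp_all
  have w': "w 0 = y1" "w 1 = y2" "w 2 = y3" "w 3 = - br y1 y2" "w 4 = - br y1 y3" "w 5 = - br y2 y3"
      using w(2) v by simp_all
  show ?thesis
    unfolding lie_isomorphic_nn3_iff[OF lie]
    by (intro exI[of _ w] exI[of _ c]) (simp add: brackets_def w(1) w' c c' y br_simps del: One_nat_def)
qed

lemma two_step_dependent:
  assumes S: "\<And>z y. z \<in> S \<Longrightarrow> br z y = 0" and sp: "span ({y1, y2, y3} \<union> S) = UNIV"
    and ind: "\<And>p q r z. z \<in> span S \<Longrightarrow> p *\<^sub>R y1 + q *\<^sub>R y2 + r *\<^sub>R y3 + z = 0 \<Longrightarrow> p = 0 \<and> q = 0 \<and> r = 0"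
    and br: "br y1 y2 \<in> span S" "br y1 y3 \<in> span S" and w: "br y2 y3 = l *\<^sub>R br y1 y2 + m *\<^sub>R br y1 y3"
  shows "lie_isomorphic br \<nn>\<^sub>2 \<or> (\<exists>z p q r. br y1 y2 = p *\<^sub>R z \<and> br y1 y3 = q *\<^sub>R z \<and> br y2 y3 = r *\<^sub>R z)"
proof (cases "\<exists>p q. (p \<noteq> 0 \<or> q \<noteq> 0) \<and> p *\<^sub>R br y1 y2 + q *\<^sub>R br y1 y3 = 0")
  case True
  then obtain p q where pq: "p \<noteq> 0 \<or> q \<noteq> 0" "p *\<^sub>R br y1 y2 + q *\<^sub>R br y1 y3 = 0" by blast
  show ?thesis
  proof (cases "p = 0")
    case False
    have "p *\<^sub>R br y1 y2 = - (q *\<^sub>R br y1 y3)" using pq(2) by (simp add: eq_neg_iff_add_eq_0)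
    then have "(1 / p) *\<^sub>R (p *\<^sub>R br y1 y2) = (1 / p) *\<^sub>R - (q *\<^sub>R br y1 y3)" by simp
    then have e: "br y1 y2 = (- q / p) *\<^sub>R br y1 y3" using False by simp
    have "br y2 y3 = (l * (- q / p) + m) *\<^sub>R br y1 y3" using w e by (metis scaleR_left_distrib scaleR_scaleR)
    then show ?thesis using e scaleR_one[of "br y1 y3"] by metis
  next
    case True
    then have "br y1 y3 = 0" using pq by simp
    then have "br y1 y3 = 0 *\<^sub>R br y1 y2" "br y2 y3 = l *\<^sub>R br y1 y2" using w by simp_all
    then show ?thesis using scaleR_one[of "br y1 y2"] by metis
  qed
next
  case False
  then have i2: "p = 0 \<and> q = 0" if "p *\<^sub>R br y1 y2 + q *\<^sub>R br y1 y3 = 0" for p q using that by blast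
  have cen: "br z x = 0" if "z \<in> span S" for z x
  proof -
    have "linear (\<lambda>z. br z x)" using lie_bilinear[OF lie] by (simp add: bilinear_def)
    then show ?thesis using linear_eq_0_on_span[of "\<lambda>z. br z x" S z] S that by blast
  qed
  define x2 x3 where "x2 = y2 - m *\<^sub>R y1" and "x3 = y3 + l *\<^sub>R y1"
  have b: "br y1 x2 = br y1 y2" "br y1 x3 = br y1 y3"
    by (simp_all add: x2_def x3_def br_simps)
  have "br x2 x3 = 0"
    using lie_swap[OF lie, of y1 y2] by (simp add: x2_def x3_def br_simps w algebra_simps)
  moreover have "span ({y1, x2, x3} \<union> S) = UNIV"
  proof -
    have y1: "y1 \<in> span ({y1, x2, x3} \<union> S)" by (simp add: span_base)
    have "x2 + m *\<^sub>R y1 \<in> span ({y1, x2, x3} \<union> S)" "x3 - l *\<^sub>R y1 \<in> span ({y1, x2, x3} \<union> S)"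
      by (intro span_add span_diff span_scale y1; simp add: span_base)+
    then have "{y1, y2, y3} \<union> S \<subseteq> span ({y1, x2, x3} \<union> S)"
      using y1 by (auto simp: x2_def x3_def span_base)
    then have "span ({y1, y2, y3} \<union> S) \<subseteq> span ({y1, x2, x3} \<union> S)"
      by (rule span_minimal) (rule subspace_span)
    then show ?thesis using sp by auto
  qed
  moreover have "p = 0 \<and> q = 0 \<and> r = 0 \<and> s = 0 \<and> t = 0"
    if "p *\<^sub>R y1 + q *\<^sub>R x2 + r *\<^sub>R x3 + s *\<^sub>R br y1 x2 + t *\<^sub>R br y1 x3 = 0" for p q r s t
  proof -
    have z: "s *\<^sub>R br y1 y2 + t *\<^sub>R br y1 y3 \<in> span S" using br by (intro span_add span_scale)
    have "(p - q * m + r * l) *\<^sub>R y1 + q *\<^sub>R y2 + r *\<^sub>R y3 + (s *\<^sub>R br y1 y2 + t *\<^sub>R br y1 y3) = 0"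
      using that unfolding b by (simp add: x2_def x3_def algebra_simps)
    from ind[OF z this] have "q = 0" "r = 0" "p = 0" by auto
    with that i2[of s t] b show ?thesis by simp
  qed
  ultimately have "lie_isomorphic br \<nn>\<^sub>2"
    using lie_isomorphic_nn2I[OF S, of S y1 x2 x3] cen br b by simp
  then show ?thesis ..
qed

lemma two_step:
  assumes S: "\<And>z y. z \<in> S \<Longrightarrow> br z y = 0" and sp: "span ({y1, y2, y3} \<union> S) = UNIV"
    and ind: "\<And>p q r z. z \<in> span S \<Longrightarrow> p *\<^sub>R y1 + q *\<^sub>R y2 + r *\<^sub>R y3 + z = 0 \<Longrightarrow> p = 0 \<and> q = 0 \<and> r = 0"
    and br: "br y1 y2 \<in> span S" "br y1 y3 \<in> span S" "br y2 y3 \<in> span S"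
  shows "lie_isomorphic br \<nn>\<^sub>2 \<or> lie_isomorphic br \<nn>\<^sub>3
    \<or> (\<exists>z p q r. br y1 y2 = p *\<^sub>R z \<and> br y1 y3 = q *\<^sub>R z \<and> br y2 y3 = r *\<^sub>R z)"
proof (cases "\<exists>p q r. (p \<noteq> 0 \<or> q \<noteq> 0 \<or> r \<noteq> 0) \<and> p *\<^sub>R br y1 y2 + q *\<^sub>R br y1 y3 + r *\<^sub>R br y2 y3 = 0")
  case False
  have cen: "br z x = 0" if "z \<in> span S" for z x
  proof -
    have "linear (\<lambda>z. br z x)" using lie_bilinear[OF lie] by (simp add: bilinear_def)
    then show ?thesis using linear_eq_0_on_span[of "\<lambda>z. br z x" S z] S that by blast
  qed
  have "p = 0 \<and> q = 0 \<and> r = 0 \<and> s = 0 \<and> t = 0 \<and> u = 0"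
    if h: "p *\<^sub>R y1 + q *\<^sub>R y2 + r *\<^sub>R y3 + s *\<^sub>R br y1 y2 + t *\<^sub>R br y1 y3 + u *\<^sub>R br y2 y3 = 0" for p q r s t u
  proof -
    have z: "s *\<^sub>R br y1 y2 + t *\<^sub>R br y1 y3 + u *\<^sub>R br y2 y3 \<in> span S" using br by (intro span_add span_scale)
    have pqr: "p = 0 \<and> q = 0 \<and> r = 0" by (rule ind[OF z]) (use h in \<open>simp add: algebra_simps\<close>)
    then have "s *\<^sub>R br y1 y2 + t *\<^sub>R br y1 y3 + u *\<^sub>R br y2 y3 = 0" using h by simp
    then have "s = 0 \<and> t = 0 \<and> u = 0" using False by blast
    with pqr show ?thesis by blast
  qed
  then have "lie_isomorphic br \<nn>\<^sub>3"
    using lie_isomorphic_nn3I[OF S sp] cen br by blast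
  then show ?thesis by blast
next
  case True
  then obtain p q r where h: "p \<noteq> 0 \<or> q \<noteq> 0 \<or> r \<noteq> 0" "p *\<^sub>R br y1 y2 + q *\<^sub>R br y1 y3 + r *\<^sub>R br y2 y3 = 0"
    by blast
  have sw: "br y2 y1 = - br y1 y2" "br y3 y1 = - br y1 y3" "br y3 y2 = - br y2 y3"
    by (rule lie_swap[OF lie])+
  have sps: "span ({y2, y1, y3} \<union> S) = UNIV" "span ({y3, y1, y2} \<union> S) = UNIV"
    using sp by (simp_all add: insert_commute)
  have solve: "x = (- p' / r') *\<^sub>R y + (- q' / r') *\<^sub>R z" if "p' *\<^sub>R y + q' *\<^sub>R z + r' *\<^sub>R x = 0" "r' \<noteq> 0"
      for x y z :: 'a and p' q' r'
  proof -
    have "r' *\<^sub>R x = - (p' *\<^sub>R y + q' *\<^sub>R z)" using that(1) by (metis add.commute eq_neg_iff_add_eq_0)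
    then have "(1 / r') *\<^sub>R (r' *\<^sub>R x) = (1 / r') *\<^sub>R - (p' *\<^sub>R y + q' *\<^sub>R z)" by simp
    then show ?thesis using that(2) by (simp add: algebra_simps)
  qed
  consider "r \<noteq> 0" | "q \<noteq> 0" | "p \<noteq> 0" using h(1) by blast
  then show ?thesis
  proof cases
    case 1
    have "lie_isomorphic br \<nn>\<^sub>2 \<or> (\<exists>z p q r. br y1 y2 = p *\<^sub>R z \<and> br y1 y3 = q *\<^sub>R z \<and> br y2 y3 = r *\<^sub>R z)"
      by (rule two_step_dependent[OF S sp ind br(1,2) solve[OF h(2) 1]])
    then show ?thesis by (elim disjE) simp_all
  next
    case 2
    have i: "p = 0 \<and> q = 0 \<and> r = 0" if "z \<in> span S" "p *\<^sub>R y2 + q *\<^sub>R y1 + r *\<^sub>R y3 + z = 0" for p q r z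
      using ind[OF that(1), of q p r] that(2) by (simp add: algebra_simps)
    have "(- p) *\<^sub>R br y2 y1 + r *\<^sub>R br y2 y3 + q *\<^sub>R br y1 y3 = 0" using h(2) by (simp add: sw algebra_simps)
    note d = solve[OF this 2]
    have b: "br y2 y1 \<in> span S" using br by (simp add: sw span_neg)
    have "lie_isomorphic br \<nn>\<^sub>2 \<or> (\<exists>z p q r. br y2 y1 = p *\<^sub>R z \<and> br y2 y3 = q *\<^sub>R z \<and> br y1 y3 = r *\<^sub>R z)"
      by (rule two_step_dependent[OF S sps(1) i b br(3) d])
    then show ?thesis
    proof (elim disjE exE conjE)
      fix z p q r assume "br y2 y1 = p *\<^sub>R z" "br y2 y3 = q *\<^sub>R z" "br y1 y3 = r *\<^sub>R z"
      then have "br y1 y2 = (- p) *\<^sub>R z \<and> br y1 y3 = r *\<^sub>R z \<and> br y2 y3 = q *\<^sub>R z"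
        using lie_swap[OF lie, of y1 y2] by simp
      then show ?thesis by (intro disjI2 exI)
    qed simp
  next
    case 3
    have i: "p = 0 \<and> q = 0 \<and> r = 0" if "z \<in> span S" "p *\<^sub>R y3 + q *\<^sub>R y1 + r *\<^sub>R y2 + z = 0" for p q r z
      using ind[OF that(1), of q r p] that(2) by (simp add: algebra_simps)
    have "(- q) *\<^sub>R br y3 y1 + (- r) *\<^sub>R br y3 y2 + p *\<^sub>R br y1 y2 = 0" using h(2) by (simp add: sw algebra_simps)
    note d = solve[OF this 3]
    have b: "br y3 y1 \<in> span S" "br y3 y2 \<in> span S" using br by (simp_all add: sw span_neg)
    have "lie_isomorphic br \<nn>\<^sub>2 \<or> (\<exists>z p q r. br y3 y1 = p *\<^sub>R z \<and> br y3 y2 = q *\<^sub>R z \<and> br y1 y2 = r *\<^sub>R z)"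
      by (rule two_step_dependent[OF S sps(2) i b d])
    then show ?thesis
    proof (elim disjE exE conjE)
      fix z p q r assume "br y3 y1 = p *\<^sub>R z" "br y3 y2 = q *\<^sub>R z" "br y1 y2 = r *\<^sub>R z"
      then have "br y1 y2 = r *\<^sub>R z \<and> br y1 y3 = (- p) *\<^sub>R z \<and> br y2 y3 = (- q) *\<^sub>R z"
        using lie_swap[OF lie, of y1 y3] lie_swap[OF lie, of y2 y3] by simp
      then show ?thesis by (intro disjI2 exI)
    qed simp
  qed
qed

end

context frame
begin

lemma span_basis: "span (b ` {..<7}) = UNIV"
proof -
  have "x \<in> span (b ` {..<7})" for x
  proof -
    have "(\<Sum>i<7. c i x *\<^sub>R b i) \<in> span (b ` {..<7})" by (intro span_sum span_scale span_base) auto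
    then show ?thesis by (simp add: expansion)
  qed
  then show ?thesis by blast
qed

lemma span_two_step: "span ({b 2, b 4, b 5} \<union> {b 0, b 1, b 3, b 6}) = UNIV"
proof -
  have "b ` {..<7} \<subseteq> {b 2, b 4, b 5} \<union> {b 0, b 1, b 3, b 6}"
    using all_less_7[of "\<lambda>i. b i \<in> {b 2, b 4, b 5} \<union> {b 0, b 1, b 3, b 6}"] by (auto simp del: One_nat_def)
  then show ?thesis using span_mono[of "b ` {..<7}"] by (simp add: span_basis top.extremum_unique)
qed

lemma independent_two_step:
  assumes z: "z \<in> span {b 0, b 1, b 3, b 6}" and h: "p *\<^sub>R b 2 + q *\<^sub>R b 4 + r *\<^sub>R b 5 + z = 0"
  shows "p = 0 \<and> q = 0 \<and> r = 0"
proof -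
  have k: "c i z = 0" if "i = 2 \<or> i = 4 \<or> i = 5" for i
  proof -
    have "linear (c i)" using that by (intro linear_coord) auto
    then show ?thesis
      by (rule linear_eq_0_on_span[OF _ _ z]) (use that in \<open>auto simp: coord_basis simp del: One_nat_def\<close>)
  qed
  show ?thesis
    using arg_cong[OF h, of "c 2"] arg_cong[OF h, of "c 4"] arg_cong[OF h, of "c 5"]
    by (simp add: coord_simps k del: One_nat_def)
qed

lemma mem_span_two_step: "p *\<^sub>R b 0 + q *\<^sub>R b 1 + r *\<^sub>R b 3 + s *\<^sub>R b 6 \<in> span {b 0, b 1, b 3, b 6}"
  by (intro span_add span_scale span_base) auto

end

context central_g2
begin

lemmas br_basis = br_expand[OF less_7(3) less_7(4), unfolded sum_7 B_e]
  br_expand[OF less_7(3) less_7(5), unfolded sum_7 B_e] br_expand[OF less_7(3) less_7(6), unfolded sum_7 B_e]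
  br_expand[OF less_7(3) less_7(7), unfolded sum_7 B_e] br_expand[OF less_7(4) less_7(5), unfolded sum_7 B_e]
  br_expand[OF less_7(4) less_7(6), unfolded sum_7 B_e] br_expand[OF less_7(4) less_7(7), unfolded sum_7 B_e]
  br_expand[OF less_7(5) less_7(6), unfolded sum_7 B_e] br_expand[OF less_7(5) less_7(7), unfolded sum_7 B_e]
  br_expand[OF less_7(6) less_7(7), unfolded sum_7 B_e]

lemma lie_isomorphic_if_q_nonabelian:
  assumes dim: "dim (UNIV :: 'a set) = 7" and red: q_reduced and z: "B 4 5 6 = 0" and n: "B 4 5 3 \<noteq> 0"
  shows "lie_isomorphic br \<nn>\<^sub>2 \<or> lie_isomorphic br \<nn>\<^sub>3"
proof -
  note q = center_if_q_nonabelian[OF red z n] q_reducedD[OF red] z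
  have Z: "B 3 4 0 = 0" "B 3 4 1 = 0" "B 3 5 0 = 0" "B 3 5 1 = 0" "B 3 6 0 = 0" "B 3 6 1 = 0"
    "B 4 6 0 = 0" "B 4 6 1 = 0" "B 5 6 0 = 0" "B 5 6 1 = 0"
    unfolding B_z q by simp_all
  have e: "br (b 2) (b 4) = B 2 4 0 *\<^sub>R b 0 + B 2 4 1 *\<^sub>R b 1 + B 2 4 3 *\<^sub>R b 3 + B 2 4 6 *\<^sub>R b 6"
    "br (b 2) (b 5) = B 2 5 0 *\<^sub>R b 0 + B 2 5 1 *\<^sub>R b 1 + B 2 5 3 *\<^sub>R b 3 + B 2 5 6 *\<^sub>R b 6"
    "br (b 4) (b 5) = B 4 5 0 *\<^sub>R b 0 + B 4 5 1 *\<^sub>R b 1 + B 4 5 3 *\<^sub>R b 3 + 0 *\<^sub>R b 6"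
    "br (b 2) (b 3) = 0" "br (b 2) (b 6) = 0" "br (b 3) (b 4) = 0" "br (b 3) (b 5) = 0" "br (b 3) (b 6) = 0"
    "br (b 4) (b 6) = 0" "br (b 5) (b 6) = 0"
    unfolding br_basis q Z by simp_all
  have s: "br (b 3) (b 0) = 0" "br (b 3) (b 1) = 0" "br (b 3) (b 2) = 0" "br (b 6) (b 0) = 0" "br (b 6) (b 1) = 0"
    "br (b 6) (b 2) = 0" "br (b 6) (b 3) = 0" "br (b 6) (b 4) = 0" "br (b 6) (b 5) = 0"
    by (subst br_swap, simp only: central e minus_zero)+
  have cen: "br x y = 0" if "x \<in> {b 0, b 1, b 3, b 6}" for x y
    using that central central_frameI[OF lie frame_axioms s(1-3) br_self e(6-8), of y]
      central_frameI[OF lie frame_axioms s(4-9) br_self, of y] by auto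
  have "lie_isomorphic br \<nn>\<^sub>2 \<or> lie_isomorphic br \<nn>\<^sub>3
    \<or> (\<exists>z p q r. br (b 2) (b 4) = p *\<^sub>R z \<and> br (b 2) (b 5) = q *\<^sub>R z \<and> br (b 4) (b 5) = r *\<^sub>R z)"
    by (rule two_step[OF lie dim cen span_two_step independent_two_step]) (simp_all only: e mem_span_two_step)
  moreover have False if h: "br (b 2) (b 4) = p *\<^sub>R z" "br (b 2) (b 5) = q *\<^sub>R z" "br (b 4) (b 5) = r *\<^sub>R z" for z p q r
  proof -
    have f: "B 2 4 i = p * c i z" "B 2 5 i = q * c i z" "B 4 5 i = r * c i z" if "i < 7" for i
      using that by (simp_all add: B_def h coord_simps)
    note f' = f[OF less_7(1)] f[OF less_7(2)] f[OF less_7(4)] f[OF less_7(7)]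
    have r: "r \<noteq> 0" "c 3 z \<noteq> 0" using n f'(9) by auto
    have c6: "c 6 z = 0" using r z f'(12) by simp
    have "r * c 0 z = p * c 3 z" "r * c 1 z = q * c 3 z" "q * c 1 z = - (p * c 0 z) - r * c 3 z"
      using B_z(4,10) B_closed_e(4)[OF red z] f' c6 by simp_all
    then have "c 3 z * (r * r + p * p + q * q) = 0" by algebra
    then have "r * r + p * p + q * q = 0" using r by simp
    moreover have "r * r > 0" using r by (simp add: zero_less_mult_iff linorder_neq_iff disj_commute)
    ultimately show False using zero_le_square[of p] zero_le_square[of q] by linarith
  qed
  ultimately show ?thesis by blast
qed

lemma omega_relations:
  assumes red: q_reduced and z: "B 4 5 6 = 0" and ab: "B 4 5 3 = 0"
  shows "B 5 6 0 = - B 3 4 0" "B 5 6 1 = - B 3 4 1" "B 4 6 0 = B 3 5 0" "B 4 6 1 = B 3 5 1"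
  using B_z B_closed_e[OF red z] by simp_all

text \<open>The \<open>b 0\<close>- and \<open>b 1\<close>-components of the bracket are 2-forms \<open>\<Omega>\<close> of type (1,1), annihilated by the
  derivation \<open>br (b 2)\<close>, which maps to them the real and imaginary parts \<open>\<omega>\<close> of a (2,0)-form. Hence
  \<open>\<omega> \<and> \<Omega> = 0\<close> implies \<open>\<Omega> \<and> \<Omega>' = 0\<close>.\<close>

lemma omega_isotropic:
  assumes red: q_reduced and z: "B 4 5 6 = 0" and ab: "B 4 5 3 = 0"
  shows "B 3 6 0 * B 4 5 0 = B 3 4 0 * B 3 4 0 + B 3 5 0 * B 3 5 0"
    "B 3 6 1 * B 4 5 1 = B 3 4 1 * B 3 4 1 + B 3 5 1 * B 3 5 1"
    "B 3 6 0 * B 4 5 1 + B 3 6 1 * B 4 5 0 = 2 * (B 3 4 0 * B 3 4 1) + 2 * (B 3 5 0 * B 3 5 1)"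
proof -
  note simps = B_e q_reducedD[OF red] z ab B_swap_nums mult_zero_left mult_zero_right mult_minus_left mult_minus_right
      minus_zero
    add_0_left add_0_right diff_0_right diff_zero
  have k: "B 2 6 6 = - B 2 3 3 - B 2 4 4 - B 2 5 5" "B 2 6 3 = B 2 3 6 + B 2 4 5 - B 2 5 4"
    using B_closed_e[OF red z] by simp_all
  note J340 = jacobi_coord[OF less_7(3) less_7(4) less_7(5) less_7(1), unfolded simps]
  note J350 = jacobi_coord[OF less_7(3) less_7(4) less_7(6) less_7(1), unfolded simps]
  note J460 = jacobi_coord[OF less_7(3) less_7(5) less_7(7) less_7(1), unfolded simps]
  note J560 = jacobi_coord[OF less_7(3) less_7(6) less_7(7) less_7(1), unfolded simps]
  note J341 = jacobi_coord[OF less_7(3) less_7(4) less_7(5) less_7(2), unfolded simps]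
  note J351 = jacobi_coord[OF less_7(3) less_7(4) less_7(6) less_7(2), unfolded simps]
  note J461 = jacobi_coord[OF less_7(3) less_7(5) less_7(7) less_7(2), unfolded simps]
  note J561 = jacobi_coord[OF less_7(3) less_7(6) less_7(7) less_7(2), unfolded simps]
  show "B 3 6 0 * B 4 5 0 = B 3 4 0 * B 3 4 0 + B 3 5 0 * B 3 5 0"
    using J350 J460 unfolding B_z k by algebra
  show "B 3 6 1 * B 4 5 1 = B 3 4 1 * B 3 4 1 + B 3 5 1 * B 3 5 1"
    using J341 J561 unfolding B_z k by algebra
  show "B 3 6 0 * B 4 5 1 + B 3 6 1 * B 4 5 0 = 2 * (B 3 4 0 * B 3 4 1) + 2 * (B 3 5 0 * B 3 5 1)"
    using J340 J560 unfolding B_z k by algebra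
qed

end

lemma isotropic_proportional:
  fixes p :: real
  assumes "S * T = p * p + r * r" "S' * T' = p' * p' + r' * r'" "S * T' + S' * T = 2 * (p * p') + 2 * (r * r')" "T \<noteq> 0"
  shows "T * p' = p * T'" "T * r' = r * T'" "r * p' = p * r'" "T * S' = r * r' + p * p'"
proof -
  have "(T * p' - p * T') * (T * p' - p * T') + (T * r' - r * T') * (T * r' - r * T') = 0 * 1"
    using assms(1-3) by algebra
  then have "T * p' - p * T' = 0 \<and> T * r' - r * T' = 0" by (simp only: mult_zero_left sum_squares_eq_zero_iff)
  then show e: "T * p' = p * T'" "T * r' = r * T'" by simp_all
  have "T * (r * p') = T * (p * r')" using e by algebra
  then show "r * p' = p * r'" using assms(4) by simp
  have "T * (T * S') = T * (r * r' + p * p')" using assms(1,3) e by algebra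
  then show "T * S' = r * r' + p * p'" using assms(4) by simp
qed

context central_g2
begin

lemma omega_kernel:
  assumes red: q_reduced and z: "B 4 5 6 = 0" and ab: "B 4 5 3 = 0"
  obtains y3 y4 y5 y6 where "y3 * y3 + y4 * y4 + y5 * y5 + y6 * y6 = 1"
    "\<forall>a\<in>{0, 1}. \<forall>j\<in>{3, 4, 5, 6}. y3 * B 3 j a + y4 * B 4 j a + y5 * B 5 j a + y6 * B 6 j a = 0"
proof -
  note iso = omega_isotropic[OF assms]
  note om = omega_relations[OF assms]
  have iso': "B 3 6 1 * B 4 5 0 + B 3 6 0 * B 4 5 1 = 2 * (B 3 4 1 * B 3 4 0) + 2 * (B 3 5 1 * B 3 5 0)"
    using iso(3) by (simp add: ac_simps)
  obtain y3 y4 y5 where y: "y3 \<noteq> 0 \<or> y4 \<noteq> 0"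
    "\<And>a j. a \<in> {0, 1} \<Longrightarrow> j \<in> {3, 4, 5, 6} \<Longrightarrow> y3 * B 3 j a + y4 * B 4 j a + y5 * B 5 j a = 0"
  proof (cases "B 4 5 0 = 0")
    case False
    note e = isotropic_proportional[OF iso False]
    show ?thesis
    proof (rule that[of "B 4 5 0" "- B 3 5 0" "B 3 4 0"])
      fix a j :: nat assume "a \<in> {0, 1}" "j \<in> {3, 4, 5, 6}"
      then show "B 4 5 0 * B 3 j a + - B 3 5 0 * B 4 j a + B 3 4 0 * B 5 j a = 0"
        using e iso(1) by (elim insertE emptyE; simp only: B_swap_nums om B_self less_7; simp add: algebra_simps)
    qed (use False in simp)
  next
    case T0: True
    show ?thesis
    proof (cases "B 4 5 1 = 0")
      case False
      note e = isotropic_proportional[OF iso(2) iso(1) iso' False]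
      show ?thesis
      proof (rule that[of "B 4 5 1" "- B 3 5 1" "B 3 4 1"])
        fix a j :: nat assume "a \<in> {0, 1}" "j \<in> {3, 4, 5, 6}"
        then show "B 4 5 1 * B 3 j a + - B 3 5 1 * B 4 j a + B 3 4 1 * B 5 j a = 0"
          using e iso(2) by (elim insertE emptyE; simp only: B_swap_nums om B_self less_7; simp add: algebra_simps)
      qed (use False in simp)
    next
      case True
      have "B 3 4 0 = 0" "B 3 5 0 = 0" "B 3 4 1 = 0" "B 3 5 1 = 0"
        using iso(1,2) unfolding T0 True by (simp_all add: sum_squares_eq_zero_iff del: One_nat_def)
      note e = this T0 True
      show ?thesis
      proof (rule that[of 0 1 0])
        fix a j :: nat assume "a \<in> {0, 1}" "j \<in> {3, 4, 5, 6}"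
        then show "0 * B 3 j a + 1 * B 4 j a + 0 * B 5 j a = 0"
          using e by (elim insertE emptyE; simp only: B_swap_nums om B_self less_7 mult_zero_left mult_1_left
              add_0_left add_0_right minus_zero)
      qed simp
    qed
  qed
  define n where "n = sqrt (y3 * y3 + y4 * y4 + y5 * y5)"
  have "y3 * y3 + y4 * y4 + y5 * y5 > 0"
    using y(1) sum_squares_gt_zero_iff[of y3 y4] zero_le_square[of y5] by linarith
  then have n: "n * n = y3 * y3 + y4 * y4 + y5 * y5" "n \<noteq> 0" by (simp_all add: n_def)
  show ?thesis
  proof (rule that[of "y3 / n" "y4 / n" "y5 / n" 0])
    show "y3 / n * (y3 / n) + y4 / n * (y4 / n) + y5 / n * (y5 / n) + 0 * 0 = 1"
      using n(2) by (simp add: n(1)[symmetric] add_divide_distrib[symmetric])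
  next
    have "y3 / n * B 3 j a + y4 / n * B 4 j a + y5 / n * B 5 j a + 0 * B 6 j a = 0"
      if "a \<in> {0, 1}" "j \<in> {3, 4, 5, 6}" for a j
    proof -
    from y(2)[OF that] have "(y3 * B 3 j a + y4 * B 4 j a + y5 * B 5 j a) / n = 0" by simp
    then show ?thesis
      by (simp add: add_divide_distrib)
    qed
    then show "\<forall>a\<in>{0, 1}. \<forall>j\<in>{3, 4, 5, 6}. y3 / n * B 3 j a + y4 / n * B 4 j a + y5 / n * B 5 j a + 0 * B 6 j a = 0"
      by blast
  qed
qed

lemma core_frame_if_omega:
  assumes red: q_reduced and z: "B 4 5 6 = 0" and ab: "B 4 5 3 = 0"
    and om: "B 3 4 0 = 0" "B 3 4 1 = 0" "B 3 5 0 = 0" "B 3 5 1 = 0" "B 3 6 0 = 0" "B 3 6 1 = 0"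
  shows "core_frame b c \<phi> br (B 2 3 3) (- B 2 4 5) (B 2 3 4) (B 2 3 5) (B 2 4 3) (B 2 4 6) (B 2 5 3) (B 2 5 6)
    (B 2 3 0) (B 2 6 0) (B 2 4 0) (B 2 5 0)"
proof -
  note om' = omega_relations[OF red z ab, unfolded om minus_zero]
  note qr = q_reducedD[OF red] z ab
  have r: "B 2 3 6 = - B 2 4 5" "B 2 5 5 = - B 2 3 3" "B 2 4 4 = - B 2 3 3" "B 2 5 4 = - B 2 4 5"
    "B 2 6 5 = B 2 3 4" "B 2 6 4 = - B 2 3 5" "B 2 6 6 = B 2 3 3" "B 2 6 3 = B 2 4 5"
    using B_z om om' by linarith+
  have e: "B 2 4 1 = B 2 5 0" "B 2 3 1 = B 2 6 0" "B 2 6 1 = - B 2 3 0" "B 2 5 1 = - B 2 4 0"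
    using B_closed_e[OF red z] ab by linarith+
  show ?thesis
  proof (rule core_frame.intro[OF g2_lie_frame_axioms], rule core_frame_axioms.intro)
    show "br (b 4) (b 5) = (B 2 4 3 - B 2 5 6) *\<^sub>R b 0 + (B 2 4 6 + B 2 5 3) *\<^sub>R b 1"
      using B_z(4,10) unfolding br_basis qr by (simp del: One_nat_def)
  qed (simp_all only: central br_basis qr om om' r e, simp_all add: algebra_simps del: One_nat_def)
qed

lemma core_frame_exists:
  assumes red: q_reduced and z: "B 4 5 6 = 0" and ab: "B 4 5 3 = 0"
  obtains b' c' m s g h A1 A2 A3 A4 p q u v where "central_g2 b' c' \<phi> br"
      "core_frame b' c' \<phi> br m s g h A1 A2 A3 A4 p q u v"
proof -
  obtain y3 y4 y5 y6 where n: "y3 * y3 + y4 * y4 + y5 * y5 + y6 * y6 = 1" and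
    y: "\<forall>a\<in>{0, 1}. \<forall>j\<in>{3, 4, 5, 6}. y3 * B 3 j a + y4 * B 4 j a + y5 * B 5 j a + y6 * B 6 j a = 0"
    by (rule omega_kernel[OF assms])
  interpret R: central_g2 "rot y3 y4 y5 y6 b" "rot_coord y3 y4 y5 y6 c" \<phi> br by (rule central_g2_rot[OF n])
  note ev = R.B_def rot_coord_def rot_simps br_linear coord_simps B_def[symmetric] B_swap_nums q_reducedD[OF red] z ab
  have R: "R.q_reduced" "R.B 4 5 6 = 0" "R.B 4 5 3 = 0" unfolding R.q_reduced_def by (simp_all add: ev br_self)
  have x: "c a (br (rot y3 y4 y5 y6 b 3) (b j)) = 0" if "a \<in> {0, 1}" "j \<in> {3, 4, 5, 6}" for a j
  proof -
    have "a < 7" using that by auto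
    then show ?thesis
      using y[rule_format, OF that] by (simp add: rot_simps br_linear coord_simps B_def[symmetric])
  qed
  have om: "R.B 3 j a = 0" if "a \<in> {0, 1}" "j \<in> {4, 5, 6}" for a j
  proof -
    have "a < 7" using that by auto
    moreover have "rot_coord y3 y4 y5 y6 c a = c a" using that by (auto simp: rot_coord_def rot_simps simp del:
        One_nat_def)
    ultimately show ?thesis
      using that(2) x[OF that(1)] unfolding R.B_def
      by (elim insertE emptyE; simp only: rot_simps(5-7) br_linear; simp add: coord_simps)
  qed
  show ?thesis
    by (rule that[OF R.central_g2_axioms R.core_frame_if_omega[OF R om om om om om om]]) simp_all
qed

end

lemma complex_eigenvector:
  obtains l r t :: complex where "cmod l * cmod l + cmod r * cmod r = 1"
    "\<mu> * l + \<kappa> * r = t * l" "\<nu> * l - \<mu> * r = t * r"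
proof -
  obtain l r t where h: "l \<noteq> 0 \<or> r \<noteq> 0" "\<mu> * l + \<kappa> * r = t * l" "\<nu> * l - \<mu> * r = t * r"
  proof (cases "\<nu> = 0")
    case True
    then show ?thesis using that[of 1 0 \<mu>] by simp
  next
    case False
    define t where "t = csqrt (\<mu> * \<mu> + \<kappa> * \<nu>)"
    have "t * t = \<mu> * \<mu> + \<kappa> * \<nu>" using power2_csqrt[of "\<mu> * \<mu> + \<kappa> * \<nu>"] by (simp add: t_def power2_eq_square)
    then show ?thesis using that[of "t + \<mu>" \<nu> t] False by (simp add: algebra_simps)
  qed
  define n where "n = sqrt (cmod l * cmod l + cmod r * cmod r)"
  have "cmod l * cmod l + cmod r * cmod r > 0" using h(1) sum_squares_gt_zero_iff[of "cmod l" "cmod r"] by simp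
  then have n: "n * n = cmod l * cmod l + cmod r * cmod r" "n > 0" by (simp_all add: n_def)
  show ?thesis
  proof (rule that[of "l / of_real n" "r / of_real n" t])
    show "cmod (l / of_real n) * cmod (l / of_real n) + cmod (r / of_real n) * cmod (r / of_real n) = 1"
      using n(2) by (simp add: norm_divide add_divide_distrib[symmetric] n(1)[symmetric])
    show "\<mu> * (l / of_real n) + \<kappa> * (r / of_real n) = t * (l / of_real n)"
      "\<nu> * (l / of_real n) - \<mu> * (r / of_real n) = t * (r / of_real n)"
      using h(2,3) by (simp_all add: add_divide_distrib[symmetric] diff_divide_distrib[symmetric])
  qed
qed

context central_g2
begin

lemma core_frame_triangular:
  assumes core: "core_frame b c \<phi> br m s g h A1 A2 (- A2) A1 p q u v"
  obtains b' c' m s A1 A2 p q u v where "core_frame b' c' \<phi> br m s 0 0 A1 A2 (- A2) A1 p q u v"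
proof -
  interpret C: core_frame b c \<phi> br m s g h A1 A2 "- A2" A1 p q u v by (fact core)
  obtain l r t :: complex where n: "cmod l * cmod l + cmod r * cmod r = 1" and
    e: "Complex m s * l + Complex A1 A2 * r = t * l" "Complex g h * l - Complex m s * r = t * r"
    by (rule complex_eigenvector)
  define y3 y6 y4 y5 where "y3 = Re l" and "y6 = Im l" and "y4 = Re r" and "y5 = Im r"
  note y = y3_def y6_def y4_def y5_def
  have n': "y3 * y3 + y4 * y4 + y5 * y5 + y6 * y6 = 1"
    using n cmod_power2[of l] cmod_power2[of r] by (simp add: y power2_eq_square)
  interpret R: central_g2 "rot y3 y4 y5 y6 b" "rot_coord y3 y4 y5 y6 c" \<phi> br by (rule central_g2_rot[OF n'])
  have ab: "br (b i) (b j) = 0" if "i \<in> {3, 4, 5, 6}" "j \<in> {3, 4, 5, 6}" for i j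
    using that C.br_core C.br_core_swap by (auto simp: br_self)
  have R: "R.B i j k = 0" if "i \<in> {3, 4, 5, 6}" "j \<in> {3, 4, 5, 6}" "k < 7" for i j k
  proof -
    have "br (rot y3 y4 y5 y6 b i) (rot y3 y4 y5 y6 b j) = 0"
      using that by (elim insertE emptyE; simp only: rot_simps br_linear) (simp_all add: ab)
    then show ?thesis using R.linear_coord[OF that(3)] by (simp add: R.B_def linear_0)
  qed
  have qr: "R.q_reduced" unfolding R.q_reduced_def by (simp add: R)
  have core': "core_frame (rot y3 y4 y5 y6 b) (rot_coord y3 y4 y5 y6 c) \<phi> br (R.B 2 3 3) (- R.B 2 4 5) (R.B 2 3 4)
      (R.B 2 3 5)
     (R.B 2 4 3) (R.B 2 4 6) (R.B 2 5 3) (R.B 2 5 6) (R.B 2 3 0) (R.B 2 6 0) (R.B 2 4 0) (R.B 2 5 0)"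
    by (rule R.core_frame_if_omega[OF qr]) (simp_all add: R)
  have T: "R.B 2 5 6 = R.B 2 4 3" "R.B 2 5 3 = - R.B 2 4 6"
    using R.B_z(4,10) R[of 4 5 0] R[of 4 5 1] by simp_all
  have x: "c 3 (br (b 2) (rot y3 y4 y5 y6 b 3)) = Re t * y3 - Im t * y6"
    "c 6 (br (b 2) (rot y3 y4 y5 y6 b 3)) = Re t * y6 + Im t * y3"
    "c 4 (br (b 2) (rot y3 y4 y5 y6 b 3)) = Re t * y4 - Im t * y5"
    "c 5 (br (b 2) (rot y3 y4 y5 y6 b 3)) = Re t * y5 + Im t * y4"
    using e unfolding complex_eq_iff rot_simps
    by (simp_all add: y br_linear C.br_core coord_simps algebra_simps del: One_nat_def)
  have "R.B 2 3 4 = 0" "R.B 2 3 5 = 0"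
    unfolding R.B_def rot_coord_def rot_simps(3,5,6) x by (simp_all add: algebra_simps)
  then show ?thesis using core' that unfolding T by metis
qed

end

section \<open>Classification\<close>

lemma (in frame) frame_of_coords:
  assumes dim: "dim (UNIV :: 'a set) = 7"
    and indep: "\<And>a. \<forall>k<7. (\<Sum>i<7. a i * c k (v i)) = 0 \<Longrightarrow>
      a 0 = 0 \<and> a 1 = 0 \<and> a 2 = 0 \<and> a 3 = 0 \<and> a 4 = 0 \<and> a 5 = 0 \<and> a 6 = 0"
  obtains d where "frame v d"
proof (rule frame_of_independent[OF dim])
  fix a i assume h: "(\<Sum>i<7. a i *\<^sub>R v i) = 0" and i: "i < (7::nat)"
  have "\<forall>k<7. (\<Sum>i<7. a i * c k (v i)) = 0"
  proof (intro allI impI)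
    fix k :: nat assume k: "k < 7"
    have "c k (\<Sum>i<7. a i *\<^sub>R v i) = (\<Sum>i<7. a i * c k (v i))"
      by (simp add: linear_sum[OF linear_coord[OF k]] linear_cmul[OF linear_coord[OF k]])
    then show "(\<Sum>i<7. a i * c k (v i)) = 0" using h linear_0[OF linear_coord[OF k]] by simp
  qed
  from indep[OF this] show "a i = 0" using i all_less_7[of "\<lambda>i. a i = 0"] by blast
qed (rule that)

lemma real_solve_2:
  fixes a b c d x y :: real
  assumes D: "a * d - b * c \<noteq> 0"
  obtains s t where "a * s + b * t = x" "c * s + d * t = y"
proof (rule that[of "(x * d - b * y) / (a * d - b * c)" "(a * y - x * c) / (a * d - b * c)"])
  show "a * ((x * d - b * y) / (a * d - b * c)) + b * ((a * y - x * c) / (a * d - b * c)) = x"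
    "c * ((x * d - b * y) / (a * d - b * c)) + d * ((a * y - x * c) / (a * d - b * c)) = y"
    unfolding times_divide_eq_right add_divide_distrib[symmetric] using D
    by (simp_all add: nonzero_divide_eq_eq) (simp_all add: algebra_simps)
qed

lemma real_injective_2:
  fixes a b c d s t :: real
  assumes "a * s + b * t = 0" "c * s + d * t = 0" "a * d - b * c \<noteq> 0"
  shows "s = 0" "t = 0"
proof -
  have "(a * d - b * c) * s = 0 * 1" "(a * d - b * c) * t = 0 * 1" using assms(1,2) by algebra+
  then show "s = 0" "t = 0" using assms(3) by simp_all
qed

context
  fixes b :: "nat \<Rightarrow> 'a::real_vector" and c :: "nat \<Rightarrow> 'a \<Rightarrow> real" and \<phi> :: "'a form" and br :: "'a \<Rightarrow> 'a \<Rightarrow> 'a"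
  assumes dim: "dim (UNIV :: 'a set) = 7"
begin

lemma core_two_step:
  assumes core: "core_frame b c \<phi> br 0 0 0 0 A1 A2 A3 A4 0 0 u v"
  shows "lie_isomorphic br \<nn>\<^sub>1 \<or> lie_isomorphic br \<nn>\<^sub>2 \<or> lie_isomorphic br \<nn>\<^sub>3"
proof -
  interpret core_frame b c \<phi> br 0 0 0 0 A1 A2 A3 A4 0 0 u v by (fact core)
  note ev = br_core br_core_swap br_self
  have cen: "br x y = 0" if "x \<in> {b 0, b 1, b 3, b 6}" for x y
  proof -
    have "br (b 3) y = 0" "br (b 6) y = 0"
      by (rule central_frameI[OF lie frame_axioms]; simp add: ev del: One_nat_def)+
    then show ?thesis using that central by auto
  qed
  have e: "br (b 2) (b 4) = u *\<^sub>R b 0 + v *\<^sub>R b 1 + A1 *\<^sub>R b 3 + A2 *\<^sub>R b 6"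
    "br (b 2) (b 5) = v *\<^sub>R b 0 + (- u) *\<^sub>R b 1 + A3 *\<^sub>R b 3 + A4 *\<^sub>R b 6"
    "br (b 4) (b 5) = (A1 - A4) *\<^sub>R b 0 + (A2 + A3) *\<^sub>R b 1 + 0 *\<^sub>R b 3 + 0 *\<^sub>R b 6"
    by (simp_all add: ev del: One_nat_def)
  have "lie_isomorphic br \<nn>\<^sub>2 \<or> lie_isomorphic br \<nn>\<^sub>3
    \<or> (\<exists>z p q r. br (b 2) (b 4) = p *\<^sub>R z \<and> br (b 2) (b 5) = q *\<^sub>R z \<and> br (b 4) (b 5) = r *\<^sub>R z)"
    by (rule two_step[OF lie dim cen span_two_step independent_two_step]) (simp_all only: e mem_span_two_step)
  moreover have "lie_isomorphic br \<nn>\<^sub>1"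
    if h: "br (b 2) (b 4) = p *\<^sub>R z" "br (b 2) (b 5) = q *\<^sub>R z" "br (b 4) (b 5) = r *\<^sub>R z" for z p q r
  proof -
    have f: "p * c 0 z = u" "p * c 1 z = v" "p * c 3 z = A1" "p * c 6 z = A2"
      "q * c 0 z = v" "q * c 1 z = - u" "q * c 3 z = A3" "q * c 6 z = A4"
      "r * c 0 z = A1 - A4" "r * c 1 z = A2 + A3" "r * c 3 z = 0" "r * c 6 z = 0"
      using arg_cong[OF h(1), of "c 0"] arg_cong[OF h(1), of "c 1"] arg_cong[OF h(1), of "c 3"] arg_cong[OF h(1), of
          "c 6"]
        arg_cong[OF h(2), of "c 0"] arg_cong[OF h(2), of "c 1"] arg_cong[OF h(2), of "c 3"] arg_cong[OF h(2), of "c 6"]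
        arg_cong[OF h(3), of "c 0"] arg_cong[OF h(3), of "c 1"] arg_cong[OF h(3), of "c 3"] arg_cong[OF h(3), of "c 6"]
      unfolding e by (simp_all add: coord_simps del: One_nat_def)
    have "u * u = (p * c 0 z) * (- (q * c 1 z))" "v * v = (p * c 1 z) * (q * c 0 z)" using f(1,2,5,6) by simp_all
    then have "u * u + v * v = 0" by (simp add: algebra_simps)
    then have uv: "u = 0" "v = 0" by (simp_all add: sum_squares_eq_zero_iff)
    have A: "A4 = A1 \<and> A3 = - A2"
    proof (cases "r = 0")
      case True
      then show ?thesis using f(9,10) by simp
    next
      case False
      then show ?thesis using f(3,4,7,8,11,12) by simp
    qed
    then have "A1 * A1 = (p * c 3 z) * (q * c 6 z)" "A2 * A2 = (p * c 6 z) * (- (q * c 3 z))"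
        using f(3,4,7,8) by simp_all
    then have "A1 * A1 + A2 * A2 = 0" by (simp add: algebra_simps)
    then have A12: "A1 = 0" "A2 = 0" by (simp_all add: sum_squares_eq_zero_iff)
    show ?thesis
      unfolding lie_isomorphic_nn1_iff[OF lie]
      by (intro exI[of _ b] exI[of _ c]) (simp add: brackets_def frame_axioms ev A12 A uv del: One_nat_def)
  qed
  ultimately show ?thesis by blast
qed

lemma core_diagonal:
  assumes core: "core_frame b c \<phi> br m s 0 0 A1 A2 (- A2) A1 p q u v" and ms: "m \<noteq> 0 \<or> s \<noteq> 0"
  obtains w d where "frame w d" "\<forall>x. br (w 0) x = 0 \<and> br (w 1) x = 0"
    "br (w 2) (w 3) = m *\<^sub>R w 3 + s *\<^sub>R w 6" "br (w 2) (w 6) = - s *\<^sub>R w 3 + m *\<^sub>R w 6"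
    "br (w 2) (w 4) = - m *\<^sub>R w 4 - s *\<^sub>R w 5" "br (w 2) (w 5) = s *\<^sub>R w 4 - m *\<^sub>R w 5"
    "br (w 3) (w 4) = 0" "br (w 3) (w 5) = 0" "br (w 3) (w 6) = 0" "br (w 4) (w 5) = 0" "br (w 4) (w 6) = 0"
        "br (w 5) (w 6) = 0"
proof -
  interpret core_frame b c \<phi> br m s 0 0 A1 A2 "- A2" A1 p q u v by (fact core)
  have "m * m - s * (- s) \<noteq> 0" using ms by (simp add: sum_squares_eq_zero_iff)
  note solve = real_solve_2[OF this]
  obtain a0 a1 where a: "m * a0 + s * a1 = p" "- s * a0 + m * a1 = q" by (rule solve)
  obtain k1 k2' where k': "m * k1 + s * k2' = - A1 / 2" "- s * k1 + m * k2' = A2 / 2" by (rule solve)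
  define k2 where "k2 = - k2'"
  have k: "A1 = 2 * (s * k2) - 2 * (m * k1)" "A2 = - 2 * (s * k1) - 2 * (m * k2)" using k' by (simp_all add: k2_def)
  obtain d0 d1 where d: "m * d0 + s * d1 = - (u + k1 * p + k2 * q)" "- s * d0 + m * d1 = - (v + k1 * q - k2 * p)"
      by (rule solve)
  have uv: "u = - (m * d0 + s * d1) - k1 * p - k2 * q" "v = s * d0 - m * d1 - k1 * q + k2 * p" using d by simp_all
  have pq: "p = m * a0 + s * a1" "q = m * a1 - s * a0" using a by simp_all
  define w where "w = (!) [b 0, b 1, b 2, b 3 + a0 *\<^sub>R b 0 + a1 *\<^sub>R b 1,
    b 4 + k1 *\<^sub>R b 3 + k2 *\<^sub>R b 6 + d0 *\<^sub>R b 0 + d1 *\<^sub>R b 1,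
    b 5 + k1 *\<^sub>R b 6 - k2 *\<^sub>R b 3 + d1 *\<^sub>R b 0 - d0 *\<^sub>R b 1, b 6 + a1 *\<^sub>R b 0 - a0 *\<^sub>R b 1]"
  have w: "w 0 = b 0" "w 1 = b 1" "w 2 = b 2" "w 3 = b 3 + a0 *\<^sub>R b 0 + a1 *\<^sub>R b 1"
    "w 4 = b 4 + k1 *\<^sub>R b 3 + k2 *\<^sub>R b 6 + d0 *\<^sub>R b 0 + d1 *\<^sub>R b 1"
    "w 5 = b 5 + k1 *\<^sub>R b 6 - k2 *\<^sub>R b 3 + d1 *\<^sub>R b 0 - d0 *\<^sub>R b 1" "w 6 = b 6 + a1 *\<^sub>R b 0 - a0 *\<^sub>R b 1"
    by (simp_all add: w_def)
  obtain d where "frame w d"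
    by (rule frame_of_coords[OF dim, of w]) (auto simp: all_less_7 sum_7 w coord_simps simp del: One_nat_def)
  moreover note ev = w br_core br_core_swap br_bilinear br_self
  have "\<forall>x. br (w 0) x = 0 \<and> br (w 1) x = 0" by (simp add: ev del: One_nat_def)
  moreover have "br (w 2) (w 3) = m *\<^sub>R w 3 + s *\<^sub>R w 6" "br (w 2) (w 6) = - s *\<^sub>R w 3 + m *\<^sub>R w 6"
    "br (w 2) (w 4) = - m *\<^sub>R w 4 - s *\<^sub>R w 5" "br (w 2) (w 5) = s *\<^sub>R w 4 - m *\<^sub>R w 5"
    unfolding coord_eq_iff by (simp_all add: ev coord_simps k uv pq algebra_simps del: One_nat_def)
  moreover have "br (w 3) (w 4) = 0" "br (w 3) (w 5) = 0" "br (w 3) (w 6) = 0" "br (w 4) (w 5) = 0"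
      "br (w 4) (w 6) = 0" "br (w 5) (w 6) = 0"
    by (simp_all add: ev del: One_nat_def)
  ultimately show ?thesis by (rule that)
qed

lemma core_semisimple:
  assumes core: "core_frame b c \<phi> br m s 0 0 A1 A2 (- A2) A1 p q u v" and ms: "m \<noteq> 0 \<or> s \<noteq> 0"
  shows "lie_isomorphic br \<ss>\<^sub>5 \<or> (\<exists>\<alpha>>0. lie_isomorphic br (\<ss>\<^sub>6 \<alpha>)) \<or> lie_isomorphic br \<ss>\<^sub>7"
proof -
  interpret core_frame b c \<phi> br m s 0 0 A1 A2 "- A2" A1 p q u v by (fact core)
  obtain w d where fr: "frame w d" and w: "\<forall>x. br (w 0) x = 0 \<and> br (w 1) x = 0"
    "br (w 2) (w 3) = m *\<^sub>R w 3 + s *\<^sub>R w 6" "br (w 2) (w 6) = - s *\<^sub>R w 3 + m *\<^sub>R w 6"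
    "br (w 2) (w 4) = - m *\<^sub>R w 4 - s *\<^sub>R w 5" "br (w 2) (w 5) = s *\<^sub>R w 4 - m *\<^sub>R w 5"
    "br (w 3) (w 4) = 0" "br (w 3) (w 5) = 0" "br (w 3) (w 6) = 0" "br (w 4) (w 5) = 0" "br (w 4) (w 6) = 0"
        "br (w 5) (w 6) = 0"
    by (rule core_diagonal[OF core ms])
  interpret w: frame w d by (fact fr)
  have w01: "br (w 0) x = 0" "br (w 1) x = 0" for x using w(1) by blast+
  note w = w01 w(2-)
  have sw: "br x (w 0) = 0" "br x (w 1) = 0" "br (w 4) (w 3) = 0" "br (w 5) (w 3) = 0" "br (w 6) (w 3) = 0"
      "br (w 5) (w 4) = 0"
    "br (w 6) (w 4) = 0" "br (w 6) (w 5) = 0" "br (w 3) (w 2) = - (m *\<^sub>R w 3 + s *\<^sub>R w 6)"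
        "br (w 6) (w 2) = - (- s *\<^sub>R w 3 + m *\<^sub>R w 6)"
    "br (w 4) (w 2) = - (- m *\<^sub>R w 4 - s *\<^sub>R w 5)" "br (w 5) (w 2) = - (s *\<^sub>R w 4 - m *\<^sub>R w 5)" for x
    by (subst br_swap, simp only: w minus_zero)+
  note ev = w sw br_bilinear
  have solve: "\<exists>d. frame v d" if v: "v = (!) [w i0, w i1, w i2, w i3, t *\<^sub>R w 2, w 0, w 1]" and t: "t \<noteq> 0"
    and i: "[i0, i1, i2, i3] = [3, 6, 4, 5] \<or> [i0, i1, i2, i3] = [6, 3, 4, 5] \<or> [i0, i1, i2, i3] = [4, 5, 6, 3] \<or>
        [i0, i1, i2, i3] = [3, 4, 5, 6]"
    for v t i0 i1 i2 i3
    using i by (elim disjE; simp only: list.inject)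
      (rule w.frame_of_coords[OF dim, of v], simp add: all_less_7 sum_7 v w.coord_simps t del: One_nat_def, blast)+
  consider "s = 0" "m \<noteq> 0" | "m = 0" "s \<noteq> 0" | "m / s > 0" | "m / s < 0"
    using ms by (cases "m = 0"; cases "s = 0") (auto simp: linorder_neq_iff zero_less_divide_iff divide_less_0_iff)
  then show ?thesis
  proof cases
    case 1
    obtain v d' where v: "v = (!) [w 3, w 4, w 5, w 6, (1 / m) *\<^sub>R w 2, w 0, w 1]" "frame v d'"
      using solve[OF refl, of "1 / m" 3 4 5 6] 1 by auto
    have "lie_isomorphic br \<ss>\<^sub>5"
      unfolding lie_isomorphic_ss5_iff[OF lie]
      by (rule exI[of _ v], rule exI[of _ d']) (simp add: v(2), simp add: brackets_def v(1) ev 1 del: One_nat_def)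
    then show ?thesis by blast
  next
    case 2
    obtain v d' where v: "v = (!) [w 6, w 3, w 4, w 5, (1 / s) *\<^sub>R w 2, w 0, w 1]" "frame v d'"
      using solve[OF refl, of "1 / s" 6 3 4 5] 2 by auto
    have "lie_isomorphic br \<ss>\<^sub>7"
      unfolding lie_isomorphic_ss7_iff[OF lie]
      by (rule exI[of _ v], rule exI[of _ d']) (simp add: v(2), simp add: brackets_def v(1) ev 2 del: One_nat_def)
    then show ?thesis by blast
  next
    case 3
    then have s: "s \<noteq> 0" by auto
    obtain v d' where v: "v = (!) [w 6, w 3, w 4, w 5, (1 / s) *\<^sub>R w 2, w 0, w 1]" "frame v d'"
      using solve[OF refl, of "1 / s" 6 3 4 5] s by auto
    have "lie_isomorphic br (\<ss>\<^sub>6 (m / s))"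
      unfolding lie_isomorphic_ss6_iff[OF lie]
      by (rule exI[of _ v], rule exI[of _ d']) (simp add: v(2), simp add: brackets_def v(1) ev s algebra_simps del:
          One_nat_def)
    then show ?thesis using 3 by blast
  next
    case 4
    then have s: "s \<noteq> 0" by auto
    obtain v d' where v: "v = (!) [w 4, w 5, w 6, w 3, (1 / s) *\<^sub>R w 2, w 0, w 1]" "frame v d'"
      using solve[OF refl, of "1 / s" 4 5 6 3] s by auto
    have "lie_isomorphic br (\<ss>\<^sub>6 (- (m / s)))"
      unfolding lie_isomorphic_ss6_iff[OF lie]
      by (rule exI[of _ v], rule exI[of _ d']) (simp add: v(2), simp add: brackets_def v(1) ev s algebra_simps del:
          One_nat_def)
    then show ?thesis using 4 by (intro disjI2 disjI1 exI[of _ "- (m / s)"]) simp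
  qed
qed

end

context
  fixes b :: "nat \<Rightarrow> 'a::real_vector" and c :: "nat \<Rightarrow> 'a \<Rightarrow> real" and \<phi> :: "'a form" and br :: "'a \<Rightarrow> 'a \<Rightarrow> 'a"
  assumes dim: "dim (UNIV :: 'a set) = 7"
begin

lemma core_chain:
  assumes core: "core_frame b c \<phi> br 0 0 0 0 A1 A2 A3 A4 p q u v" and pq: "p \<noteq> 0 \<or> q \<noteq> 0"
    and D: "A1 * A4 - A2 * A3 \<noteq> 0" and y: "y4 * y5' - y5 * y4' \<noteq> 0"
  defines "x \<equiv> y4 * A1 + y5 * A3" and "x' \<equiv> y4 * A2 + y5 * A4" and "t \<equiv> y4' * A1 + y5' * A3"
      and "t' \<equiv> y4' * A2 + y5' * A4"
  obtains w d where "frame w d" "w 0 = b 2" "w 1 = y4 *\<^sub>R b 4 + y5 *\<^sub>R b 5" "w 2 = y4' *\<^sub>R b 4 + y5' *\<^sub>R b 5"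
    "brackets br w = [- w 3, - w 4, - w 5, - w 6, 0, 0, br (w 1) (w 2), 0, 0, 0, 0, 0, 0, 0, 0, 0, 0, 0, 0, 0, 0]"
    "w 5 = (x * p + x' * q) *\<^sub>R b 0 + (x * q - x' * p) *\<^sub>R b 1"
proof -
  interpret core_frame b c \<phi> br 0 0 0 0 A1 A2 A3 A4 p q u v by (fact core)
  define w where "w = (!) [b 2, y4 *\<^sub>R b 4 + y5 *\<^sub>R b 5, y4' *\<^sub>R b 4 + y5' *\<^sub>R b 5,
    - (x *\<^sub>R b 3 + x' *\<^sub>R b 6 + (y4 * u + y5 * v) *\<^sub>R b 0 + (y4 * v - y5 * u) *\<^sub>R b 1),
    - (t *\<^sub>R b 3 + t' *\<^sub>R b 6 + (y4' * u + y5' * v) *\<^sub>R b 0 + (y4' * v - y5' * u) *\<^sub>R b 1),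
    (x * p + x' * q) *\<^sub>R b 0 + (x * q - x' * p) *\<^sub>R b 1, (t * p + t' * q) *\<^sub>R b 0 + (t * q - t' * p) *\<^sub>R b 1]"
  have w: "w 0 = b 2" "w 1 = y4 *\<^sub>R b 4 + y5 *\<^sub>R b 5" "w 2 = y4' *\<^sub>R b 4 + y5' *\<^sub>R b 5"
    "w 3 = - (x *\<^sub>R b 3 + x' *\<^sub>R b 6 + (y4 * u + y5 * v) *\<^sub>R b 0 + (y4 * v - y5 * u) *\<^sub>R b 1)"
    "w 4 = - (t *\<^sub>R b 3 + t' *\<^sub>R b 6 + (y4' * u + y5' * v) *\<^sub>R b 0 + (y4' * v - y5' * u) *\<^sub>R b 1)"
    "w 5 = (x * p + x' * q) *\<^sub>R b 0 + (x * q - x' * p) *\<^sub>R b 1"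
        "w 6 = (t * p + t' * q) *\<^sub>R b 0 + (t * q - t' * p) *\<^sub>R b 1"
    by (simp_all add: w_def)
  have "x * t' - x' * t = (y4 * y5' - y5 * y4') * (A1 * A4 - A2 * A3)"
    by (simp add: x_def x'_def t_def t'_def algebra_simps)
  then have D1: "x * t' - x' * t \<noteq> 0" using D y by simp
  have "(x * p + x' * q) * (t * q - t' * p) - (x * q - x' * p) * (t * p + t' * q) = - (x * t' - x' * t) * (p * p
      + q * q)"
    by (simp add: algebra_simps)
  then have D2: "(x * p + x' * q) * (t * q - t' * p) - (x * q - x' * p) * (t * p + t' * q) \<noteq> 0"
    using D1 pq by (simp add: sum_squares_eq_zero_iff)
  obtain d where d: "frame w d"
  proof (rule frame_of_coords[OF dim, of w])
    fix a :: "nat \<Rightarrow> real" assume a: "\<forall>k<7. (\<Sum>i<7. a i * c k (w i)) = 0"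
    have e: "(\<Sum>i<7. a i * c k (w i)) = 0" if "k < 7" for k using a that by blast
    note e = e[OF less_7(1)] e[OF less_7(2)] e[OF less_7(3)] e[OF less_7(4)] e[OF less_7(5)] e[OF less_7(6)] e[OF
        less_7(7)]
    note e = e[unfolded sum_7 w]
    have a0: "a 0 = 0" using e(3) by (simp add: coord_simps del: One_nat_def)
    have "y4 * a 1 + y4' * a 2 = 0" "y5 * a 1 + y5' * a 2 = 0"
      using e(5,6) by (simp_all add: coord_simps a0 algebra_simps del: One_nat_def)
    from real_injective_2[OF this] y have a12: "a 1 = 0" "a 2 = 0" by (simp_all add: mult.commute[of y4' y5])
    have "x * a 3 + t * a 4 = 0" "x' * a 3 + t' * a 4 = 0"
      using e(4,7) by (simp_all add: coord_simps a0 a12 algebra_simps del: One_nat_def)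
    from real_injective_2[OF this] D1 have a34: "a 3 = 0" "a 4 = 0" by (simp_all add: mult.commute[of t x'])
    have "(x * p + x' * q) * a 5 + (t * p + t' * q) * a 6 = 0" "(x * q - x' * p) * a 5 + (t * q - t' * p) * a 6 = 0"
      using e(1,2) by (simp_all add: coord_simps a0 a12 a34 algebra_simps del: One_nat_def)
    from real_injective_2[OF this] D2 have "a 5 = 0" "a 6 = 0"
      by (simp_all add: mult.commute[of "t * p + t' * q" "x * q - x' * p"])
    with a0 a12 a34 show "a 0 = 0 \<and> a 1 = 0 \<and> a 2 = 0 \<and> a 3 = 0 \<and> a 4 = 0 \<and> a 5 = 0 \<and> a 6 = 0" by blast
  qed
  note ev = w br_core br_core_swap br_bilinear br_self
  show ?thesis
    by (rule that[OF d w(1-3) _ w(6)])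
      (simp add: brackets_def coord_eq_iff ev coord_simps x_def x'_def t_def t'_def algebra_simps del: One_nat_def)
qed

lemma core_n6:
  assumes core: "core_frame b c \<phi> br 0 0 0 0 A1 A2 (- A2) A1 p q u v" and pq: "p \<noteq> 0 \<or> q \<noteq> 0"
    and A: "A1 \<noteq> 0 \<or> A2 \<noteq> 0"
  shows "lie_isomorphic br \<nn>\<^sub>6"
proof -
  interpret core_frame b c \<phi> br 0 0 0 0 A1 A2 "- A2" A1 p q u v by (fact core)
  have D: "A1 * A1 - A2 * (- A2) \<noteq> 0" using A by (simp add: sum_squares_eq_zero_iff)
  obtain w d where w: "frame w d" "w 0 = b 2" "w 1 = 1 *\<^sub>R b 4 + 0 *\<^sub>R b 5" "w 2 = 0 *\<^sub>R b 4 + 1 *\<^sub>R b 5"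
    "brackets br w = [- w 3, - w 4, - w 5, - w 6, 0, 0, br (w 1) (w 2), 0, 0, 0, 0, 0, 0, 0, 0, 0, 0, 0, 0, 0, 0]"
    by (rule core_chain[OF core pq D, of 1 1 0 0]) simp_all
  have "br (w 1) (w 2) = 0" unfolding w(3,4) by (simp add: br_core br_bilinear br_self)
  then show ?thesis
    unfolding lie_isomorphic_nn6_iff[OF lie] using w(1,5) by auto
qed

lemma core_n7:
  assumes core: "core_frame b c \<phi> br 0 0 0 0 A1 A2 A3 A4 p q u v" and pq: "p \<noteq> 0 \<or> q \<noteq> 0"
    and D: "A1 * A4 - A2 * A3 \<noteq> 0" and T: "A1 - A4 \<noteq> 0 \<or> A2 + A3 \<noteq> 0"
  shows "lie_isomorphic br \<nn>\<^sub>7"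
proof -
  interpret core_frame b c \<phi> br 0 0 0 0 A1 A2 A3 A4 p q u v by (fact core)
  have "p * (- p) - q * q \<noteq> 0" using pq sum_squares_gt_zero_iff[of p q] by simp
  then obtain x x' where x: "p * x + q * x' = A1 - A4" "q * x + (- p) * x' = A2 + A3"
    by (rule real_solve_2)
  have "A1 * A4 - A3 * A2 \<noteq> 0" using D by (simp add: mult.commute)
  then obtain y4 y5 where y: "A1 * y4 + A3 * y5 = x" "A2 * y4 + A4 * y5 = x'" by (rule real_solve_2)
  have y0: "y4 \<noteq> 0 \<or> y5 \<noteq> 0" using x y T by auto
  define n where "n = y4 * y4 + y5 * y5"
  have n: "n > 0" using y0 sum_squares_gt_zero_iff[of y4 y5] by (simp add: n_def)
  have det: "y4 * (- y4 / n) - y5 * (y5 / n) = -1"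
  proof -
    have "y4 * (- y4 / n) - y5 * (y5 / n) = - ((y4 * y4 + y5 * y5) / n)" by (simp add: add_divide_distrib)
    then show ?thesis using n unfolding n_def[symmetric] by simp
  qed
  then have det': "y4 * (- y4 / n) - y5 * (y5 / n) \<noteq> 0" by simp
  obtain w d where w: "frame w d" "w 0 = b 2" "w 1 = y4 *\<^sub>R b 4 + y5 *\<^sub>R b 5"
      "w 2 = (y5 / n) *\<^sub>R b 4 + (- y4 / n) *\<^sub>R b 5"
    "brackets br w = [- w 3, - w 4, - w 5, - w 6, 0, 0, br (w 1) (w 2), 0, 0, 0, 0, 0, 0, 0, 0, 0, 0, 0, 0, 0, 0]" and
    w5: "w 5 = ((y4 * A1 + y5 * A3) * p + (y4 * A2 + y5 * A4) * q) *\<^sub>R b 0 + ((y4 * A1 + y5 * A3) * q - (y4 * A2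
        + y5 * A4) * p) *\<^sub>R b 1"
    by (rule core_chain[OF core pq D det'])
  have "br (w 1) (w 2) = (y4 * (- y4 / n) - y5 * (y5 / n)) *\<^sub>R br (b 4) (b 5)"
    unfolding w(3,4) by (simp add: br_core br_core_swap br_bilinear br_self algebra_simps del: One_nat_def)
  then have "br (w 1) (w 2) = - br (b 4) (b 5)" unfolding det by simp
  moreover have "w 5 = br (b 4) (b 5)"
    unfolding w5 br_core using x y by (simp add: mult.commute)
  ultimately have "br (w 1) (w 2) = - w 5" by simp
  then show ?thesis
    unfolding lie_isomorphic_nn7_iff[OF lie] using w(1,5) by auto
qed

lemma core_n2:
  assumes core: "core_frame b c \<phi> br 0 0 0 0 0 0 0 0 p q u v" and pq: "p \<noteq> 0 \<or> q \<noteq> 0"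
  shows "lie_isomorphic br \<nn>\<^sub>2"
proof -
  interpret core_frame b c \<phi> br 0 0 0 0 0 0 0 0 p q u v by (fact core)
  have D: "p * (- p) - q * q \<noteq> 0" using pq sum_squares_gt_zero_iff[of p q] by simp
  then obtain k1 k2 where k: "p * k1 + q * k2 = u" "q * k1 + (- p) * k2 = v" by (rule real_solve_2)
  have uv: "u = p * k1 + q * k2" "v = q * k1 - p * k2" using k by simp_all
  define w where "w = (!) [b 2, b 3, b 6, b 4 - k1 *\<^sub>R b 3 - k2 *\<^sub>R b 6, - p *\<^sub>R b 0 - q *\<^sub>R b 1,
      - q *\<^sub>R b 0 + p *\<^sub>R b 1,
    b 5 + k2 *\<^sub>R b 3 - k1 *\<^sub>R b 6]"
  have w: "w 0 = b 2" "w 1 = b 3" "w 2 = b 6" "w 3 = b 4 - k1 *\<^sub>R b 3 - k2 *\<^sub>R b 6" "w 4 = - p *\<^sub>R b 0 - q *\<^sub>R b 1"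
    "w 5 = - q *\<^sub>R b 0 + p *\<^sub>R b 1" "w 6 = b 5 + k2 *\<^sub>R b 3 - k1 *\<^sub>R b 6"
    by (simp_all add: w_def)
  obtain d where d: "frame w d"
  proof (rule frame_of_coords[OF dim, of w])
    fix a :: "nat \<Rightarrow> real" assume a: "\<forall>k<7. (\<Sum>i<7. a i * c k (w i)) = 0"
    have e: "(\<Sum>i<7. a i * c k (w i)) = 0" if "k < 7" for k using a that by blast
    note e = e[OF less_7(1)] e[OF less_7(2)] e[OF less_7(3)] e[OF less_7(4)] e[OF less_7(5)] e[OF less_7(6)] e[OF
        less_7(7)]
    note e = e[unfolded sum_7 w]
    have a0: "a 0 = 0" "a 3 = 0" "a 6 = 0" using e(3,5,6) by (simp_all add: coord_simps del: One_nat_def)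
    have a1: "a 1 = 0" "a 2 = 0" using e(4,7) by (simp_all add: coord_simps a0 del: One_nat_def)
    have "p * a 4 + q * a 5 = 0" "q * a 4 + (- p) * a 5 = 0"
      using e(1,2) by (simp_all add: coord_simps a0 a1 algebra_simps del: One_nat_def)
    from real_injective_2[OF this D] a0 a1
    show "a 0 = 0 \<and> a 1 = 0 \<and> a 2 = 0 \<and> a 3 = 0 \<and> a 4 = 0 \<and> a 5 = 0 \<and> a 6 = 0" by blast
  qed
  show ?thesis
    unfolding lie_isomorphic_nn2_iff[OF lie]
    by (rule exI[of _ w], rule exI[of _ d])
      (simp add: d del: One_nat_def, simp add: brackets_def w br_core br_core_swap br_bilinear br_self uv coord_eq_iff
          coord_simps algebra_simps del: One_nat_def)
qed

lemma core_n4_n5: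
  assumes core: "core_frame b c \<phi> br 0 0 0 0 A1 A2 A3 A4 p q u v" and pq: "p \<noteq> 0 \<or> q \<noteq> 0"
    and D: "A1 * A4 - A2 * A3 = 0" and T: "A1 - A4 \<noteq> 0 \<or> A2 + A3 \<noteq> 0"
  shows "lie_isomorphic br \<nn>\<^sub>4 \<or> lie_isomorphic br \<nn>\<^sub>5"
proof -
  interpret core_frame b c \<phi> br 0 0 0 0 A1 A2 A3 A4 p q u v by (fact core)
  obtain r4 r5 d4 d5 where r: "r4 * A1 + r5 * A3 = 0" "r4 * A2 + r5 * A4 = 0" and dr: "d4 * r5 - d5 * r4 = 1"
  proof (cases "A1 = 0 \<and> A2 = 0")
    case True
    then show ?thesis using that[of 1 0 0 "-1"] by simp
  next
    case False
    then consider "A1 \<noteq> 0" | "A2 \<noteq> 0" by blast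
    then show ?thesis
    proof cases
      case 1
      then have "- (A3 / A1) * A2 + 1 * A4 = 0" using D by (simp add: field_simps)
      then show ?thesis using that[of "- (A3 / A1)" 1 1 0] 1 by simp
    next
      case 2
      then have "- (A4 / A2) * A1 + 1 * A3 = 0" using D by (simp add: field_simps)
      then show ?thesis using that[of "- (A4 / A2)" 1 1 0] 2 by simp
    qed
  qed
  define x x' where "x = d4 * A1 + d5 * A3" and "x' = d4 * A2 + d5 * A4"
  have xx: "x \<noteq> 0 \<or> x' \<noteq> 0"
  proof (rule ccontr)
    assume "\<not> ?thesis"
    then have z: "d4 * A1 + d5 * A3 = 0" "d4 * A2 + d5 * A4 = 0" by (simp_all add: x_def x'_def)
    have "A1 = 0" "A3 = 0" "A2 = 0" "A4 = 0"
      using real_injective_2[OF z(1) r(1)] real_injective_2[OF z(2) r(2)] dr by simp_all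
    then show False using T by simp
  qed
  have E: "p * (- p) - q * q \<noteq> 0" using pq sum_squares_gt_zero_iff[of p q] by simp
  obtain k k' where k: "p * k + q * k' = - (r4 * u + r5 * v)" "q * k + (- p) * k' = - (r4 * v - r5 * u)"
    by (rule real_solve_2[OF E])
  define P Q where "P = x * p + x' * q" and "Q = x * q - x' * p"
  have PQ: "P * P + Q * Q = (x * x + x' * x') * (p * p + q * q)" by (simp add: P_def Q_def algebra_simps)
  then have PQ0: "P * P + Q * Q \<noteq> 0" using xx pq by (simp add: sum_squares_eq_zero_iff)
  define X where "X = x *\<^sub>R b 3 + x' *\<^sub>R b 6 + (d4 * u + d5 * v) *\<^sub>R b 0 + (d4 * v - d5 * u) *\<^sub>R b 1"
  define Y where "Y = r4 *\<^sub>R b 4 + r5 *\<^sub>R b 5 + k *\<^sub>R b 3 + k' *\<^sub>R b 6"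
  define y where "y = d4 *\<^sub>R b 4 + d5 *\<^sub>R b 5"
  note ev = br_core br_core_swap br_bilinear br_self
  have e: "br (b 2) y = X" "br (b 2) X = P *\<^sub>R b 0 + Q *\<^sub>R b 1"
    by (simp_all add: y_def X_def ev x_def x'_def P_def Q_def algebra_simps del: One_nat_def)
  have eY: "br (b 2) Y = 0"
  proof -
    have "br (b 2) Y = (r4 * u + r5 * v + (p * k + q * k')) *\<^sub>R b 0 + (r4 * v - r5 * u + (q * k + (- p) * k')) *\<^sub>R b 1
      + (r4 * A1 + r5 * A3) *\<^sub>R b 3 + (r4 * A2 + r5 * A4) *\<^sub>R b 6"
      by (simp add: Y_def ev algebra_simps del: One_nat_def)
    then show ?thesis unfolding r k by (simp del: One_nat_def)
  qed
  have yY: "br y Y = (A1 - A4) *\<^sub>R b 0 + (A2 + A3) *\<^sub>R b 1"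
  proof -
    have "br y Y = (d4 * r5 - d5 * r4) *\<^sub>R br (b 4) (b 5)"
      by (simp add: y_def Y_def ev algebra_simps del: One_nat_def)
    then show ?thesis unfolding dr by (simp add: br_core del: One_nat_def)
  qed
  have q0: "br y X = 0" "br X Y = 0" "br y (b 3) = 0" "br y (b 6) = 0" "br X (b 3) = 0" "br X (b 6) = 0"
      "br Y (b 3) = 0" "br Y (b 6) = 0"
    by (simp_all add: y_def X_def Y_def ev del: One_nat_def)
  have q1: "br X y = 0" "br Y X = 0" "br (b 3) y = 0" "br (b 6) y = 0" "br (b 3) X = 0" "br (b 6) X = 0"
      "br (b 3) Y = 0" "br (b 6) Y = 0"
    by (subst br_swap, simp only: q0 minus_zero)+
  have coord: "c 0 y = 0" "c 1 y = 0" "c 2 y = 0" "c 3 y = 0" "c 4 y = d4" "c 5 y = d5" "c 6 y = 0"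
    "c 2 X = 0" "c 3 X = x" "c 4 X = 0" "c 5 X = 0" "c 6 X = x'"
    "c 0 Y = 0" "c 1 Y = 0" "c 2 Y = 0" "c 3 Y = k" "c 4 Y = r4" "c 5 Y = r5" "c 6 Y = k'"
    by (simp_all add: y_def X_def Y_def coord_simps del: One_nat_def)
  show ?thesis
  proof (cases "P * (A2 + A3) - Q * (A1 - A4) = 0")
    case True
    define l where "l = (P * (A1 - A4) + Q * (A2 + A3)) / (P * P + Q * Q)"
    have ll: "l * (P * P + Q * Q) = P * (A1 - A4) + Q * (A2 + A3)" using PQ0 by (simp add: l_def)
    have "(l * P) * (P * P + Q * Q) = (A1 - A4) * (P * P + Q * Q)"
        "(l * Q) * (P * P + Q * Q) = (A2 + A3) * (P * P + Q * Q)"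
      using ll True by algebra+
    then have l: "l * P = A1 - A4" "l * Q = A2 + A3" using PQ0 by auto
    have l0: "l \<noteq> 0" using T l by auto
    define w where "w = (!) [b 2, y, - X, - (1 / l) *\<^sub>R Y, - x' *\<^sub>R b 3 + x *\<^sub>R b 6, P *\<^sub>R b 0 + Q *\<^sub>R b 1,
        - Q *\<^sub>R b 0 + P *\<^sub>R b 1]"
    have w: "w 0 = b 2" "w 1 = y" "w 2 = - X" "w 3 = - (1 / l) *\<^sub>R Y" "w 4 = - x' *\<^sub>R b 3 + x *\<^sub>R b 6"
      "w 5 = P *\<^sub>R b 0 + Q *\<^sub>R b 1" "w 6 = - Q *\<^sub>R b 0 + P *\<^sub>R b 1"
      by (simp_all add: w_def)
    obtain d where d: "frame w d"
    proof (rule frame_of_coords[OF dim, of w])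
      fix a :: "nat \<Rightarrow> real" assume a: "\<forall>k<7. (\<Sum>i<7. a i * c k (w i)) = 0"
      have e: "(\<Sum>i<7. a i * c k (w i)) = 0" if "k < 7" for k using a that by blast
      note e = e[OF less_7(1)] e[OF less_7(2)] e[OF less_7(3)] e[OF less_7(4)] e[OF less_7(5)] e[OF less_7(6)] e[OF
          less_7(7)]
      note e = e[unfolded sum_7 w]
      have a0: "a 0 = 0" using e(3) by (simp add: coord_simps coord del: One_nat_def)
      have "d4 * a 1 + r4 * (- (1 / l) * a 3) = 0" "d5 * a 1 + r5 * (- (1 / l) * a 3) = 0"
        using e(5,6) by (simp_all add: coord_simps coord a0 algebra_simps del: One_nat_def)
      from real_injective_2[OF this] dr have a1: "a 1 = 0" "a 3 = 0" using l0 by (simp_all add: mult.commute[of r4 d5])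
      have "x * a 2 + x' * a 4 = 0" "(- x') * a 2 + x * a 4 = 0"
        using e(4,7) by (simp_all add: coord_simps coord a0 a1 algebra_simps del: One_nat_def)
      from real_injective_2[OF this] have a2: "a 2 = 0" "a 4 = 0" using xx by (simp_all add: sum_squares_eq_zero_iff)
      have "P * a 5 + (- Q) * a 6 = 0" "Q * a 5 + P * a 6 = 0"
        using e(1,2) by (simp_all add: coord_simps coord a0 a1 a2 algebra_simps del: One_nat_def)
      from real_injective_2[OF this] have "a 5 = 0" "a 6 = 0" using PQ0 by simp_all
      with a0 a1 a2 show "a 0 = 0 \<and> a 1 = 0 \<and> a 2 = 0 \<and> a 3 = 0 \<and> a 4 = 0 \<and> a 5 = 0 \<and> a 6 = 0" by blast
    qed
    have "br y (- (1 / l) *\<^sub>R Y) = - (P *\<^sub>R b 0 + Q *\<^sub>R b 1)"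
      using l0 by (simp add: br_bilinear yY l[symmetric] scaleR_add_right del: One_nat_def)
    moreover have "br (b 2) (- x' *\<^sub>R b 3 + x *\<^sub>R b 6) = - (- Q *\<^sub>R b 0 + P *\<^sub>R b 1)"
      by (simp add: ev P_def Q_def algebra_simps del: One_nat_def)
    ultimately have "lie_isomorphic br \<nn>\<^sub>4"
      unfolding lie_isomorphic_nn4_iff[OF lie]
      by (intro exI[of _ w] exI[of _ d]) (simp add: brackets_def d w e eY q0 q1 ev del: One_nat_def)
    then show ?thesis ..
  next
    case False
    obtain l l' where l: "p * l + q * l' = A1 - A4" "q * l + (- p) * l' = A2 + A3" by (rule real_solve_2[OF E])
    have "P * (A2 + A3) - Q * (A1 - A4) = (x' * l - x * l') * (p * p + q * q)"
      unfolding l[symmetric] P_def Q_def by (simp add: algebra_simps)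
    then have xl: "x' * l - x * l' \<noteq> 0" using False by auto
    define w where "w = (!) [b 2, y, - X, l *\<^sub>R b 3 + l' *\<^sub>R b 6, Y, P *\<^sub>R b 0 + Q *\<^sub>R b 1,
        - (A1 - A4) *\<^sub>R b 0 - (A2 + A3) *\<^sub>R b 1]"
    have w: "w 0 = b 2" "w 1 = y" "w 2 = - X" "w 3 = l *\<^sub>R b 3 + l' *\<^sub>R b 6" "w 4 = Y"
      "w 5 = P *\<^sub>R b 0 + Q *\<^sub>R b 1" "w 6 = - (A1 - A4) *\<^sub>R b 0 - (A2 + A3) *\<^sub>R b 1"
      by (simp_all add: w_def)
    obtain d where d: "frame w d"
    proof (rule frame_of_coords[OF dim, of w])
      fix a :: "nat \<Rightarrow> real" assume a: "\<forall>k<7. (\<Sum>i<7. a i * c k (w i)) = 0"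
      have e: "(\<Sum>i<7. a i * c k (w i)) = 0" if "k < 7" for k using a that by blast
      note e = e[OF less_7(1)] e[OF less_7(2)] e[OF less_7(3)] e[OF less_7(4)] e[OF less_7(5)] e[OF less_7(6)] e[OF
          less_7(7)]
      note e = e[unfolded sum_7 w]
      have a0: "a 0 = 0" using e(3) by (simp add: coord_simps coord del: One_nat_def)
      have "d4 * a 1 + r4 * a 4 = 0" "d5 * a 1 + r5 * a 4 = 0"
        using e(5,6) by (simp_all add: coord_simps coord a0 algebra_simps del: One_nat_def)
      from real_injective_2[OF this] dr have a1: "a 1 = 0" "a 4 = 0" by (simp_all add: mult.commute[of r4 d5])
      have "(- x) * a 2 + l * a 3 = 0" "(- x') * a 2 + l' * a 3 = 0"
        using e(4,7) by (simp_all add: coord_simps coord a0 a1 algebra_simps del: One_nat_def)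
      from real_injective_2[OF this] have a2: "a 2 = 0" "a 3 = 0" using xl by (simp_all add: mult.commute[of l x'])
      have "P * a 5 + (- (A1 - A4)) * a 6 = 0" "Q * a 5 + (- (A2 + A3)) * a 6 = 0"
        using e(1,2) by (simp_all add: coord_simps coord a0 a1 a2 algebra_simps del: One_nat_def)
      from real_injective_2[OF this] have "a 5 = 0" "a 6 = 0" using False by (simp_all add: algebra_simps)
      with a0 a1 a2 show "a 0 = 0 \<and> a 1 = 0 \<and> a 2 = 0 \<and> a 3 = 0 \<and> a 4 = 0 \<and> a 5 = 0 \<and> a 6 = 0" by blast
    qed
    have "br (b 2) (l *\<^sub>R b 3 + l' *\<^sub>R b 6) = - (- (A1 - A4) *\<^sub>R b 0 - (A2 + A3) *\<^sub>R b 1)"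
      unfolding l[symmetric] by (simp add: ev algebra_simps del: One_nat_def)
    moreover have "br y Y = - (- (A1 - A4) *\<^sub>R b 0 - (A2 + A3) *\<^sub>R b 1)"
      by (simp add: yY algebra_simps del: One_nat_def)
    ultimately have "lie_isomorphic br \<nn>\<^sub>5"
      unfolding lie_isomorphic_nn5_iff[OF lie]
      by (intro exI[of _ w] exI[of _ d]) (simp add: brackets_def d w e eY q0 q1 ev del: One_nat_def)
    then show ?thesis ..
  qed
qed

end

lemma core_not_soliton:
  assumes core: "core_frame b c \<phi> br 0 s 0 0 A1 A2 A3 A4 p q u v" and s: "s \<noteq> 0"
    and T: "A1 - A4 \<noteq> 0 \<or> A2 + A3 \<noteq> 0"
  shows "\<not> semi_algebraic_soliton br \<phi>"
proof
  interpret core_frame b c \<phi> br 0 s 0 0 A1 A2 A3 A4 p q u v by (fact core)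
  assume "semi_algebraic_soliton br \<phi>"
  then obtain L D where D: "derivation br D"
    and sol: "\<forall>K\<in>combs 3. ce_diff br 2 \<tau> (bt K) = L * \<phi> (bt K) + endo_act D 3 \<phi> (bt K)"
    using soliton_iff[OF core_closed] by blast
  have lin: "linear D" using D by (simp add: derivation_def)
  define d where "d k i = c k (D (b i))" for k i
  have Db: "D (b i) = d 0 i *\<^sub>R b 0 + d 1 i *\<^sub>R b 1 + d 2 i *\<^sub>R b 2 + d 3 i *\<^sub>R b 3 + d 4 i *\<^sub>R b 4 + d 5 i *\<^sub>R b 5
      + d 6 i *\<^sub>R b 6" for i
    using expansion[of "D (b i)"] by (simp add: sum_7 d_def del: One_nat_def)
  have E: "c k (D (br (b i) (b j))) = c k (br (D (b i)) (b j) + br (b i) (D (b j)))" for i j k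
    using D by (simp add: derivation_def)
  note ev = br_core br_core_swap br_bilinear br_self coord_simps Db linear_add[OF lin] linear_diff[OF lin]
    linear_neg[OF lin] linear_cmul[OF lin] linear_0[OF lin]
  have S: "ce_diff br 2 \<tau> (bt [i, j, k]) = L * g2_table i j k + endo_act D 3 \<phi> (bt [i, j, k])" if "i < j" "j < k"
      "k < 7" for i j k
    using bspec[OF sol, of "[i, j, k]"] tab_bt[of i j k] that by (simp add: combs3_iff)
  note S' = core_d_tau endo_act_values[OF lin] d_def[symmetric] g2_table_def
  have d2: "d 2 3 = 0" "d 2 6 = 0" using E[of 3 3 6] E[of 6 3 6] s by (simp_all add: ev del: One_nat_def)
  have d24: "d 2 4 = 0" and d25: "d 2 5 = 0" using E[of 6 3 4] E[of 6 3 5] s by (simp_all add: ev d2 del: One_nat_def)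
  note d2 = d2 d24 d25
  have d45: "d 4 3 = 0" "d 5 3 = 0" "d 4 6 = 0" "d 5 6 = 0"
    using E[of 0 3 4] E[of 1 3 4] E[of 0 3 5] E[of 1 3 5] E[of 0 4 6] E[of 1 4 6] E[of 0 5 6] E[of 1 5 6] T
    by (auto simp: ev d2 simp del: One_nat_def)
  have d0: "d 2 0 = 0" "d 2 1 = 0" using E[of 6 0 3] E[of 6 1 3] s by (simp_all add: ev del: One_nat_def)
  have d0': "d 3 0 = 0" "d 4 0 = 0" "d 5 0 = 0" "d 6 0 = 0" "d 3 1 = 0" "d 4 1 = 0" "d 5 1 = 0" "d 6 1 = 0"
    using E[of 4 2 0] E[of 5 2 0] E[of 4 2 1] E[of 5 2 1] E[of 3 2 0] E[of 6 2 0] E[of 3 2 1] E[of 6 2 1] s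
    by (simp_all add: ev del: One_nat_def)
  note z = d2 d45 d0 d0'
  have "s * (d 6 6 - d 2 2 - d 3 3) = 0" "s * (d 3 3 - d 2 2 - d 6 6) = 0" "s * (d 3 6 + d 6 3) = 0"
    using E[of 3 2 3] E[of 6 2 3] E[of 3 2 6] by (simp_all add: ev z algebra_simps del: One_nat_def)
  then have 1: "d 2 2 = 0" "d 6 6 = d 3 3" "d 3 6 = - d 6 3" using s by simp_all
  have S1: "L + d 0 0 + d 1 1 = 0" "L + d 0 0 + d 3 3 + d 4 4 = 0" "L + d 0 0 + d 5 5 + d 3 3 = 0"
      "L + d 1 1 + d 3 3 + d 5 5 = 0"
    using S[of 0 1 2] S[of 0 3 4] S[of 0 5 6] S[of 1 3 5] by (simp_all add: S' 1 del: One_nat_def)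
  have S2: "d 1 0 - d 6 3 + d 4 5 = 0" "- d 1 0 + d 5 4 + d 6 3 = 0" "d 0 1 - d 4 5 + d 6 3 = 0"
    using S[of 0 3 5] S[of 0 4 6] S[of 1 5 6] by (simp_all add: S' 1 z del: One_nat_def)
  define a where "a = d 0 0"
  have 2: "d 0 0 = a" "d 1 1 = a" "L = - 2 * a" "d 4 4 = a - d 3 3" "d 5 5 = a - d 3 3" "d 0 1 = - d 1 0"
    using S1 S2 unfolding a_def by linarith+
  have "(a - 2 * d 4 4) * (A1 - A4) = d 1 0 * (A2 + A3)" "(a - 2 * d 4 4) * (A2 + A3) = - d 1 0 * (A1 - A4)"
    using E[of 0 4 5] E[of 1 4 5] by (simp_all add: ev z 2 algebra_simps del: One_nat_def)
  then have "(a - 2 * d 4 4) * ((A1 - A4) * (A1 - A4) + (A2 + A3) * (A2 + A3)) = 0 * 1"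
    "d 1 0 * ((A1 - A4) * (A1 - A4) + (A2 + A3) * (A2 + A3)) = 0 * 1"
    by algebra+
  then have 3: "d 4 4 = a / 2" "d 1 0 = 0" using T by (auto simp: sum_squares_eq_zero_iff)
  then have 4: "d 3 3 = a / 2" using 2 by simp
  have a: "a = - 2 * (p * p + q * q)" using S[of 2 3 6] by (simp add: S' 1 2 4 algebra_simps del: One_nat_def)
  have S3: "p * s = - d 4 2 - d 1 3" "q * s = d 5 2 - d 1 6" "q * s = d 0 3 - d 5 2" "- p * s = - d 4 2 + d 0 6"
    using S[of 0 2 3] S[of 0 2 6] S[of 1 2 3] S[of 1 2 6] by (simp_all add: S' z del: One_nat_def)
  have E3: "s * d 0 6 = - (a / 2) * p + d 6 3 * q" "s * d 1 6 = - (a / 2) * q - d 6 3 * p"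
    "s * d 0 3 = (a / 2) * q + d 6 3 * p" "s * d 1 3 = - (a / 2) * p + d 6 3 * q"
    using E[of 0 2 3] E[of 1 2 3] E[of 0 2 6] E[of 1 2 6] by (simp_all add: ev z 1 2 3 4 field_simps del: One_nat_def)
  have "s * d 0 6 = s * d 1 3" "s * d 1 6 = s * (- d 0 3)" using E3 by simp_all
  then have "d 0 6 = d 1 3" "d 1 6 = - d 0 3" using s by (simp_all only: mult_cancel_left simp_thms)
  then have "d 0 6 = - p * s" "d 1 6 = - q * s" using S3 by linarith+
  then have "s * (- p * s) = - (a / 2) * p + d 6 3 * q" "s * (- q * s) = - (a / 2) * q - d 6 3 * p" using E3 by simp_all
  then have "(s * s - a / 2) * (p * p + q * q) = 0 * 1" by algebra
  moreover have "s * s - a / 2 > 0"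
  proof -
  have "s * s > 0" using s by (simp add: zero_less_mult_iff linorder_neq_iff disj_commute)
  moreover have "0 \<le> p * p + q * q" by simp
  then have "a \<le> 0" using a by simp
  ultimately show ?thesis by linarith
  qed
  ultimately have "p * p + q * q = 0" by simp
  then have "a = 0" using a by simp
  then have "A1 * A1 + A4 * A4 + (A1 - A4) * (A1 - A4) + A2 * A2 + A3 * A3 + (A2 + A3) * (A2 + A3) + 2 * (u * u)
      + 2 * (v * v) = 0"
    using S[of 2 4 5] by (simp add: S' 1 2 3 4 algebra_simps del: One_nat_def)
  moreover have "(A1 - A4) * (A1 - A4) + (A2 + A3) * (A2 + A3) > 0" using T sum_squares_gt_zero_iff by blast
  ultimately show False
    using zero_le_square[of A1] zero_le_square[of A2] zero_le_square[of A3] zero_le_square[of A4] zero_le_square[of u]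
        zero_le_square[of v]
    by linarith
qed

definition classified :: "('a::real_vector \<Rightarrow> 'a \<Rightarrow> 'a) \<Rightarrow> bool" where
  "classified br \<longleftrightarrow>
    lie_isomorphic br \<nn>\<^sub>1 \<or> lie_isomorphic br \<nn>\<^sub>2 \<or> lie_isomorphic br \<nn>\<^sub>3 \<or>
    lie_isomorphic br \<nn>\<^sub>4 \<or> lie_isomorphic br \<nn>\<^sub>5 \<or> lie_isomorphic br \<nn>\<^sub>6 \<or>
    lie_isomorphic br \<nn>\<^sub>7 \<or> lie_isomorphic br \<ss>\<^sub>5 \<or>
    (\<exists>\<alpha>>0. lie_isomorphic br (\<ss>\<^sub>6 \<alpha>)) \<or> lie_isomorphic br \<ss>\<^sub>7"

lemma classifiedI:
  "lie_isomorphic br \<nn>\<^sub>1 \<or> lie_isomorphic br \<nn>\<^sub>2 \<or> lie_isomorphic br \<nn>\<^sub>3 \<Longrightarrow> classified br"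
  "lie_isomorphic br \<nn>\<^sub>2 \<or> lie_isomorphic br \<nn>\<^sub>3 \<Longrightarrow> classified br"
  "lie_isomorphic br \<nn>\<^sub>2 \<Longrightarrow> classified br"
  "lie_isomorphic br \<nn>\<^sub>4 \<or> lie_isomorphic br \<nn>\<^sub>5 \<Longrightarrow> classified br"
  "lie_isomorphic br \<nn>\<^sub>6 \<Longrightarrow> classified br"
  "lie_isomorphic br \<nn>\<^sub>7 \<Longrightarrow> classified br"
  "lie_isomorphic br \<ss>\<^sub>5 \<or> (\<exists>\<alpha>>0. lie_isomorphic br (\<ss>\<^sub>6 \<alpha>)) \<or> lie_isomorphic br \<ss>\<^sub>7 \<Longrightarrow> classified br"
  unfolding classified_def by blast+

lemma core_jacobi:
  assumes core: "core_frame b c \<phi> br m s g h A1 A2 A3 A4 p q u v" and T: "A1 - A4 \<noteq> 0 \<or> A2 + A3 \<noteq> 0"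
  shows "m = 0 \<and> g = 0 \<and> h = 0"
proof -
  interpret core_frame b c \<phi> br m s g h A1 A2 A3 A4 p q u v by (fact core)
  have J: "c k (br (b 2) (br (b i) (b j)) + br (b i) (br (b j) (b 2)) + br (b j) (br (b 2) (b i))) = c k 0" for i j k
    by (simp add: lie_algebra.jacobi[OF lie])
  note ev = br_core br_core_swap br_bilinear br_self coord_simps
  have "(A1 - A4) * (m * 2) = 0" "(A2 + A3) * (m * 2) = 0" "(A1 - A4) * g = 0" "(A2 + A3) * g = 0" "(A1 - A4) * h = 0"
      "(A2 + A3) * h = 0"
    using J[of 0 4 5] J[of 1 4 5] J[of 0 3 5] J[of 1 3 5] J[of 0 3 4] J[of 1 3 4]
    by (auto simp: ev algebra_simps simp del: One_nat_def)
  then show ?thesis using T by auto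
qed

lemma (in central_g2) classified_if_core:
  assumes dim: "dim (UNIV :: 'a set) = 7" and core: "core_frame b c \<phi> br m s g h A1 A2 A3 A4 p q u v"
    and sol: "semi_algebraic_soliton br \<phi>"
  shows "classified br"
proof (cases "A1 - A4 \<noteq> 0 \<or> A2 + A3 \<noteq> 0")
  case T: True
  have z: "m = 0" "g = 0" "h = 0" using core_jacobi[OF core T] by simp_all
  note core = core[unfolded z]
  have s: "s = 0" using core_not_soliton[OF core _ T] sol by blast
  note core = core[unfolded s]
  show ?thesis
  proof (cases "p = 0 \<and> q = 0")
    case True
    then have "p = 0" "q = 0" by simp_all
    from core_two_step[OF dim core[unfolded this]] show ?thesis by (rule classifiedI)
  next
    case False
    then have pq: "p \<noteq> 0 \<or> q \<noteq> 0" by blast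
    show ?thesis
    proof (cases "A1 * A4 - A2 * A3 = 0")
      case True
      from core_n4_n5[OF dim core pq True T] show ?thesis by (rule classifiedI)
    next
      case False
      from core_n7[OF dim core pq False T] show ?thesis by (rule classifiedI)
    qed
  qed
next
  case False
  then have "A4 = A1" "A3 = - A2" by simp_all
  note core = core[unfolded this]
  obtain b c m s A1 A2 p q u v where core: "core_frame b c \<phi> br m s 0 0 A1 A2 (- A2) A1 p q u v"
    by (rule core_frame_triangular[OF core])
  show ?thesis
  proof (cases "m = 0 \<and> s = 0")
    case False
    then have "m \<noteq> 0 \<or> s \<noteq> 0" by blast
    from core_semisimple[OF dim core this] show ?thesis by (rule classifiedI)
  next
    case True
    then have "m = 0" "s = 0" by simp_all
    note core = core[unfolded this]
    show ?thesis
    proof (cases "p = 0 \<and> q = 0")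
      case True
      then have "p = 0" "q = 0" by simp_all
      from core_two_step[OF dim core[unfolded this]] show ?thesis by (rule classifiedI)
    next
      case False
      then have pq: "p \<noteq> 0 \<or> q \<noteq> 0" by blast
      show ?thesis
      proof (cases "A1 = 0 \<and> A2 = 0")
        case True
        then have A: "A1 = 0" "A2 = 0" by simp_all
        from core_n2[OF dim core[unfolded A minus_zero] pq] show ?thesis by (rule classifiedI)
      next
        case False
        then have "A1 \<noteq> 0 \<or> A2 \<noteq> 0" by blast
        from core_n6[OF dim core pq this] show ?thesis by (rule classifiedI)
      qed
    qed
  qed
qed

lemma (in central_g2) classified_if_soliton:
  assumes dim: "dim (UNIV :: 'a set) = 7" and sol: "semi_algebraic_soliton br \<phi>"
  shows "classified br"
proof -
  obtain b1 c1 where "central_g2 b1 c1 \<phi> br" "central_g2.q_reduced b1 c1 br" by (rule q_reduced_exists)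
  then obtain b2 c2 where b2: "central_g2 b2 c2 \<phi> br" "central_g2.q_reduced b2 c2 br"
      "g2_lie_frame.B b2 c2 br 4 5 6 = 0"
    by (rule central_g2.q_reduced_exists')
  interpret C: central_g2 b2 c2 \<phi> br by (fact b2)
  show ?thesis
  proof (cases "C.B 4 5 3 = 0")
    case False
    from C.lie_isomorphic_if_q_nonabelian[OF dim b2(2,3) this] show ?thesis by (rule classifiedI)
  next
    case True
    obtain b c m s g h A1 A2 A3 A4 p q u v where
      "central_g2 b c \<phi> br" "core_frame b c \<phi> br m s g h A1 A2 A3 A4 p q u v"
      by (rule C.core_frame_exists[OF b2(2,3) True])
    then show ?thesis using central_g2.classified_if_core[OF _ dim _ sol] by blast
  qed
qed

lemma central_g2_exists:
  assumes lie: "lie_algebra br" and dim: "dim (UNIV :: 'a::real_vector set) = 7" and uni: "unimodular br"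
    and cen: "dim (lie_center br) \<ge> 2" and closed: "closed_g2_structure br (\<phi> :: 'a form)"
  obtains b c where "central_g2 b c \<phi> br"
proof -
  have def: "definite \<phi>" and cl: "ce_diff br 3 \<phi> = (\<lambda>x. 0)" using closed by (simp_all add: closed_g2_structure_def)
  obtain B where B: "B \<subseteq> lie_center br" "independent B" "card B = dim (lie_center br)"
    using basis_exists by metis
  obtain C where C: "C \<subseteq> B" "card C = 2" using cen B(3) obtain_subset_with_card_n by metis
  then obtain z1 z2 where z: "C = {z1, z2}" "z1 \<noteq> z2" by (auto simp: card_2_iff)
  have ind: "r = 0 \<and> s = 0" if "r *\<^sub>R z1 + s *\<^sub>R z2 = 0" for r s
  proof -
    have C': "independent C" using independent_mono[OF B(2) C(1)] .
    have "(\<Sum>x\<in>C. (if x = z1 then r else s) *\<^sub>R x) = 0" using that z by simp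
    from independentD[OF C' _ subset_refl this] z show ?thesis by force
  qed
  obtain b c q r s where b: "g2_frame b c \<phi>" "b 0 = q *\<^sub>R z1" "b 1 = r *\<^sub>R z1 + s *\<^sub>R z2"
    by (rule normal_form[OF dim def ind])
  have "br z1 y = 0" "br z2 y = 0" for y
    using B(1) C(1) z(1) by (auto simp: lie_center_def)
  then have "br (b 0) y = 0" "br (b 1) y = 0" for y
    unfolding b by (simp_all add: lie_simps[OF lie])
  then have "central_g2 b c \<phi> br"
    by (intro central_g2.intro g2_lie_frame.intro b(1) g2_lie_frame_axioms.intro lie central_g2_axioms.intro uni)
        (simp add: cl)
  then show ?thesis by (rule that)
qed

theorem theorem5p7:
  fixes br :: "'a::real_vector \<Rightarrow> 'a \<Rightarrow> 'a"
  assumes "lie_algebra br"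
    and "dim (UNIV :: 'a set) = 7"
    and "unimodular br"
    and "dim (lie_center br) \<ge> 2"
    and "\<exists>\<phi>. closed_g2_structure br \<phi>"
  shows "(\<exists>\<phi>. semi_algebraic_soliton br \<phi>) \<longleftrightarrow>
    lie_isomorphic br \<nn>\<^sub>1 \<or> lie_isomorphic br \<nn>\<^sub>2 \<or> lie_isomorphic br \<nn>\<^sub>3 \<or>
    lie_isomorphic br \<nn>\<^sub>4 \<or> lie_isomorphic br \<nn>\<^sub>5 \<or> lie_isomorphic br \<nn>\<^sub>6 \<or>
    lie_isomorphic br \<nn>\<^sub>7 \<or> lie_isomorphic br \<ss>\<^sub>5 \<or>
    (\<exists>\<alpha>>0. lie_isomorphic br (\<ss>\<^sub>6 \<alpha>)) \<or> lie_isomorphic br \<ss>\<^sub>7"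
proof
  assume "\<exists>\<phi>. semi_algebraic_soliton br \<phi>"
  then obtain \<phi> where sol: "semi_algebraic_soliton br \<phi>" ..
  then have "closed_g2_structure br \<phi>" by (simp add: semi_algebraic_soliton_def)
  then obtain b c where "central_g2 b c \<phi> br" by (rule central_g2_exists[OF assms(1-4)])
  from central_g2.classified_if_soliton[OF this assms(2) sol]
  show "lie_isomorphic br \<nn>\<^sub>1 \<or> lie_isomorphic br \<nn>\<^sub>2 \<or> lie_isomorphic br \<nn>\<^sub>3 \<or>
    lie_isomorphic br \<nn>\<^sub>4 \<or> lie_isomorphic br \<nn>\<^sub>5 \<or> lie_isomorphic br \<nn>\<^sub>6 \<or>
    lie_isomorphic br \<nn>\<^sub>7 \<or> lie_isomorphic br \<ss>\<^sub>5 \<or>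
    (\<exists>\<alpha>>0. lie_isomorphic br (\<ss>\<^sub>6 \<alpha>)) \<or> lie_isomorphic br \<ss>\<^sub>7"
    unfolding classified_def .
next
  assume "lie_isomorphic br \<nn>\<^sub>1 \<or> lie_isomorphic br \<nn>\<^sub>2 \<or> lie_isomorphic br \<nn>\<^sub>3 \<or>
    lie_isomorphic br \<nn>\<^sub>4 \<or> lie_isomorphic br \<nn>\<^sub>5 \<or> lie_isomorphic br \<nn>\<^sub>6 \<or>
    lie_isomorphic br \<nn>\<^sub>7 \<or> lie_isomorphic br \<ss>\<^sub>5 \<or>
    (\<exists>\<alpha>>0. lie_isomorphic br (\<ss>\<^sub>6 \<alpha>)) \<or> lie_isomorphic br \<ss>\<^sub>7"
  then show "\<exists>\<phi>. semi_algebraic_soliton br \<phi>"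
    using soliton_if_nn1 soliton_if_nn2 soliton_if_nn3 soliton_if_nn4 soliton_if_nn5 soliton_if_nn6 soliton_if_nn7
      soliton_if_ss5 soliton_if_ss6 soliton_if_ss7 assms(1) by (elim disjE exE conjE) blast+
qed

end
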